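(* Let $\varphi$ be a growth function on $\mathbb R^n\times[0,\infty)$ satisfying $$\frac{2np(\varphi)}{i(\varphi)}-\frac{n[r(\varphi)-1]}{r(\varphi)}<n+1.$$ (i) Suppose in addition that either there exists a positive constant $C$ such that $\frac{\|\chi_{B_1}\|_{L^\varphi(\mathbb R^n)}}{|B_1|}\le C\frac{\|\chi_{B_2}\|_{L^\varphi(\mathbb R^n)}}{|B_2|}$ for all balls $B_1\subset B_2$ in $\mathbb R^n$, or $p(\varphi)[r(\varphi)]'\in(1,2)$. Then, for any $f\in\mathrm{BMO}^\varphi_{\sqrt\Delta}(\mathbb R^n)$, $$\left|t\frac{\partial}{\partial t}P_t(\mathcal I-P_t)f(x)\right|^2\frac{dx\,dt}{t}$$ is a $\varphi$-Carleson measure on $\mathbb R^{n+1}_+$. (ii) Assume further (in addition to the hypotheses of (i)) that $np(\varphi)<(n+1)i(\varphi)$. Then the spaces $\mathrm{BMO}^\varphi(\mathbb R^n)$ and $\mathrm{BMO}^\varphi_{\sqrt\Delta}(\mathbb R^n)$ (modulo $\mathcal K_{\sqrt\Delta}(\mathbb R^n)$) coincide with equivalent norms.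
   Context: $\mathbb R^n$ carries the Euclidean metric and Lebesgue measure; $|E|$ is the Lebesgue measure of $E$; balls are Euclidean; $s'$ is the conjugate index of $s$ ($1/s+1/s'=1$). **Growth functions.** $\varphi:\mathbb R^n\times[0,\infty)\to[0,\infty)$ is of uniformly upper type $p$ (resp. uniformly lower type $p$) if $\exists C$ with $\varphi(x,st)\le Cs^p\varphi(x,t)$ for all $x$, $t\ge0$ and $s\ge1$ (resp. $s\in(0,1)$). For $p\in(1,\infty)$, $\varphi\in\mathbb A_p(\mathbb R^n)$ means $\sup_{t>0}\sup_B\frac1{|B|}\int_B\varphi(x,t)dx\{\frac1{|B|}\int_B[\varphi(x,t)]^{-1/(p-1)}dx\}^{p-1}<\infty$; $\varphi\in\mathbb A_1(\mathbb R^n)$ means $\sup_{t>0}\sup_B\frac1{|B|}\int_B\varphi(x,t)dx\{\mathrm{ess\,sup}_{y\in B}[\varphi(y,t)]^{-1}\}<\infty$; $\mathbb A_\infty=\bigcup_{p\in[1,\infty)}\mathbb A_p$. For $q\in(1,\infty)$, $\varphi\in\mathbb{RH}_q(\mathbb R^n)$ means $\sup_{t>0}\sup_B\{\frac1{|B|}\int_B[\varphi(x,t)]^qdx\}^{1/q}\{\frac1{|B|}\int_B\varphi(x,t)dx\}^{-1}<\infty$; for $q=\infty$ the first factor is replaced by $\mathrm{ess\,sup}_{y\in B}\varphi(y,t)$. $\varphi$ is a growth function if: for each $x$, $\varphi(x,\cdot)$ is nondecreasing, $\varphi(x,0)=0$, $\varphi(x,t)>0$ for $t>0$, $\lim_{t\to\infty}\varphi(x,t)=\infty$;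 $\varphi(\cdot,t)$ is measurable for each $t$; $\varphi\in\mathbb A_\infty(\mathbb R^n)$; $\varphi$ is of uniformly upper type $1$ and of uniformly lower type $p$ for some $p\in(0,1]$. $i(\varphi)=\sup\{p>0:\varphi$ of uniformly lower type $p\}$; $p(\varphi)=\inf\{p\in[1,\infty):\varphi\in\mathbb A_p(\mathbb R^n)\}$; $r(\varphi)=\sup\{q\in(1,\infty]:\varphi\in\mathbb{RH}_q(\mathbb R^n)\}$, with $(r-1)/r:=1$ if $r=\infty$. $\|f\|_{L^\varphi(\mathbb R^n)}=\inf\{\lambda>0:\int_{\mathbb R^n}\varphi(x,|f(x)|/\lambda)dx\le1\}$. **Space $\mathrm{BMO}^\varphi(\mathbb R^n)$.** Locally integrable $f$ with $\|f\|_{\mathrm{BMO}^\varphi(\mathbb R^n)}=\sup_B\frac1{\|\chi_B\|_{L^\varphi(\mathbb R^n)}}\int_B|f(x)-f_B|dx<\infty$, $f_B=\frac1{|B|}\int_Bf$. **Poisson semigroup.** $\Delta=-\sum_{i=1}^n\partial_{x_i}^2$. For $f$ in $\mathcal M_{\sqrt\Delta}=\{f\in L^1_{\rm loc}(\mathbb R^n): f(x)(1+|x|^{n+1})^{-1}\in L^1(\mathbb R^n)\}$, $P_tf(x)=\int_{\mathbb R^n}p_t(x-y)f(y)dy$ with $p_t(x)=\frac{c_nt}{(t^2+|x|^2)^{(n+1)/2}}$, $c_n=\Gamma[(n+1)/2]/\pi^{(n+1)/2}$; on $L^p(\mathbb R^n)$, $p\in[1,\infty]$, $P_t=e^{-t\sqrt\Delta}$.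 $\mathcal I$ is the identity operator, and $t\frac{\partial}{\partial t}P_t(\mathcal I-P_t)f$ denotes the operator $t\frac{\partial}{\partial t}P_t$ applied to $f-P_tf$. **Space $\mathrm{BMO}^\varphi_{\sqrt\Delta}(\mathbb R^n)$.** All $f\in\mathcal M_{\sqrt\Delta}$ with $\|f\|_{\mathrm{BMO}^\varphi_{\sqrt\Delta}(\mathbb R^n)}=\sup_B\frac1{\|\chi_B\|_{L^\varphi(\mathbb R^n)}}\int_B|f(x)-P_{r_B}f(x)|dx<\infty$, the supremum over all balls $B$, $r_B$ the radius of $B$. $\mathcal K_{\sqrt\Delta}(\mathbb R^n)=\{f\in\mathcal M_{\sqrt\Delta}: P_tf=f$ a.e. for all $t>0\}$, on which the seminorm vanishes; "modulo" means that functions differing by an element of this space are identified. **$\varphi$-Carleson measure.** A measure $d\nu$ on $\mathbb R^{n+1}_+$ with $\sup_B\frac{|B|^{1/2}}{\|\chi_B\|_{L^\varphi(\mathbb R^n)}}\{\int_{\widehat B}|d\nu(x,t)|\}^{1/2}<\infty$, the supremum over all balls $B\subset\mathbb R^n$, $\widehat B=\{(x,t)\in\mathbb R^{n+1}_+: x\in B,\ t\in(0,r_B)\}$. *)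

theory Defs
  imports "HOL-Analysis.Analysis" "HOL-Probability.Essential_Supremum"
begin

text \<open>
  The space \<open>R^n\<close> is \<open>real ^ 'n\<close>, so that \<open>n = CARD('n)\<close>. Functions on \<open>R^n\<close> are
  complex-valued, which includes the real-valued case. All suprema and norms that may be
  infinite are taken in \<^typ>\<open>ennreal\<close>. A supremum over all balls is a supremum over all
  centres \<open>x\<close> and radii \<open>r > 0\<close>. A function on \<open>R^n \<times> [0, \<infinity>)\<close> is a curried function whose
  values at negative second arguments are never used.
\<close>

subsection \<open>Growth functions and their indices\<close>

text \<open>Powers with exponent \<open>s > 0\<close>; negative powers are written as inverses of these.\<close>

definition ennpow :: "ennreal \<Rightarrow> real \<Rightarrow> ennreal" where
  "ennpow a s = (if a = \<infinity> then \<infinity> else ennreal (enn2real a powr s))"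

definition ball_avg :: "real ^ 'n \<Rightarrow> real \<Rightarrow> (real ^ 'n \<Rightarrow> ennreal) \<Rightarrow> ennreal" where
  "ball_avg x r g = (\<integral>\<^sup>+ y \<in> ball x r. g y \<partial>lebesgue) / emeasure lebesgue (ball x r)"

definition unif_upper_type :: "(real ^ 'n \<Rightarrow> real \<Rightarrow> real) \<Rightarrow> real \<Rightarrow> bool" where
  "unif_upper_type \<phi> p \<longleftrightarrow>
     (\<exists>C. \<forall>x. \<forall>t\<ge>0. \<forall>s\<ge>1. \<phi> x (s * t) \<le> C * s powr p * \<phi> x t)"

definition unif_lower_type :: "(real ^ 'n \<Rightarrow> real \<Rightarrow> real) \<Rightarrow> real \<Rightarrow> bool" where
  "unif_lower_type \<phi> p \<longleftrightarrow>
     (\<exists>C. \<forall>x. \<forall>t\<ge>0. \<forall>s. 0 < s \<and> s < 1 \<longrightarrow> \<phi> x (s * t) \<le> C * s powr p * \<phi> x t)"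

definition Muckenhoupt :: "(real ^ 'n \<Rightarrow> real \<Rightarrow> real) \<Rightarrow> real \<Rightarrow> bool" where
  "Muckenhoupt \<phi> p \<longleftrightarrow>
     (if p = 1 then
        (SUP t\<in>{0<..}. SUP x. SUP r\<in>{0<..}.
           ball_avg x r (\<lambda>y. ennreal (\<phi> y t)) *
           esssup (restrict_space lebesgue (ball x r)) (\<lambda>y. inverse (ennreal (\<phi> y t)))) < \<infinity>
      else
        (SUP t\<in>{0<..}. SUP x. SUP r\<in>{0<..}.
           ball_avg x r (\<lambda>y. ennreal (\<phi> y t)) *
           ennpow (ball_avg x r (\<lambda>y. inverse (ennpow (ennreal (\<phi> y t)) (1 / (p - 1))))) (p - 1)) < \<infinity>)"

definition Muckenhoupt_infty :: "(real ^ 'n \<Rightarrow> real \<Rightarrow> real) \<Rightarrow> bool" where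
  "Muckenhoupt_infty \<phi> \<longleftrightarrow> (\<exists>p\<ge>1. Muckenhoupt \<phi> p)"

text \<open>
  The reverse Hoelder condition for \<open>q \<in> (1, \<infinity>]\<close>. The quotient is meant for functions whose
  averages are positive and finite, which is the case for every growth function, by the
  Muckenhoupt condition.
\<close>

definition reverse_Hoelder :: "(real ^ 'n \<Rightarrow> real \<Rightarrow> real) \<Rightarrow> ennreal \<Rightarrow> bool" where
  "reverse_Hoelder \<phi> q \<longleftrightarrow>
     (if q = \<infinity> then
        (SUP t\<in>{0<..}. SUP x. SUP r\<in>{0<..}.
           esssup (restrict_space lebesgue (ball x r)) (\<lambda>y. ennreal (\<phi> y t)) *
           inverse (ball_avg x r (\<lambda>y. ennreal (\<phi> y t)))) < \<infinity>
      else
        (SUP t\<in>{0<..}. SUP x. SUP r\<in>{0<..}.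
           ennpow (ball_avg x r (\<lambda>y. ennpow (ennreal (\<phi> y t)) (enn2real q))) (1 / enn2real q) *
           inverse (ball_avg x r (\<lambda>y. ennreal (\<phi> y t)))) < \<infinity>)"

definition growth_function :: "(real ^ 'n \<Rightarrow> real \<Rightarrow> real) \<Rightarrow> bool" where
  "growth_function \<phi> \<longleftrightarrow>
     (\<forall>x. mono_on {0..} (\<phi> x) \<and> \<phi> x 0 = 0 \<and> (\<forall>t>0. \<phi> x t > 0) \<and>
          filterlim (\<phi> x) at_top at_top) \<and>
     (\<forall>t\<ge>0. (\<lambda>x. \<phi> x t) \<in> borel_measurable lebesgue) \<and>
     Muckenhoupt_infty \<phi> \<and>
     unif_upper_type \<phi> 1 \<and>
     (\<exists>p. 0 < p \<and> p \<le> 1 \<and> unif_lower_type \<phi> p)"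

text \<open>
  For a growth function the sets below are nonempty, the first one is bounded above by \<open>1\<close> and
  the second one is bounded below by \<open>1\<close>.
\<close>

definition lower_type_index :: "(real ^ 'n \<Rightarrow> real \<Rightarrow> real) \<Rightarrow> real" where
  "lower_type_index \<phi> = Sup {p. p > 0 \<and> unif_lower_type \<phi> p}"

definition Muckenhoupt_index :: "(real ^ 'n \<Rightarrow> real \<Rightarrow> real) \<Rightarrow> real" where
  "Muckenhoupt_index \<phi> = Inf {p. p \<ge> 1 \<and> Muckenhoupt \<phi> p}"

definition reverse_Hoelder_index :: "(real ^ 'n \<Rightarrow> real \<Rightarrow> real) \<Rightarrow> ennreal" where
  "reverse_Hoelder_index \<phi> = Sup {q. q > 1 \<and> reverse_Hoelder \<phi> q}"

text \<open>The quotient \<open>(r - 1) / r\<close> and the conjugate index \<open>r'\<close> of \<open>r \<in> (1, \<infinity>]\<close>.\<close>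

definition pred_quot :: "ennreal \<Rightarrow> real" where
  "pred_quot r = (if r = \<infinity> then 1 else (enn2real r - 1) / enn2real r)"

definition conj_index :: "ennreal \<Rightarrow> real" where
  "conj_index r = (if r = \<infinity> then 1 else enn2real r / (enn2real r - 1))"

definition Lphi_norm ::
    "(real ^ 'n \<Rightarrow> real \<Rightarrow> real) \<Rightarrow> (real ^ 'n \<Rightarrow> 'b::real_normed_vector) \<Rightarrow> ennreal" where
  "Lphi_norm \<phi> f =
     Inf {ennreal l | l. l > 0 \<and> (\<integral>\<^sup>+ x. ennreal (\<phi> x (norm (f x) / l)) \<partial>lebesgue) \<le> 1}"

abbreviation ball_norm :: "(real ^ 'n \<Rightarrow> real \<Rightarrow> real) \<Rightarrow> real ^ 'n \<Rightarrow> real \<Rightarrow> ennreal" where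
  "ball_norm \<phi> x r \<equiv> Lphi_norm \<phi> (indicator (ball x r) :: real ^ 'n \<Rightarrow> real)"


subsection \<open>The space $\mathrm{BMO}^\varphi$\<close>

definition locally_integrable :: "(real ^ 'n \<Rightarrow> complex) \<Rightarrow> bool" where
  "locally_integrable f \<longleftrightarrow> (\<forall>K. compact K \<longrightarrow> set_integrable lebesgue K f)"

definition ball_mean :: "(real ^ 'n \<Rightarrow> complex) \<Rightarrow> real ^ 'n \<Rightarrow> real \<Rightarrow> complex" where
  "ball_mean f x r = (LINT y:ball x r|lebesgue. f y) /\<^sub>R measure lebesgue (ball x r)"

definition BMO_norm :: "(real ^ 'n \<Rightarrow> real \<Rightarrow> real) \<Rightarrow> (real ^ 'n \<Rightarrow> complex) \<Rightarrow> ennreal" where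
  "BMO_norm \<phi> f = (SUP x. SUP r\<in>{0<..}.
     (\<integral>\<^sup>+ y \<in> ball x r. ennreal (norm (f y - ball_mean f x r)) \<partial>lebesgue) / ball_norm \<phi> x r)"

definition BMO :: "(real ^ 'n \<Rightarrow> real \<Rightarrow> real) \<Rightarrow> (real ^ 'n \<Rightarrow> complex) set" where
  "BMO \<phi> = {f. locally_integrable f \<and> BMO_norm \<phi> f < \<infinity>}"


subsection \<open>The Poisson semigroup and the space $\mathrm{BMO}^\varphi_{\sqrt\Delta}$\<close>

definition M_Poisson :: "(real ^ 'n \<Rightarrow> complex) set" where
  "M_Poisson = {f. locally_integrable f \<and>
     integrable lebesgue (\<lambda>x. f x /\<^sub>R (1 + norm x ^ (CARD('n) + 1)))}"

definition poisson_kernel :: "real \<Rightarrow> real ^ 'n \<Rightarrow> real" where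
  "poisson_kernel t x =
     (Gamma ((real CARD('n) + 1) / 2) / pi powr ((real CARD('n) + 1) / 2)) * t /
     (t\<^sup>2 + (norm x)\<^sup>2) powr ((real CARD('n) + 1) / 2)"

definition poisson :: "real \<Rightarrow> (real ^ 'n \<Rightarrow> complex) \<Rightarrow> real ^ 'n \<Rightarrow> complex" where
  "poisson t f x = (LINT y|lebesgue. poisson_kernel t (x - y) *\<^sub>R f y)"

text \<open>The operator $t\frac{\partial}{\partial t}P_t$.\<close>

definition t_deriv_poisson :: "real \<Rightarrow> (real ^ 'n \<Rightarrow> complex) \<Rightarrow> real ^ 'n \<Rightarrow> complex" where
  "t_deriv_poisson t g x = t *\<^sub>R vector_derivative (\<lambda>s. poisson s g x) (at t)"

definition BMO_Poisson_norm ::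
    "(real ^ 'n \<Rightarrow> real \<Rightarrow> real) \<Rightarrow> (real ^ 'n \<Rightarrow> complex) \<Rightarrow> ennreal" where
  "BMO_Poisson_norm \<phi> f = (SUP x. SUP r\<in>{0<..}.
     (\<integral>\<^sup>+ y \<in> ball x r. ennreal (norm (f y - poisson r f y)) \<partial>lebesgue) / ball_norm \<phi> x r)"

definition BMO_Poisson :: "(real ^ 'n \<Rightarrow> real \<Rightarrow> real) \<Rightarrow> (real ^ 'n \<Rightarrow> complex) set" where
  "BMO_Poisson \<phi> = {f \<in> M_Poisson. BMO_Poisson_norm \<phi> f < \<infinity>}"

definition K_Poisson :: "(real ^ 'n \<Rightarrow> complex) set" where
  "K_Poisson = {f \<in> M_Poisson. \<forall>t>0. AE x in lebesgue. poisson t f x = f x}"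

definition mod_K :: "((real ^ 'n \<Rightarrow> complex) \<times> (real ^ 'n \<Rightarrow> complex)) set" where
  "mod_K = {(f, g). (\<lambda>x. f x - g x) \<in> K_Poisson}"


subsection \<open>Carleson measures\<close>

definition upper_half_space :: "((real ^ 'n) \<times> real) set" where
  "upper_half_space = UNIV \<times> {0<..}"

definition tent :: "real ^ 'n \<Rightarrow> real \<Rightarrow> ((real ^ 'n) \<times> real) set" where
  "tent x r = ball x r \<times> {0<..<r}"

text \<open>
  Only nonnegative measures are considered, for which \<open>|\<nu>| = \<nu>\<close>. All Borel sets have to be
  measurable, because \<^const>\<open>emeasure\<close> is \<open>0\<close> on non-measurable sets.
\<close>

definition Carleson_measure ::
    "(real ^ 'n \<Rightarrow> real \<Rightarrow> real) \<Rightarrow> ((real ^ 'n) \<times> real) measure \<Rightarrow> bool" where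
  "Carleson_measure \<phi> \<nu> \<longleftrightarrow>
     space \<nu> = upper_half_space \<and>
     sets (restrict_space borel upper_half_space) \<subseteq> sets \<nu> \<and>
     (SUP x. SUP r\<in>{0<..}.
        ennpow (emeasure lebesgue (ball x r)) (1 / 2) / ball_norm \<phi> x r *
        ennpow (emeasure \<nu> (tent x r)) (1 / 2)) < \<infinity>"

definition square_measure :: "(real ^ 'n \<Rightarrow> complex) \<Rightarrow> ((real ^ 'n) \<times> real) measure" where
  "square_measure f =
     density (restrict_space lebesgue upper_half_space)
       (\<lambda>(x, t). ennreal ((norm (t_deriv_poisson t (\<lambda>y. f y - poisson t f y) x))\<^sup>2 / t))"

end

theory Submission
  imports Defs "HOL-Probability.Distributions"
begin

text \<open>
  Since \<open>(r(\<phi>) - 1) / r(\<phi>) \<le> 1\<close>, the index hypothesis provides a Muckenhoupt exponent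
  \<open>q\<close> and a lower type \<open>p\<close> of \<open>\<phi>\<close> with \<open>n q / p < n + 1\<close>. Hence the norm of the indicator of a ball grows
  under dilation by \<open>\<Lambda>\<close> at most like \<open>\<Lambda>\<^sup>\<kappa>\<close> with \<open>\<kappa> < n + 1\<close>, slower than the Poisson kernel decays, and
  summing over dyadic annuli bounds the Poisson oscillation by the mean oscillation. Conversely
  \<open>P\<^sub>s f - P\<^bsub>2 s\<^esub> f = P\<^sub>s (f - P\<^sub>s f)\<close>, so the oscillation of \<open>P\<^sub>r f\<close> on a ball of radius \<open>r\<close> telescopes over
  \<open>s = 2\<^sup>k r\<close> into Poisson oscillations.

  For the Carleson estimate, \<open>t \<partial>\<^sub>t P\<^sub>t (f - P\<^sub>t f)\<close> is \<open>t\<close> times the difference of \<open>\<partial>\<^sub>t P\<^sub>t f\<close> at the times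
  \<open>t\<close> and \<open>2 t\<close>. The part of \<open>f\<close> far from the ball is estimated pointwise; the local part needs the
  \<open>L\<^sup>2\<close> square function bound and a local \<open>L\<^sup>2\<close> bound for \<open>f\<close> minus its mean. The latter is a dyadic
  John-Nirenberg argument in which the oscillation on each subcube \<open>Q'\<close> is at most the integral over
  \<open>Q'\<close> of a fixed square integrable weight. The weight is constant under the first alternative, and a
  multiple of \<open>\<phi> (\<cdot>, 1 / N B)\<close> under the second one, which forces a reverse Hoelder exponent larger
  than \<open>2\<close>.
\<close>

text \<open>The obstacle is that N B, the norm of the indicator of a ball B, is not additive and not
  a power of |B|, so bounds on small balls cannot simply be added. The substitute is linear: upper
  type 1 gives N B' \<le> C * N B * (integral of w over B') for B' \<subseteq> B, where w =
  \<phi>(., 1 / N B) has integral of order 1 over B. Covering and stopping arguments are then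
  carried out with integrals of w. The square function bound is obtained from kernels: the squared
  L2 norm of the time derivative of P_t g is a double integral against the second time derivative of
  the kernel at 2 t, and t times that derivative has an explicit primitive dominated by the kernel,
  to which the Schur test applies. This rests on the semigroup law, which comes from writing the
  Poisson kernel as a mixture of Gaussians. In the dyadic argument the integral of (2 w - M)^2, with
  M the running maximum of the averages of w, is Doob's L2 maximal inequality in the form of a
  potential: it pays for every increase of M, so no level sets have to be summed.\<close>

subsection \<open>Subordination of the Poisson kernel to Gaussians\<close>

text \<open>The integral over the image must be known and finite in advance: this makes the
  integrand absolutely integrable, so that the change of variables for injective maps applies.
  Decreasing substitutions are covered through the absolute value of the derivative.\<close>

lemma nn_integral_substitution_inj:
  fixes f g g' :: "real \<Rightarrow> real"
  assumes S: "S \<in> sets borel"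
    and der: "\<And>x. x \<in> S \<Longrightarrow> (g has_field_derivative g' x) (at x)"
    and inj: "inj_on g S"
    and f: "f \<in> borel_measurable borel" and nonneg: "\<And>x. 0 \<le> f x"
    and val: "(\<integral>\<^sup>+x\<in>g ` S. ennreal (f x) \<partial>lborel) = ennreal b" "0 \<le> b"
    and im: "g ` S \<in> sets borel"
    and meas: "(\<lambda>x. \<bar>g' x\<bar> * f (g x)) \<in> borel_measurable (restrict_space borel S)"
  shows "(\<integral>\<^sup>+x\<in>S. ennreal (\<bar>g' x\<bar> * f (g x)) \<partial>lborel) = ennreal b"
proof -
  have "((\<lambda>x. f x) has_integral b) (g ` S)"
  proof -
    have "((\<lambda>x. if x \<in> g ` S then f x else 0) has_integral b) UNIV"
    proof (rule nn_integral_has_integral)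
      show "(\<lambda>x. if x \<in> g ` S then f x else 0) \<in> borel_measurable borel"
        using f im by measurable
      show "(\<integral>\<^sup>+ x. ennreal (if x \<in> g ` S then f x else 0) \<partial>lborel) = ennreal b"
        unfolding val(1)[symmetric] by (rule nn_integral_cong) (auto simp: indicator_def)
    qed (use nonneg val in auto)
    then show ?thesis by (simp add: has_integral_restrict_UNIV)
  qed
  then have "f absolutely_integrable_on (g ` S) \<and> integral (g ` S) f = b"
    using nonneg by (auto intro!: nonnegative_absolutely_integrable_1)
  then have "(\<lambda>x. \<bar>g' x\<bar> * f(g x)) absolutely_integrable_on S \<and>
           integral S (\<lambda>x. \<bar>g' x\<bar> * f (g x)) = b"
    using has_absolute_integral_change_of_variables_1'[of S g g' f b] S der inj
    by (auto intro: has_field_derivative_at_within)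
  then have 1: "((\<lambda>x. \<bar>g' x\<bar> * f (g x)) has_integral b) S"
    by (metis absolutely_integrable_on_def has_integral_integral)
  have 2: "((\<lambda>x. if x \<in> S then \<bar>g' x\<bar> * f (g x) else 0) has_integral b) UNIV"
    using 1 by (simp add: has_integral_restrict_UNIV)
  have "(\<integral>\<^sup>+x. ennreal (if x \<in> S then \<bar>g' x\<bar> * f (g x) else 0) \<partial>lborel) = ennreal b"
  proof (rule nn_integral_has_integral_lborel[OF _ _ 2])
    show "(\<lambda>x. if x \<in> S then \<bar>g' x\<bar> * f (g x) else 0) \<in> borel_measurable borel"
    proof -
      have "(\<lambda>x. indicator S x *\<^sub>R (\<bar>g' x\<bar> * f (g x))) \<in> borel_measurable borel"
        using meas S by (subst (asm) borel_measurable_restrict_space_iff) auto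
      also have "(\<lambda>x. indicator S x *\<^sub>R (\<bar>g' x\<bar> * f (g x))) = (\<lambda>x. if x \<in> S then \<bar>g' x\<bar> * f (g x) else 0)"
        by (auto simp: fun_eq_iff)
      finally show ?thesis .
    qed
  qed (use nonneg in auto)
  then show ?thesis
    by (rule trans[rotated]) (rule nn_integral_cong, auto simp: indicator_def)
qed

lemma nn_integral_exp_square:
  assumes "c > 0"
  shows "(\<integral>\<^sup>+x. ennreal (exp (- c * (x - m)\<^sup>2)) \<partial>lborel) = ennreal (sqrt (pi / c))"
proof -
  define \<sigma> where "\<sigma> = sqrt (1 / (2 * c))"
  have \<sigma>: "\<sigma> > 0" "2 * \<sigma>\<^sup>2 = 1 / c"
    using assms by (auto simp: \<sigma>_def)
  have "exp (- c * (x - m)\<^sup>2) = sqrt (pi / c) * normal_density m \<sigma> x" for x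
    using assms \<sigma> by (simp add: normal_density_def \<sigma>_def divide_simps real_sqrt_divide real_sqrt_mult)
  then have "(\<integral>\<^sup>+x. ennreal (exp (- c * (x - m)\<^sup>2)) \<partial>lborel) =
      (\<integral>\<^sup>+x. ennreal (sqrt (pi / c)) * ennreal (normal_density m \<sigma> x) \<partial>lborel)"
    by (intro nn_integral_cong) (simp add: ennreal_mult' normal_density_nonneg assms less_imp_le)
  also have "\<dots> = ennreal (sqrt (pi / c)) * (\<integral>\<^sup>+x. ennreal (normal_density m \<sigma> x) \<partial>lborel)"
    by (intro nn_integral_cmult) auto
  also have "(\<integral>\<^sup>+x. ennreal (normal_density m \<sigma> x) \<partial>lborel) = 1"
    using \<sigma> by (simp add: nn_integral_eq_integral integral_normal_density integrable_normal_density normal_density_nonneg)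
  finally show ?thesis by simp
qed

lemma nn_integral_Gaussian:
  fixes m :: "real ^ 'n"
  assumes "c > 0"
  shows "(\<integral>\<^sup>+x. ennreal (exp (- c * (norm (x - m))\<^sup>2)) \<partial>lborel) =
    ennreal ((pi / c) powr (real CARD('n) / 2))"
proof -
  have "(\<integral>\<^sup>+x. ennreal (exp (- c * (norm (x - m))\<^sup>2)) \<partial>lborel) =
      (\<integral>\<^sup>+x. (\<Prod>b\<in>Basis. ennreal (exp (- c * (x \<bullet> b - m \<bullet> b)\<^sup>2))) \<partial>lborel)"
  proof (intro nn_integral_cong)
    fix x :: "real ^ 'n"
    have "(norm (x - m))\<^sup>2 = (\<Sum>b\<in>Basis. (x \<bullet> b - m \<bullet> b)\<^sup>2)"
      unfolding power2_norm_eq_inner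
      by (subst euclidean_inner) (simp add: inner_diff_left power2_eq_square)
    then show "ennreal (exp (- c * (norm (x - m))\<^sup>2)) = (\<Prod>b\<in>Basis. ennreal (exp (- c * (x \<bullet> b - m \<bullet> b)\<^sup>2)))"
      by (simp add: prod_ennreal sum_distrib_left exp_sum flip: sum_negf)
  qed
  also have "\<dots> = (\<Prod>b\<in>(Basis :: (real ^ 'n) set). (\<integral>\<^sup>+x. ennreal (exp (- c * (x - m \<bullet> b)\<^sup>2)) \<partial>lborel))"
    by (rule nn_integral_lborel_prod) auto
  also have "\<dots> = ennreal (sqrt (pi / c) ^ CARD('n))"
    using nn_integral_exp_square[OF assms] by (simp add: ennreal_power assms less_imp_le)
  also have "sqrt (pi / c) ^ CARD('n) = (pi / c) powr (real CARD('n) / 2)"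
    using assms by (simp add: powr_half_sqrt[symmetric] powr_powr flip: powr_realpow)
  finally show ?thesis .
qed

text \<open>Completing the square in y: the product of the two Gaussians is centred at
  \<open>m\<close>, a weighted mean of 0 and x, and the factor left outside is a Gaussian in x in
  which the parameters have been added.\<close>

lemma nn_integral_Gaussian_convolution:
  fixes x :: "real ^ 'n"
  assumes u: "u > 0" and v: "v > 0"
  shows "(\<integral>\<^sup>+y. ennreal (exp (- (norm (x - y))\<^sup>2 / u) * exp (- (norm y)\<^sup>2 / v)) \<partial>lborel) =
    ennreal ((pi * u * v / (u + v)) powr (real CARD('n) / 2) * exp (- (norm x)\<^sup>2 / (u + v)))"
proof -
  define m where "m = (v / (u + v)) *\<^sub>R x"
  have eq: "- (norm (x - y))\<^sup>2 / u - (norm y)\<^sup>2 / v =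
      - ((u + v) / (u * v)) * (norm (y - m))\<^sup>2 - (norm x)\<^sup>2 / (u + v)" for y
  proof -
    have nz: "u \<noteq> 0" "v \<noteq> 0" "u + v \<noteq> 0" using u v by auto
    have 1: "(norm (x - y))\<^sup>2 = x \<bullet> x - 2 * (x \<bullet> y) + y \<bullet> y"
      by (simp add: power2_norm_eq_inner inner_diff inner_commute)
    have 2: "(norm (y - m))\<^sup>2 = y \<bullet> y - 2 * (v / (u + v)) * (x \<bullet> y) + (v / (u + v))\<^sup>2 * (x \<bullet> x)"
      unfolding m_def power2_norm_eq_inner
      by (simp add: inner_diff inner_commute power2_eq_square)
    show ?thesis
      unfolding 1 2 unfolding power2_norm_eq_inner using nz
      by (simp add: divide_simps power2_eq_square) (simp add: algebra_simps)
  qed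
  have "(\<integral>\<^sup>+y. ennreal (exp (- (norm (x - y))\<^sup>2 / u) * exp (- (norm y)\<^sup>2 / v)) \<partial>lborel) =
     (\<integral>\<^sup>+y. ennreal (exp (- (norm x)\<^sup>2 / (u + v))) * ennreal (exp (- ((u + v) / (u * v)) * (norm (y - m))\<^sup>2)) \<partial>lborel)"
  proof (intro nn_integral_cong)
    fix y
    have "exp (- (norm (x - y))\<^sup>2 / u) * exp (- (norm y)\<^sup>2 / v) =
        exp (- (norm x)\<^sup>2 / (u + v)) * exp (- ((u + v) / (u * v)) * (norm (y - m))\<^sup>2)"
      unfolding exp_add[symmetric] using eq[of y] by (simp add: algebra_simps)
    then show "ennreal (exp (- (norm (x - y))\<^sup>2 / u) * exp (- (norm y)\<^sup>2 / v)) =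
        ennreal (exp (- (norm x)\<^sup>2 / (u + v))) * ennreal (exp (- ((u + v) / (u * v)) * (norm (y - m))\<^sup>2))"
      by (simp flip: ennreal_mult)
  qed
  also have "\<dots> = ennreal (exp (- (norm x)\<^sup>2 / (u + v))) *
      (\<integral>\<^sup>+y. ennreal (exp (- ((u + v) / (u * v)) * (norm (y - m))\<^sup>2)) \<partial>lborel)"
    by (intro nn_integral_cmult) auto
  also have "\<dots> = ennreal (exp (- (norm x)\<^sup>2 / (u + v))) * ennreal ((pi / ((u + v) / (u * v))) powr (real CARD('n) / 2))"
    using u v by (subst nn_integral_Gaussian) auto
  also have "pi / ((u + v) / (u * v)) = pi * u * v / (u + v)" by simp
  finally show ?thesis
    by (rule trans) (subst mult.commute, rule ennreal_mult''[symmetric], simp)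
qed

text \<open>
  The substitution \<open>z \<mapsto> s / (t z)\<close> exchanges the two summands up to a factor, and their combination
  with weights \<open>t\<close> and \<open>s\<close> is a Gaussian integral in \<open>w = t z - s / z\<close>.
\<close>

lemma Levy_substituted:
  assumes t: "t > (0::real)" and s: "s > 0" and \<gamma>: "\<gamma> > 0"
  shows "(\<integral>\<^sup>+z\<in>{0<..}. ennreal ((1 + 1 / z\<^sup>2) * exp (- (t * z - s / z)\<^sup>2 / \<gamma>)) \<partial>lborel) =
    ennreal (sqrt (pi * \<gamma>) * (t + s) / (2 * t * s))"
proof -
  let ?e = "\<lambda>z. exp (- (t * z - s / z)\<^sup>2 / \<gamma>)"
  define I1 where "I1 = (\<integral>\<^sup>+z\<in>{0<..}. ennreal (?e z) \<partial>lborel)"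
  define I2 where "I2 = (\<integral>\<^sup>+z\<in>{0<..}. ennreal (1 / z\<^sup>2 * ?e z) \<partial>lborel)"
  have total: "(\<integral>\<^sup>+z\<in>{0<..}. ennreal (\<bar>t + s / z\<^sup>2\<bar> * exp (- (1 / \<gamma>) * (t * z - s / z - 0)\<^sup>2)) \<partial>lborel) = ennreal (sqrt (pi / (1 / \<gamma>)))"
  proof (rule nn_integral_substitution_inj[where g="\<lambda>z. t * z - s / z" and g'="\<lambda>z. t + s / z\<^sup>2"
        and f="\<lambda>w. exp (- (1 / \<gamma>) * (w - 0)\<^sup>2)"])
    show "((\<lambda>z. t * z - s / z) has_real_derivative t + s / x\<^sup>2) (at x)" if "x \<in> {0<..}" for x
      using that by (auto intro!: derivative_eq_intros simp: power2_eq_square)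
    have "strict_mono_on {0<..} (\<lambda>z. t * z - s / z)"
    proof (rule strict_mono_onI)
      fix x y :: real assume "x \<in> {0<..}" "y \<in> {0<..}" "x < y"
      then have "t * x < t * y" "s / y < s / x"
        using t s by (auto intro!: divide_strict_left_mono)
      then show "t * x - s / x < t * y - s / y" by linarith
    qed
    then show "inj_on (\<lambda>z. t * z - s / z) {0<..}"
      by (rule strict_mono_on_imp_inj_on)
    have im: "(\<lambda>z. t * z - s / z) ` {0<..} = UNIV"
    proof (intro equalityI subsetI)
      fix w :: real
      define d where "d = sqrt (w\<^sup>2 + 4 * t * s)"
      have d: "d\<^sup>2 = w\<^sup>2 + 4 * t * s" "d > \<bar>w\<bar>"
      proof -
        show "d\<^sup>2 = w\<^sup>2 + 4 * t * s" using t s by (simp add: d_def)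
        have "sqrt (w\<^sup>2) < d" unfolding d_def using t s by (intro real_sqrt_less_mono) auto
        then show "d > \<bar>w\<bar>" by simp
      qed
      \<comment> \<open>The positive root of t z^2 - w z - s = 0; d > |w| makes it positive for
        either sign of w.\<close>
      define z where "z = (w + d) / (2 * t)"
      have z: "z > 0" using d t by (auto simp: z_def)
      have "t * z * z - s = w * z"
      proof -
        have "2 * t * z - w = d" using t by (simp add: z_def)
        then have "(2 * t * z - w)\<^sup>2 = w\<^sup>2 + 4 * t * s" using d(1) by simp
        then have "4 * t * (t * z * z - s - w * z) = 0"
          by (simp add: power2_eq_square algebra_simps)
        then show ?thesis using t by simp
      qed
      then have "w = t * z - s / z" using z by (simp add: field_simps)
      then show "w \<in> (\<lambda>z. t * z - s / z) ` {0<..}" using z by auto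
    qed auto
    show "(\<integral>\<^sup>+ x\<in>(\<lambda>z. t * z - s / z) ` {0<..}. ennreal (exp (- (1 / \<gamma>) * (x - 0)\<^sup>2)) \<partial>lborel) = ennreal (sqrt (pi / (1 / \<gamma>)))"
      unfolding im using nn_integral_exp_square[of "1 / \<gamma>" 0] \<gamma> by simp
    show "(\<lambda>z. t * z - s / z) ` {0<..} \<in> sets borel" unfolding im by simp
    show "(\<lambda>z. \<bar>t + s / z\<^sup>2\<bar> * exp (- (1 / \<gamma>) * (t * z - s / z - 0)\<^sup>2)) \<in> borel_measurable (restrict_space borel {0<..})"
      by (intro measurable_restrict_space1) measurable
  qed (use \<gamma> in auto)
  have comb: "ennreal t * I1 + ennreal s * I2 = ennreal (sqrt (pi * \<gamma>))"
  proof -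
    have "ennreal t * I1 + ennreal s * I2 =
       (\<integral>\<^sup>+z. ennreal t * (ennreal (?e z) * indicator {0<..} z) + ennreal s * (ennreal (1 / z\<^sup>2 * ?e z) * indicator {0<..} z) \<partial>lborel)"
      unfolding I1_def I2_def
      by (subst nn_integral_add) (auto simp: nn_integral_cmult)
    also have "\<dots> = (\<integral>\<^sup>+z\<in>{0<..}. ennreal (\<bar>t + s / z\<^sup>2\<bar> * exp (- (1 / \<gamma>) * (t * z - s / z - 0)\<^sup>2)) \<partial>lborel)"
    proof (intro nn_integral_cong)
      fix z :: real
      have "\<bar>t + s / z\<^sup>2\<bar> = t + s / z\<^sup>2" using s t by (simp add: add_nonneg_nonneg)
      then show "ennreal t * (ennreal (?e z) * indicator {0<..} z) + ennreal s * (ennreal (1 / z\<^sup>2 * ?e z) * indicator {0<..} z)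
        = ennreal (\<bar>t + s / z\<^sup>2\<bar> * exp (- (1 / \<gamma>) * (t * z - s / z - 0)\<^sup>2)) * indicator {0<..} z"
        using s t by (auto simp: indicator_def algebra_simps simp flip: ennreal_mult ennreal_plus)
    qed
    also note total
    finally show ?thesis by simp
  qed
  have "I1 < \<infinity>" "I2 < \<infinity>"
    using comb t s by (auto simp: less_top[symmetric] ennreal_mult_eq_top_iff ennreal_add_eq_top dest: arg_cong[where f="\<lambda>x. x = \<infinity>"])
  then obtain i1 i2 where i: "I1 = ennreal i1" "0 \<le> i1" "I2 = ennreal i2" "0 \<le> i2"
    by (metis less_top_ennreal infinity_ennreal_def)
  \<comment> \<open>Under the substitution t z - s / z only changes its sign, so the exponential is
    invariant and the Jacobian s / (t z^2) turns one integral into the other.\<close>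
  have sym: "I1 = ennreal (s / t) * I2"
  proof -
    have "(\<integral>\<^sup>+z\<in>{0<..}. ennreal (\<bar>- (s / (t * z\<^sup>2))\<bar> * ?e (s / (t * z))) \<partial>lborel) = ennreal i1"
    proof (rule nn_integral_substitution_inj[where g="\<lambda>z. s / (t * z)" and g'="\<lambda>z. - (s / (t * z\<^sup>2))" and f="?e"])
      show "((\<lambda>z. s / (t * z)) has_real_derivative - (s / (t * x\<^sup>2))) (at x)" if "x \<in> {0<..}" for x
        using that t by (auto intro!: derivative_eq_intros simp: power2_eq_square field_simps)
      show "inj_on (\<lambda>z. s / (t * z)) {0<..}"
        using s t by (auto simp: inj_on_def)
      have im: "(\<lambda>z. s / (t * z)) ` {0<..} = {0<..}"
      proof (intro equalityI subsetI)
        fix w :: real assume "w \<in> {0<..}"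
        then show "w \<in> (\<lambda>z. s / (t * z)) ` {0<..}"
          using s t by (intro image_eqI[of _ _ "s / (t * w)"]) auto
      qed (use s t in auto)
      show "(\<integral>\<^sup>+ x\<in>(\<lambda>z. s / (t * z)) ` {0<..}. ennreal (?e x) \<partial>lborel) = ennreal i1"
        unfolding im using i by (simp add: I1_def)
      show "(\<lambda>z. s / (t * z)) ` {0<..} \<in> sets borel" unfolding im by simp
      show "(\<lambda>z. \<bar>- (s / (t * z\<^sup>2))\<bar> * ?e (s / (t * z))) \<in> borel_measurable (restrict_space borel {0<..})"
        by (intro measurable_restrict_space1) measurable
    qed (use i in auto)
    then have "I1 = (\<integral>\<^sup>+z\<in>{0<..}. ennreal (\<bar>- (s / (t * z\<^sup>2))\<bar> * ?e (s / (t * z))) \<partial>lborel)"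
      using i by simp
    also have "\<dots> = (\<integral>\<^sup>+z. ennreal (s / t) * (ennreal (1 / z\<^sup>2 * ?e z) * indicator {0<..} z) \<partial>lborel)"
    proof (intro nn_integral_cong)
      fix z :: real
      have "?e (s / (t * z)) = ?e z" if "z > 0"
      proof -
        have "t * (s / (t * z)) - s / (s / (t * z)) = - (t * z - s / z)"
          using that s t by simp
        then show ?thesis by (metis power2_minus)
      qed
      then show "ennreal (\<bar>- (s / (t * z\<^sup>2))\<bar> * ?e (s / (t * z))) * indicator {0<..} z =
         ennreal (s / t) * (ennreal (1 / z\<^sup>2 * ?e z) * indicator {0<..} z)"
        using s t by (auto simp: indicator_def simp flip: ennreal_mult)
    qed
    also have "\<dots> = ennreal (s / t) * I2"
      unfolding I2_def by (rule nn_integral_cmult) auto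
    finally show ?thesis .
  qed
  have "i1 = s / t * i2"
    using sym i s t by (simp flip: ennreal_mult)
  moreover have "t * i1 + s * i2 = sqrt (pi * \<gamma>)"
    using comb i s t \<gamma> by (simp flip: ennreal_mult ennreal_plus)
  ultimately have "i1 = sqrt (pi * \<gamma>) / (2 * t)" "i2 = sqrt (pi * \<gamma>) / (2 * s)"
    using s t by (auto simp: field_simps)
  then have "i1 + i2 = sqrt (pi * \<gamma>) * (t + s) / (2 * t * s)"
    using s t by (simp add: field_simps)
  moreover have "(\<integral>\<^sup>+z\<in>{0<..}. ennreal ((1 + 1 / z\<^sup>2) * ?e z) \<partial>lborel) = I1 + I2"
    unfolding I1_def I2_def
    by (subst nn_integral_add[symmetric]) (auto intro!: nn_integral_cong simp: indicator_def algebra_simps simp flip: ennreal_plus)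
  ultimately show ?thesis
    using i by (simp flip: ennreal_plus)
qed

text \<open>Up to constants, \<alpha> powr (-3/2) * exp (- t^2 / \<alpha>) is the density of the
  one-sided stable law of index 1/2 (Levy law) with parameter t, and the claim is that parameters
  add under convolution. With z^2 = (\<gamma> - \<alpha>) / \<alpha> the sum t^2 / \<alpha> + s^2 /
  (\<gamma> - \<alpha>) becomes (t z - s / z)^2 / \<gamma> plus the constant (t + s)^2 / \<gamma>,
  which leads to \<open>Levy_substituted\<close>.\<close>

lemma Levy_convolution:
  assumes t: "t > (0::real)" and s: "s > 0" and \<gamma>: "\<gamma> > 0"
  shows "(\<integral>\<^sup>+\<alpha>\<in>{0<..<\<gamma>}. ennreal ((\<alpha> * (\<gamma> - \<alpha>)) powr (-3/2) * exp (- t\<^sup>2 / \<alpha> - s\<^sup>2 / (\<gamma> - \<alpha>))) \<partial>lborel) =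
    ennreal (sqrt pi * (t + s) / (t * s) * \<gamma> powr (-3/2) * exp (- (t + s)\<^sup>2 / \<gamma>))"
proof -
  let ?h = "\<lambda>\<alpha>. ennreal ((\<alpha> * (\<gamma> - \<alpha>)) powr (-3/2) * exp (- t\<^sup>2 / \<alpha> - s\<^sup>2 / (\<gamma> - \<alpha>)))"
  let ?I = "\<integral>\<^sup>+\<alpha>\<in>{0<..<\<gamma>}. ?h \<alpha> \<partial>lborel"
  let ?g = "\<lambda>\<alpha>. sqrt (\<gamma> / \<alpha> - 1)"
  let ?g' = "\<lambda>\<alpha>. - (\<gamma> / \<alpha>\<^sup>2) / (2 * sqrt (\<gamma> / \<alpha> - 1))"
  let ?f = "\<lambda>z. (1 + 1 / z\<^sup>2) * exp (- (t * z - s / z)\<^sup>2 / \<gamma>)"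
  let ?V = "sqrt (pi * \<gamma>) * (t + s) / (2 * t * s)"
  have "(\<integral>\<^sup>+\<alpha>\<in>{0<..<\<gamma>}. ennreal (\<bar>?g' \<alpha>\<bar> * ?f (?g \<alpha>)) \<partial>lborel) = ennreal ?V"
  proof (rule nn_integral_substitution_inj[where g="?g" and g'="?g'" and f="?f"])
    show "(?g has_real_derivative ?g' x) (at x)" if "x \<in> {0<..<\<gamma>}" for x
      using that by (auto intro!: derivative_eq_intros simp: power2_eq_square field_simps)
    show "inj_on ?g {0<..<\<gamma>}"
      using \<gamma> by (auto simp: inj_on_def field_simps)
    have im: "?g ` {0<..<\<gamma>} = {0<..}"
    proof (intro equalityI subsetI)
      fix w :: real assume w: "w \<in> {0<..}"
      then have "\<gamma> / (\<gamma> / (1 + w\<^sup>2)) - 1 = w\<^sup>2" using \<gamma> by simp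
      then have "w = ?g (\<gamma> / (1 + w\<^sup>2))" using w by simp
      moreover have "\<gamma> / (1 + w\<^sup>2) \<in> {0<..<\<gamma>}"
        using \<gamma> w by (auto simp: divide_simps add_pos_pos)
      ultimately show "w \<in> ?g ` {0<..<\<gamma>}" by blast
    qed (use \<gamma> in \<open>auto simp: field_simps\<close>)
    show "(\<integral>\<^sup>+ x\<in>?g ` {0<..<\<gamma>}. ennreal (?f x) \<partial>lborel) = ennreal ?V"
      unfolding im by (rule Levy_substituted[OF assms])
    show "?g ` {0<..<\<gamma>} \<in> sets borel" unfolding im by simp
    show "(\<lambda>x. \<bar>?g' x\<bar> * ?f (?g x)) \<in> borel_measurable (restrict_space borel {0<..<\<gamma>})"
      by (intro measurable_restrict_space1) measurable
  qed (use assms in auto)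
  also have "(\<integral>\<^sup>+\<alpha>\<in>{0<..<\<gamma>}. ennreal (\<bar>?g' \<alpha>\<bar> * ?f (?g \<alpha>)) \<partial>lborel) =
    (\<integral>\<^sup>+\<alpha>. ennreal (\<gamma>\<^sup>2 / 2 * exp ((t + s)\<^sup>2 / \<gamma>)) * (?h \<alpha> * indicator {0<..<\<gamma>} \<alpha>) \<partial>lborel)"
  proof (intro nn_integral_cong)
    fix \<alpha> :: real
    show "ennreal (\<bar>?g' \<alpha>\<bar> * ?f (?g \<alpha>)) * indicator {0<..<\<gamma>} \<alpha> =
      ennreal (\<gamma>\<^sup>2 / 2 * exp ((t + s)\<^sup>2 / \<gamma>)) * (?h \<alpha> * indicator {0<..<\<gamma>} \<alpha>)"
    proof (cases "\<alpha> \<in> {0<..<\<gamma>}")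
      case True
      define \<beta> where "\<beta> = \<gamma> - \<alpha>"
      have pos: "\<alpha> > 0" "\<beta> > 0" "\<gamma> = \<alpha> + \<beta>" using True by (auto simp: \<beta>_def)
      define z where "z = ?g \<alpha>"
      have z2: "z\<^sup>2 = \<beta> / \<alpha>" and z: "z > 0"
        using pos by (auto simp: z_def field_simps)
      have "(t * z - s / z)\<^sup>2 = t\<^sup>2 * z\<^sup>2 - 2 * t * s + s\<^sup>2 / z\<^sup>2"
        using z by (simp add: power2_eq_square field_simps)
      also have "\<dots> = t\<^sup>2 * (\<beta> / \<alpha>) - 2 * t * s + s\<^sup>2 * (\<alpha> / \<beta>)"
        by (simp add: z2)
      also have "\<dots> / \<gamma> = (t\<^sup>2 / \<alpha> + s\<^sup>2 / \<beta>) - (t + s)\<^sup>2 / \<gamma>"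
        using pos by (simp add: divide_simps power2_eq_square) (simp add: algebra_simps)
      finally have e: "exp (- (t * z - s / z)\<^sup>2 / \<gamma>) = exp ((t + s)\<^sup>2 / \<gamma>) * exp (- t\<^sup>2 / \<alpha> - s\<^sup>2 / \<beta>)"
        by (simp flip: exp_add)
      have zs: "z = sqrt \<beta> / sqrt \<alpha>"
        using z2 z pos by (metis abs_of_pos real_sqrt_abs real_sqrt_divide)
      have p: "(\<alpha> * \<beta>) powr (-3/2) = 1 / (\<alpha> * \<beta> * (sqrt \<alpha> * sqrt \<beta>))"
      proof -
        have "(\<alpha> * \<beta>) powr (-3/2) = (\<alpha> * \<beta>) powr (- (1 + 1/2))" by simp
        also have "\<dots> = 1 / ((\<alpha> * \<beta>) powr 1 * (\<alpha> * \<beta>) powr (1/2))"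
          unfolding powr_minus powr_add by (simp add: inverse_eq_divide)
        finally show ?thesis using pos by (simp add: powr_half_sqrt real_sqrt_mult)
      qed
      define A B where "A = sqrt \<alpha>" and "B = sqrt \<beta>"
      have sq: "\<alpha> = A * A" "\<beta> = B * B" "A > 0" "B > 0"
        using pos by (auto simp: A_def B_def)
      have "\<bar>?g' \<alpha>\<bar> * (1 + 1 / z\<^sup>2) = \<gamma> / \<alpha>\<^sup>2 / (2 * z) * (\<gamma> / \<beta>)"
      proof -
        have "\<bar>?g' \<alpha>\<bar> = \<gamma> / \<alpha>\<^sup>2 / (2 * z)"
          unfolding z_def[symmetric] using pos(1,2) z \<gamma> by (simp add: abs_mult)
        moreover have "1 + 1 / z\<^sup>2 = \<gamma> / \<beta>"
          unfolding z2 using pos by (simp add: field_simps)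
        ultimately show ?thesis by simp
      qed
      also have "\<dots> = \<gamma>\<^sup>2 / 2 * (\<alpha> * \<beta>) powr (-3/2)"
        unfolding p zs A_def[symmetric] B_def[symmetric] unfolding sq(1,2) using sq(3,4)
        by (simp add: field_simps power2_eq_square)
      finally have "\<bar>?g' \<alpha>\<bar> * (1 + 1 / z\<^sup>2) = \<gamma>\<^sup>2 / 2 * (\<alpha> * \<beta>) powr (-3/2)" .
      note g' = this
      have "\<bar>?g' \<alpha>\<bar> * ?f z = (\<bar>?g' \<alpha>\<bar> * (1 + 1 / z\<^sup>2)) * exp (- (t * z - s / z)\<^sup>2 / \<gamma>)"
        by (simp only: mult.assoc)
      also have "\<dots> = (\<gamma>\<^sup>2 / 2 * exp ((t + s)\<^sup>2 / \<gamma>)) * ((\<alpha> * \<beta>) powr (-3/2) * exp (- t\<^sup>2 / \<alpha> - s\<^sup>2 / \<beta>))"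
        unfolding g' e by (simp only: mult_ac)
      finally have "\<bar>?g' \<alpha>\<bar> * ?f z = (\<gamma>\<^sup>2 / 2 * exp ((t + s)\<^sup>2 / \<gamma>)) * ((\<alpha> * \<beta>) powr (-3/2) * exp (- t\<^sup>2 / \<alpha> - s\<^sup>2 / \<beta>))" .
      then show ?thesis
        using True unfolding z_def[symmetric] \<beta>_def[symmetric]
        by (simp flip: ennreal_mult'')
    qed simp
  qed
  also have "\<dots> = ennreal (\<gamma>\<^sup>2 / 2 * exp ((t + s)\<^sup>2 / \<gamma>)) * ?I"
    by (intro nn_integral_cmult) auto
  finally have I: "ennreal (\<gamma>\<^sup>2 / 2 * exp ((t + s)\<^sup>2 / \<gamma>)) * ?I = ennreal ?V" .
  define c where "c = \<gamma>\<^sup>2 / 2 * exp ((t + s)\<^sup>2 / \<gamma>)"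
  have c: "c > 0" using \<gamma> by (simp add: c_def)
  have "?I = ennreal (1 / c) * (ennreal c * ?I)"
    using c by (simp add: mult.assoc[symmetric] flip: ennreal_mult)
  also have "\<dots> = ennreal (1 / c * ?V)"
    using c I assms unfolding c_def by (simp flip: ennreal_mult)
  also have "1 / c * ?V = sqrt pi * (t + s) / (t * s) * \<gamma> powr (-3/2) * exp (- (t + s)\<^sup>2 / \<gamma>)"
  proof -
    have gp: "\<gamma> powr (-3/2) = sqrt \<gamma> / \<gamma>\<^sup>2"
    proof -
      have "\<gamma> powr (-3/2) = \<gamma> powr (1/2 - 2)" by simp
      also have "\<dots> = sqrt \<gamma> / \<gamma>\<^sup>2" unfolding powr_diff using \<gamma> by (simp add: powr_half_sqrt)
      finally show ?thesis .
    qed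
    show ?thesis
      unfolding gp c_def real_sqrt_mult using assms by (simp add: exp_minus field_simps)
  qed
  finally show ?thesis .
qed

text \<open>The Gamma integral after the substitution of b / \<alpha>, where b = t^2 + |x|^2. The
  integrand is the Levy density with parameter t times the normalised Gaussian (\<pi>
  \<alpha>)^(-n/2) exp (- |x|^2 / \<alpha>), so the Poisson kernel is a mixture of
  Gaussians.\<close>

lemma poisson_kernel_subordination:
  fixes x :: "real ^ 'n"
  assumes t: "t > 0"
  shows "ennreal (poisson_kernel t x) =
    (\<integral>\<^sup>+\<alpha>\<in>{0<..}. ennreal (pi powr (- ((real CARD('n) + 1) / 2)) * t * \<alpha> powr (- ((real CARD('n) + 3) / 2)) *
       exp (- (t\<^sup>2 + (norm x)\<^sup>2) / \<alpha>)) \<partial>lborel)"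
proof -
  define a where "a = (real CARD('n) + 1) / 2"
  define b where "b = t\<^sup>2 + (norm x)\<^sup>2"
  have a: "a > 0" by (simp add: a_def)
  have b: "b > 0" unfolding b_def using t by (intro add_pos_nonneg) auto
  have n: "real CARD('n) = 2 * a - 1" by (simp add: a_def field_simps)
  let ?f = "\<lambda>u. indicator {0..} u * u powr (a - 1) / exp u :: real"
  let ?C = "pi powr (- a) * t"
  have G: "(\<integral>\<^sup>+u. ennreal (?f u) \<partial>lborel) = ennreal (Gamma a)"
    using Gamma_conv_nn_integral_real[OF a] by simp
  have "(\<integral>\<^sup>+u\<in>{0<..}. ennreal (\<bar>- (b / u\<^sup>2)\<bar> * ?f (b / u)) \<partial>lborel) = ennreal (Gamma a)"
  proof (rule nn_integral_substitution_inj[where g="\<lambda>u. b / u" and g'="\<lambda>u. - (b / u\<^sup>2)" and f="?f"])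
    show "((\<lambda>u. b / u) has_real_derivative - (b / u\<^sup>2)) (at u)" if "u \<in> {0<..}" for u
      using that by (auto intro!: derivative_eq_intros simp: power2_eq_square)
    show "inj_on (\<lambda>u. b / u) {0<..}" using b by (auto simp: inj_on_def)
    have im: "(\<lambda>u. b / u) ` {0<..} = {0<..}"
    proof (intro equalityI subsetI)
      fix w :: real assume "w \<in> {0<..}"
      then show "w \<in> (\<lambda>u. b / u) ` {0<..}"
        using b by (intro image_eqI[of _ _ "b / w"]) auto
    qed (use b in auto)
    have "(\<integral>\<^sup>+u\<in>{0<..}. ennreal (?f u) \<partial>lborel) = (\<integral>\<^sup>+u. ennreal (?f u) \<partial>lborel)"
    proof (rule nn_integral_cong)
      fix u :: real show "ennreal (?f u) * indicator {0<..} u = ennreal (?f u)"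
        by (cases "u = 0") (auto simp: indicator_def)
    qed
    then show "(\<integral>\<^sup>+u\<in>(\<lambda>u. b / u) ` {0<..}. ennreal (?f u) \<partial>lborel) = ennreal (Gamma a)"
      unfolding im using G by simp
    show "(\<lambda>u. b / u) ` {0<..} \<in> sets borel" unfolding im by simp
    show "(\<lambda>u. \<bar>- (b / u\<^sup>2)\<bar> * ?f (b / u)) \<in> borel_measurable (restrict_space borel {0<..})"
      by (intro measurable_restrict_space1) measurable
  qed (use a in \<open>auto intro!: divide_nonneg_pos Gamma_real_nonneg\<close>)
  then have "ennreal (?C * b powr (- a)) * ennreal (Gamma a) =
     ennreal (?C * b powr (- a)) * (\<integral>\<^sup>+u\<in>{0<..}. ennreal (\<bar>- (b / u\<^sup>2)\<bar> * ?f (b / u)) \<partial>lborel)"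
    by simp
  also have "\<dots> = (\<integral>\<^sup>+u. ennreal (?C * b powr (- a)) * (ennreal (\<bar>- (b / u\<^sup>2)\<bar> * ?f (b / u)) * indicator {0<..} u) \<partial>lborel)"
    by (rule nn_integral_cmult[symmetric]) measurable
  also have "\<dots> = (\<integral>\<^sup>+u\<in>{0<..}. ennreal (?C * u powr (- (a + 1)) * exp (- b / u)) \<partial>lborel)"
  proof (intro nn_integral_cong)
    fix u :: real
    show "ennreal (?C * b powr (- a)) * (ennreal (\<bar>- (b / u\<^sup>2)\<bar> * ?f (b / u)) * indicator {0<..} u) =
       ennreal (?C * u powr (- (a + 1)) * exp (- b / u)) * indicator {0<..} u"
    proof (cases "u > 0")
      case True
      have p1: "(b / u) powr (a - 1) = b powr a / b * (u / u powr a)"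
        using True b by (simp add: powr_divide powr_diff)
      have p2: "u powr (- (a + 1)) = 1 / (u powr a * u)"
        using True by (simp only: powr_minus powr_add powr_one inverse_eq_divide)
      have p3: "b powr (- a) = 1 / b powr a" by (simp add: powr_minus inverse_eq_divide)
      have f: "?f (b / u) = (b / u) powr (a - 1) * exp (- b / u)"
        using True b by (simp add: exp_minus field_simps)
      have "?C * b powr (- a) * (\<bar>- (b / u\<^sup>2)\<bar> * ?f (b / u)) = ?C * u powr (- (a + 1)) * exp (- b / u)"
        unfolding f p1 p2 p3 using True b by (simp add: field_simps power2_eq_square exp_minus)
      then show ?thesis using True t b by (simp flip: ennreal_mult'')
    qed simp
  qed
  finally have "ennreal (?C * b powr (- a)) * ennreal (Gamma a) =
    (\<integral>\<^sup>+u\<in>{0<..}. ennreal (?C * u powr (- (a + 1)) * exp (- b / u)) \<partial>lborel)" .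
  moreover have "ennreal (?C * b powr (- a)) * ennreal (Gamma a) = ennreal (poisson_kernel t x)"
  proof -
    have "poisson_kernel t x = ?C * b powr (- a) * Gamma a"
      unfolding poisson_kernel_def a_def[symmetric] b_def[symmetric]
      by (simp add: powr_minus field_simps)
    then show ?thesis using a t by (simp add: ennreal_mult'' Gamma_real_nonneg)
  qed
  moreover have "a + 1 = (real CARD('n) + 3) / 2" by (simp add: n)
  ultimately show ?thesis unfolding a_def[symmetric] b_def[symmetric] by simp
qed

lemma poisson_kernel_pos: "t > 0 \<Longrightarrow> poisson_kernel t (x :: real ^ 'n) > 0"
  by (auto simp: poisson_kernel_def intro!: divide_pos_pos mult_pos_pos Gamma_real_pos add_pos_nonneg)

lemma poisson_kernel_nonneg: "t > 0 \<Longrightarrow> poisson_kernel t (x :: real ^ 'n) \<ge> 0"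
  using poisson_kernel_pos[of t x] by simp

lemma poisson_kernel_minus: "poisson_kernel t (- x) = poisson_kernel t (x :: real ^ 'n)"
  by (simp add: poisson_kernel_def)

lemma poisson_kernel_commute: "poisson_kernel t (x - y) = poisson_kernel t (y - (x :: real ^ 'n))"
  by (simp add: poisson_kernel_def norm_minus_commute)

lemma borel_measurable_poisson_kernel[measurable]:
  "(\<lambda>z. poisson_kernel (fst z) (snd z :: real ^ 'n)) \<in> borel_measurable (borel \<Otimes>\<^sub>M borel)"
  unfolding poisson_kernel_def by measurable

text \<open>Both kernels are written as Gaussian mixtures. After Tonelli the Gaussians are convolved
  in y, which adds \<alpha> and \<beta>; then the mixing laws are convolved over \<alpha> + \<beta>
  = \<gamma>, and what remains is the mixture that represents time t + s.\<close>

lemma nn_integral_poisson_kernel_convolution_lborel: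
  fixes x :: "real ^ 'n"
  assumes t: "t > 0" and s: "s > 0"
  shows "(\<integral>\<^sup>+y. ennreal (poisson_kernel t (x - y) * poisson_kernel s y) \<partial>lborel) = ennreal (poisson_kernel (t + s) x)"
proof -
  define a where "a = (real CARD('n) + 1) / 2"
  have n2: "real CARD('n) / 2 = a - 1/2" and n3: "(real CARD('n) + 3) / 2 = a + 1"
    by (simp_all add: a_def add_divide_distrib)
  let ?G = "\<lambda>t \<alpha> x. pi powr (- a) * t * \<alpha> powr (- (a + 1)) * exp (- (t\<^sup>2 + (norm x)\<^sup>2) / \<alpha>) :: real"
  have sub: "ennreal (poisson_kernel t x) = (\<integral>\<^sup>+\<alpha>. ennreal (?G t \<alpha> x) * indicator {0<..} \<alpha> \<partial>lborel)"
    if "t > 0" for t and x :: "real ^ 'n"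
    using poisson_kernel_subordination[OF that, of x] unfolding n3 a_def[symmetric] .
  have G0: "?G t \<alpha> x \<ge> 0" if "t > 0" for t \<alpha> and x :: "real ^ 'n" using that by simp
  let ?K = "\<lambda>\<alpha> \<beta>. (pi powr (-2 * a) * t * s * (\<alpha> * \<beta>) powr (- (a + 1)) * exp (- t\<^sup>2 / \<alpha> - s\<^sup>2 / \<beta>)) * ((pi * \<alpha> * \<beta> / (\<alpha> + \<beta>)) powr (a - 1/2) * exp (- (norm x)\<^sup>2 / (\<alpha> + \<beta>))) :: real"
  let ?H = "\<lambda>\<alpha> \<beta> y. ennreal (?G t \<alpha> (x - y)) * indicator {0<..} \<alpha> * (ennreal (?G s \<beta> y) * indicator {0<..} \<beta>)"
  let ?J = "\<lambda>\<alpha> \<gamma>. ennreal (?K \<alpha> (\<gamma> - \<alpha>)) * (indicator {0<..} \<alpha> * indicator {0<..} (\<gamma> - \<alpha>))"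
  have "(\<integral>\<^sup>+y. ennreal (poisson_kernel t (x - y) * poisson_kernel s y) \<partial>lborel) =
    (\<integral>\<^sup>+y. (\<integral>\<^sup>+\<alpha>. (\<integral>\<^sup>+\<beta>. ?H \<alpha> \<beta> y \<partial>lborel) \<partial>lborel) \<partial>lborel)"
    using t s by (intro nn_integral_cong)
      (simp add: ennreal_mult poisson_kernel_nonneg sub[OF t] sub[OF s] nn_integral_cmult nn_integral_multc del: times_divide_eq_left minus_divide_left[symmetric])
  also have "\<dots> = (\<integral>\<^sup>+\<alpha>. (\<integral>\<^sup>+y. (\<integral>\<^sup>+\<beta>. ?H \<alpha> \<beta> y \<partial>lborel) \<partial>lborel) \<partial>lborel)"
    by (rule lborel_pair.Fubini') measurable
  also have "\<dots> = (\<integral>\<^sup>+\<alpha>. (\<integral>\<^sup>+\<beta>. (\<integral>\<^sup>+y. ?H \<alpha> \<beta> y \<partial>lborel) \<partial>lborel) \<partial>lborel)"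
    by (intro nn_integral_cong lborel_pair.Fubini') measurable
  also have "\<dots> = (\<integral>\<^sup>+\<alpha>. (\<integral>\<^sup>+\<beta>. ennreal (?K \<alpha> \<beta>) * (indicator {0<..} \<alpha> * indicator {0<..} \<beta>) \<partial>lborel) \<partial>lborel)"
  proof (intro nn_integral_cong)
    fix \<alpha> \<beta> :: real
    show "(\<integral>\<^sup>+y. ?H \<alpha> \<beta> y \<partial>lborel) =
      ennreal (?K \<alpha> \<beta>) * (indicator {0<..} \<alpha> * indicator {0<..} \<beta>)"
    proof (cases "\<alpha> > 0 \<and> \<beta> > 0")
      case True
      define c where "c = pi powr (-2 * a) * t * s * (\<alpha> * \<beta>) powr (- (a + 1)) * exp (- t\<^sup>2 / \<alpha> - s\<^sup>2 / \<beta>)"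
      have c: "c \<ge> 0" using t s by (simp add: c_def)
      have "?G t \<alpha> (x - y) * ?G s \<beta> y = c * (exp (- (norm (x - y))\<^sup>2 / \<alpha>) * exp (- (norm y)\<^sup>2 / \<beta>))" for y
      proof -
        have "exp (- (t\<^sup>2 + (norm (x - y))\<^sup>2) / \<alpha>) * exp (- (s\<^sup>2 + (norm y)\<^sup>2) / \<beta>) =
            exp (- t\<^sup>2 / \<alpha> - s\<^sup>2 / \<beta>) * (exp (- (norm (x - y))\<^sup>2 / \<alpha>) * exp (- (norm y)\<^sup>2 / \<beta>))"
          unfolding exp_add[symmetric] by (simp add: diff_divide_distrib add_divide_distrib)
        moreover have "pi powr (-2 * a) = pi powr (- a) * pi powr (- a)"
          by (simp flip: powr_add)
        ultimately show ?thesis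
          using True by (simp add: c_def powr_mult)
      qed
      then have "(\<integral>\<^sup>+y. ?H \<alpha> \<beta> y \<partial>lborel) =
        (\<integral>\<^sup>+y. ennreal c * ennreal (exp (- (norm (x - y))\<^sup>2 / \<alpha>) * exp (- (norm y)\<^sup>2 / \<beta>)) \<partial>lborel)"
        using True c G0[OF t] G0[OF s] by (intro nn_integral_cong) (simp flip: ennreal_mult del: times_divide_eq_left minus_divide_left[symmetric])
      also have "\<dots> = ennreal c * ennreal ((pi * \<alpha> * \<beta> / (\<alpha> + \<beta>)) powr (a - 1/2) * exp (- (norm x)\<^sup>2 / (\<alpha> + \<beta>)))"
        using True nn_integral_Gaussian_convolution[of \<alpha> \<beta> x, unfolded n2]
        by (subst nn_integral_cmult) auto
      finally show ?thesis using True c by (simp add: c_def flip: ennreal_mult)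
    qed (auto simp: indicator_def)
  qed
  \<comment> \<open>The inner variable \<beta> is replaced by \<gamma> = \<alpha> + \<beta>, so that
    the order of integration can be exchanged and \<alpha> integrated first.\<close>
  also have "\<dots> = (\<integral>\<^sup>+\<alpha>. (\<integral>\<^sup>+\<gamma>. ?J \<alpha> \<gamma> \<partial>lborel) \<partial>lborel)"
  proof (rule nn_integral_cong)
    fix \<alpha> :: real
    let ?h = "\<lambda>\<beta>. ennreal (?K \<alpha> \<beta>) * (indicator {0<..} \<alpha> * indicator {0<..} \<beta>)"
    have "(\<integral>\<^sup>+\<beta>. ?h \<beta> \<partial>lborel) = (\<integral>\<^sup>+\<gamma>. ?h (- \<alpha> + 1 * \<gamma>) \<partial>lborel)"
      by (subst nn_integral_real_affine[where c=1 and t="-\<alpha>"]) auto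
    then show "(\<integral>\<^sup>+\<beta>. ?h \<beta> \<partial>lborel) = (\<integral>\<^sup>+\<gamma>. ?h (\<gamma> - \<alpha>) \<partial>lborel)" by simp
  qed
  also have "\<dots> = (\<integral>\<^sup>+\<gamma>. (\<integral>\<^sup>+\<alpha>. ?J \<alpha> \<gamma> \<partial>lborel) \<partial>lborel)"
    by (rule lborel_pair.Fubini') measurable
  also have "\<dots> = (\<integral>\<^sup>+\<gamma>. ennreal (?G (t + s) \<gamma> x) * indicator {0<..} \<gamma> \<partial>lborel)"
  proof (intro nn_integral_cong)
    fix \<gamma> :: real
    show "(\<integral>\<^sup>+\<alpha>. ?J \<alpha> \<gamma> \<partial>lborel) =
       ennreal (?G (t + s) \<gamma> x) * indicator {0<..} \<gamma>"
    proof (cases "\<gamma> > 0")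
      case True
      define c where "c = pi powr (- a - 1/2) * t * s * \<gamma> powr (- a + 1/2) * exp (- (norm x)\<^sup>2 / \<gamma>)"
      have c: "c \<ge> 0" using t s by (simp add: c_def)
      have "?J \<alpha> \<gamma> =
        ennreal c * (ennreal ((\<alpha> * (\<gamma> - \<alpha>)) powr (-3/2) * exp (- t\<^sup>2 / \<alpha> - s\<^sup>2 / (\<gamma> - \<alpha>))) * indicator {0<..<\<gamma>} \<alpha>)" for \<alpha>
      proof (cases "\<alpha> \<in> {0<..<\<gamma>}")
        case A: True
        define m where "m = \<alpha> * (\<gamma> - \<alpha>)"
        have m: "m > 0" using A by (simp add: m_def)
        have e1: "pi * \<alpha> * (\<gamma> - \<alpha>) / (\<alpha> + (\<gamma> - \<alpha>)) = pi * m / \<gamma>" by (simp add: m_def)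
        have f1: "m powr (- (a + 1)) * (pi * m / \<gamma>) powr (a - 1/2) = pi powr (a - 1/2) * \<gamma> powr (- a + 1/2) * m powr (-3/2)"
        proof -
          have "(pi * m / \<gamma>) powr (a - 1/2) = pi powr (a - 1/2) * m powr (a - 1/2) / \<gamma> powr (a - 1/2)"
            using m True by (simp add: powr_mult powr_divide)
          also have "\<gamma> powr (a - 1/2) = 1 / \<gamma> powr (- a + 1/2)"
            using powr_minus[of \<gamma> "- a + 1/2"] by (simp add: inverse_eq_divide)
          finally have "m powr (- (a + 1)) * (pi * m / \<gamma>) powr (a - 1/2) =
             pi powr (a - 1/2) * \<gamma> powr (- a + 1/2) * (m powr (- (a + 1)) * m powr (a - 1/2))" by simp
          also have "m powr (- (a + 1)) * m powr (a - 1/2) = m powr (-3/2)" by (simp flip: powr_add)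
          finally show ?thesis .
        qed
        have f2: "pi powr (-2 * a) * pi powr (a - 1/2) = pi powr (- a - 1/2)"
          by (simp flip: powr_add)
        let ?E = "exp (- t\<^sup>2 / \<alpha> - s\<^sup>2 / (\<gamma> - \<alpha>))" and ?X = "exp (- (norm x)\<^sup>2 / \<gamma>)"
        have "?K \<alpha> (\<gamma> - \<alpha>) = (pi powr (-2 * a) * t * s * m powr (- (a + 1)) * ?E) * ((pi * m / \<gamma>) powr (a - 1/2) * ?X)"
          unfolding e1 m_def by simp
        also have "\<dots> = pi powr (-2 * a) * t * s * ?E * ?X * (m powr (- (a + 1)) * (pi * m / \<gamma>) powr (a - 1/2))"
          by (simp only: mult_ac)
        also have "\<dots> = (pi powr (-2 * a) * pi powr (a - 1/2)) * t * s * ?E * ?X * (\<gamma> powr (- a + 1/2) * m powr (-3/2))"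
          unfolding f1 by (simp only: mult_ac)
        also have "\<dots> = c * (m powr (-3/2) * ?E)"
          unfolding f2 c_def by (simp only: mult_ac)
        finally have K: "?K \<alpha> (\<gamma> - \<alpha>) = c * (m powr (-3/2) * ?E)" .
        have "ennreal (?K \<alpha> (\<gamma> - \<alpha>)) = ennreal c * ennreal (m powr (-3/2) * ?E)"
          unfolding K by (rule ennreal_mult'[OF c])
        then show ?thesis using A unfolding m_def by simp
      qed (auto simp: indicator_def)
      then have "(\<integral>\<^sup>+\<alpha>. ?J \<alpha> \<gamma> \<partial>lborel) =
        ennreal c * ennreal (sqrt pi * (t + s) / (t * s) * \<gamma> powr (-3/2) * exp (- (t + s)\<^sup>2 / \<gamma>))"
        using Levy_convolution[OF t s True] by (simp add: nn_integral_cmult)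
      also have "\<dots> = ennreal (?G (t + s) \<gamma> x)"
      proof -
        have "pi powr (- a - 1/2) * sqrt pi = pi powr (- a)"
          by (simp add: powr_half_sqrt[symmetric] flip: powr_add)
        moreover have "\<gamma> powr (- a + 1/2) * \<gamma> powr (-3/2) = \<gamma> powr (- (a + 1))"
          unfolding powr_add[symmetric] by (simp add: algebra_simps)
        moreover have "exp (- (norm x)\<^sup>2 / \<gamma>) * exp (- (t + s)\<^sup>2 / \<gamma>) = exp (- ((t + s)\<^sup>2 + (norm x)\<^sup>2) / \<gamma>)"
          unfolding exp_add[symmetric] by (simp add: add_divide_distrib diff_divide_distrib)
        moreover have "c * (sqrt pi * (t + s) / (t * s) * \<gamma> powr (-3/2) * exp (- (t + s)\<^sup>2 / \<gamma>)) =
          (pi powr (- a - 1/2) * sqrt pi) * (t + s) * (\<gamma> powr (- a + 1/2) * \<gamma> powr (-3/2)) * (exp (- (norm x)\<^sup>2 / \<gamma>) * exp (- (t + s)\<^sup>2 / \<gamma>))"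
          unfolding c_def using t s by (simp add: divide_simps)
        ultimately show ?thesis using c by (simp flip: ennreal_mult')
      qed
      finally show ?thesis using True by simp
    next
      case False
      then show ?thesis
        by (auto simp: indicator_def nn_integral_0_iff_AE)
    qed
  qed
  also have "\<dots> = ennreal (poisson_kernel (t + s) x)"
    using sub[of "t + s" x] t s by simp
  finally show ?thesis .
qed

text \<open>By subordination the Gaussians integrate to 1, and the total mass of the Levy law is
  left; w = t * u powr (-1/2) turns it into a multiple of half a Gaussian integral.\<close>

lemma nn_integral_poisson_kernel_lborel:
  assumes t: "t > 0"
  shows "(\<integral>\<^sup>+y. ennreal (poisson_kernel t (y :: real ^ 'n)) \<partial>lborel) = 1"
proof -
  define a where "a = (real CARD('n) + 1) / 2"
  have n2: "real CARD('n) / 2 = a - 1/2" and n3: "(real CARD('n) + 3) / 2 = a + 1"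
    by (simp_all add: a_def add_divide_distrib)
  let ?G = "\<lambda>\<alpha> x. pi powr (- a) * t * \<alpha> powr (- (a + 1)) * exp (- (t\<^sup>2 + (norm x)\<^sup>2) / \<alpha>) :: real"
  have "(\<integral>\<^sup>+y. ennreal (poisson_kernel t (y :: real ^ 'n)) \<partial>lborel) =
    (\<integral>\<^sup>+y. (\<integral>\<^sup>+\<alpha>. ennreal (?G \<alpha> (y :: real ^ 'n)) * indicator {0<..} \<alpha> \<partial>lborel) \<partial>lborel)"
    using poisson_kernel_subordination[OF t, where ?'n='n] unfolding n3 a_def[symmetric] by simp
  also have "\<dots> = (\<integral>\<^sup>+\<alpha>. (\<integral>\<^sup>+y. ennreal (?G \<alpha> (y :: real ^ 'n)) * indicator {0<..} \<alpha> \<partial>lborel) \<partial>lborel)"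
    by (rule lborel_pair.Fubini') measurable
  also have "\<dots> = (\<integral>\<^sup>+\<alpha>. ennreal (t / sqrt pi * \<alpha> powr (-3/2) * exp (- (t\<^sup>2 / \<alpha>))) * indicator {0<..} \<alpha> \<partial>lborel)"
  proof (intro nn_integral_cong)
    fix \<alpha> :: real
    show "(\<integral>\<^sup>+y. ennreal (?G \<alpha> (y :: real ^ 'n)) * indicator {0<..} \<alpha> \<partial>lborel) =
      ennreal (t / sqrt pi * \<alpha> powr (-3/2) * exp (- (t\<^sup>2 / \<alpha>))) * indicator {0<..} \<alpha>"
    proof (cases "\<alpha> > 0")
      case True
      define c where "c = pi powr (- a) * t * \<alpha> powr (- (a + 1)) * exp (- (t\<^sup>2 / \<alpha>))"
      have c: "c \<ge> 0" using t by (simp add: c_def)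
      have "?G \<alpha> y = c * exp (- (1 / \<alpha>) * (norm (y - 0))\<^sup>2)" for y :: "real ^ 'n"
      proof -
        have "exp (- (t\<^sup>2 + (norm y)\<^sup>2) / \<alpha>) = exp (- (t\<^sup>2 / \<alpha>)) * exp (- (1 / \<alpha>) * (norm (y - 0))\<^sup>2)"
          unfolding exp_add[symmetric] by (simp add: add_divide_distrib diff_divide_distrib)
        then show ?thesis by (simp add: c_def)
      qed
      then have "(\<integral>\<^sup>+y. ennreal (?G \<alpha> (y :: real ^ 'n)) * indicator {0<..} \<alpha> \<partial>lborel) =
         (\<integral>\<^sup>+y. ennreal c * ennreal (exp (- (1 / \<alpha>) * (norm (y - 0 :: real ^ 'n))\<^sup>2)) \<partial>lborel)"
        using True c by (intro nn_integral_cong) (simp flip: ennreal_mult)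
      also have "\<dots> = ennreal c * ennreal ((pi / (1 / \<alpha>)) powr (a - 1/2))"
        using True nn_integral_Gaussian[of "1 / \<alpha>" "0 :: real ^ 'n", unfolded n2]
        by (subst nn_integral_cmult) auto
      also have "\<dots> = ennreal (t / sqrt pi * \<alpha> powr (-3/2) * exp (- (t\<^sup>2 / \<alpha>)))"
      proof -
        have "(pi / (1 / \<alpha>)) powr (a - 1/2) = pi powr (a - 1/2) * \<alpha> powr (a - 1/2)"
          using True by (simp add: powr_mult)
        moreover have "pi powr (- a) * pi powr (a - 1/2) = 1 / sqrt pi"
        proof -
          have "pi powr (- a) * pi powr (a - 1/2) = pi powr (- (1/2))" by (simp flip: powr_add)
          then show ?thesis by (simp add: powr_minus powr_half_sqrt inverse_eq_divide)
        qed
        moreover have "\<alpha> powr (- (a + 1)) * \<alpha> powr (a - 1/2) = \<alpha> powr (-3/2)" by (simp flip: powr_add)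
        moreover have "c * (pi powr (a - 1/2) * \<alpha> powr (a - 1/2)) = t * (pi powr (- a) * pi powr (a - 1/2)) *
            (\<alpha> powr (- (a + 1)) * \<alpha> powr (a - 1/2)) * exp (- (t\<^sup>2 / \<alpha>))"
          by (simp add: c_def)
        ultimately show ?thesis using c by (simp flip: ennreal_mult')
      qed
      finally show ?thesis using True by simp
    qed simp
  qed
  also have "\<dots> = 1"
  proof -
    have "(\<integral>\<^sup>+u\<in>{0<..}. ennreal (\<bar>- (t / 2 * u powr (-3/2))\<bar> * exp (- (t * u powr (-1/2))\<^sup>2)) \<partial>lborel) = ennreal (sqrt pi / 2)"
    proof (rule nn_integral_substitution_inj[where g="\<lambda>u. t * u powr (-1/2)" and g'="\<lambda>u. - (t / 2 * u powr (-3/2))" and f="\<lambda>w. exp (- w\<^sup>2)"])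
      show "((\<lambda>u. t * u powr (-1/2)) has_real_derivative - (t / 2 * u powr (-3/2))) (at u)" if "u \<in> {0<..}" for u
        using that by (auto intro!: derivative_eq_intros)
      show inj: "inj_on (\<lambda>u. t * u powr (-1/2)) {0<..}"
      proof (rule inj_onI)
        fix x y :: real assume xy: "x \<in> {0<..}" "y \<in> {0<..}" "t * x powr (-1/2) = t * y powr (-1/2)"
        then have "(x powr (-1/2)) powr (-2) = (y powr (-1/2)) powr (-2)" using t by simp
        then show "x = y" using xy by (simp add: powr_powr)
      qed
      have im: "(\<lambda>u. t * u powr (-1/2)) ` {0<..} = {0<..}"
      proof (intro equalityI subsetI)
        fix w :: real assume "w \<in> {0<..}"
        then show "w \<in> (\<lambda>u. t * u powr (-1/2)) ` {0<..}"
          using t by (intro image_eqI[of _ _ "(w / t) powr (-2)"]) (auto simp: powr_powr)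
      qed (use t in auto)
      have "(\<integral>\<^sup>+u. ennreal (indicator {0..} u *\<^sub>R exp (- u\<^sup>2)) \<partial>lborel) = ennreal (sqrt pi / 2)"
        using gaussian_moment_0 by (intro nn_integral_eq_integral[THEN trans]) (auto simp: has_bochner_integral_iff)
      also have "(\<integral>\<^sup>+u. ennreal (indicator {0..} u *\<^sub>R exp (- u\<^sup>2)) \<partial>lborel) = (\<integral>\<^sup>+u\<in>{0<..}. ennreal (exp (- u\<^sup>2)) \<partial>lborel)"
      proof (rule nn_integral_cong_AE)
        show "AE u in lborel. ennreal (indicator {0..} u *\<^sub>R exp (- u\<^sup>2)) = ennreal (exp (- u\<^sup>2)) * indicator {0<..} (u :: real)"
          using AE_lborel_singleton[of "0 :: real"] by eventually_elim (auto simp: indicator_def)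
      qed
      finally show "(\<integral>\<^sup>+u\<in>(\<lambda>u. t * u powr (-1/2)) ` {0<..}. ennreal (exp (- u\<^sup>2)) \<partial>lborel) = ennreal (sqrt pi / 2)"
        unfolding im .
      show "(\<lambda>u. t * u powr (-1/2)) ` {0<..} \<in> sets borel" unfolding im by simp
      show "(\<lambda>u. \<bar>- (t / 2 * u powr (-3/2))\<bar> * exp (- (t * u powr (-1/2))\<^sup>2)) \<in> borel_measurable (restrict_space borel {0<..})"
        by (intro measurable_restrict_space1) measurable
    qed auto
    moreover have "ennreal (t / sqrt pi * u powr (-3/2) * exp (- (t\<^sup>2 / u))) * indicator {0<..} u =
      ennreal (2 / sqrt pi) * (ennreal (\<bar>- (t / 2 * u powr (-3/2))\<bar> * exp (- (t * u powr (-1/2))\<^sup>2)) * indicator {0<..} u)" for u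
    proof (cases "u > 0")
      case True
      have "(t * u powr (-1/2))\<^sup>2 = t\<^sup>2 / u"
      proof -
        have "(u powr (-1/2))\<^sup>2 = u powr (-1)" by (simp add: power2_eq_square flip: powr_add)
        then show ?thesis using True by (simp add: power_mult_distrib powr_minus field_simps)
      qed
      then show ?thesis using True t by (simp add: abs_mult flip: ennreal_mult)
    qed simp
    ultimately show ?thesis
      by (simp add: nn_integral_cmult) (simp flip: ennreal_mult)
  qed
  finally show ?thesis .
qed

subsection \<open>Derivatives and comparison of Poisson kernels\<close>

text \<open>Dominated convergence for the difference quotients, which the mean value inequality
  bounds by \<open>m\<close> on the whole interval. Domination is asked of m * |h| rather than of m,
  so that h may grow as long as the kernel decays.\<close>

lemma has_vector_derivative_integral_parameter:
  fixes k k' :: "real \<Rightarrow> 'a \<Rightarrow> real" and h :: "'a \<Rightarrow> 'b::{banach, second_countable_topology}"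
  assumes \<delta>: "\<delta> > 0"
    and deriv: "\<And>s y. \<bar>s - t\<bar> < \<delta> \<Longrightarrow> y \<in> space M \<Longrightarrow> ((\<lambda>s. k s y) has_real_derivative k' s y) (at s)"
    and bound: "\<And>s y. \<bar>s - t\<bar> < \<delta> \<Longrightarrow> y \<in> space M \<Longrightarrow> \<bar>k' s y\<bar> \<le> m y"
    and m: "integrable M (\<lambda>y. m y * norm (h y))"
    and k: "integrable M (\<lambda>y. k t y *\<^sub>R h y)"
    and meas: "\<And>s. \<bar>s - t\<bar> < \<delta> \<Longrightarrow> (\<lambda>y. k s y *\<^sub>R h y) \<in> borel_measurable M"
      "(\<lambda>y. k' t y *\<^sub>R h y) \<in> borel_measurable M"
  shows "((\<lambda>s. \<integral>y. k s y *\<^sub>R h y \<partial>M) has_vector_derivative (\<integral>y. k' t y *\<^sub>R h y \<partial>M)) (at t)"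
    and "integrable M (\<lambda>y. k' t y *\<^sub>R h y)"
proof -
  let ?F = "\<lambda>s. \<integral>y. k s y *\<^sub>R h y \<partial>M" and ?D = "\<integral>y. k' t y *\<^sub>R h y \<partial>M"
  have diff: "\<bar>k s y - k t y\<bar> \<le> \<bar>s - t\<bar> * m y" if s: "\<bar>s - t\<bar> < \<delta>" and y: "y \<in> space M" for s y
  proof -
    have "norm (k s y - k t y) \<le> m y * norm (s - t)"
    proof (rule field_differentiable_bound[where S="{t - \<delta><..<t + \<delta>}"])
      fix z assume "z \<in> {t - \<delta><..<t + \<delta>}"
      then have z: "\<bar>z - t\<bar> < \<delta>" by auto
      show "((\<lambda>s. k s y) has_field_derivative k' z y) (at z within {t - \<delta><..<t + \<delta>})"
        using deriv[OF z y] by (rule has_field_derivative_at_within)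
      show "norm (k' z y) \<le> m y" using bound[OF z y] by simp
    qed (use s \<delta> in auto)
    then show ?thesis by (simp add: mult.commute)
  qed
  show int': "integrable M (\<lambda>y. k' t y *\<^sub>R h y)"
  proof (rule Bochner_Integration.integrable_bound[OF m meas(2)])
    show "AE y in M. norm (k' t y *\<^sub>R h y) \<le> norm (m y * norm (h y))"
    proof (rule AE_I2)
      fix y assume "y \<in> space M"
      then have "\<bar>k' t y\<bar> \<le> m y" using bound[of t y] \<delta> by simp
      then show "norm (k' t y *\<^sub>R h y) \<le> norm (m y * norm (h y))"
        by (simp add: abs_mult mult_right_mono)
    qed
  qed
  have int: "integrable M (\<lambda>y. k s y *\<^sub>R h y)" if s: "\<bar>s - t\<bar> < \<delta>" for s
  proof -
    have "integrable M (\<lambda>y. k s y *\<^sub>R h y - k t y *\<^sub>R h y)"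
    proof (rule Bochner_Integration.integrable_bound)
      show "integrable M (\<lambda>y. \<bar>s - t\<bar> * (m y * norm (h y)))" using m by simp
      show "(\<lambda>y. k s y *\<^sub>R h y - k t y *\<^sub>R h y) \<in> borel_measurable M"
        using meas(1)[OF s] k by simp
      show "AE y in M. norm (k s y *\<^sub>R h y - k t y *\<^sub>R h y) \<le> norm (\<bar>s - t\<bar> * (m y * norm (h y)))"
      proof (rule AE_I2)
        fix y assume "y \<in> space M"
        from diff[OF s this] have "\<bar>k s y - k t y\<bar> * norm (h y) \<le> \<bar>s - t\<bar> * m y * norm (h y)"
          by (rule mult_right_mono) simp
        also have "\<dots> \<le> norm (\<bar>s - t\<bar> * (m y * norm (h y)))"
          by (simp add: mult.assoc)
        finally show "norm (k s y *\<^sub>R h y - k t y *\<^sub>R h y) \<le> norm (\<bar>s - t\<bar> * (m y * norm (h y)))"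
          by (simp flip: scaleR_left_diff_distrib)
      qed
    qed
    from Bochner_Integration.integrable_add[OF this k] show ?thesis by simp
  qed
  have "((\<lambda>e. norm (?F (t + e) - ?F t - e *\<^sub>R ?D) / norm e) \<longlongrightarrow> 0) (at 0)"
    unfolding tendsto_at_iff_sequentially
  proof (intro allI impI)
    fix X :: "nat \<Rightarrow> real"
    assume X0: "\<forall>i. X i \<in> UNIV - {0}" and X: "X \<longlonglongrightarrow> 0"
    have "eventually (\<lambda>i. \<bar>X i\<bar> < \<delta>) sequentially"
      using tendstoD[OF X \<delta>] by (simp add: dist_real_def)
    \<comment> \<open>Dropping the first N terms puts the whole sequence inside the interval on
      which the bounds hold.\<close>
    then obtain N where N: "\<And>i. \<bar>X (i + N)\<bar> < \<delta>"
      unfolding eventually_sequentially by (metis le_add2)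
    let ?Y = "\<lambda>i. X (i + N)"
    have Y: "?Y \<longlonglongrightarrow> 0" using X by (rule LIMSEQ_ignore_initial_segment)
    have Y0: "?Y i \<noteq> 0" for i using X0 by auto
    let ?s = "\<lambda>i y. (1 / ?Y i) *\<^sub>R (k (t + ?Y i) y *\<^sub>R h y - k t y *\<^sub>R h y - ?Y i *\<^sub>R (k' t y *\<^sub>R h y))"
    have "(\<lambda>i. \<integral>y. ?s i y \<partial>M) \<longlonglongrightarrow> (\<integral>y. 0 \<partial>M)"
    proof (rule integral_dominated_convergence[where w="\<lambda>y. 2 * (m y * norm (h y))"])
      show "?s i \<in> borel_measurable M" for i
        using int[of "t + ?Y i"] N[of i] k int'
        by (intro borel_measurable_integrable integrable_scaleR_right Bochner_Integration.integrable_diff) auto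
      show "integrable M (\<lambda>y. 2 * (m y * norm (h y)))" using m by simp
      show "AE y in M. (\<lambda>i. ?s i y) \<longlonglongrightarrow> 0"
      proof (rule AE_I2)
        fix y assume y: "y \<in> space M"
        have "((\<lambda>e. (k (t + e) y - k t y) / e) \<longlongrightarrow> k' t y) (at 0)"
          using deriv[of t y] y \<delta> by (simp add: DERIV_def)
        then have "(\<lambda>i. (k (t + ?Y i) y - k t y) / ?Y i) \<longlonglongrightarrow> k' t y"
          unfolding tendsto_at_iff_sequentially using Y Y0 by (auto simp: o_def)
        then have "(\<lambda>i. ((k (t + ?Y i) y - k t y) / ?Y i - k' t y) *\<^sub>R h y) \<longlonglongrightarrow> (k' t y - k' t y) *\<^sub>R h y"
          by (intro tendsto_intros)
        moreover have "?s i y = ((k (t + ?Y i) y - k t y) / ?Y i - k' t y) *\<^sub>R h y" for i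
          using Y0[of i] by (simp add: algebra_simps divide_inverse)
        ultimately show "(\<lambda>i. ?s i y) \<longlonglongrightarrow> 0" by simp
      qed
      show "AE y in M. norm (?s i y) \<le> 2 * (m y * norm (h y))" for i
      proof (rule AE_I2)
        fix y assume y: "y \<in> space M"
        have "?s i y = ((k (t + ?Y i) y - k t y) / ?Y i - k' t y) *\<^sub>R h y"
          using Y0[of i] by (simp add: algebra_simps divide_inverse)
        moreover have "\<bar>(k (t + ?Y i) y - k t y) / ?Y i - k' t y\<bar> \<le> 2 * m y"
        proof -
          have "\<bar>(k (t + ?Y i) y - k t y) / ?Y i\<bar> \<le> m y"
            using diff[of "t + ?Y i" y] N[of i] Y0[of i] y by (simp add: abs_divide divide_le_eq mult.commute)
          moreover have "\<bar>k' t y\<bar> \<le> m y" using bound[of t y] \<delta> y by simp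
          ultimately show ?thesis
            using abs_triangle_ineq4[of "(k (t + ?Y i) y - k t y) / ?Y i" "k' t y"] by linarith
        qed
        ultimately have "norm (?s i y) \<le> (2 * m y) * norm (h y)"
          by (simp only: norm_scaleR real_norm_def) (rule mult_right_mono, auto)
        then show "norm (?s i y) \<le> 2 * (m y * norm (h y))" by simp
      qed
    qed auto
    then have "(\<lambda>i. norm (\<integral>y. ?s i y \<partial>M)) \<longlonglongrightarrow> 0"
      by (intro tendsto_norm_zero) (simp only: Bochner_Integration.integral_zero)
    moreover have scal: "norm ((1 / c) *\<^sub>R v) = norm v / norm c" for c :: real and v :: 'b
      by (simp add: divide_inverse mult.commute)
    moreover have "norm (\<integral>y. ?s i y \<partial>M) = norm (?F (t + ?Y i) - ?F t - ?Y i *\<^sub>R ?D) / norm (?Y i)" for i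
    proof -
      have "(\<integral>y. ?s i y \<partial>M) = (1 / ?Y i) *\<^sub>R (?F (t + ?Y i) - ?F t - ?Y i *\<^sub>R ?D)"
      proof -
        have i1: "integrable M (\<lambda>y. k (t + ?Y i) y *\<^sub>R h y)" using int[of "t + ?Y i"] N[of i] by simp
        have "(\<integral>y. ?s i y \<partial>M) = (1 / ?Y i) *\<^sub>R
            (\<integral>y. k (t + ?Y i) y *\<^sub>R h y - k t y *\<^sub>R h y - ?Y i *\<^sub>R (k' t y *\<^sub>R h y) \<partial>M)"
          by (rule Bochner_Integration.integral_scaleR_right)
        then show ?thesis
          using i1 k int' by (simp only: Bochner_Integration.integral_diff Bochner_Integration.integrable_diff integrable_scaleR_right Bochner_Integration.integral_scaleR_right)
      qed
      then show ?thesis by (simp only: scal)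
    qed
    ultimately have "(\<lambda>i. norm (?F (t + ?Y i) - ?F t - ?Y i *\<^sub>R ?D) / norm (?Y i)) \<longlonglongrightarrow> 0"
      by (simp only:)
    then show "((\<lambda>e. norm (?F (t + e) - ?F t - e *\<^sub>R ?D) / norm e) \<circ> X) \<longlonglongrightarrow> 0"
      unfolding o_def by (rule LIMSEQ_offset)
  qed
  then show "(?F has_vector_derivative ?D) (at t)"
    unfolding has_vector_derivative_def has_derivative_at
    by (auto intro: bounded_linear_scaleR_left)
qed

definition poisson_const :: "'n::finite itself \<Rightarrow> real" where
  "poisson_const _ = Gamma ((real CARD('n) + 1) / 2) / pi powr ((real CARD('n) + 1) / 2)"

lemma poisson_const_pos: "poisson_const TYPE('n::finite) > 0"
  by (auto simp: poisson_const_def intro!: divide_pos_pos Gamma_real_pos add_pos_nonneg)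

lemma poisson_kernel_alt:
  "poisson_kernel t (x :: real ^ 'n) =
     poisson_const TYPE('n) * t * (t\<^sup>2 + (norm x)\<^sup>2) powr (- ((real CARD('n) + 1) / 2))"
  by (simp add: poisson_kernel_def poisson_const_def powr_minus field_simps)

text \<open>The time derivative written as the kernel times its logarithmic derivative; in this form
  it is visibly bounded by C / t times the kernel itself.\<close>

definition poisson_dt :: "real \<Rightarrow> real ^ 'n \<Rightarrow> real" where
  "poisson_dt t x = poisson_kernel t x * (1 / t - (real CARD('n) + 1) * t / (t\<^sup>2 + (norm x)\<^sup>2))"

definition poisson_dt2 :: "real \<Rightarrow> real ^ 'n \<Rightarrow> real" where
  "poisson_dt2 t x = poisson_dt t x * (1 / t - (real CARD('n) + 1) * t / (t\<^sup>2 + (norm x)\<^sup>2)) +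
     poisson_kernel t x * (- 1 / t\<^sup>2 - (real CARD('n) + 1) / (t\<^sup>2 + (norm x)\<^sup>2) +
       2 * (real CARD('n) + 1) * t\<^sup>2 / (t\<^sup>2 + (norm x)\<^sup>2)\<^sup>2)"

lemma borel_measurable_poisson_dt[measurable]:
  "(\<lambda>z. poisson_dt (fst z) (snd z :: real ^ 'n)) \<in> borel_measurable (borel \<Otimes>\<^sub>M borel)"
  unfolding poisson_dt_def by measurable

lemma borel_measurable_poisson_dt2[measurable]:
  "(\<lambda>z. poisson_dt2 (fst z) (snd z :: real ^ 'n)) \<in> borel_measurable (borel \<Otimes>\<^sub>M borel)"
  unfolding poisson_dt2_def by measurable

lemma has_real_derivative_poisson_kernel:
  fixes x :: "real ^ 'n"
  assumes t: "t > 0"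
  shows "((\<lambda>t. poisson_kernel t x) has_real_derivative poisson_dt t x) (at t)"
proof -
  define a where "a = (real CARD('n) + 1) / 2"
  define u where "u = t\<^sup>2 + (norm x)\<^sup>2"
  have u: "u > 0" unfolding u_def using t by (intro add_pos_nonneg) auto
  have "((\<lambda>t. (t\<^sup>2 + (norm x)\<^sup>2) powr (- a)) has_real_derivative - a * u powr (- a - 1) * (2 * t)) (at t)"
    using u by (auto intro!: derivative_eq_intros simp: u_def)
  from DERIV_mult[OF DERIV_cmult_Id[of "poisson_const TYPE('n)"] this]
  have "((\<lambda>t. poisson_const TYPE('n) * t * (t\<^sup>2 + (norm x)\<^sup>2) powr (- a)) has_real_derivative
      poisson_const TYPE('n) * u powr (- a) + (- a * u powr (- a - 1) * (2 * t)) * (poisson_const TYPE('n) * t)) (at t)"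
    by (simp add: u_def)
  moreover have "poisson_const TYPE('n) * u powr (- a) + (- a * u powr (- a - 1) * (2 * t)) * (poisson_const TYPE('n) * t) = poisson_dt t x"
  proof -
    have "u powr (- a - 1) = u powr (- a) / u" using u by (simp add: powr_diff)
    moreover have "real CARD('n) + 1 = 2 * a" by (simp add: a_def)
    ultimately show ?thesis
      unfolding poisson_dt_def poisson_kernel_alt a_def[symmetric] u_def[symmetric]
      using t u by (simp add: field_simps)
  qed
  ultimately show ?thesis unfolding poisson_kernel_alt a_def[symmetric] by simp
qed

lemma has_real_derivative_poisson_dt:
  fixes x :: "real ^ 'n"
  assumes t: "t > 0"
  shows "((\<lambda>t. poisson_dt t x) has_real_derivative poisson_dt2 t x) (at t)"
proof -
  have u: "t\<^sup>2 + (norm x)\<^sup>2 > 0" using t by (intro add_pos_nonneg) auto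
  let ?k = "real CARD('n) + 1"
  have D: "((\<lambda>t. 1 / t - ?k * t / (t\<^sup>2 + (norm x)\<^sup>2)) has_real_derivative
    (- 1 / t\<^sup>2 - (?k * (t\<^sup>2 + (norm x)\<^sup>2) - ?k * t * (2 * t)) / ((t\<^sup>2 + (norm x)\<^sup>2) * (t\<^sup>2 + (norm x)\<^sup>2)))) (at t)"
    using t u by (auto intro!: derivative_eq_intros simp: power2_eq_square)
  have E: "- 1 / t\<^sup>2 - (?k * (t\<^sup>2 + (norm x)\<^sup>2) - ?k * t * (2 * t)) / ((t\<^sup>2 + (norm x)\<^sup>2) * (t\<^sup>2 + (norm x)\<^sup>2)) =
     - 1 / t\<^sup>2 - ?k / (t\<^sup>2 + (norm x)\<^sup>2) + 2 * ?k * t\<^sup>2 / (t\<^sup>2 + (norm x)\<^sup>2)\<^sup>2"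
    (is "_ - (?k * ?u - ?k * t * (2 * t)) / _ = _")
  proof -
    have "(?k * ?u - ?k * t * (2 * t)) / (?u * ?u) = ?k * ?u / (?u * ?u) - 2 * ?k * t\<^sup>2 / ?u\<^sup>2"
      by (simp add: diff_divide_distrib power2_eq_square mult_ac)
    also have "?k * ?u / (?u * ?u) = ?k / ?u" using u by simp
    finally show ?thesis by simp
  qed
  note D = D[unfolded E]
  from DERIV_mult[OF has_real_derivative_poisson_kernel[OF t, of x] D] show ?thesis
    unfolding poisson_dt_def[abs_def] poisson_dt2_def by (simp add: mult_ac)
qed

lemma poisson_factor_bound:
  fixes x :: "'a::real_normed_vector" and k :: real
  assumes t: "t > 0" and k: "k \<ge> 0"
  shows "\<bar>1 / t - k * t / (t\<^sup>2 + (norm x)\<^sup>2)\<bar> \<le> (k + 1) / t"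
    "k / (t\<^sup>2 + (norm x)\<^sup>2) \<le> k / t\<^sup>2"
    "2 * k * t\<^sup>2 / (t\<^sup>2 + (norm x)\<^sup>2)\<^sup>2 \<le> 2 * k / t\<^sup>2"
proof -
  have u: "t\<^sup>2 + (norm x)\<^sup>2 \<ge> t\<^sup>2" "t\<^sup>2 > 0" "t\<^sup>2 + (norm x)\<^sup>2 > 0"
    using t by (auto intro: add_pos_nonneg)
  show 1: "k / (t\<^sup>2 + (norm x)\<^sup>2) \<le> k / t\<^sup>2"
    using u k by (intro divide_left_mono mult_pos_pos) auto
  have "k * t / (t\<^sup>2 + (norm x)\<^sup>2) \<le> k * t / t\<^sup>2"
    using u k t by (intro divide_left_mono mult_pos_pos) auto
  also have "\<dots> = k / t" using t by (simp add: power2_eq_square)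
  finally have "k * t / (t\<^sup>2 + (norm x)\<^sup>2) \<le> k / t" .
  moreover have "0 \<le> k * t / (t\<^sup>2 + (norm x)\<^sup>2)" using u k t by (intro divide_nonneg_nonneg) auto
  moreover have "1 / t \<ge> 0" using t by simp
  moreover have "(k + 1) / t = k / t + 1 / t" by (simp add: add_divide_distrib)
  moreover have "0 \<le> k / t" using k t by simp
  ultimately show "\<bar>1 / t - k * t / (t\<^sup>2 + (norm x)\<^sup>2)\<bar> \<le> (k + 1) / t" by linarith
  have "(t\<^sup>2)\<^sup>2 \<le> (t\<^sup>2 + (norm x)\<^sup>2)\<^sup>2" using u by (intro power_mono) auto
  then have "2 * k * t\<^sup>2 / (t\<^sup>2 + (norm x)\<^sup>2)\<^sup>2 \<le> 2 * k * t\<^sup>2 / (t\<^sup>2)\<^sup>2"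
    using u k t by (intro divide_left_mono mult_pos_pos zero_less_power) auto
  also have "\<dots> = 2 * k / t\<^sup>2" using t by (simp add: power2_eq_square)
  finally show "2 * k * t\<^sup>2 / (t\<^sup>2 + (norm x)\<^sup>2)\<^sup>2 \<le> 2 * k / t\<^sup>2" .
qed

lemma abs_poisson_dt_le:
  fixes x :: "real ^ 'n"
  assumes t: "t > 0"
  shows "\<bar>poisson_dt t x\<bar> \<le> (real CARD('n) + 2) / t * poisson_kernel t x"
proof -
  have "\<bar>poisson_dt t x\<bar> = poisson_kernel t x * \<bar>1 / t - (real CARD('n) + 1) * t / (t\<^sup>2 + (norm x)\<^sup>2)\<bar>"
    using poisson_kernel_pos[OF t, of x] by (simp add: poisson_dt_def abs_mult)
  also have "\<dots> \<le> poisson_kernel t x * ((real CARD('n) + 1 + 1) / t)"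
    using poisson_factor_bound(1)[OF t, of "real CARD('n) + 1" x] poisson_kernel_nonneg[OF t, of x]
    by (intro mult_left_mono) auto
  finally show ?thesis by (simp add: mult.commute add.commute)
qed

lemma abs_poisson_dt2_le:
  fixes x :: "real ^ 'n"
  assumes t: "t > 0"
  shows "\<bar>poisson_dt2 t x\<bar> \<le> ((real CARD('n) + 2)\<^sup>2 + 3 * (real CARD('n) + 2)) / t\<^sup>2 * poisson_kernel t x"
proof -
  let ?k = "real CARD('n) + 1" and ?u = "t\<^sup>2 + (norm x)\<^sup>2" and ?p = "poisson_kernel t x"
  have p: "?p > 0" by (rule poisson_kernel_pos[OF t])
  have k: "?k \<ge> 0" by simp
  note b = poisson_factor_bound[OF t k, of x]
  have "\<bar>poisson_dt t x * (1 / t - ?k * t / ?u)\<bar> \<le> ((?k + 1) / t * ?p) * ((?k + 1) / t)"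
    unfolding abs_mult using abs_poisson_dt_le[OF t, of x] b(1) p t
    by (intro mult_mono) (auto simp: add.commute)
  moreover have "\<bar>- 1 / t\<^sup>2 - ?k / ?u + 2 * ?k * t\<^sup>2 / ?u\<^sup>2\<bar> \<le> (3 * ?k + 1) / t\<^sup>2"
  proof -
    have *: "\<bar>- A - B + C\<bar> \<le> A + B' + C'" if "0 \<le> A" "0 \<le> B" "0 \<le> C" "B \<le> B'" "C \<le> C'" for A B C B' C' :: real
      using that by arith
    have "\<bar>- (1 / t\<^sup>2) - ?k / ?u + 2 * ?k * t\<^sup>2 / ?u\<^sup>2\<bar> \<le> 1 / t\<^sup>2 + ?k / t\<^sup>2 + 2 * ?k / t\<^sup>2"
      by (rule *[OF _ _ _ b(2,3)]) (auto intro!: divide_nonneg_nonneg)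
    moreover have "(3 * ?k + 1) / t\<^sup>2 = 1 / t\<^sup>2 + ?k / t\<^sup>2 + 2 * ?k / t\<^sup>2" by (simp add: add_divide_distrib)
    ultimately show ?thesis by simp
  qed
  then have "\<bar>?p * (- 1 / t\<^sup>2 - ?k / ?u + 2 * ?k * t\<^sup>2 / ?u\<^sup>2)\<bar> \<le> ?p * ((3 * ?k + 1) / t\<^sup>2)"
    unfolding abs_mult using p by (intro mult_mono) auto
  ultimately have "\<bar>poisson_dt2 t x\<bar> \<le> ((?k + 1) / t * ?p) * ((?k + 1) / t) + ?p * ((3 * ?k + 1) / t\<^sup>2)"
    unfolding poisson_dt2_def by linarith
  also have "\<dots> = ((?k + 1)\<^sup>2 + (3 * ?k + 1)) / t\<^sup>2 * ?p"
    using t by (simp add: field_simps power2_eq_square)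
  also have "\<dots> \<le> ((?k + 1)\<^sup>2 + 3 * (?k + 1)) / t\<^sup>2 * ?p"
    using p by (intro mult_right_mono divide_right_mono) auto
  finally show ?thesis by (simp add: add.commute)
qed

text \<open>The common source of the comparisons between kernels: the Harnack inequality, a change
  of time or base point, and the bound far from a ball are instances with a suitable constant
  \<open>c\<close>.\<close>

lemma poisson_kernel_compare:
  fixes z z' :: "real ^ 'n"
  assumes t: "t > 0" and s: "s > 0" and c: "s\<^sup>2 + (norm z')\<^sup>2 \<le> c * (t\<^sup>2 + (norm z)\<^sup>2)"
  shows "poisson_kernel t z \<le> t / s * c powr ((real CARD('n) + 1) / 2) * poisson_kernel s z'"
proof -
  define a where "a = (real CARD('n) + 1) / 2"
  have a: "a > 0" by (simp add: a_def)
  define u v where "u = t\<^sup>2 + (norm z)\<^sup>2" and "v = s\<^sup>2 + (norm z')\<^sup>2"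
  have uv: "u > 0" "v > 0" unfolding u_def v_def using t s by (auto intro!: add_pos_nonneg)
  have cuv: "v \<le> c * u" using c by (simp add: u_def v_def)
  then have c0: "c > 0" using uv by (metis less_le_trans zero_less_mult_pos2)
  have "v powr a \<le> (c * u) powr a" using cuv uv a by (intro powr_mono2) auto
  also have "\<dots> = c powr a * u powr a" using c0 uv by (simp add: powr_mult)
  finally have "1 / u powr a \<le> c powr a / v powr a"
    using uv by (simp add: field_simps)
  then have "poisson_const TYPE('n) * t * (1 / u powr a) \<le> poisson_const TYPE('n) * t * (c powr a / v powr a)"
    using poisson_const_pos[where 'n='n] t by (intro mult_left_mono) auto
  also have "\<dots> = t / s * c powr a * (poisson_const TYPE('n) * s * (1 / v powr a))"
    using s by simp
  finally show ?thesis
    unfolding poisson_kernel_alt a_def[symmetric] u_def[symmetric] v_def[symmetric] by (simp add: powr_minus inverse_eq_divide)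
qed

lemma three_times_bound: "x \<le> 2 * d + 2 * y \<Longrightarrow> d \<le> t \<Longrightarrow> 0 \<le> y \<Longrightarrow> t + x \<le> 3 * (t + y :: real)"
  by (simp add: algebra_simps)

lemma norm_square_le_twice: "(norm (x :: 'a::real_inner))\<^sup>2 \<le> 2 * (norm (x - y))\<^sup>2 + 2 * (norm y)\<^sup>2"
proof -
  have "norm x \<le> norm (x - y) + norm y" by (metis diff_add_cancel norm_triangle_ineq)
  then have "(norm x)\<^sup>2 \<le> (norm (x - y) + norm y)\<^sup>2" by (intro power_mono) auto
  also have "\<dots> \<le> 2 * (norm (x - y))\<^sup>2 + 2 * (norm y)\<^sup>2"
    using sum_squares_bound[of "norm (x - y)" "norm y"] by (simp add: power2_sum)
  finally show ?thesis .
qed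

lemma poisson_kernel_compare_any:
  fixes x x' :: "real ^ 'n"
  assumes t: "t > 0" and s: "s > 0"
  obtains C where "C > 0" "\<And>y. poisson_kernel t (x - y) \<le> C * poisson_kernel s (x' - y)"
proof
  define d where "d = norm (x' - x)"
  define c where "c = max 2 ((s\<^sup>2 + 2 * d\<^sup>2) / t\<^sup>2)"
  show "t / s * c powr ((real CARD('n) + 1) / 2) > 0"
    using t s by (auto simp: c_def)
  fix y
  have "(norm (x' - y))\<^sup>2 \<le> 2 * d\<^sup>2 + 2 * (norm (x - y))\<^sup>2"
    using norm_square_le_twice[of "x' - y" "x - y"] by (simp add: d_def)
  moreover have "2 * (norm (x - y))\<^sup>2 \<le> c * (norm (x - y))\<^sup>2"
    by (intro mult_right_mono) (auto simp: c_def)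
  moreover have "s\<^sup>2 + 2 * d\<^sup>2 \<le> c * t\<^sup>2"
  proof -
    have "(s\<^sup>2 + 2 * d\<^sup>2) / t\<^sup>2 \<le> c" by (simp add: c_def)
    then show ?thesis using t by (simp add: pos_divide_le_eq)
  qed
  ultimately have "s\<^sup>2 + (norm (x' - y))\<^sup>2 \<le> c * (t\<^sup>2 + (norm (x - y))\<^sup>2)"
    by (simp add: distrib_left)
  then show "poisson_kernel t (x - y) \<le> t / s * c powr ((real CARD('n) + 1) / 2) * poisson_kernel s (x' - y)"
    by (rule poisson_kernel_compare[OF t s])
qed

lemma poisson_kernel_Harnack:
  fixes x x' :: "real ^ 'n"
  assumes t: "t > 0" and d: "norm (x - x') \<le> t"
  shows "poisson_kernel t (x - y) \<le> 3 powr ((real CARD('n) + 1) / 2) * poisson_kernel t (x' - y)"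
proof -
  have "(norm (x' - y))\<^sup>2 \<le> 2 * (norm (x - x'))\<^sup>2 + 2 * (norm (x - y))\<^sup>2"
    using norm_square_le_twice[of "x' - y" "x - y"] by (simp add: norm_minus_commute)
  moreover have "(norm (x - x'))\<^sup>2 \<le> t\<^sup>2" using d by (intro power_mono) auto
  ultimately have "t\<^sup>2 + (norm (x' - y))\<^sup>2 \<le> 3 * (t\<^sup>2 + (norm (x - y))\<^sup>2)"
    by (rule three_times_bound) simp
  from poisson_kernel_compare[OF t t this] t show ?thesis by simp
qed

text \<open>Mean value inequality for w powr (- a) between u and v. The condition |z - z'| \<le> t
  keeps both points above v / 3 and gives |u - v| \<le> 3 * sqrt v * |z - z'|; since t \<le> sqrt v,
  the bound is again a multiple of the kernel, with the gain |z - z'| / t.\<close>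

lemma poisson_kernel_Lipschitz:
  fixes z z' :: "real ^ 'n"
  assumes t: "t > 0" and d: "norm (z - z') \<le> t"
  shows "\<bar>poisson_kernel t z - poisson_kernel t z'\<bar> \<le>
    (real CARD('n) + 1) * 3 powr ((real CARD('n) + 1) / 2 + 2) * norm (z - z') / t * poisson_kernel t z'"
proof -
  define a where "a = (real CARD('n) + 1) / 2"
  have a: "a > 0" by (simp add: a_def)
  define u v where "u = t\<^sup>2 + (norm z)\<^sup>2" and "v = t\<^sup>2 + (norm z')\<^sup>2"
  have uv: "u > 0" "v > 0" unfolding u_def v_def using t by (auto intro!: add_pos_nonneg)
  have dz: "(norm (z - z'))\<^sup>2 \<le> t\<^sup>2" using d by (intro power_mono) auto
  have v3: "v / 3 \<le> u"
  proof -
    have "(norm z')\<^sup>2 \<le> 2 * (norm (z - z'))\<^sup>2 + 2 * (norm z)\<^sup>2"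
      using norm_square_le_twice[of z' z] by (simp add: norm_minus_commute)
    from three_times_bound[OF this dz] have "v \<le> 3 * u" by (simp add: u_def v_def)
    then show ?thesis by simp
  qed
  have t_v: "t \<le> sqrt v" and z_v: "norm z' \<le> sqrt v"
    using t by (auto simp: v_def intro!: real_le_rsqrt)
  have "\<bar>u - v\<bar> = \<bar>norm z - norm z'\<bar> * (norm z + norm z')"
  proof -
    have "u - v = (norm z - norm z') * (norm z + norm z')"
      by (simp add: u_def v_def power2_eq_square algebra_simps)
    then show ?thesis by (simp add: abs_mult)
  qed
  also have "\<dots> \<le> norm (z - z') * (3 * sqrt v)"
  proof (rule mult_mono)
    show "\<bar>norm z - norm z'\<bar> \<le> norm (z - z')" by (rule norm_triangle_ineq3)
    have "norm z \<le> norm z' + t" using d norm_triangle_sub[of z z'] by simp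
    then show "norm z + norm z' \<le> 3 * sqrt v" using t_v z_v by linarith
  qed auto
  finally have duv: "\<bar>u - v\<bar> \<le> norm (z - z') * (3 * sqrt v)" .
  have "norm (u powr (- a) - v powr (- a)) \<le> (a * (v / 3) powr (- a - 1)) * norm (u - v)"
  proof (rule field_differentiable_bound[where S="{v / 3..}"])
    fix w assume w: "w \<in> {v / 3..}"
    then have w0: "w > 0" using uv by (auto intro: less_le_trans[of 0 "v / 3"])
    show "((\<lambda>w. w powr (- a)) has_field_derivative - a * w powr (- a - 1)) (at w within {v / 3..})"
      using w0 by (auto intro!: derivative_eq_intros)
    have "w powr (- a - 1) \<le> (v / 3) powr (- a - 1)"
      using w uv a by (intro powr_mono2') auto
    then show "norm (- a * w powr (- a - 1)) \<le> a * (v / 3) powr (- a - 1)"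
      using a by (simp add: abs_mult)
  qed (use v3 uv in auto)
  also have "(v / 3) powr (- a - 1) = 3 powr (a + 1) * (v powr (- a) / v)"
  proof -
    have "(v / 3) powr (- a - 1) = v powr (- a - 1) / 3 powr (- (a + 1))" using uv by (simp add: powr_divide)
    then show ?thesis using uv by (simp only: powr_minus powr_diff powr_one divide_inverse inverse_inverse_eq) simp
  qed
  also have "a * (3 powr (a + 1) * (v powr (- a) / v)) * norm (u - v) \<le>
     a * (3 powr (a + 1) * (v powr (- a) / v)) * (norm (z - z') * (3 * sqrt v))"
    using duv a uv by (intro mult_left_mono) auto
  also have "\<dots> = (a * 3 powr (a + 1) * 3) * v powr (- a) * norm (z - z') * (sqrt v / v)"
    by simp
  also have "\<dots> \<le> (a * 3 powr (a + 1) * 3) * v powr (- a) * norm (z - z') * (1 / t)"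
  proof (intro mult_left_mono)
    have "t * sqrt v \<le> sqrt v * sqrt v" using t_v uv by (intro mult_right_mono) auto
    then show "sqrt v / v \<le> 1 / t" using t uv by (simp add: field_simps)
  qed (use a in auto)
  also have "a * 3 powr (a + 1) * 3 = a * 3 powr (a + 2)"
    using powr_add[of 3 "a + 1" 1] by (simp add: add.assoc)
  finally have "\<bar>u powr (- a) - v powr (- a)\<bar> \<le> a * 3 powr (a + 2) * v powr (- a) * norm (z - z') * (1 / t)"
    by simp
  \<comment> \<open>A factor 2 is given away so that the constant reads n + 1 = 2 a.\<close>
  also have "\<dots> \<le> (2 * a) * 3 powr (a + 2) * v powr (- a) * norm (z - z') * (1 / t)"
    using a t by (intro mult_right_mono) auto
  finally have "poisson_const TYPE('n) * t * \<bar>u powr (- a) - v powr (- a)\<bar> \<le>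
      poisson_const TYPE('n) * t * ((2 * a) * 3 powr (a + 2) * v powr (- a) * norm (z - z') * (1 / t))"
    using poisson_const_pos[where 'n='n] t by (intro mult_left_mono) auto
  moreover have "\<bar>poisson_kernel t z - poisson_kernel t z'\<bar> = poisson_const TYPE('n) * t * \<bar>u powr (- a) - v powr (- a)\<bar>"
    unfolding poisson_kernel_alt a_def[symmetric] u_def[symmetric] v_def[symmetric]
    using poisson_const_pos[where 'n='n] t
    by (simp add: abs_mult flip: right_diff_distrib)
  moreover have "real CARD('n) + 1 = 2 * a" by (simp add: a_def)
  ultimately show ?thesis
    unfolding poisson_kernel_alt[of t z'] a_def[symmetric] u_def[symmetric] v_def[symmetric] by (simp add: mult_ac)
qed

lemma square_powr_half:
  assumes "t > 0"
  shows "(t\<^sup>2) powr ((real k + 1) / 2) = t ^ (k + 1)"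
proof -
  have "(t\<^sup>2) powr ((real k + 1) / 2) = (t powr 2) powr ((real k + 1) / 2)"
    using assms by (subst powr_numeral) auto
  also have "\<dots> = t powr (2 * ((real k + 1) / 2))" by (rule powr_powr)
  also have "2 * ((real k + 1) / 2) = real (k + 1)" by simp
  also have "t powr real (k + 1) = t ^ (k + 1)" by (rule powr_realpow[OF assms])
  finally show ?thesis .
qed

text \<open>One statement for two uses: \<rho> = t gives the supremum bound, and \<rho> \<le> |z|
  gives the decay in space.\<close>

lemma poisson_kernel_le_decay:
  assumes t: "t > 0" and \<rho>: "\<rho> > 0" and z: "\<rho>\<^sup>2 \<le> t\<^sup>2 + (norm z)\<^sup>2"
  shows "poisson_kernel t (z :: real ^ 'n) \<le> poisson_const TYPE('n) * t / \<rho> ^ (CARD('n) + 1)"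
proof -
  let ?a = "(real CARD('n) + 1) / 2"
  have "(\<rho>\<^sup>2) powr ?a \<le> (t\<^sup>2 + (norm z)\<^sup>2) powr ?a"
    using z by (intro powr_mono2) auto
  then have "\<rho> ^ (CARD('n) + 1) \<le> (t\<^sup>2 + (norm z)\<^sup>2) powr ?a"
    using square_powr_half[OF \<rho>, of "CARD('n)"] by simp
  then have "poisson_const TYPE('n) * t / (t\<^sup>2 + (norm z)\<^sup>2) powr ?a \<le> poisson_const TYPE('n) * t / \<rho> ^ (CARD('n) + 1)"
    using poisson_const_pos[where 'n='n] t \<rho> by (intro divide_left_mono mult_pos_pos) (auto intro: less_le_trans[OF zero_less_power])
  then show ?thesis unfolding poisson_kernel_alt powr_minus divide_inverse .
qed

lemma poisson_kernel_ge:
  assumes t: "t > 0" and z: "norm z \<le> R * t"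
  shows "poisson_const TYPE('n) / ((1 + R\<^sup>2) powr ((real CARD('n) + 1) / 2) * t ^ CARD('n)) \<le> poisson_kernel t (z :: real ^ 'n)"
proof -
  let ?a = "(real CARD('n) + 1) / 2"
  have R: "1 + R\<^sup>2 > 0" by (intro add_pos_nonneg) auto
  have u: "t\<^sup>2 + (norm z)\<^sup>2 > 0" using t by (intro add_pos_nonneg) auto
  have "(norm z)\<^sup>2 \<le> (R * t)\<^sup>2" using z by (intro power_mono) auto
  then have "t\<^sup>2 + (norm z)\<^sup>2 \<le> (1 + R\<^sup>2) * t\<^sup>2" by (simp add: algebra_simps power_mult_distrib)
  then have "(t\<^sup>2 + (norm z)\<^sup>2) powr ?a \<le> ((1 + R\<^sup>2) * t\<^sup>2) powr ?a"
    using u by (intro powr_mono2) auto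
  also have "\<dots> = (1 + R\<^sup>2) powr ?a * t ^ (CARD('n) + 1)"
    using R square_powr_half[OF t, of "CARD('n)"] by (simp add: powr_mult)
  finally have "poisson_const TYPE('n) * t / ((1 + R\<^sup>2) powr ?a * t ^ (CARD('n) + 1)) \<le>
      poisson_const TYPE('n) * t / (t\<^sup>2 + (norm z)\<^sup>2) powr ?a"
    using poisson_const_pos[where 'n='n] t u R by (intro divide_left_mono mult_pos_pos) auto
  moreover have "poisson_const TYPE('n) * t / ((1 + R\<^sup>2) powr ?a * t ^ (CARD('n) + 1)) =
      poisson_const TYPE('n) / ((1 + R\<^sup>2) powr ?a * t ^ CARD('n))"
    using t by simp
  moreover have "poisson_kernel t z = poisson_const TYPE('n) * t / (t\<^sup>2 + (norm z)\<^sup>2) powr ?a"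
    unfolding poisson_kernel_alt powr_minus divide_inverse ..
  ultimately show ?thesis by (simp only:)
qed

subsection \<open>The Poisson semigroup\<close>

lemma id_lebesgue_borel: "(\<lambda>x. x) \<in> measurable lebesgue (borel :: 'a::euclidean_space measure)"
  by (intro measurable_completion) simp

lemma borel_measurable_lebesgue_borel: "f \<in> borel_measurable borel \<Longrightarrow> f \<in> borel_measurable (lebesgue :: 'a::euclidean_space measure)"
  by (intro measurable_completion) simp

abbreviation lebesgue2 :: "('a::euclidean_space \<times> 'b::euclidean_space) measure" where
  "lebesgue2 \<equiv> lebesgue \<Otimes>\<^sub>M lebesgue"

text \<open>The product of the completed measures contains the Borel product sets, so jointly Borel
  functions can be pulled back along the identity. The joint measurability of the kernels is
  obtained in this way.\<close>

lemma id_pair_lebesgue_borel: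
  "(\<lambda>z. z) \<in> measurable lebesgue2 (borel \<Otimes>\<^sub>M (borel :: 'b::euclidean_space measure) :: ('a::euclidean_space \<times> 'b) measure)"
proof -
  have "(\<lambda>z. (fst z, snd z)) \<in> measurable lebesgue2 (borel \<Otimes>\<^sub>M (borel :: 'b measure) :: ('a \<times> 'b) measure)"
    by (intro measurable_Pair measurable_compose[OF measurable_fst id_lebesgue_borel]
        measurable_compose[OF measurable_snd id_lebesgue_borel])
  then show ?thesis by simp
qed

lemma borel_measurable_pair_lebesgue:
  fixes f :: "'a::euclidean_space \<times> 'b::euclidean_space \<Rightarrow> 'c::topological_space"
  assumes "f \<in> borel_measurable (borel \<Otimes>\<^sub>M borel)"
  shows "f \<in> borel_measurable lebesgue2"
  using measurable_compose[OF id_pair_lebesgue_borel assms] by simp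

lemma sigma_finite_lebesgue: "sigma_finite_measure (lebesgue :: 'a::euclidean_space measure)"
proof
  from lborel.sigma_finite_countable
  show "\<exists>A. countable A \<and> A \<subseteq> sets lebesgue \<and> \<Union> A = space lebesgue \<and> (\<forall>a\<in>A. emeasure (lebesgue :: 'a measure) a \<noteq> \<infinity>)"
  proof (elim exE, intro exI)
    fix A :: "'a set set"
    assume A: "countable A \<and> A \<subseteq> sets lborel \<and> \<Union> A = space lborel \<and> (\<forall>a\<in>A. emeasure lborel a \<noteq> \<infinity>)"
    then have "emeasure lebesgue a = emeasure lborel a" if "a \<in> A" for a
      using that by (subst emeasure_completion) (auto simp: sets_completionI_sets main_part_sets)
    moreover have "A \<subseteq> sets lebesgue" using A by (auto intro!: sets_completionI_sets)
    ultimately show "countable A \<and> A \<subseteq> sets lebesgue \<and> \<Union> A = space lebesgue \<and> (\<forall>a\<in>A. emeasure (lebesgue :: 'a measure) a \<noteq> \<infinity>)"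
      using A by simp
  qed
qed

lemma pair_sigma_finite_lebesgue: "pair_sigma_finite (lebesgue :: 'a::euclidean_space measure) (lebesgue :: 'b::euclidean_space measure)"
  by (intro pair_sigma_finite.intro sigma_finite_lebesgue)

declare poisson_kernel_nonneg[simp]

lemma borel_measurable_poisson_kernel_unary:
  "poisson_kernel t \<in> borel_measurable (borel :: (real ^ 'n) measure)"
  "poisson_dt t \<in> borel_measurable (borel :: (real ^ 'n) measure)"
  "poisson_dt2 t \<in> borel_measurable (borel :: (real ^ 'n) measure)"
  unfolding poisson_dt2_def[abs_def] poisson_dt_def[abs_def] poisson_kernel_def[abs_def] by measurable

lemma lebesgue_measurable_poisson_kernel[measurable]:
  "(\<lambda>y. poisson_kernel t (x - y :: real ^ 'n)) \<in> borel_measurable lebesgue"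
  "(\<lambda>y. poisson_dt t (x - y :: real ^ 'n)) \<in> borel_measurable lebesgue"
  "(\<lambda>y. poisson_dt2 t (x - y :: real ^ 'n)) \<in> borel_measurable lebesgue"
proof -
  have d: "(\<lambda>y. x - y) \<in> borel_measurable lebesgue"
    by (rule borel_measurable_lebesgue_borel) measurable
  show "(\<lambda>y. poisson_kernel t (x - y :: real ^ 'n)) \<in> borel_measurable lebesgue"
    "(\<lambda>y. poisson_dt t (x - y :: real ^ 'n)) \<in> borel_measurable lebesgue"
    "(\<lambda>y. poisson_dt2 t (x - y :: real ^ 'n)) \<in> borel_measurable lebesgue"
    by (rule measurable_compose[OF d borel_measurable_poisson_kernel_unary(1)]
        measurable_compose[OF d borel_measurable_poisson_kernel_unary(2)]
        measurable_compose[OF d borel_measurable_poisson_kernel_unary(3)])+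
qed

lemma borel_measurable_poisson_kernel_pair[measurable]:
  "(\<lambda>z. poisson_kernel t (fst z - snd z :: real ^ 'n)) \<in> borel_measurable lebesgue2"
  "(\<lambda>z. poisson_dt t (fst z - snd z :: real ^ 'n)) \<in> borel_measurable lebesgue2"
  "(\<lambda>z. poisson_dt2 t (fst z - snd z :: real ^ 'n)) \<in> borel_measurable lebesgue2"
proof -
  have d: "(\<lambda>z. fst z - snd z :: real ^ 'n) \<in> borel_measurable lebesgue2"
    by (rule borel_measurable_pair_lebesgue) measurable
  show "(\<lambda>z. poisson_kernel t (fst z - snd z :: real ^ 'n)) \<in> borel_measurable lebesgue2"
    "(\<lambda>z. poisson_dt t (fst z - snd z :: real ^ 'n)) \<in> borel_measurable lebesgue2"
    "(\<lambda>z. poisson_dt2 t (fst z - snd z :: real ^ 'n)) \<in> borel_measurable lebesgue2"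
    by (rule measurable_compose[OF d borel_measurable_poisson_kernel_unary(1)]
        measurable_compose[OF d borel_measurable_poisson_kernel_unary(2)]
        measurable_compose[OF d borel_measurable_poisson_kernel_unary(3)])+
qed

lemma nn_integral_lborel_translate:
  fixes f :: "'a::euclidean_space \<Rightarrow> ennreal"
  assumes "f \<in> borel_measurable borel"
  shows "(\<integral>\<^sup>+y. f (c + y) \<partial>lborel) = (\<integral>\<^sup>+y. f y \<partial>lborel)"
proof -
  have "(\<integral>\<^sup>+y. f y \<partial>lborel) = (\<integral>\<^sup>+y. f y \<partial>distr lborel borel ((+) c))"
    by (simp add: lborel_distr_plus)
  also have "\<dots> = (\<integral>\<^sup>+y. f (c + y) \<partial>lborel)"
    using assms by (subst nn_integral_distr) auto
  finally show ?thesis ..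
qed

lemma nn_integral_poisson_kernel:
  assumes t: "t > 0"
  shows "(\<integral>\<^sup>+y. ennreal (poisson_kernel t (x - y :: real ^ 'n)) \<partial>lebesgue) = 1"
proof -
  have "(\<integral>\<^sup>+y. ennreal (poisson_kernel t (x - y)) \<partial>lebesgue) = (\<integral>\<^sup>+y. ennreal (poisson_kernel t (- x + y)) \<partial>lborel)"
    unfolding nn_integral_completion by (subst poisson_kernel_commute) simp
  also have "\<dots> = (\<integral>\<^sup>+y. ennreal (poisson_kernel t (y :: real ^ 'n)) \<partial>lborel)"
    by (rule nn_integral_lborel_translate[where f="\<lambda>y. ennreal (poisson_kernel t y)"])
      (simp add: poisson_kernel_def)
  finally show ?thesis using nn_integral_poisson_kernel_lborel[OF t] by simp
qed

lemma nn_integral_poisson_kernel_convolution: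
  fixes x y :: "real ^ 'n"
  assumes t: "t > 0" and s: "s > 0"
  shows "(\<integral>\<^sup>+z. ennreal (poisson_kernel t (x - z) * poisson_kernel s (z - y)) \<partial>lebesgue) =
    ennreal (poisson_kernel (t + s) (x - y))"
proof -
  have "(\<integral>\<^sup>+z. ennreal (poisson_kernel t (x - z) * poisson_kernel s (z - y)) \<partial>lebesgue) =
      (\<integral>\<^sup>+z. ennreal (poisson_kernel t ((x - y) - (- y + z)) * poisson_kernel s (- y + z)) \<partial>lborel)"
    unfolding nn_integral_completion by simp
  also have "\<dots> = (\<integral>\<^sup>+z. ennreal (poisson_kernel t ((x - y) - z) * poisson_kernel s z) \<partial>lborel)"
    by (rule nn_integral_lborel_translate[where f="\<lambda>z. ennreal (poisson_kernel t ((x - y) - z) * poisson_kernel s z)"])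
      (simp add: poisson_kernel_def)
  also have "\<dots> = ennreal (poisson_kernel (t + s) (x - y))"
    by (rule nn_integral_poisson_kernel_convolution_lborel[OF t s])
  finally show ?thesis .
qed

lemma integrable_poisson_kernel:
  assumes t: "t > 0"
  shows "integrable lebesgue (\<lambda>y. poisson_kernel t (x - y :: real ^ 'n))"
    and integral_poisson_kernel: "(LINT y|lebesgue. poisson_kernel t (x - y :: real ^ 'n)) = 1"
proof -
  show 1: "integrable lebesgue (\<lambda>y. poisson_kernel t (x - y :: real ^ 'n))"
    using nn_integral_poisson_kernel[OF t, of x] t
    by (intro integrableI_bounded) (auto simp: abs_of_nonneg)
  have "ennreal (LINT y|lebesgue. poisson_kernel t (x - y :: real ^ 'n)) = 1"
    using nn_integral_eq_integral[OF 1] nn_integral_poisson_kernel[OF t, of x] t by simp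
  then show "(LINT y|lebesgue. poisson_kernel t (x - y :: real ^ 'n)) = 1" by simp
qed

lemma poisson_const: "t > 0 \<Longrightarrow> poisson t (\<lambda>_. c) (x :: real ^ 'n) = c"
  unfolding poisson_def by (subst integral_scaleR_left) (auto simp: integrable_poisson_kernel integral_poisson_kernel)

section \<open>The class \<open>M_Poisson\<close> as an L1 space weighted by the kernel\<close>

lemma M_weight_bounds:
  fixes y :: "real ^ 'n"
  shows "(1 + (norm y)\<^sup>2) powr ((real CARD('n) + 1) / 2) \<le> 2 powr ((real CARD('n) + 1) / 2) * (1 + norm y ^ (CARD('n) + 1))"
    and "1 + norm y ^ (CARD('n) + 1) \<le> 2 * (1 + (norm y)\<^sup>2) powr ((real CARD('n) + 1) / 2)"
proof -
  let ?a = "(real CARD('n) + 1) / 2"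
  have a: "?a > 0" by simp
  have p: "((norm y)\<^sup>2) powr ?a = norm y ^ (CARD('n) + 1)"
    using square_powr_half[of "norm y" "CARD('n)"] by (cases "y = 0") auto
  have "(1 + (norm y)\<^sup>2) powr ?a \<le> (2 * max 1 ((norm y)\<^sup>2)) powr ?a"
    using a by (intro powr_mono2) (auto intro!: add_nonneg_nonneg)
  also have "\<dots> = 2 powr ?a * (max 1 ((norm y)\<^sup>2)) powr ?a"
    by (rule powr_mult)
  finally have 1: "(1 + (norm y)\<^sup>2) powr ?a \<le> 2 powr ?a * (max 1 ((norm y)\<^sup>2)) powr ?a" .
  have "(max 1 ((norm y)\<^sup>2)) powr ?a \<le> 1 + norm y ^ (CARD('n) + 1)"
  proof (cases "(norm y)\<^sup>2 \<le> 1")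
    case True
    then have "max 1 ((norm y)\<^sup>2) = 1" by simp
    then show ?thesis by (simp only: powr_one_eq_one) simp
  next
    case False
    then have "max 1 ((norm y)\<^sup>2) = (norm y)\<^sup>2" by simp
    then show ?thesis by (simp only: p)
  qed
  then have "2 powr ?a * (max 1 ((norm y)\<^sup>2)) powr ?a \<le> 2 powr ?a * (1 + norm y ^ (CARD('n) + 1))"
    by (intro mult_left_mono) auto
  with 1 show "(1 + (norm y)\<^sup>2) powr ?a \<le> 2 powr ?a * (1 + norm y ^ (CARD('n) + 1))"
    by (rule order_trans)
  have "1 powr ?a \<le> (1 + (norm y)\<^sup>2) powr ?a" using a by (intro powr_mono2) auto
  moreover have "((norm y)\<^sup>2) powr ?a \<le> (1 + (norm y)\<^sup>2) powr ?a" using a by (intro powr_mono2) auto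
  ultimately show "1 + norm y ^ (CARD('n) + 1) \<le> 2 * (1 + (norm y)\<^sup>2) powr ?a"
    unfolding p by simp
qed

lemma poisson_kernel_1: "poisson_kernel 1 (0 - y :: real ^ 'n) = poisson_const TYPE('n) / (1 + (norm y)\<^sup>2) powr ((real CARD('n) + 1) / 2)"
  unfolding poisson_kernel_alt powr_minus divide_inverse by simp

lemma integrable_scaleR_bound:
  fixes f :: "'a \<Rightarrow> 'b::{banach, second_countable_topology}"
  assumes "integrable M (\<lambda>y. k y *\<^sub>R f y)"
    and "f \<in> borel_measurable M" "h \<in> borel_measurable M"
    and "\<And>y. \<bar>h y\<bar> \<le> C * k y"
  shows "integrable M (\<lambda>y. h y *\<^sub>R f y)"
proof (rule Bochner_Integration.integrable_bound)
  show "integrable M (\<lambda>y. C *\<^sub>R k y *\<^sub>R f y)" by (intro integrable_scaleR_right assms(1))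
  show "(\<lambda>y. h y *\<^sub>R f y) \<in> borel_measurable M" using assms by simp
  show "AE y in M. norm (h y *\<^sub>R f y) \<le> norm (C *\<^sub>R k y *\<^sub>R f y)"
  proof (rule AE_I2)
    fix y
    have "\<bar>h y\<bar> * norm (f y) \<le> \<bar>C * k y\<bar> * norm (f y)"
      using assms(4)[of y] by (intro mult_right_mono) auto
    then show "norm (h y *\<^sub>R f y) \<le> norm (C *\<^sub>R k y *\<^sub>R f y)" by (simp add: abs_mult)
  qed
qed

text \<open>The weight 1 / (1 + |x|^(n+1)) and the kernel at time 1 dominate each other up to
  constants. In the direction from right to left, local integrability comes from a positive lower
  bound of the kernel on compact sets.\<close>

lemma M_Poisson_iff:
  fixes f :: "real ^ 'n \<Rightarrow> complex"
  shows "f \<in> M_Poisson \<longleftrightarrow> f \<in> borel_measurable lebesgue \<and> integrable lebesgue (\<lambda>y. poisson_kernel 1 (0 - y) *\<^sub>R f y)"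
    (is "_ \<longleftrightarrow> ?R")
proof
  let ?a = "(real CARD('n) + 1) / 2" and ?c = "poisson_const TYPE('n)"
  have W[measurable]: "(\<lambda>x :: real ^ 'n. inverse (1 + norm x ^ (CARD('n) + 1))) \<in> borel_measurable lebesgue"
    "(\<lambda>x :: real ^ 'n. 1 + norm x ^ (CARD('n) + 1)) \<in> borel_measurable lebesgue"
    by (intro borel_measurable_lebesgue_borel; measurable)+
  have Wpos: "1 + norm x ^ (CARD('n) + 1) > 0" for x :: "real ^ 'n" by (intro add_pos_nonneg) auto
  have Ppos: "(1 + (norm x)\<^sup>2) powr ?a > 0" for x :: "real ^ 'n"
  proof -
    have "1 + (norm x)\<^sup>2 > 0" by (intro add_pos_nonneg) auto
    then show ?thesis by simp
  qed
  have c: "?c > 0" by (rule poisson_const_pos)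
  {
    assume "f \<in> M_Poisson"
    then have I: "integrable lebesgue (\<lambda>x. inverse (1 + norm x ^ (CARD('n) + 1)) *\<^sub>R f x)"
      by (simp add: M_Poisson_def)
    have "(\<lambda>x. (1 + norm x ^ (CARD('n) + 1)) *\<^sub>R (inverse (1 + norm x ^ (CARD('n) + 1)) *\<^sub>R f x)) \<in> borel_measurable lebesgue"
      by (rule borel_measurable_scaleR[OF W(2) borel_measurable_integrable[OF I]])
    moreover have "(1 + norm x ^ (CARD('n) + 1)) *\<^sub>R (inverse (1 + norm x ^ (CARD('n) + 1)) *\<^sub>R f x) = f x" for x
      using Wpos[of x] by simp
    ultimately have f: "f \<in> borel_measurable lebesgue" by (simp only:)
    have "integrable lebesgue (\<lambda>y. poisson_kernel 1 (0 - y) *\<^sub>R f y)"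
    proof (rule integrable_scaleR_bound[OF I f])
      fix y :: "real ^ 'n"
      have "?c / (1 + (norm y)\<^sup>2) powr ?a \<le> ?c * 2 * inverse (1 + norm y ^ (CARD('n) + 1))"
      proof -
        have "c / P \<le> c * 2 * inverse W" if "W \<le> 2 * P" "W > 0" "P > 0" "c > 0" for c P W :: real
          using that by (simp add: field_simps)
        from this[OF M_weight_bounds(2) Wpos Ppos c] show ?thesis .
      qed
      then show "\<bar>poisson_kernel 1 (0 - y)\<bar> \<le> ?c * 2 * inverse (1 + norm y ^ (CARD('n) + 1))"
        using poisson_kernel_nonneg[of 1 "0 - y"] by (simp only: poisson_kernel_1 abs_of_nonneg)
    qed measurable
    with f show ?R by simp
  }
  {
    assume ?R
    then have f: "f \<in> borel_measurable lebesgue" and I: "integrable lebesgue (\<lambda>y. poisson_kernel 1 (0 - y) *\<^sub>R f y)" by auto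
    have "integrable lebesgue (\<lambda>x. inverse (1 + norm x ^ (CARD('n) + 1)) *\<^sub>R f x)"
    proof (rule integrable_scaleR_bound[OF I f])
      fix y :: "real ^ 'n"
      have "inverse (1 + norm y ^ (CARD('n) + 1)) \<le> 2 powr ?a / ?c * (?c / (1 + (norm y)\<^sup>2) powr ?a)"
      proof -
        have "inverse W \<le> k / c * (c / P)" if "P \<le> k * W" "W > 0" "P > 0" "c > 0" for c k P W :: real
          using that by (simp add: field_simps)
        from this[OF M_weight_bounds(1) Wpos Ppos c] show ?thesis .
      qed
      then show "\<bar>inverse (1 + norm y ^ (CARD('n) + 1))\<bar> \<le> 2 powr ?a / ?c * poisson_kernel 1 (0 - y)"
        using Wpos[of y] by (simp only: poisson_kernel_1) simp
    qed measurable
    moreover have "locally_integrable f"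
      unfolding locally_integrable_def
    proof (intro allI impI)
      fix K :: "(real ^ 'n) set" assume K: "compact K"
      then obtain R where R: "\<And>y. y \<in> K \<Longrightarrow> norm y \<le> R" by (meson bounded_iff compact_imp_bounded)
      have m: "K \<in> sets lebesgue" using K by (simp add: compact_imp_closed borel_closed)
      show "set_integrable lebesgue K f"
        unfolding set_integrable_def
      proof (rule integrable_scaleR_bound[OF I f])
        show "indicat_real K \<in> borel_measurable lebesgue" using m by simp
        fix y :: "real ^ 'n"
        define q where "q = ?c / ((1 + R\<^sup>2) powr ?a)"
        have "1 + R\<^sup>2 > 0" by (intro add_pos_nonneg) auto
        then have q: "q > 0" using c by (simp add: q_def)
        have p: "poisson_kernel 1 (0 - y) \<ge> 0" by (rule poisson_kernel_nonneg) simp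
        show "\<bar>indicat_real K y\<bar> \<le> 1 / q * poisson_kernel 1 (0 - y)"
        proof (cases "y \<in> K")
          case True
          have "q \<le> poisson_kernel 1 (0 - y)"
            using poisson_kernel_ge[of 1 "0 - y" R] R[OF True] by (simp add: q_def)
          then show ?thesis using True q by (simp add: field_simps)
        next
          case False
          then show ?thesis using q p by simp
        qed
      qed
    qed
    ultimately show "f \<in> M_Poisson" by (simp add: M_Poisson_def)
  }
qed

lemma M_Poisson_measurable: "f \<in> M_Poisson \<Longrightarrow> f \<in> borel_measurable lebesgue"
  by (simp add: M_Poisson_iff)

text \<open>Kernels at different times and base points are comparable with each other, so
  integrability against the kernel at time 1 and base point 0 passes to all of them.\<close>

lemma M_Poisson_integrable:
  fixes f :: "real ^ 'n \<Rightarrow> complex"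
  assumes f: "f \<in> M_Poisson" and t: "t > 0"
  shows "integrable lebesgue (\<lambda>y. poisson_kernel t (x - y) *\<^sub>R f y)"
proof -
  obtain C where C: "\<And>y. poisson_kernel t (x - y) \<le> C * poisson_kernel 1 (0 - y)"
    using poisson_kernel_compare_any[of t 1 x 0] t by auto
  show ?thesis
  proof (rule integrable_scaleR_bound)
    show "integrable lebesgue (\<lambda>y. poisson_kernel 1 (0 - y) *\<^sub>R f y)" "f \<in> borel_measurable lebesgue"
      using f unfolding M_Poisson_iff by blast+
    show "\<bar>poisson_kernel t (x - y)\<bar> \<le> C * poisson_kernel 1 (0 - y)" for y
      using C[of y] t by simp
  qed (rule lebesgue_measurable_poisson_kernel)
qed

lemma M_PoissonI:
  fixes f :: "real ^ 'n \<Rightarrow> complex"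
  assumes f: "f \<in> borel_measurable lebesgue" and t: "t > 0"
    and I: "(\<integral>\<^sup>+y. ennreal (poisson_kernel t (x - y) * norm (f y)) \<partial>lebesgue) < \<infinity>"
  shows "f \<in> M_Poisson"
proof -
  have I: "integrable lebesgue (\<lambda>y. poisson_kernel t (x - y) *\<^sub>R f y)"
    using I f t by (intro integrableI_bounded) auto
  obtain C where C: "\<And>y. poisson_kernel 1 (0 - y) \<le> C * poisson_kernel t (x - y)"
    using poisson_kernel_compare_any[of 1 t 0 x] t by auto
  have "integrable lebesgue (\<lambda>y. poisson_kernel 1 (0 - y) *\<^sub>R f y)"
    using C
    by (intro integrable_scaleR_bound[OF I f lebesgue_measurable_poisson_kernel(1), where C=C]) auto
  with f show ?thesis by (simp add: M_Poisson_iff)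
qed

lemma M_Poisson_nn_integral_finite:
  fixes f :: "real ^ 'n \<Rightarrow> complex"
  assumes f: "f \<in> M_Poisson" and t: "t > 0"
  shows "(\<integral>\<^sup>+y. ennreal (poisson_kernel t (x - y) * norm (f y)) \<partial>lebesgue) < \<infinity>"
proof -
  have "(\<integral>\<^sup>+y. ennreal (norm (poisson_kernel t (x - y) *\<^sub>R f y)) \<partial>lebesgue) < \<infinity>"
    using M_Poisson_integrable[OF f t, of x] by (simp add: integrable_iff_bounded)
  then show ?thesis using t by simp
qed

lemma M_Poisson_const: "(\<lambda>_. c) \<in> (M_Poisson :: (real ^ 'n \<Rightarrow> complex) set)"
  unfolding M_Poisson_iff using integrable_poisson_kernel[of 1 "0 :: real ^ 'n"] by auto

lemma M_Poisson_diff: "f \<in> M_Poisson \<Longrightarrow> g \<in> M_Poisson \<Longrightarrow> (\<lambda>x. f x - g x) \<in> M_Poisson"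
  unfolding M_Poisson_iff by (auto simp: scaleR_diff_right)

lemma M_Poisson_add: "f \<in> M_Poisson \<Longrightarrow> g \<in> M_Poisson \<Longrightarrow> (\<lambda>x. f x + g x) \<in> M_Poisson"
  unfolding M_Poisson_iff by (auto simp: scaleR_add_right)

lemma poisson_diff:
  "f \<in> M_Poisson \<Longrightarrow> g \<in> M_Poisson \<Longrightarrow> t > 0 \<Longrightarrow> poisson t (\<lambda>x. f x - g x) x = poisson t f x - poisson t g x"
  unfolding poisson_def scaleR_diff_right by (intro Bochner_Integration.integral_diff M_Poisson_integrable)

lemma norm_poisson_le:
  assumes t: "t > 0"
  shows "ennreal (norm (poisson t f x)) \<le> (\<integral>\<^sup>+y. ennreal (poisson_kernel t (x - y) * norm (f y)) \<partial>lebesgue)"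
proof (cases "integrable lebesgue (\<lambda>y. poisson_kernel t (x - y) *\<^sub>R f y)")
  case True
  have "ennreal (norm (poisson t f x)) \<le> (\<integral>\<^sup>+y. ennreal (norm (poisson_kernel t (x - y) *\<^sub>R f y)) \<partial>lebesgue)"
    unfolding poisson_def by (rule integral_norm_bound_ennreal[OF True])
  then show ?thesis using t by simp
next
  \<comment> \<open>Here the Bochner integral has the default value 0.\<close>
  case False
  then show ?thesis by (simp add: poisson_def not_integrable_integral_eq)
qed

lemma borel_measurable_poisson:
  fixes f :: "real ^ 'n \<Rightarrow> complex"
  assumes f: "f \<in> borel_measurable lebesgue"
  shows "poisson t f \<in> borel_measurable lebesgue"
proof -
  interpret sigma_finite_measure "lebesgue :: (real ^ 'n) measure" by (rule sigma_finite_lebesgue)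
  have [measurable]: "(\<lambda>z. f (snd z)) \<in> borel_measurable (lebesgue2 :: ((real ^ 'n) \<times> (real ^ 'n)) measure)"
    using f by measurable
  have "(\<lambda>z. poisson_kernel t (fst z - snd z) *\<^sub>R f (snd z)) \<in> borel_measurable (lebesgue2 :: ((real ^ 'n) \<times> (real ^ 'n)) measure)"
    by measurable
  then have "(\<lambda>(x, y). poisson_kernel t (x - y) *\<^sub>R f y) \<in> borel_measurable (lebesgue2 :: ((real ^ 'n) \<times> (real ^ 'n)) measure)"
    by (simp add: split_def)
  from borel_measurable_lebesgue_integral[OF this] show ?thesis
    unfolding poisson_def[abs_def] .
qed

lemma nn_integral_poisson_iterated:
  fixes g :: "real ^ 'n \<Rightarrow> real"
  assumes g: "g \<in> borel_measurable lebesgue" and g0: "\<And>y. 0 \<le> g y" and t: "t > 0" and s: "s > 0"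
  shows "(\<integral>\<^sup>+y. (\<integral>\<^sup>+z. ennreal (poisson_kernel t (x - z) * (poisson_kernel s (z - y) * g y)) \<partial>lebesgue) \<partial>lebesgue) =
    (\<integral>\<^sup>+y. ennreal (poisson_kernel (t + s) (x - y) * g y) \<partial>lebesgue)"
proof (rule nn_integral_cong)
  fix y
  have "(\<integral>\<^sup>+z. ennreal (poisson_kernel t (x - z) * (poisson_kernel s (z - y) * g y)) \<partial>lebesgue) =
     (\<integral>\<^sup>+z. ennreal (poisson_kernel t (x - z) * poisson_kernel s (z - y)) * ennreal (g y) \<partial>lebesgue)"
    using g0 by (intro nn_integral_cong) (simp add: ennreal_mult'' mult.assoc[symmetric])
  also have "\<dots> = ennreal (poisson_kernel (t + s) (x - y)) * ennreal (g y)"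
    unfolding nn_integral_poisson_kernel_convolution[OF t s, symmetric]
    by (rule nn_integral_multc) (subst poisson_kernel_commute[of s], measurable)
  finally show "(\<integral>\<^sup>+z. ennreal (poisson_kernel t (x - z) * (poisson_kernel s (z - y) * g y)) \<partial>lebesgue) =
     ennreal (poisson_kernel (t + s) (x - y) * g y)"
    using g0 by (simp add: ennreal_mult'')
qed

text \<open>Fubini is justified by the same computation with absolute values: the iterated integral
  of |f| collapses to its Poisson integral at time t + s, which is finite. The same finiteness shows
  that P_s f stays in the class.\<close>

lemma poisson_semigroup:
  fixes f :: "real ^ 'n \<Rightarrow> complex"
  assumes f: "f \<in> M_Poisson" and t: "t > 0" and s: "s > 0"
  shows "poisson t (poisson s f) x = poisson (t + s) f x" and "poisson s f \<in> M_Poisson"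
proof -
  interpret L: pair_sigma_finite "lebesgue :: (real ^ 'n) measure" "lebesgue :: (real ^ 'n) measure"
    by (rule pair_sigma_finite_lebesgue)
  have fm[measurable]: "f \<in> borel_measurable lebesgue" using f by (rule M_Poisson_measurable)
  have kz[measurable]: "(\<lambda>z. poisson_kernel t (x - fst z)) \<in> borel_measurable (lebesgue2 :: ((real ^ 'n) \<times> (real ^ 'n)) measure)"
    by (rule measurable_compose[OF measurable_fst]) measurable
  have fz[measurable]: "(\<lambda>z. f (snd z)) \<in> borel_measurable (lebesgue2 :: ((real ^ 'n) \<times> (real ^ 'n)) measure)"
    by measurable
  let ?F = "\<lambda>z y. poisson_kernel t (x - z) *\<^sub>R (poisson_kernel s (z - y) *\<^sub>R f y)"
  have Fm: "(\<lambda>z. ?F (fst z) (snd z)) \<in> borel_measurable lebesgue2"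
    by measurable
  have nF: "norm (?F z y) = poisson_kernel t (x - z) * (poisson_kernel s (z - y) * norm (f y))" for z y
    using t s by simp
  have "(\<integral>\<^sup>+w. ennreal (norm (?F (fst w) (snd w))) \<partial>lebesgue2) = (\<integral>\<^sup>+y. (\<integral>\<^sup>+z. ennreal (norm (?F z y)) \<partial>lebesgue) \<partial>lebesgue)"
    using Fm by (subst L.nn_integral_snd[symmetric]) auto
  also have "\<dots> = (\<integral>\<^sup>+y. ennreal (poisson_kernel (t + s) (x - y) * norm (f y)) \<partial>lebesgue)"
    unfolding nF by (rule nn_integral_poisson_iterated) (use t s in auto)
  finally have fin: "(\<integral>\<^sup>+w. ennreal (norm (?F (fst w) (snd w))) \<partial>lebesgue2) < \<infinity>"
    using M_Poisson_nn_integral_finite[OF f, of "t + s" x] t s by simp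
  then have I: "integrable lebesgue2 (\<lambda>(z, y). ?F z y)"
    using Fm by (intro integrableI_bounded) (auto simp: split_def)
  have "poisson t (poisson s f) x = (LINT z|lebesgue. (LINT y|lebesgue. ?F z y))"
    unfolding poisson_def by (subst integral_scaleR_right) simp
  also have "\<dots> = (LINT y|lebesgue. (LINT z|lebesgue. ?F z y))"
    using L.Fubini_integral[OF I] by simp
  also have "\<dots> = (LINT y|lebesgue. poisson_kernel (t + s) (x - y) *\<^sub>R f y)"
  proof (rule Bochner_Integration.integral_cong[OF refl])
    fix y
    have m: "(\<lambda>z. poisson_kernel t (x - z) * poisson_kernel s (z - y)) \<in> borel_measurable lebesgue"
      by (subst poisson_kernel_commute[of s]) measurable
    have nn: "(\<integral>\<^sup>+z. ennreal (poisson_kernel t (x - z) * poisson_kernel s (z - y)) \<partial>lebesgue) = ennreal (poisson_kernel (t + s) (x - y))"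
      by (rule nn_integral_poisson_kernel_convolution[OF t s])
    have hb: "has_bochner_integral lebesgue (\<lambda>z. poisson_kernel t (x - z) * poisson_kernel s (z - y)) (poisson_kernel (t + s) (x - y))"
      by (rule has_bochner_integral_nn_integral[OF m _ _ nn])
        (use t s t s in auto)
    have "(LINT z|lebesgue. ?F z y) = (LINT z|lebesgue. (poisson_kernel t (x - z) * poisson_kernel s (z - y)) *\<^sub>R f y)"
      by simp
    also have "\<dots> = poisson_kernel (t + s) (x - y) *\<^sub>R f y"
      using hb by (subst integral_scaleR_left) (auto simp: has_bochner_integral_iff)
    finally show "(LINT z|lebesgue. ?F z y) = poisson_kernel (t + s) (x - y) *\<^sub>R f y" .
  qed
  finally show "poisson t (poisson s f) x = poisson (t + s) f x" unfolding poisson_def .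
  show "poisson s f \<in> M_Poisson"
  proof (rule M_PoissonI[OF borel_measurable_poisson[OF fm] t])
    have "(\<integral>\<^sup>+z. ennreal (poisson_kernel t (x - z) * norm (poisson s f z)) \<partial>lebesgue) \<le>
      (\<integral>\<^sup>+z. (\<integral>\<^sup>+y. ennreal (norm (?F z y)) \<partial>lebesgue) \<partial>lebesgue)"
    proof (rule nn_integral_mono)
      fix z
      have "ennreal (poisson_kernel t (x - z) * norm (poisson s f z)) \<le>
        ennreal (poisson_kernel t (x - z)) * (\<integral>\<^sup>+y. ennreal (poisson_kernel s (z - y) * norm (f y)) \<partial>lebesgue)"
        using norm_poisson_le[OF s, of f z] t by (simp add: ennreal_mult' mult_left_mono)
      also have "\<dots> = (\<integral>\<^sup>+y. ennreal (norm (?F z y)) \<partial>lebesgue)"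
        unfolding nF using t by (subst nn_integral_cmult[symmetric]) (auto simp: ennreal_mult')
      finally show "ennreal (poisson_kernel t (x - z) * norm (poisson s f z)) \<le> (\<integral>\<^sup>+y. ennreal (norm (?F z y)) \<partial>lebesgue)" .
    qed
    also have "\<dots> = (\<integral>\<^sup>+w. ennreal (norm (?F (fst w) (snd w))) \<partial>lebesgue2)"
      using sigma_finite_measure.nn_integral_fst[OF sigma_finite_lebesgue, of "\<lambda>w. ennreal (norm (?F (fst w) (snd w)))" "lebesgue :: (real ^ 'n) measure"] Fm
      by (simp del: norm_scaleR)
    finally show "(\<integral>\<^sup>+z. ennreal (poisson_kernel t (x - z) * norm (poisson s f z)) \<partial>lebesgue) < \<infinity>"
      using fin by simp
  qed
qed

section \<open>Time derivatives of Poisson integrals\<close>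

definition poisson_deriv :: "real \<Rightarrow> (real ^ 'n \<Rightarrow> complex) \<Rightarrow> real ^ 'n \<Rightarrow> complex" where
  "poisson_deriv t f x = (LINT y|lebesgue. poisson_dt t (x - y) *\<^sub>R f y)"

text \<open>The bounds are uniform in s and expressed by the kernel at the single time t, as
  differentiation under the integral at t requires of a majorant.\<close>

lemma poisson_dt_local_bound:
  fixes z :: "real ^ 'n"
  assumes t: "t > 0" and s: "\<bar>s - t\<bar> < t / 2"
  shows "\<bar>poisson_dt s z\<bar> \<le> (real CARD('n) + 2) * (3 / t * 4 powr ((real CARD('n) + 1) / 2)) * poisson_kernel t z"
    and "\<bar>poisson_dt2 s z\<bar> \<le> ((real CARD('n) + 2)\<^sup>2 + 3 * (real CARD('n) + 2)) * (6 / t\<^sup>2 * 4 powr ((real CARD('n) + 1) / 2)) * poisson_kernel t z"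
    and "s > 0"
proof -
  have "s - t < t / 2" "t - s < t / 2" using s by linarith+
  then have s': "t / 2 < s" "s < 3 / 2 * t" by linarith+
  then show s0: "s > 0" using t by linarith
  have "t\<^sup>2 \<le> (2 * s)\<^sup>2" using s' t by (intro power_mono) auto
  then have "t\<^sup>2 \<le> 4 * s\<^sup>2" by (simp add: power_mult_distrib)
  then have "t\<^sup>2 + (norm z)\<^sup>2 \<le> 4 * (s\<^sup>2 + (norm z)\<^sup>2)"
    unfolding distrib_left by (rule add_mono) simp
  from poisson_kernel_compare[OF s0 t this]
  have p: "poisson_kernel s z \<le> s / t * 4 powr ((real CARD('n) + 1) / 2) * poisson_kernel t z" .
  have f0: "4 powr ((real CARD('n) + 1) / 2) * poisson_kernel t z \<ge> 0"
    using t by simp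
  have "\<bar>poisson_dt s z\<bar> \<le> (real CARD('n) + 2) / s * poisson_kernel s z"
    by (rule abs_poisson_dt_le[OF s0])
  also have "\<dots> \<le> (real CARD('n) + 2) / s * (s / t * 4 powr ((real CARD('n) + 1) / 2) * poisson_kernel t z)"
    using s0 by (intro mult_left_mono[OF p]) auto
  also have "\<dots> = (real CARD('n) + 2) * (1 / t) * (4 powr ((real CARD('n) + 1) / 2) * poisson_kernel t z)"
    using s0 by simp
  also have "\<dots> \<le> (real CARD('n) + 2) * (3 / t) * (4 powr ((real CARD('n) + 1) / 2) * poisson_kernel t z)"
    using t f0 by (intro mult_right_mono mult_left_mono divide_right_mono) auto
  finally show "\<bar>poisson_dt s z\<bar> \<le> (real CARD('n) + 2) * (3 / t * 4 powr ((real CARD('n) + 1) / 2)) * poisson_kernel t z"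
    by (simp only: mult.assoc)
  let ?k = "(real CARD('n) + 2)\<^sup>2 + 3 * (real CARD('n) + 2)"
  have k: "?k \<ge> 0" by simp
  have "\<bar>poisson_dt2 s z\<bar> \<le> ?k / s\<^sup>2 * poisson_kernel s z"
    by (rule abs_poisson_dt2_le[OF s0])
  also have "\<dots> \<le> ?k / s\<^sup>2 * (s / t * 4 powr ((real CARD('n) + 1) / 2) * poisson_kernel t z)"
    using s0 k by (intro mult_left_mono[OF p]) auto
  also have "\<dots> = ?k * (1 / (s * t)) * (4 powr ((real CARD('n) + 1) / 2) * poisson_kernel t z)"
    using s0 by (simp add: power2_eq_square)
  also have "\<dots> \<le> ?k * (6 / t\<^sup>2) * (4 powr ((real CARD('n) + 1) / 2) * poisson_kernel t z)"
  proof (intro mult_right_mono mult_left_mono)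
    have "t * t \<le> 6 * (s * t)" using s' t s0 by (simp add: mult_right_mono)
    then show "1 / (s * t) \<le> 6 / t\<^sup>2" using s0 t by (simp add: field_simps power2_eq_square)
  qed (use f0 k in auto)
  finally show "\<bar>poisson_dt2 s z\<bar> \<le> ?k * (6 / t\<^sup>2 * 4 powr ((real CARD('n) + 1) / 2)) * poisson_kernel t z"
    by (simp only: mult.assoc)
qed

lemma has_vector_derivative_poisson:
  fixes f :: "real ^ 'n \<Rightarrow> complex"
  assumes f: "f \<in> M_Poisson" and t: "t > 0"
  shows "((\<lambda>s. poisson s f x) has_vector_derivative poisson_deriv t f x) (at t)"
    and "integrable lebesgue (\<lambda>y. poisson_dt t (x - y) *\<^sub>R f y)"
proof -
  have [measurable]: "f \<in> borel_measurable lebesgue" using f by (rule M_Poisson_measurable)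
  let ?C = "(real CARD('n) + 2) * (3 / t * 4 powr ((real CARD('n) + 1) / 2))"
  have m: "integrable lebesgue (\<lambda>y. ?C * poisson_kernel t (x - y) * norm (f y))"
    using integrable_mult_right[OF integrable_norm[OF M_Poisson_integrable[OF f t, of x]], of ?C] t
    by (simp add: mult.assoc)
  note D = has_vector_derivative_integral_parameter[where \<delta>="t / 2" and k="\<lambda>s y. poisson_kernel s (x - y)" and k'="\<lambda>s y. poisson_dt s (x - y)"
      and h=f and M=lebesgue and t=t, OF _ _ _ m M_Poisson_integrable[OF f t]]
  have d: "((\<lambda>s. poisson_kernel s (x - y)) has_real_derivative poisson_dt s (x - y)) (at s)" if "\<bar>s - t\<bar> < t / 2" for s y
    by (rule has_real_derivative_poisson_kernel[OF poisson_dt_local_bound(3)[OF t that]])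
  have b: "\<bar>poisson_dt s (x - y)\<bar> \<le> ?C * poisson_kernel t (x - y)" if "\<bar>s - t\<bar> < t / 2" for s y
    by (rule poisson_dt_local_bound(1)[OF t that])
  have t2: "t / 2 > 0" using t by simp
  show "((\<lambda>s. poisson s f x) has_vector_derivative poisson_deriv t f x) (at t)"
    unfolding poisson_def poisson_deriv_def by (rule D(1)[OF t2 d b]) measurable
  show "integrable lebesgue (\<lambda>y. poisson_dt t (x - y) *\<^sub>R f y)"
    by (rule D(2)[OF t2 d b]) measurable
qed

text \<open>Inside f - P_t f the time is frozen while s varies, so the function to be differentiated
  is P_s f - P_(s+t) f. At s = t this gives the derivatives at the times t and 2 t.\<close>

lemma t_deriv_poisson_eq:
  fixes f :: "real ^ 'n \<Rightarrow> complex"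
  assumes f: "f \<in> M_Poisson" and t: "t > 0"
  shows "t_deriv_poisson t (\<lambda>y. f y - poisson t f y) x = t *\<^sub>R (poisson_deriv t f x - poisson_deriv (2 * t) f x)"
proof -
  have "((\<lambda>s. poisson s f x - poisson (s + t) f x) has_vector_derivative
      (poisson_deriv t f x - poisson_deriv (t + t) f x)) (at t)"
  proof (rule has_vector_derivative_diff[OF has_vector_derivative_poisson(1)[OF f t]])
    have "((\<lambda>s. poisson s f x) has_vector_derivative poisson_deriv (t + t) f x) (at (t + t))"
      using has_vector_derivative_poisson(1)[OF f] t by simp
    from vector_diff_chain_at[of "\<lambda>s. s + t" 1 t "\<lambda>s. poisson s f x", OF _ this]
    show "((\<lambda>s. poisson (s + t) f x) has_vector_derivative poisson_deriv (t + t) f x) (at t)"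
      by (simp add: o_def has_vector_derivative_add_const has_vector_derivative_id)
  qed
  then have "((\<lambda>s. poisson s (\<lambda>y. f y - poisson t f y) x) has_vector_derivative
      (poisson_deriv t f x - poisson_deriv (t + t) f x)) (at t)"
  proof (rule has_vector_derivative_transform_within_open[where S="{0<..}"])
    fix s :: real assume "s \<in> {0<..}"
    then show "poisson s f x - poisson (s + t) f x = poisson s (\<lambda>y. f y - poisson t f y) x"
      using poisson_semigroup(1)[OF f _ t, of s x] poisson_semigroup(2)[OF f t t] t poisson_diff[OF f, of "poisson t f" s x] by simp
  qed (use t in auto)
  from vector_derivative_at[OF this] show ?thesis
    unfolding t_deriv_poisson_def mult_2 by (simp only:)
qed

subsection \<open>Dyadic averages\<close>

text \<open>Half-open, so that the children form an exact partition.\<close>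

definition hcube :: "real ^ 'n \<Rightarrow> real \<Rightarrow> (real ^ 'n) set" where
  "hcube a h = {x. \<forall>i. a $ i \<le> x $ i \<and> x $ i < a $ i + h}"

text \<open>A child is indexed by the set of coordinates in which the upper half is taken, which
  makes 2^n children.\<close>

definition hchild :: "real ^ 'n \<Rightarrow> real \<Rightarrow> 'n set \<Rightarrow> real ^ 'n" where
  "hchild a h S = (\<chi> i. a $ i + (if i \<in> S then h / 2 else 0))"

inductive dyadic_sub :: "real ^ 'n \<Rightarrow> real \<Rightarrow> real ^ 'n \<Rightarrow> real \<Rightarrow> bool" for a h where
  self: "dyadic_sub a h a h"
| child: "dyadic_sub a h b k \<Longrightarrow> dyadic_sub a h (hchild b k S) (k / 2)"

text \<open>The inductive definition appends a generation at the bottom. Here one is prepended at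
  the top, which is the direction in which the recursions over generations proceed.\<close>

lemma dyadic_sub_child: "dyadic_sub (hchild a h S) (h / 2) b k \<Longrightarrow> dyadic_sub a h b k"
  by (induction rule: dyadic_sub.induct) (auto intro: dyadic_sub.intros)

lemma hcube_borel[measurable]: "hcube a h \<in> sets borel"
proof -
  have "hcube a h = (\<Inter>i. {x. a $ i \<le> x $ i} \<inter> {x. x $ i < a $ i + h})"
    by (auto simp: hcube_def)
  also have "\<dots> \<in> sets borel"
    by (intro sets.finite_INT) (auto intro!: sets.Int borel_closed borel_open closed_Collect_le open_Collect_less continuous_intros)
  finally show ?thesis .
qed

lemma hcube_lebesgue[measurable]: "hcube a h \<in> sets lebesgue"
  using hcube_borel by (rule sets_completionI_sets[of _ lborel, simplified])

lemma hcube_box: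
  fixes a :: "real ^ 'n"
  shows "box a (a + (\<chi> i. h)) \<subseteq> hcube a h" "hcube a h \<subseteq> cbox a (a + (\<chi> i. h))"
  by (auto simp: hcube_def mem_box_cart less_imp_le)

lemma emeasure_hcube:
  fixes a :: "real ^ 'n"
  assumes h: "h > 0"
  shows "emeasure lebesgue (hcube a h) = ennreal (h ^ CARD('n))"
    and emeasure_lborel_hcube: "emeasure lborel (hcube a h) = ennreal (h ^ CARD('n))"
proof -
  let ?b = "a + (\<chi> i. h)"
  have le: "a \<bullet> b \<le> ?b \<bullet> b" if "b \<in> Basis" for b
    using that h by (auto simp: Basis_vec_def inner_axis)
  have p: "(\<Prod>b\<in>Basis. (?b - a) \<bullet> b) = h ^ CARD('n)"
  proof -
    have "(?b - a) \<bullet> b = h" if "b \<in> Basis" for b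
      using that by (auto simp: Basis_vec_def inner_axis)
    then have "(\<Prod>b\<in>Basis. (?b - a) \<bullet> b) = (\<Prod>b\<in>(Basis :: (real ^ 'n) set). h)" by (intro prod.cong) auto
    then show ?thesis by simp
  qed
  have 1: "emeasure lborel (box a ?b) = ennreal (h ^ CARD('n))"
    using emeasure_lborel_box[of a ?b] le p by simp
  have 2: "emeasure lborel (cbox a ?b) = ennreal (h ^ CARD('n))"
    using emeasure_lborel_cbox[of a ?b] le p by simp
  show 3: "emeasure lborel (hcube a h) = ennreal (h ^ CARD('n))"
  proof (rule antisym)
    show "emeasure lborel (hcube a h) \<le> ennreal (h ^ CARD('n))"
      unfolding 2[symmetric] by (rule emeasure_mono[OF hcube_box(2)]) simp
    show "ennreal (h ^ CARD('n)) \<le> emeasure lborel (hcube a h)"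
      unfolding 1[symmetric] by (rule emeasure_mono[OF hcube_box(1)]) simp
  qed
  then show "emeasure lebesgue (hcube a h) = ennreal (h ^ CARD('n))"
    by (subst emeasure_completion) (auto simp: main_part_sets)
qed

lemma hcube_children:
  fixes a :: "real ^ 'n"
  assumes h: "h > 0"
  shows "hcube a h = (\<Union>S\<in>UNIV. hcube (hchild a h S) (h / 2))"
    and "disjoint_family_on (\<lambda>S. hcube (hchild a h S) (h / 2)) UNIV"
proof -
  show "hcube a h = (\<Union>S\<in>UNIV. hcube (hchild a h S) (h / 2))"
  proof (intro equalityI subsetI)
    fix x assume x: "x \<in> hcube a h"
    then have "x \<in> hcube (hchild a h {i. x $ i \<ge> a $ i + h / 2}) (h / 2)"
      by (auto simp: hcube_def hchild_def algebra_simps)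
    then show "x \<in> (\<Union>S\<in>UNIV. hcube (hchild a h S) (h / 2))" by blast
  next
    fix x assume "x \<in> (\<Union>S\<in>UNIV. hcube (hchild a h S) (h / 2))"
    then obtain S where S: "x \<in> hcube (hchild a h S) (h / 2)" by blast
    show "x \<in> hcube a h"
      unfolding hcube_def
    proof (intro CollectI allI)
      fix i
      have "hchild a h S $ i \<le> x $ i" "x $ i < hchild a h S $ i + h / 2"
        using S by (auto simp: hcube_def)
      moreover have "hchild a h S $ i = a $ i + (if i \<in> S then h / 2 else 0)" by (simp add: hchild_def)
      ultimately show "a $ i \<le> x $ i \<and> x $ i < a $ i + h" using h by (cases "i \<in> S") auto
    qed
  qed
  show "disjoint_family_on (\<lambda>S. hcube (hchild a h S) (h / 2)) UNIV"
    unfolding disjoint_family_on_def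
  proof (intro ballI impI, rule ccontr)
    fix S T :: "'n set" assume ST: "S \<noteq> T" and "hcube (hchild a h S) (h / 2) \<inter> hcube (hchild a h T) (h / 2) \<noteq> {}"
    then obtain x where x: "x \<in> hcube (hchild a h S) (h / 2)" "x \<in> hcube (hchild a h T) (h / 2)" by blast
    have "i \<in> U \<longleftrightarrow> a $ i + h / 2 \<le> x $ i" if "x \<in> hcube (hchild a h U) (h / 2)" for U i
    proof -
      have "hchild a h U $ i \<le> x $ i" "x $ i < hchild a h U $ i + h / 2"
        using that by (auto simp: hcube_def)
      then show ?thesis by (auto simp: hchild_def split: if_splits)
    qed
    from this[OF x(1)] this[OF x(2)] have "S = T" by blast
    with ST show False by simp
  qed
qed

lemma hchild_subset: "h > 0 \<Longrightarrow> hcube (hchild a h S) (h / 2) \<subseteq> hcube a h"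
  using hcube_children(1)[of h a] by blast

lemma dyadic_sub_props:
  assumes "dyadic_sub a h b k" "h > 0"
  shows "k > 0" "hcube b k \<subseteq> hcube a h" "k \<le> h"
proof -
  from assms have "k > 0 \<and> hcube b k \<subseteq> hcube a h \<and> k \<le> h"
  proof (induction rule: dyadic_sub.induct)
    case (child b k S)
    then show ?case using hchild_subset[of k b S] by auto
  qed auto
  then show "k > 0" "hcube b k \<subseteq> hcube a h" "k \<le> h" by auto
qed

abbreviation cube_on :: "real ^ 'n \<Rightarrow> real \<Rightarrow> (real ^ 'n) measure" where
  "cube_on a h \<equiv> lebesgue_on (hcube a h)"

lemma finite_measure_cube_on: "h > 0 \<Longrightarrow> finite_measure (cube_on a h)"
  by (rule finite_measureI) (simp add: emeasure_restrict_space space_restrict_space emeasure_hcube emeasure_lborel_hcube)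

lemma measure_cube_on[simp]: "h > 0 \<Longrightarrow> measure (cube_on a h) (hcube a h) = h ^ CARD('n)"
  for a :: "real ^ 'n"
  by (simp add: measure_def emeasure_restrict_space emeasure_hcube emeasure_lborel_hcube)

lemma integrable_cube_const[simp]: "h > 0 \<Longrightarrow> integrable (cube_on a h) (\<lambda>x. c)"
  for c :: "'b::{banach, second_countable_topology}" and a :: "real ^ 'n"
  using finite_measure.integrable_const[OF finite_measure_cube_on] by blast

lemma integral_cube_const:
  fixes c :: "'b::{banach, second_countable_topology}" and a :: "real ^ 'n"
  assumes "h > 0"
  shows "(LINT x|cube_on a h. c) = h ^ CARD('n) *\<^sub>R c" "integrable (cube_on a h) (\<lambda>x. c)"
  using assms by (simp_all add: space_restrict_space)

lemma integrable_cube_mono: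
  fixes f :: "real ^ 'n \<Rightarrow> 'b::{banach, second_countable_topology}"
  assumes "integrable (cube_on a h) f" "hcube b k \<subseteq> hcube a h"
  shows "integrable (cube_on b k) f"
proof -
  have "set_integrable lebesgue (hcube a h) f"
    using assms(1) by (simp add: integrable_restrict_space set_integrable_def)
  then have "set_integrable lebesgue (hcube b k) f"
    by (rule set_integrable_subset) (use assms in auto)
  then show ?thesis by (simp add: integrable_restrict_space set_integrable_def)
qed

lemma integral_cube_children:
  fixes f :: "real ^ 'n \<Rightarrow> 'b::{banach, second_countable_topology}"
  assumes h: "h > 0" and f: "integrable (cube_on a h) f"
  shows "(LINT x|cube_on a h. f x) = (\<Sum>S\<in>UNIV. LINT x|cube_on (hchild a h S) (h / 2). f x)"
proof -
  have "(LINT x:(\<Union>S\<in>UNIV. hcube (hchild a h S) (h / 2))|lebesgue. f x) = (\<Sum>S\<in>UNIV. LINT x:hcube (hchild a h S) (h / 2)|lebesgue. f x)"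
  proof (rule set_integral_finite_Union)
    show "set_integrable lebesgue (hcube (hchild a h S) (h / 2)) f" for S
      using integrable_cube_mono[OF f hchild_subset[OF h, of a S]]
      by (simp add: integrable_restrict_space set_integrable_def)
  qed (use hcube_children(2)[OF h] in auto)
  then show ?thesis
    unfolding hcube_children(1)[OF h, symmetric]
    by (simp add: integral_restrict_space set_lebesgue_integral_def)
qed

definition cube_avg :: "real ^ 'n \<Rightarrow> real \<Rightarrow> (real ^ 'n \<Rightarrow> complex) \<Rightarrow> complex" where
  "cube_avg a h f = (1 / h ^ CARD('n)) *\<^sub>R (LINT y|cube_on a h. f y)"

text \<open>The conditional expectation of f on the N-th dyadic generation below the cube. Summands
  vanish outside their own cube, so at every point at most one child contributes.\<close>

fun dyadic_avg :: "nat \<Rightarrow> real ^ 'n \<Rightarrow> real \<Rightarrow> (real ^ 'n \<Rightarrow> complex) \<Rightarrow> real ^ 'n \<Rightarrow> complex" where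
  "dyadic_avg 0 a h f x = indicator (hcube a h) x *\<^sub>R cube_avg a h f"
| "dyadic_avg (Suc N) a h f x = (\<Sum>S\<in>UNIV. dyadic_avg N (hchild a h S) (h / 2) f x)"

lemma dyadic_avg_outside: "h > 0 \<Longrightarrow> x \<notin> hcube a h \<Longrightarrow> dyadic_avg N a h f x = 0"
proof (induction N arbitrary: a h)
  case (Suc N)
  then have "x \<notin> hcube (hchild a h S) (h / 2)" for S using hchild_subset by blast
  then show ?case using Suc by simp
qed simp

lemma dyadic_avg_child:
  assumes h: "h > 0" and x: "x \<in> hcube (hchild a h S) (h / 2)"
  shows "dyadic_avg (Suc N) a h f x = dyadic_avg N (hchild a h S) (h / 2) f x"
proof -
  have "dyadic_avg N (hchild a h T) (h / 2) f x = 0" if "T \<noteq> S" for T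
  proof (rule dyadic_avg_outside)
    show "x \<notin> hcube (hchild a h T) (h / 2)"
      using hcube_children(2)[OF h, of a] x that unfolding disjoint_family_on_def by blast
  qed (use h in simp)
  then have "(\<Sum>T\<in>UNIV. dyadic_avg N (hchild a h T) (h / 2) f x) = (\<Sum>T\<in>UNIV. if T = S then dyadic_avg N (hchild a h S) (h / 2) f x else 0)"
    by (intro sum.cong) auto
  then show ?thesis by simp
qed

lemma borel_measurable_dyadic_avg[measurable]: "dyadic_avg N a h f \<in> borel_measurable borel"
proof (induction N arbitrary: a h)
  case 0
  show ?case by (simp add: fun_eq_iff[THEN iffD2, OF allI, OF dyadic_avg.simps(1)])
next
  case (Suc N)
  have "dyadic_avg (Suc N) a h f = (\<lambda>x. \<Sum>S\<in>UNIV. dyadic_avg N (hchild a h S) (h / 2) f x)"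
    by (simp add: fun_eq_iff)
  then show ?case using Suc by simp
qed

lemma dyadic_avg_bounded: "\<exists>B. \<forall>x. norm (dyadic_avg N a h f x) \<le> B"
proof (induction N arbitrary: a h)
  case 0
  then show ?case by (intro exI[of _ "norm (cube_avg a h f)"]) (auto simp: indicator_def)
next
  case (Suc N)
  then have "\<forall>S. \<exists>B. \<forall>x. norm (dyadic_avg N (hchild a h S) (h / 2) f x) \<le> B" by blast
  from choice[OF this] obtain B where B: "\<forall>S x. norm (dyadic_avg N (hchild a h S) (h / 2) f x) \<le> B S" ..
  show ?case
  proof (intro exI[of _ "\<Sum>S\<in>UNIV. B S"] allI)
    fix x
    show "norm (dyadic_avg (Suc N) a h f x) \<le> (\<Sum>S\<in>UNIV. B S)"
      unfolding dyadic_avg.simps using B by (intro sum_norm_le) blast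
  qed
qed

text \<open>A general continuous \<open>\<Phi>\<close> covers at once the average, its shift by a
  constant, and its squared distance from a constant.\<close>

lemma integrable_cube_dyadic_avg:
  fixes \<Phi> :: "complex \<Rightarrow> 'b::{banach, second_countable_topology}"
  assumes h: "k > 0" and \<Phi>: "continuous_on UNIV \<Phi>"
  shows "integrable (cube_on b k) (\<lambda>x. \<Phi> (dyadic_avg N a h f x))"
proof -
  interpret finite_measure "cube_on b k" by (rule finite_measure_cube_on[OF h])
  obtain B where B: "\<And>x. norm (dyadic_avg N a h f x) \<le> B" using dyadic_avg_bounded[of N a h f] by blast
  have "bounded (\<Phi> ` cball 0 B)"
    by (intro compact_imp_bounded compact_continuous_image continuous_on_subset[OF \<Phi>]) auto
  then obtain C where "\<forall>z\<in>cball 0 B. norm (\<Phi> z) \<le> C" by (auto simp: bounded_iff)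
  then have C: "norm (\<Phi> z) \<le> C" if "norm z \<le> B" for z using that by auto
  have m: "(\<lambda>x. \<Phi> (dyadic_avg N a h f x)) \<in> borel_measurable borel"
    using borel_measurable_continuous_onI[OF \<Phi>] by measurable
  have "(\<lambda>x. \<Phi> (dyadic_avg N a h f x)) \<in> borel_measurable (cube_on b k)"
    by (rule measurable_restrict_space1, rule measurable_completion) (use m in simp)
  then show ?thesis
    by (rule integrable_const_bound[where B=C, rotated]) (auto intro!: C B)
qed

lemma integral_dyadic_avg:
  assumes h: "h > 0" and f: "integrable (cube_on a h) f"
  shows "(LINT x|cube_on a h. dyadic_avg N a h f x) = (LINT x|cube_on a h. f x)"
  using assms
proof (induction N arbitrary: a h)
  case 0
  have "(LINT x|cube_on a h. dyadic_avg 0 a h f x) = (LINT x|cube_on a h. cube_avg a h f)"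
    by (intro Bochner_Integration.integral_cong) (auto simp: space_restrict_space)
  then show ?case using 0 by (simp add: space_restrict_space cube_avg_def)
next
  case (Suc N)
  have "(LINT x|cube_on a h. dyadic_avg (Suc N) a h f x) =
     (\<Sum>S\<in>UNIV. LINT x|cube_on (hchild a h S) (h / 2). dyadic_avg (Suc N) a h f x)"
    using integrable_cube_dyadic_avg[where \<Phi>="\<lambda>z. z" and N="Suc N"] Suc.prems
    by (intro integral_cube_children) (auto simp del: dyadic_avg.simps)
  also have "\<dots> = (\<Sum>S\<in>UNIV. LINT x|cube_on (hchild a h S) (h / 2). f x)"
  proof (rule sum.cong[OF refl])
    fix S :: "'a set"
    have "(LINT x|cube_on (hchild a h S) (h / 2). dyadic_avg (Suc N) a h f x) =
       (LINT x|cube_on (hchild a h S) (h / 2). dyadic_avg N (hchild a h S) (h / 2) f x)"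
      using Suc.prems dyadic_avg_child[of h] by (intro Bochner_Integration.integral_cong) (auto simp: space_restrict_space simp del: dyadic_avg.simps)
    also have "\<dots> = (LINT x|cube_on (hchild a h S) (h / 2). f x)"
      using Suc.prems by (intro Suc.IH integrable_cube_mono[OF Suc.prems(2)] hchild_subset) auto
    finally show "(LINT x|cube_on (hchild a h S) (h / 2). dyadic_avg (Suc N) a h f x) = (LINT x|cube_on (hchild a h S) (h / 2). f x)" .
  qed
  also have "\<dots> = (LINT x|cube_on a h. f x)"
    using Suc.prems by (intro integral_cube_children[symmetric])
  finally show ?case .
qed

section \<open>A dyadic John-Nirenberg inequality in L2\<close>

text \<open>
  The two cases of the inductive step below: either the mean oscillation around \<open>c\<close> is still
  controlled by the running maximum \<open>M' = max M (Iw / V)\<close>, or \<open>c\<close> is replaced by the new average.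
\<close>

lemma oscillation_step_keep:
  fixes \<alpha> \<gamma> :: real
  assumes V: "V > 0" and \<alpha>: "\<alpha> \<ge> 0" and M: "M \<ge> 0" and \<gamma>: "\<gamma> = 2 * \<alpha>"
    and M': "M' = max M (Iw / V)" and J: "J \<le> 2 * M' * V"
    and X: "X \<le> \<alpha> * M' * J + \<gamma> * (4 * I2 - 4 * M' * Iw + M'\<^sup>2 * V)"
  shows "X \<le> \<alpha> * M * J + \<gamma> * (4 * I2 - 4 * M * Iw + M\<^sup>2 * V)"
proof (cases "Iw / V \<le> M")
  case True
  then show ?thesis using X M' by (simp add: max_def)
next
  case False
  define w where "w = Iw / V"
  have Iw: "Iw = w * V" using V by (simp add: w_def)
  have wM: "M < w" and M'w: "M' = w" using False M' by (auto simp: w_def)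
  \<comment> \<open>Raising M to w costs \<alpha> (w - M) J \<le> 2 \<alpha> (w - M) w V in the
    linear term and gains 2 \<alpha> (w - M) (3 w - M) V in the quadratic one. The choice \<gamma> =
    2 \<alpha> makes the gain at least the cost.\<close>
  have "\<alpha> * (w - M) * J \<le> \<alpha> * (w - M) * (2 * w * V)"
    using J M'w \<alpha> wM by (intro mult_left_mono) auto
  moreover have "0 \<le> 2 * \<alpha> * (w - M) * (2 * w - M) * V"
    using \<alpha> wM M V by (intro mult_nonneg_nonneg) auto
  moreover have "\<alpha> * M' * J + \<gamma> * (4 * I2 - 4 * M' * Iw + M'\<^sup>2 * V) =
      \<alpha> * M * J + \<gamma> * (4 * I2 - 4 * M * Iw + M\<^sup>2 * V) + \<alpha> * (w - M) * J - 2 * \<alpha> * (w - M) * (3 * w - M) * V"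
    unfolding \<gamma> M'w Iw by (simp add: power2_eq_square algebra_simps)
  moreover have "2 * \<alpha> * (w - M) * (3 * w - M) * V = \<alpha> * (w - M) * (2 * w * V) + 2 * \<alpha> * (w - M) * (2 * w - M) * V"
    by (simp add: algebra_simps)
  ultimately show ?thesis using X by linarith
qed

lemma oscillation_step_restart:
  fixes \<alpha> \<gamma> :: real
  assumes V: "V > 0" and D: "D \<ge> 0" and M: "M \<ge> 0" and \<alpha>: "\<alpha> = 4 * D" and \<gamma>: "\<gamma> = 2 * \<alpha>"
    and M': "M' = max M (Iw / V)" and J: "J > 2 * M' * V" and J': "J \<le> 2 * M * D * V"
    and d: "0 \<le> d" "d * V \<le> J" and I': "I' \<le> Iw"
    and X: "X \<le> \<alpha> * M' * I' + \<gamma> * (4 * I2 - 4 * M' * Iw + M'\<^sup>2 * V) + d\<^sup>2 * V"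
  shows "X \<le> \<alpha> * M * J + \<gamma> * (4 * I2 - 4 * M * Iw + M\<^sup>2 * V)"
proof -
  define w where "w = Iw / V"
  have Iw: "Iw = w * V" using V by (simp add: w_def)
  have \<alpha>0: "\<alpha> \<ge> 0" using D \<alpha> by simp
  have M'0: "M' \<ge> 0" using M M' by simp
  then have Im0: "J \<ge> 0" using J V by (smt (verit) mult_nonneg_nonneg)
  have "d * V \<le> (2 * M * D) * V" using d(2) J' by simp
  then have dM: "d \<le> 2 * M * D" using V by simp
  \<comment> \<open>The jump of the centre costs d^2 V. From d V \<le> J and d \<le> 2 M D it is at
    most 2 M D J, which is half of \<alpha> M J because \<alpha> = 4 D; the other half of \<alpha> M
    J pays for the restarted linear term.\<close>
  have "d\<^sup>2 * V = d * (d * V)" by (simp add: power2_eq_square)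
  also have "\<dots> \<le> (2 * M * D) * J" using d dM Im0 V M D by (intro mult_mono) auto
  finally have d2: "d\<^sup>2 * V \<le> \<alpha> / 2 * M * J" by (simp add: \<alpha> mult_ac)
  have I'': "\<alpha> * M' * I' \<le> \<alpha> * M' * (w * V)"
    using I' \<alpha>0 M'0 unfolding Iw by (intro mult_left_mono) auto
  show ?thesis
  proof (cases "w \<le> M")
    case True
    then have M'M: "M' = M" using M' by (simp add: w_def)
    have "w * V \<le> M * V" using True V by simp
    also have "\<dots> \<le> J / 2" using J M'M by simp
    finally have "\<alpha> * M * (w * V) \<le> \<alpha> * M * (J / 2)" using \<alpha>0 M by (intro mult_left_mono) auto
    then show ?thesis using X d2 I'' unfolding M'M by (simp add: algebra_simps)
  next
    case False
    then have wM: "M < w" and M'w: "M' = w" using M' by (auto simp: w_def)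
    have "\<alpha> / 2 * M * (2 * w * V) \<le> \<alpha> / 2 * M * J"
      using J M'w \<alpha>0 M by (intro mult_left_mono) auto
    moreover have "0 \<le> \<alpha> * (w - M) * (5 * w - 2 * M) * V"
      using \<alpha>0 wM M V by (intro mult_nonneg_nonneg) auto
    moreover have "\<alpha> * w * (w * V) + \<gamma> * (4 * I2 - 4 * w * (w * V) + w\<^sup>2 * V) =
        \<gamma> * (4 * I2 - 4 * M * (w * V) + M\<^sup>2 * V) + \<alpha> / 2 * M * (2 * w * V) - \<alpha> * (w - M) * (5 * w - 2 * M) * V"
      unfolding \<gamma> by (simp add: power2_eq_square algebra_simps)
    ultimately show ?thesis using X d2 I'' unfolding M'w Iw by linarith
  qed
qed

text \<open>Induction over generations with a potential: \<open>c\<close> is the current centre and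
  \<open>M\<close> the running maximum of the averages of w. The last bracket is the integral of (2
  w - M)^2, the potential behind Doob's maximal inequality. The centre is kept while the mean
  deviation on the child is at most twice the new maximum and is replaced by the average of the
  child otherwise. Before the jump the deviation was at most 2 M on the parent, hence at most 2 *
  2^n * M on the child, which is the origin of the factor 2^n.\<close>

lemma dyadic_oscillation_L2_aux:
  fixes a :: "real ^ 'n" and f :: "real ^ 'n \<Rightarrow> complex" and w :: "real ^ 'n \<Rightarrow> real"
  assumes h: "h > 0" and f: "integrable (cube_on a h) f"
    and w: "integrable (cube_on a h) w" and w2: "integrable (cube_on a h) (\<lambda>x. (w x)\<^sup>2)"
    and osc: "\<And>b k. dyadic_sub a h b k \<Longrightarrow>
        (LINT x|cube_on b k. norm (f x - cube_avg b k f)) \<le> (LINT x|cube_on b k. w x)"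
    and M: "M \<ge> 0" and wM: "(LINT x|cube_on a h. w x) \<le> M * h ^ CARD('n)"
    and fM: "(LINT x|cube_on a h. norm (f x - c)) \<le> 2 * M * h ^ CARD('n)"
  shows "(LINT x|cube_on a h. (norm (dyadic_avg N a h f x - c))\<^sup>2) \<le>
    4 * 2 ^ CARD('n) * M * (LINT x|cube_on a h. norm (f x - c)) +
    8 * 2 ^ CARD('n) * (4 * (LINT x|cube_on a h. (w x)\<^sup>2) - 4 * M * (LINT x|cube_on a h. w x) + M\<^sup>2 * h ^ CARD('n))"
  using assms
proof (induction N arbitrary: a h c M)
  case 0
  define V where "V = h ^ CARD('n)"
  have V: "V > 0" using 0 by (simp add: V_def)
  let ?Im = "LINT x|cube_on a h. norm (f x - c)"
  have d: "norm (cube_avg a h f - c) * V \<le> ?Im"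
  proof -
    have "V *\<^sub>R (cube_avg a h f - c) = (LINT x|cube_on a h. f x - c)"
      using 0(1,2) V by (simp add: cube_avg_def V_def[symmetric] space_restrict_space scaleR_diff_right)
    then have "norm (V *\<^sub>R (cube_avg a h f - c)) \<le> ?Im" by (simp add: integral_norm_bound del: norm_scaleR)
    then show ?thesis using V by (simp add: mult.commute)
  qed
  then have "norm (cube_avg a h f - c) * V \<le> (2 * M) * V" using 0(8) by (simp add: V_def)
  then have d2: "norm (cube_avg a h f - c) \<le> 2 * M" using V by simp
  have Im0: "?Im \<ge> 0" by (rule Bochner_Integration.integral_nonneg) simp
  have "(LINT x|cube_on a h. (norm (dyadic_avg 0 a h f x - c))\<^sup>2) = (LINT x|cube_on a h. (norm (cube_avg a h f - c))\<^sup>2)"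
    by (intro Bochner_Integration.integral_cong) (auto simp: space_restrict_space)
  also have "\<dots> = norm (cube_avg a h f - c) * (norm (cube_avg a h f - c) * V)"
    using 0(1) by (simp add: V_def space_restrict_space power2_eq_square)
  also have "\<dots> \<le> (2 * M) * ?Im" using d d2 Im0 V 0(6) by (intro mult_mono) auto
  also have "\<dots> \<le> 4 * 2 ^ CARD('n) * M * ?Im"
  proof (rule mult_right_mono)
    have "(1::real) \<le> 2 ^ CARD('n)" by simp
    then have "2 \<le> 4 * (2::real) ^ CARD('n)" by linarith
    then have "2 * M \<le> 4 * 2 ^ CARD('n) * M" using 0(6) by (rule mult_right_mono)
    then show "2 * M \<le> 4 * 2 ^ CARD('n) * M" .
  qed (rule Im0)
  finally have X: "(LINT x|cube_on a h. (norm (dyadic_avg 0 a h f x - c))\<^sup>2) \<le> 4 * 2 ^ CARD('n) * M * ?Im" .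
  \<comment> \<open>The second summand is the integral of a square, hence may be added to the bound
    just obtained.\<close>
  have "0 \<le> (LINT x|cube_on a h. (2 * w x - M)\<^sup>2)" by (rule Bochner_Integration.integral_nonneg) simp
  also have "(LINT x|cube_on a h. (2 * w x - M)\<^sup>2) = (LINT x|cube_on a h. 4 * (w x)\<^sup>2 - 4 * M * w x + M\<^sup>2)"
    by (intro Bochner_Integration.integral_cong) (auto simp: power2_eq_square algebra_simps)
  also have "\<dots> = 4 * (LINT x|cube_on a h. (w x)\<^sup>2) - 4 * M * (LINT x|cube_on a h. w x) + M\<^sup>2 * V"
    using 0(1,3,4) by (simp add: V_def space_restrict_space mult.commute)
  finally have "0 \<le> 8 * 2 ^ CARD('n) * (4 * (LINT x|cube_on a h. (w x)\<^sup>2) - 4 * M * (LINT x|cube_on a h. w x) + M\<^sup>2 * V)"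
    by simp
  with X show ?case unfolding V_def by linarith
next
  case (Suc N)
  define V where "V = (h / 2) ^ CARD('n)"
  define D where "D = (2::real) ^ CARD('n)"
  define \<alpha> where "\<alpha> = 4 * D"
  have V: "V > 0" and D: "D > 0" and hV: "h ^ CARD('n) = D * V"
    using Suc.prems(1) by (auto simp: V_def D_def power_divide)
  let ?q = "\<lambda>S. cube_on (hchild a h S) (h / 2)"
  let ?Im = "\<lambda>S. LINT x|?q S. norm (f x - c)" and ?Iw = "\<lambda>S. LINT x|?q S. w x" and ?I2 = "\<lambda>S. LINT x|?q S. (w x)\<^sup>2"
  have h2: "h / 2 > 0" using Suc.prems(1) by simp
  have fS: "integrable (?q S) f" and wS: "integrable (?q S) w" and w2S: "integrable (?q S) (\<lambda>x. (w x)\<^sup>2)" for S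
    using Suc.prems by (auto intro!: integrable_cube_mono[OF _ hchild_subset])
  have fc: "integrable (cube_on a h) (\<lambda>x. norm (f x - c))"
    by (intro integrable_norm Bochner_Integration.integrable_diff Suc.prems integrable_cube_const)
  have oscS: "(LINT x|cube_on b k. norm (f x - cube_avg b k f)) \<le> (LINT x|cube_on b k. w x)"
    if "dyadic_sub (hchild a h S) (h / 2) b k" for S b k
    using Suc.prems(5) dyadic_sub_child[OF that] by blast
  have one: "(LINT x|?q S. (norm (dyadic_avg (Suc N) a h f x - c))\<^sup>2) \<le>
      \<alpha> * M * ?Im S + (2 * \<alpha>) * (4 * ?I2 S - 4 * M * ?Iw S + M\<^sup>2 * V)" for S
  proof -
    let ?A = "dyadic_avg N (hchild a h S) (h / 2) f"
    have X: "(LINT x|?q S. (norm (dyadic_avg (Suc N) a h f x - c))\<^sup>2) = (LINT x|?q S. (norm (?A x - c))\<^sup>2)"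
    proof (rule Bochner_Integration.integral_cong[OF refl])
      fix x assume "x \<in> space (?q S)"
      then have "x \<in> hcube (hchild a h S) (h / 2)" by (simp add: space_restrict_space)
      then show "(norm (dyadic_avg (Suc N) a h f x - c))\<^sup>2 = (norm (?A x - c))\<^sup>2"
        by (simp only: dyadic_avg_child[OF Suc.prems(1)])
    qed
    define M' where "M' = max M (?Iw S / V)"
    have M'0: "M' \<ge> 0" using Suc.prems(6) by (simp add: M'_def)
    have "?Iw S / V \<le> M'" by (simp add: M'_def)
    then have wM': "?Iw S \<le> M' * V" using V by (simp add: pos_divide_le_eq)
    have IH: "(LINT x|?q S. (norm (?A x - e))\<^sup>2) \<le>
        4 * D * M' * (LINT x|?q S. norm (f x - e)) + 8 * D * (4 * ?I2 S - 4 * M' * ?Iw S + M'\<^sup>2 * V)"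
      if e: "(LINT x|?q S. norm (f x - e)) \<le> 2 * M' * V" for e
      unfolding D_def V_def
      by (rule Suc.IH[OF h2 fS wS w2S oscS M'0 wM'[unfolded V_def] e[unfolded V_def]])
    show ?thesis
    proof (cases "?Im S \<le> 2 * M' * V")
      case True
      show ?thesis
        unfolding X
        by (rule oscillation_step_keep[OF V _ Suc.prems(6) refl M'_def True])
          (use IH[OF True] D in \<open>auto simp: \<alpha>_def mult.assoc\<close>)
    next
      case False
      define c' where "c' = cube_avg (hchild a h S) (h / 2) f"
      let ?I' = "LINT x|?q S. norm (f x - c')"
      have I': "?I' \<le> ?Iw S" using oscS[OF dyadic_sub.self] by (simp add: c'_def)
      have "?Iw S \<le> 2 * (M' * V)" using wM' M'0 V by (smt (verit) mult_nonneg_nonneg)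
      then have I'M: "?I' \<le> 2 * M' * V" using I' by simp
      have Ac: "(LINT x|?q S. ?A x) = V *\<^sub>R c'"
        unfolding integral_dyadic_avg[OF h2 fS] c'_def cube_avg_def V_def[symmetric] using V by simp
      have iA: "integrable (?q S) ?A" using integrable_cube_dyadic_avg[OF h2, where \<Phi>="\<lambda>z. z"] by auto
      have iA2: "integrable (?q S) (\<lambda>x. (norm (?A x - e))\<^sup>2)" for e
        by (rule integrable_cube_dyadic_avg[OF h2, where \<Phi>="\<lambda>z. (norm (z - e))\<^sup>2"]) (intro continuous_intros)
      \<comment> \<open>Orthogonality: the mean of \<open>?A\<close> over the child is
        \<open>c'\<close>, so the cross term integrates to zero.\<close>
      have "(LINT x|?q S. (norm (?A x - c))\<^sup>2) = (LINT x|?q S. (norm (?A x - c'))\<^sup>2 + 2 * (?A x \<bullet> (c' - c)) - 2 * (c' \<bullet> (c' - c)) + (norm (c' - c))\<^sup>2)"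
        by (intro Bochner_Integration.integral_cong refl)
          (simp add: power2_norm_eq_inner inner_diff_left inner_diff_right inner_commute algebra_simps)
      also have "\<dots> = (LINT x|?q S. (norm (?A x - c'))\<^sup>2) + 2 * ((V *\<^sub>R c') \<bullet> (c' - c)) - 2 * (V * (c' \<bullet> (c' - c))) + V * (norm (c' - c))\<^sup>2"
        using iA iA2 h2 Ac
        by (simp add: V_def[symmetric] space_restrict_space)
      also have "\<dots> = (LINT x|?q S. (norm (?A x - c'))\<^sup>2) + (norm (c' - c))\<^sup>2 * V" by simp
      finally have dec: "(LINT x|?q S. (norm (?A x - c))\<^sup>2) = (LINT x|?q S. (norm (?A x - c'))\<^sup>2) + (norm (c' - c))\<^sup>2 * V" .
      have d: "norm (c' - c) * V \<le> ?Im S"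
      proof -
        have "V *\<^sub>R (c' - c) = (LINT x|?q S. f x - c)"
          using fS h2 V by (simp add: c'_def cube_avg_def V_def[symmetric] space_restrict_space scaleR_diff_right)
        then have "norm (V *\<^sub>R (c' - c)) \<le> ?Im S" by (simp add: integral_norm_bound del: norm_scaleR)
        then show ?thesis using V by (simp add: mult.commute)
      qed
      \<comment> \<open>The deviation on a child is at most that on the parent, whose volume is D =
        2^n times larger.\<close>
      have "?Im S \<le> (\<Sum>S\<in>UNIV. ?Im S)"
        by (rule member_le_sum) (auto intro: Bochner_Integration.integral_nonneg)
      also have "\<dots> = (LINT x|cube_on a h. norm (f x - c))"
        by (rule integral_cube_children[OF Suc.prems(1) fc, symmetric])
      also have "\<dots> \<le> 2 * M * D * V" using Suc.prems(8) unfolding hV by simp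
      finally have Im': "?Im S \<le> 2 * M * D * V" .
      show ?thesis
        unfolding X dec
        by (rule oscillation_step_restart[OF V _ Suc.prems(6) \<alpha>_def refl M'_def _ Im' norm_ge_zero d I'])
          (use IH[OF I'M] D False in \<open>auto simp: \<alpha>_def mult.assoc\<close>)
    qed
  qed
  have cardS: "card (UNIV :: 'n set set) = 2 ^ CARD('n)" by (metis Pow_UNIV card_Pow finite)
  have "(LINT x|cube_on a h. (norm (dyadic_avg (Suc N) a h f x - c))\<^sup>2) =
      (\<Sum>S\<in>UNIV. LINT x|?q S. (norm (dyadic_avg (Suc N) a h f x - c))\<^sup>2)"
    by (rule integral_cube_children[OF Suc.prems(1)],
        rule integrable_cube_dyadic_avg[OF Suc.prems(1), where \<Phi>="\<lambda>z. (norm (z - c))\<^sup>2"]) (intro continuous_intros)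
  also have "\<dots> \<le> (\<Sum>S\<in>UNIV. \<alpha> * M * ?Im S + (2 * \<alpha>) * (4 * ?I2 S - 4 * M * ?Iw S + M\<^sup>2 * V))"
    by (rule sum_mono) (rule one)
  also have "\<dots> = \<alpha> * M * (\<Sum>S\<in>UNIV. ?Im S) + (2 * \<alpha>) * (4 * (\<Sum>S\<in>UNIV. ?I2 S) - 4 * M * (\<Sum>S\<in>UNIV. ?Iw S) + M\<^sup>2 * (D * V))"
    by (simp add: sum.distrib sum_subtractf sum_distrib_left[symmetric] D_def cardS)
  also have "(\<Sum>S\<in>UNIV. ?Im S) = (LINT x|cube_on a h. norm (f x - c))"
    by (rule integral_cube_children[OF Suc.prems(1) fc, symmetric])
  also have "(\<Sum>S\<in>UNIV. ?I2 S) = (LINT x|cube_on a h. (w x)\<^sup>2)"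
    by (rule integral_cube_children[OF Suc.prems(1,4), symmetric])
  also have "(\<Sum>S\<in>UNIV. ?Iw S) = (LINT x|cube_on a h. w x)"
    by (rule integral_cube_children[OF Suc.prems(1,3), symmetric])
  finally show ?case unfolding hV \<alpha>_def D_def by (simp add: mult.assoc)
qed

text \<open>The induction is started with the average of f as centre and the average of w as M. The
  terms in M then add up to (4 - 32 + 8) * 2^n * M^2 V \<le> 0, and 8 * 4 = 32 times 2^n remains in
  front of the integral of w^2.\<close>

lemma dyadic_oscillation_L2:
  fixes a :: "real ^ 'n" and f :: "real ^ 'n \<Rightarrow> complex" and w :: "real ^ 'n \<Rightarrow> real"
  assumes h: "h > 0" and f: "integrable (cube_on a h) f"
    and w: "integrable (cube_on a h) w" and w2: "integrable (cube_on a h) (\<lambda>x. (w x)\<^sup>2)"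
    and osc: "\<And>b k. dyadic_sub a h b k \<Longrightarrow>
        (LINT x|cube_on b k. norm (f x - cube_avg b k f)) \<le> (LINT x|cube_on b k. w x)"
  shows "(LINT x|cube_on a h. (norm (dyadic_avg N a h f x - cube_avg a h f))\<^sup>2) \<le>
    32 * 2 ^ CARD('n) * (LINT x|cube_on a h. (w x)\<^sup>2)"
proof -
  define V where "V = h ^ CARD('n)"
  have V: "V > 0" using h by (simp add: V_def)
  define Iw where "Iw = (LINT x|cube_on a h. w x)"
  define M where "M = Iw / V"
  let ?Im = "LINT x|cube_on a h. norm (f x - cube_avg a h f)"
  have Im0: "?Im \<ge> 0" by (rule Bochner_Integration.integral_nonneg) simp
  have Im: "?Im \<le> Iw" using osc[OF dyadic_sub.self] by (simp add: Iw_def)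
  have Iw0: "Iw \<ge> 0" by (rule order_trans[OF Im0 Im])
  have M0: "M \<ge> 0" and MV: "Iw = M * V" using Iw0 V by (auto simp: M_def)
  have "(LINT x|cube_on a h. (norm (dyadic_avg N a h f x - cube_avg a h f))\<^sup>2) \<le>
    4 * 2 ^ CARD('n) * M * ?Im +
    8 * 2 ^ CARD('n) * (4 * (LINT x|cube_on a h. (w x)\<^sup>2) - 4 * M * Iw + M\<^sup>2 * V)"
    unfolding Iw_def V_def
    by (rule dyadic_oscillation_L2_aux[OF h f w w2 osc M0])
      (use MV Im Iw0 in \<open>auto simp: V_def[symmetric] Iw_def[symmetric]\<close>)
  also have "\<dots> \<le> 4 * 2 ^ CARD('n) * M * (M * V) + 8 * 2 ^ CARD('n) * (4 * (LINT x|cube_on a h. (w x)\<^sup>2) - 4 * M * (M * V) + M\<^sup>2 * V)"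
    using Im M0 unfolding MV by (intro add_right_mono mult_left_mono) auto
  also have "\<dots> = 32 * 2 ^ CARD('n) * (LINT x|cube_on a h. (w x)\<^sup>2) - 20 * 2 ^ CARD('n) * (M\<^sup>2 * V)"
    by (simp add: power2_eq_square algebra_simps)
  also have "\<dots> \<le> 32 * 2 ^ CARD('n) * (LINT x|cube_on a h. (w x)\<^sup>2)"
    using V by simp
  finally show ?thesis .
qed

text \<open>On a cube of the last generation \<open>\<kappa>\<close> may be replaced by its
  difference from the value at the corner, because f minus its average integrates to zero there. The
  error is at most \<epsilon> times the integral of |average - f|, hence 2 \<epsilon> times that of
  |f|. The induction step only adds these estimates over the children.\<close>

lemma dyadic_avg_weak_bound:
  fixes a :: "real ^ 'n" and f :: "real ^ 'n \<Rightarrow> complex" and \<kappa> :: "real ^ 'n \<Rightarrow> real"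
  assumes h: "h > 0" and f: "integrable (cube_on a h) f" and \<kappa>: "continuous_on UNIV \<kappa>"
    and \<epsilon>: "\<And>x y. x \<in> hcube a h \<Longrightarrow> y \<in> hcube a h \<Longrightarrow> (\<forall>i. \<bar>x $ i - y $ i\<bar> < h / 2 ^ N) \<Longrightarrow> \<bar>\<kappa> x - \<kappa> y\<bar> \<le> \<epsilon>"
  shows "norm ((LINT x|cube_on a h. \<kappa> x *\<^sub>R dyadic_avg N a h f x) - (LINT x|cube_on a h. \<kappa> x *\<^sub>R f x)) \<le>
    2 * \<epsilon> * (LINT x|cube_on a h. norm (f x))"
proof -
  let ?I = "\<lambda>M g. LINT x|M. \<kappa> x *\<^sub>R g x"
  have int\<kappa>: "integrable (cube_on b k) (\<lambda>x. \<kappa> x *\<^sub>R g x)" if g: "integrable (cube_on b k) g" for b k and g :: "real ^ 'n \<Rightarrow> complex"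
  proof -
    have "bounded (\<kappa> ` cbox b (b + (\<chi> i. k)))"
      by (intro compact_imp_bounded compact_continuous_image continuous_on_subset[OF \<kappa>]) auto
    then obtain C where C: "\<And>x. x \<in> hcube b k \<Longrightarrow> \<bar>\<kappa> x\<bar> \<le> C"
      using hcube_box(2)[of b k] by (auto simp: bounded_iff subset_iff)
    show ?thesis
    proof (rule Bochner_Integration.integrable_bound)
      show "integrable (cube_on b k) (\<lambda>x. C * norm (g x))" using g by simp
      have "\<kappa> \<in> borel_measurable (cube_on b k)"
        by (rule measurable_restrict_space1, rule measurable_completion) (use borel_measurable_continuous_onI[OF \<kappa>] in simp)
      then show "(\<lambda>x. \<kappa> x *\<^sub>R g x) \<in> borel_measurable (cube_on b k)" using g by simp
      show "AE x in cube_on b k. norm (\<kappa> x *\<^sub>R g x) \<le> norm (C * norm (g x))"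
      proof (rule AE_I2)
        fix x assume "x \<in> space (cube_on b k)"
        then have "\<bar>\<kappa> x\<bar> \<le> C" using C by (simp add: space_restrict_space)
        then show "norm (\<kappa> x *\<^sub>R g x) \<le> norm (C * norm (g x))"
          by (simp add: abs_mult mult_right_mono)
      qed
    qed
  qed
  from h f \<epsilon> show ?thesis
  proof (induction N arbitrary: a h)
    case 0
    note const = integral_cube_const[OF 0(1), of a]
    define V where "V = h ^ CARD('n)"
    have V: "V > 0" using 0 by (simp add: V_def)
    let ?c = "cube_avg a h f"
    have e0: "\<epsilon> \<ge> 0"
    proof -
      have "a \<in> hcube a h" using 0(1) by (simp add: hcube_def)
      from 0(3)[OF this this] 0(1) show ?thesis by simp
    qed
    have nf: "integrable (cube_on a h) (\<lambda>x. norm (?c - f x))" using 0(2) const(2)[of ?c] by simp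
    have "?I (cube_on a h) (dyadic_avg 0 a h f) = (LINT x|cube_on a h. \<kappa> x *\<^sub>R ?c)"
      by (intro Bochner_Integration.integral_cong) (auto simp: space_restrict_space)
    moreover have "(LINT x|cube_on a h. \<kappa> x *\<^sub>R ?c) - ?I (cube_on a h) f = (LINT x|cube_on a h. (\<kappa> x - \<kappa> a) *\<^sub>R (?c - f x))"
    proof -
      have z: "(LINT x|cube_on a h. \<kappa> a *\<^sub>R (?c - f x)) = 0"
        using 0(1,2) V by (simp add: cube_avg_def V_def[symmetric] space_restrict_space)
      have "(LINT x|cube_on a h. (\<kappa> x - \<kappa> a) *\<^sub>R (?c - f x)) = (LINT x|cube_on a h. \<kappa> x *\<^sub>R (?c - f x)) - (LINT x|cube_on a h. \<kappa> a *\<^sub>R (?c - f x))"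
        unfolding scaleR_left_diff_distrib using 0(2) const(2)[of ?c]
        by (intro Bochner_Integration.integral_diff int\<kappa> integrable_scaleR_right) auto
      also have "(LINT x|cube_on a h. \<kappa> x *\<^sub>R (?c - f x)) = (LINT x|cube_on a h. \<kappa> x *\<^sub>R ?c) - ?I (cube_on a h) f"
        unfolding scaleR_diff_right using 0(2) const(2)[of ?c]
        by (intro Bochner_Integration.integral_diff int\<kappa>)
      finally show ?thesis using z by simp
    qed
    ultimately have "norm (?I (cube_on a h) (dyadic_avg 0 a h f) - ?I (cube_on a h) f) \<le>
       (LINT x|cube_on a h. norm ((\<kappa> x - \<kappa> a) *\<^sub>R (?c - f x)))"
      by (simp only: integral_norm_bound)
    also have "\<dots> \<le> (LINT x|cube_on a h. \<epsilon> * norm (?c - f x))"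
    proof (rule integral_mono')
      show "integrable (cube_on a h) (\<lambda>x. \<epsilon> * norm (?c - f x))" using nf by simp
      fix x assume "x \<in> space (cube_on a h)"
      then have x: "x \<in> hcube a h" by (simp add: space_restrict_space)
      have "a \<in> hcube a h" using 0(1) by (simp add: hcube_def)
      moreover have "\<bar>x $ i - a $ i\<bar> < h" for i
      proof -
        have "a $ i \<le> x $ i" "x $ i < a $ i + h" using x by (auto simp: hcube_def)
        then show ?thesis by simp
      qed
      ultimately have "\<bar>\<kappa> x - \<kappa> a\<bar> \<le> \<epsilon>" using 0(3)[OF x] by simp
      then show "norm ((\<kappa> x - \<kappa> a) *\<^sub>R (?c - f x)) \<le> \<epsilon> * norm (?c - f x)"
        by (simp add: mult_right_mono)
      show "0 \<le> \<epsilon> * norm (?c - f x)" using e0 by simp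
    qed
    also have "\<dots> = \<epsilon> * (LINT x|cube_on a h. norm (?c - f x))" by simp
    also have "\<dots> \<le> \<epsilon> * (2 * (LINT x|cube_on a h. norm (f x)))"
    proof (intro mult_left_mono e0)
      have "(LINT x|cube_on a h. norm (?c - f x)) \<le> (LINT x|cube_on a h. norm ?c + norm (f x))"
        using nf 0(2) const(2)[of "norm ?c"] by (intro integral_mono) (auto intro: norm_triangle_ineq4)
      also have "\<dots> = V * norm ?c + (LINT x|cube_on a h. norm (f x))"
        using 0(1,2) by (simp add: V_def space_restrict_space)
      also have "V * norm ?c = norm (LINT x|cube_on a h. f x)"
        using V by (simp add: cube_avg_def V_def[symmetric])
      also have "\<dots> \<le> (LINT x|cube_on a h. norm (f x))" by (rule integral_norm_bound)
      finally show "(LINT x|cube_on a h. norm (?c - f x)) \<le> 2 * (LINT x|cube_on a h. norm (f x))" by simp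
    qed
    finally show ?case by (simp add: mult_ac)
  next
    case (Suc N)
    let ?q = "\<lambda>S. cube_on (hchild a h S) (h / 2)"
    have h2: "h / 2 > 0" using Suc.prems by simp
    have fS: "integrable (?q S) f" for S
      using Suc.prems by (auto intro!: integrable_cube_mono[OF _ hchild_subset])
    have A: "?I (cube_on a h) (dyadic_avg (Suc N) a h f) = (\<Sum>S\<in>UNIV. LINT x|?q S. \<kappa> x *\<^sub>R dyadic_avg N (hchild a h S) (h / 2) f x)"
    proof -
      have "integrable (cube_on a h) (dyadic_avg (Suc N) a h f)"
        using integrable_cube_dyadic_avg[OF Suc.prems(1), where \<Phi>="\<lambda>z. z" and N="Suc N"] by (simp del: dyadic_avg.simps)
      then have "?I (cube_on a h) (dyadic_avg (Suc N) a h f) = (\<Sum>S\<in>UNIV. LINT x|?q S. \<kappa> x *\<^sub>R dyadic_avg (Suc N) a h f x)"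
        by (intro integral_cube_children Suc.prems(1) int\<kappa>)
      also have "\<dots> = (\<Sum>S\<in>UNIV. LINT x|?q S. \<kappa> x *\<^sub>R dyadic_avg N (hchild a h S) (h / 2) f x)"
      proof (intro sum.cong Bochner_Integration.integral_cong refl)
        fix S x assume "x \<in> space (?q S)"
        then have "x \<in> hcube (hchild a h S) (h / 2)" by (simp add: space_restrict_space)
        then show "\<kappa> x *\<^sub>R dyadic_avg (Suc N) a h f x = \<kappa> x *\<^sub>R dyadic_avg N (hchild a h S) (h / 2) f x"
          by (simp only: dyadic_avg_child[OF Suc.prems(1)])
      qed
      finally show ?thesis .
    qed
    have B: "?I (cube_on a h) f = (\<Sum>S\<in>UNIV. LINT x|?q S. \<kappa> x *\<^sub>R f x)"
      using Suc.prems by (intro integral_cube_children int\<kappa>)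
    have C: "(LINT x|cube_on a h. norm (f x)) = (\<Sum>S\<in>UNIV. LINT x|?q S. norm (f x))"
      using Suc.prems by (intro integral_cube_children) auto
    have "norm (?I (cube_on a h) (dyadic_avg (Suc N) a h f) - ?I (cube_on a h) f) \<le>
       (\<Sum>S\<in>UNIV. norm (?I (?q S) (dyadic_avg N (hchild a h S) (h / 2) f) - ?I (?q S) f))"
      unfolding A B sum_subtractf[symmetric] by (rule norm_sum)
    also have "\<dots> \<le> (\<Sum>S\<in>UNIV. 2 * \<epsilon> * (LINT x|?q S. norm (f x)))"
    proof (rule sum_mono)
      fix S :: "'n set"
      show "norm (?I (?q S) (dyadic_avg N (hchild a h S) (h / 2) f) - ?I (?q S) f) \<le> 2 * \<epsilon> * (LINT x|?q S. norm (f x))"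
      proof (rule Suc.IH[OF h2 fS])
        fix x y assume "x \<in> hcube (hchild a h S) (h / 2)" "y \<in> hcube (hchild a h S) (h / 2)" "\<forall>i. \<bar>x $ i - y $ i\<bar> < h / 2 / 2 ^ N"
        then show "\<bar>\<kappa> x - \<kappa> y\<bar> \<le> \<epsilon>"
          using hchild_subset[OF Suc.prems(1), of a S] by (intro Suc.prems(3)) (auto simp: divide_divide_eq_left)
      qed
    qed
    also have "\<dots> = 2 * \<epsilon> * (LINT x|cube_on a h. norm (f x))" unfolding C by (simp add: sum_distrib_left)
    finally show ?case .
  qed
qed

text \<open>Uniform continuity of \<open>\<kappa>\<close> on the closed cube makes its oscillation
  over small cubes uniformly small. With the derivative of the Poisson kernel as
  \<open>\<kappa>\<close>, this is the pointwise convergence that Fatou's lemma will use.\<close>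

lemma dyadic_avg_weak_limit:
  fixes a :: "real ^ 'n" and f :: "real ^ 'n \<Rightarrow> complex" and \<kappa> :: "real ^ 'n \<Rightarrow> real"
  assumes h: "h > 0" and f: "integrable (cube_on a h) f" and \<kappa>: "continuous_on UNIV \<kappa>"
  shows "(\<lambda>N. LINT x|cube_on a h. \<kappa> x *\<^sub>R dyadic_avg N a h f x) \<longlonglongrightarrow> (LINT x|cube_on a h. \<kappa> x *\<^sub>R f x)"
proof (rule LIMSEQ_I)
  fix r :: real assume r: "r > 0"
  define F where "F = (LINT x|cube_on a h. norm (f x))"
  have F: "F \<ge> 0" unfolding F_def by (rule Bochner_Integration.integral_nonneg) simp
  define \<epsilon> where "\<epsilon> = r / (2 * (F + 1) * 2)"
  have e: "\<epsilon> > 0" "2 * \<epsilon> * F < r"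
  proof -
    show "\<epsilon> > 0" using r F by (simp add: \<epsilon>_def)
    have "2 * \<epsilon> * F = r * (F / (F + 1)) / 2" using F by (simp add: \<epsilon>_def field_simps)
    also have "\<dots> \<le> r * 1 / 2" using F r by (intro divide_right_mono mult_left_mono) auto
    also have "\<dots> < r" using r by simp
    finally show "2 * \<epsilon> * F < r" .
  qed
  have "uniformly_continuous_on (cbox a (a + (\<chi> i. h))) \<kappa>"
    by (intro compact_uniformly_continuous continuous_on_subset[OF \<kappa>]) auto
  then obtain d where d: "d > 0" "\<And>x y. x \<in> cbox a (a + (\<chi> i. h)) \<Longrightarrow> y \<in> cbox a (a + (\<chi> i. h)) \<Longrightarrow> dist y x < d \<Longrightarrow> dist (\<kappa> y) (\<kappa> x) < \<epsilon>"
    unfolding uniformly_continuous_on_def using e(1) by metis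
  have "(\<lambda>N. real CARD('n) * (h / 2 ^ N)) \<longlonglongrightarrow> real CARD('n) * 0"
    by (intro tendsto_mult tendsto_const LIMSEQ_divide_realpow_zero) simp
  then have "eventually (\<lambda>N. real CARD('n) * (h / 2 ^ N) < d) sequentially"
    using d(1) by (intro order_tendstoD(2)) auto
  then obtain N0 where N0: "\<And>N. N \<ge> N0 \<Longrightarrow> real CARD('n) * (h / 2 ^ N) < d"
    unfolding eventually_sequentially by blast
  show "\<exists>no. \<forall>N\<ge>no. norm ((LINT x|cube_on a h. \<kappa> x *\<^sub>R dyadic_avg N a h f x) - (LINT x|cube_on a h. \<kappa> x *\<^sub>R f x)) < r"
  proof (intro exI allI impI)
    fix N assume N: "N \<ge> N0"
    have "norm ((LINT x|cube_on a h. \<kappa> x *\<^sub>R dyadic_avg N a h f x) - (LINT x|cube_on a h. \<kappa> x *\<^sub>R f x)) \<le> 2 * \<epsilon> * F"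
      unfolding F_def
    proof (rule dyadic_avg_weak_bound[OF h f \<kappa>])
      fix x y assume xy: "x \<in> hcube a h" "y \<in> hcube a h" "\<forall>i. \<bar>x $ i - y $ i\<bar> < h / 2 ^ N"
      have "dist x y \<le> (\<Sum>i\<in>UNIV. \<bar>(x - y) $ i\<bar>)"
        unfolding dist_norm by (rule norm_le_l1_cart)
      also have "\<dots> \<le> (\<Sum>i\<in>(UNIV :: 'n set). h / 2 ^ N)"
        using xy(3) by (intro sum_mono) (auto simp: less_imp_le)
      also have "\<dots> < d" using N0[OF N] by simp
      finally have "dist (\<kappa> x) (\<kappa> y) < \<epsilon>"
        using xy hcube_box(2)[of a h] by (intro d(2)) auto
      then show "\<bar>\<kappa> x - \<kappa> y\<bar> \<le> \<epsilon>" by (simp add: dist_real_def)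
    qed
    then show "norm ((LINT x|cube_on a h. \<kappa> x *\<^sub>R dyadic_avg N a h f x) - (LINT x|cube_on a h. \<kappa> x *\<^sub>R f x)) < r"
      using e(2) by simp
  qed
qed

section \<open>Convolution of time derivatives of the kernel\<close>

lemma poisson_dt_even: "poisson_dt t (- x) = poisson_dt t (x :: real ^ 'n)"
  by (simp add: poisson_dt_def poisson_kernel_minus)

lemma poisson_dt_commute: "poisson_dt t (x - y) = poisson_dt t (y - (x :: real ^ 'n))"
  using poisson_dt_even[of t "x - y"] by simp

text \<open>Makes translates of the kernel and of its time derivative admissible functions, so that
  the results on Poisson integrals apply to the kernel itself.\<close>

lemma M_Poisson_kernel_bound:
  fixes k :: "real ^ 'n \<Rightarrow> real"
  assumes t: "t > 0" and k: "k \<in> borel_measurable lebesgue" and b: "\<And>z. \<bar>k z\<bar> \<le> C * poisson_kernel t (z - y)"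
  shows "(\<lambda>z. complex_of_real (k z)) \<in> M_Poisson"
proof (rule M_PoissonI[OF _ t])
  show "(\<lambda>z. complex_of_real (k z)) \<in> borel_measurable lebesgue" using k by simp
  have C: "C \<ge> 0"
  proof -
    have "0 \<le> C * poisson_kernel t (y - y)" using b[of y] by (rule order_trans[rotated]) simp
    then show ?thesis using poisson_kernel_pos[OF t, of "y - y"] by (simp add: zero_le_mult_iff)
  qed
  have "(\<integral>\<^sup>+z. ennreal (poisson_kernel t (y - z) * norm (complex_of_real (k z))) \<partial>lebesgue) \<le>
     (\<integral>\<^sup>+z. ennreal C * ennreal (poisson_kernel t (y - z) * poisson_kernel t (z - y)) \<partial>lebesgue)"
  proof (rule nn_integral_mono)
    fix z
    have "poisson_kernel t (y - z) * \<bar>k z\<bar> \<le> poisson_kernel t (y - z) * (C * poisson_kernel t (z - y))"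
      using b[of z] t by (intro mult_left_mono) auto
    then show "ennreal (poisson_kernel t (y - z) * norm (complex_of_real (k z))) \<le>
       ennreal C * ennreal (poisson_kernel t (y - z) * poisson_kernel t (z - y))"
      using C t by (simp add: mult_ac flip: ennreal_mult)
  qed
  also have "\<dots> = ennreal C * ennreal (poisson_kernel (t + t) (y - y))"
    unfolding nn_integral_poisson_kernel_convolution[OF t t, symmetric]
    by (rule nn_integral_cmult) (subst (2) poisson_kernel_commute, measurable)
  also have "\<dots> < \<infinity>" by (simp add: ennreal_mult_less_top)
  finally show "(\<integral>\<^sup>+z. ennreal (poisson_kernel t (y - z) * norm (complex_of_real (k z))) \<partial>lebesgue) < \<infinity>" .
qed

text \<open>By the semigroup law the Poisson integral of a translated kernel is the kernel at the
  added time; this identity is differentiated in s on both sides.\<close>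

lemma poisson_dt_convolution_1:
  fixes x y :: "real ^ 'n"
  assumes t: "t > 0" and s: "s > 0"
  shows "poisson_deriv s (\<lambda>z. complex_of_real (poisson_kernel t (z - y))) x = complex_of_real (poisson_dt (s + t) (x - y))"
proof -
  let ?f = "\<lambda>z. complex_of_real (poisson_kernel t (z - y))"
  have fm: "(\<lambda>z. poisson_kernel t (z - y)) \<in> borel_measurable lebesgue"
    by (subst poisson_kernel_commute) measurable
  have f: "?f \<in> M_Poisson"
    by (rule M_Poisson_kernel_bound[OF t fm, where C=1 and y=y]) (use t in auto)
  have eq: "poisson s ?f x = complex_of_real (poisson_kernel (s + t) (x - y))" if s: "s > 0" for s
  proof -
    have "has_bochner_integral lebesgue (\<lambda>z. poisson_kernel s (x - z) * poisson_kernel t (z - y)) (poisson_kernel (s + t) (x - y))"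
      by (rule has_bochner_integral_nn_integral[OF _ _ _ nn_integral_poisson_kernel_convolution[OF s t]])
        (use s t fm in auto)
    then have "(LINT z|lebesgue. complex_of_real (poisson_kernel s (x - z) * poisson_kernel t (z - y))) = complex_of_real (poisson_kernel (s + t) (x - y))"
      by (subst integral_complex_of_real) (simp add: has_bochner_integral_integral_eq)
    then show ?thesis by (simp add: poisson_def scaleR_conv_of_real)
  qed
  have "((\<lambda>s. poisson s ?f x) has_vector_derivative poisson_deriv s ?f x) (at s)"
    by (rule has_vector_derivative_poisson(1)[OF f s])
  moreover have "((\<lambda>s. poisson s ?f x) has_vector_derivative complex_of_real (poisson_dt (s + t) (x - y))) (at s)"
  proof (rule has_vector_derivative_transform_within_open[where S="{0<..}"])
    have "((\<lambda>s. poisson_kernel (s + t) (x - y)) has_real_derivative poisson_dt (s + t) (x - y)) (at s)"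
      using DERIV_shift[THEN iffD1, OF has_real_derivative_poisson_kernel[of "s + t" "x - y"]] s t by simp
    then show "((\<lambda>s. complex_of_real (poisson_kernel (s + t) (x - y))) has_vector_derivative complex_of_real (poisson_dt (s + t) (x - y))) (at s)"
      by (intro has_vector_derivative_of_real) (simp add: has_real_derivative_iff_has_vector_derivative)
  qed (use s eq in auto)
  ultimately show ?thesis by (rule vector_derivative_unique_at)
qed

text \<open>Read with the roles of the two kernels exchanged, the preceding lemma says that P_t maps
  the derivative kernel at time s to that at time s + t. One further derivative in t gives the
  claim.\<close>

lemma poisson_dt_convolution:
  fixes x y :: "real ^ 'n"
  assumes t: "t > 0" and s: "s > 0"
  shows "(LINT z|lebesgue. poisson_dt t (x - z) * poisson_dt s (z - y)) = poisson_dt2 (t + s) (x - y)"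
proof -
  let ?f = "\<lambda>z. complex_of_real (poisson_dt s (z - y))"
  have fm: "(\<lambda>z. poisson_dt s (z - y)) \<in> borel_measurable lebesgue"
    by (subst poisson_dt_commute) measurable
  have f: "?f \<in> M_Poisson"
    by (rule M_Poisson_kernel_bound[OF s fm, where y=y]) (rule abs_poisson_dt_le[OF s])
  have eq: "poisson t ?f x = complex_of_real (poisson_dt (s + t) (x - y))" if t: "t > 0" for t
  proof -
    have "poisson t ?f x = (LINT z|lebesgue. complex_of_real (poisson_dt s (y - z) * poisson_kernel t (z - x)))"
      unfolding poisson_def
      by (intro Bochner_Integration.integral_cong refl)
        (simp add: scaleR_conv_of_real poisson_dt_commute[of s y] poisson_kernel_commute[of t x])
    also have "\<dots> = poisson_deriv s (\<lambda>z. complex_of_real (poisson_kernel t (z - x))) y"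
      by (simp add: poisson_deriv_def scaleR_conv_of_real)
    also have "\<dots> = complex_of_real (poisson_dt (s + t) (y - x))"
      by (rule poisson_dt_convolution_1[OF t s])
    finally show ?thesis by (simp add: poisson_dt_commute)
  qed
  have "((\<lambda>t. poisson t ?f x) has_vector_derivative poisson_deriv t ?f x) (at t)"
    by (rule has_vector_derivative_poisson(1)[OF f t])
  moreover have "((\<lambda>t. poisson t ?f x) has_vector_derivative complex_of_real (poisson_dt2 (s + t) (x - y))) (at t)"
  proof (rule has_vector_derivative_transform_within_open[where S="{0<..}"])
    have "((\<lambda>t. poisson_dt (t + s) (x - y)) has_real_derivative poisson_dt2 (t + s) (x - y)) (at t)"
      using DERIV_shift[THEN iffD1, OF has_real_derivative_poisson_dt[of "t + s" "x - y"]] s t by simp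
    then show "((\<lambda>t. complex_of_real (poisson_dt (s + t) (x - y))) has_vector_derivative complex_of_real (poisson_dt2 (s + t) (x - y))) (at t)"
      by (intro has_vector_derivative_of_real) (simp add: has_real_derivative_iff_has_vector_derivative add.commute)
  qed (use t eq in auto)
  ultimately have "poisson_deriv t ?f x = complex_of_real (poisson_dt2 (s + t) (x - y))"
    by (rule vector_derivative_unique_at)
  then have "(LINT z|lebesgue. complex_of_real (poisson_dt t (x - z) * poisson_dt s (z - y))) = complex_of_real (poisson_dt2 (s + t) (x - y))"
    by (simp add: poisson_deriv_def scaleR_conv_of_real)
  then have "complex_of_real (LINT z|lebesgue. poisson_dt t (x - z) * poisson_dt s (z - y)) = complex_of_real (poisson_dt2 (s + t) (x - y))"
    by (simp only: integral_complex_of_real)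
  then show ?thesis by (simp add: add.commute)
qed

text \<open>The inner product on the complex numbers is the real one, so the squared modulus of an
  integral becomes a double integral of a real function.\<close>

lemma integral_pair_inner:
  fixes a b :: "real ^ 'n \<Rightarrow> complex"
  assumes a: "integrable lebesgue a" and b: "integrable lebesgue b"
  shows "integrable lebesgue2 (\<lambda>z. a (fst z) \<bullet> b (snd z))"
    and "(LINT z|lebesgue2. a (fst z) \<bullet> b (snd z)) = (LINT y|lebesgue. a y) \<bullet> (LINT y|lebesgue. b y)"
proof -
  interpret L: pair_sigma_finite "lebesgue :: (real ^ 'n) measure" "lebesgue :: (real ^ 'n) measure"
    by (rule pair_sigma_finite_lebesgue)
  have am[measurable]: "a \<in> borel_measurable lebesgue" and bm[measurable]: "b \<in> borel_measurable lebesgue"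
    using a b by auto
  have m: "(\<lambda>z. a (fst z) \<bullet> b (snd z)) \<in> borel_measurable lebesgue2" by measurable
  show I: "integrable lebesgue2 (\<lambda>z. a (fst z) \<bullet> b (snd z))"
  proof (rule integrableI_bounded[OF m])
    have "(\<integral>\<^sup>+z. ennreal (norm (a (fst z) \<bullet> b (snd z))) \<partial>lebesgue2) \<le>
        (\<integral>\<^sup>+z. ennreal (norm (a (fst z))) * ennreal (norm (b (snd z))) \<partial>lebesgue2)"
      by (intro nn_integral_mono) (simp add: Cauchy_Schwarz_ineq2 flip: ennreal_mult)
    also have "\<dots> = (\<integral>\<^sup>+y. (\<integral>\<^sup>+w. ennreal (norm (a y)) * ennreal (norm (b w)) \<partial>lebesgue) \<partial>lebesgue)"
      using sigma_finite_measure.nn_integral_fst[OF sigma_finite_lebesgue, of "\<lambda>z. ennreal (norm (a (fst z))) * ennreal (norm (b (snd z)))" "lebesgue :: (real ^ 'n) measure"]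
      by simp
    also have "\<dots> = (\<integral>\<^sup>+y. ennreal (norm (a y)) \<partial>lebesgue) * (\<integral>\<^sup>+w. ennreal (norm (b w)) \<partial>lebesgue)"
      by (simp add: nn_integral_cmult nn_integral_multc)
    also have "\<dots> < \<infinity>" using a b by (simp add: integrable_iff_bounded ennreal_mult_less_top)
    finally show "(\<integral>\<^sup>+z. ennreal (norm (a (fst z) \<bullet> b (snd z))) \<partial>lebesgue2) < \<infinity>" .
  qed
  have "(LINT z|lebesgue2. a (fst z) \<bullet> b (snd z)) = (LINT y|lebesgue. (LINT w|lebesgue. a y \<bullet> b w))"
    using L.integral_fst'[OF I] by simp
  also have "\<dots> = (LINT y|lebesgue. a y) \<bullet> (LINT y|lebesgue. b y)"
    using a b by simp
  finally show "(LINT z|lebesgue2. a (fst z) \<bullet> b (snd z)) = (LINT y|lebesgue. a y) \<bullet> (LINT y|lebesgue. b y)" .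
qed

lemma integrable_M_Poisson:
  fixes g :: "real ^ 'n \<Rightarrow> complex"
  assumes g: "integrable lebesgue g"
  shows "g \<in> M_Poisson"
proof (rule M_PoissonI[where t=1 and x=0])
  let ?K = "poisson_const TYPE('n)"
  have K: "poisson_kernel 1 (z :: real ^ 'n) \<le> ?K" for z
    using poisson_kernel_le_decay[of 1 1 z] by simp
  have K0: "?K \<ge> 0" using poisson_const_pos[where 'n='n] by simp
  show "g \<in> borel_measurable lebesgue" using g by simp
  have "(\<integral>\<^sup>+y. ennreal (poisson_kernel 1 (0 - y) * norm (g y)) \<partial>lebesgue) \<le> (\<integral>\<^sup>+y. ennreal ?K * ennreal (norm (g y)) \<partial>lebesgue)"
    using K K0 by (intro nn_integral_mono) (simp add: mult_right_mono flip: ennreal_mult)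
  also have "\<dots> = ennreal ?K * (\<integral>\<^sup>+y. ennreal (norm (g y)) \<partial>lebesgue)"
    using g by (intro nn_integral_cmult) auto
  also have "\<dots> < \<infinity>" using g by (simp add: integrable_iff_bounded ennreal_mult_less_top)
  finally show "(\<integral>\<^sup>+y. ennreal (poisson_kernel 1 (0 - y) * norm (g y)) \<partial>lebesgue) < \<infinity>" .
qed simp

subsection \<open>The square function\<close>

abbreviation square_norm :: "('a::euclidean_space \<Rightarrow> complex) \<Rightarrow> ennreal" where
  "square_norm g \<equiv> (\<integral>\<^sup>+y. ennreal ((norm (g y))\<^sup>2) \<partial>lebesgue)"

text \<open>Schur test: 2 |g(y)| |g(w)| \<le> |g(y)|^2 + |g(w)|^2, and the kernel has mass 1 in each
  variable.\<close>

lemma poisson_kernel_Schur: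
  fixes g :: "real ^ 'n \<Rightarrow> complex"
  assumes g: "g \<in> borel_measurable lebesgue" and t: "t > 0"
  shows "(\<integral>\<^sup>+z. ennreal (poisson_kernel t (fst z - snd z) * (norm (g (fst z)) * norm (g (snd z)))) \<partial>lebesgue2) \<le>
    square_norm g"
proof -
  interpret L: pair_sigma_finite "lebesgue :: (real ^ 'n) measure" "lebesgue :: (real ^ 'n) measure"
    by (rule pair_sigma_finite_lebesgue)
  note [measurable] = g
  let ?A = "\<lambda>z. ennreal (1/2) * ennreal (poisson_kernel t (fst z - snd z) * (norm (g (fst z)))\<^sup>2)"
  let ?B = "\<lambda>z. ennreal (1/2) * ennreal (poisson_kernel t (fst z - snd z) * (norm (g (snd z)))\<^sup>2)"
  let ?I = "\<integral>\<^sup>+y. ennreal ((norm (g y))\<^sup>2) \<partial>lebesgue"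
  have h1: "ennreal (1/2) + ennreal (1/2) = 1" by (subst ennreal_plus[symmetric]) auto
  have half: "ennreal (1/2) * X + ennreal (1/2) * X = X" for X
    by (simp only: distrib_right[symmetric] h1 mult_1)
  have mA: "?A \<in> borel_measurable lebesgue2" and mB: "?B \<in> borel_measurable lebesgue2"
    by measurable
  have "(\<integral>\<^sup>+z. ennreal (poisson_kernel t (fst z - snd z) * (norm (g (fst z)) * norm (g (snd z)))) \<partial>lebesgue2) \<le>
    (\<integral>\<^sup>+z. ?A z + ?B z \<partial>lebesgue2)"
  proof (rule nn_integral_mono)
    fix z :: "(real ^ 'n) \<times> (real ^ 'n)"
    let ?p = "poisson_kernel t (fst z - snd z)"
    have "?p * (norm (g (fst z)) * norm (g (snd z))) \<le> ?p * (1/2 * ((norm (g (fst z)))\<^sup>2 + (norm (g (snd z)))\<^sup>2))"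
      using sum_squares_bound[of "norm (g (fst z))" "norm (g (snd z))"] t by (intro mult_left_mono) auto
    also have "\<dots> = 1/2 * (?p * (norm (g (fst z)))\<^sup>2) + 1/2 * (?p * (norm (g (snd z)))\<^sup>2)"
      by (simp add: algebra_simps)
    finally have "ennreal (?p * (norm (g (fst z)) * norm (g (snd z)))) \<le> ennreal (1/2 * (?p * (norm (g (fst z)))\<^sup>2) + 1/2 * (?p * (norm (g (snd z)))\<^sup>2))"
      by (rule ennreal_leI)
    also have "\<dots> = ?A z + ?B z"
    proof -
      have "ennreal (1/2 * X + 1/2 * Y) = ennreal (1/2) * ennreal X + ennreal (1/2) * ennreal Y" if "0 \<le> X" "0 \<le> Y" for X Y :: real
      proof -
        have "ennreal (1/2 * X + 1/2 * Y) = ennreal (1/2 * X) + ennreal (1/2 * Y)"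
          by (rule ennreal_plus) (use that in auto)
        also have "ennreal (1/2 * X) = ennreal (1/2) * ennreal X" by (rule ennreal_mult') simp
        also have "ennreal (1/2 * Y) = ennreal (1/2) * ennreal Y" by (rule ennreal_mult') simp
        finally show ?thesis .
      qed
      then show ?thesis using t by simp
    qed
    finally show "ennreal (?p * (norm (g (fst z)) * norm (g (snd z)))) \<le> ?A z + ?B z" .
  qed
  also have "\<dots> = (\<integral>\<^sup>+z. ?A z \<partial>lebesgue2) + (\<integral>\<^sup>+z. ?B z \<partial>lebesgue2)"
    by (rule nn_integral_add[OF mA mB])
  also have "(\<integral>\<^sup>+z. ?A z \<partial>lebesgue2) = (\<integral>\<^sup>+y. (\<integral>\<^sup>+w. ?A (y, w) \<partial>lebesgue) \<partial>lebesgue)"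
    by (rule sigma_finite_measure.nn_integral_fst[OF sigma_finite_lebesgue mA, symmetric])
  also have "\<dots> = (\<integral>\<^sup>+y. ennreal (1/2) * ennreal ((norm (g y))\<^sup>2) \<partial>lebesgue)"
  proof (rule nn_integral_cong)
    fix y
    have "(\<integral>\<^sup>+w. ?A (y, w) \<partial>lebesgue) = (\<integral>\<^sup>+w. ennreal (1/2) * ennreal ((norm (g y))\<^sup>2) * ennreal (poisson_kernel t (y - w)) \<partial>lebesgue)"
      using t by (intro nn_integral_cong) (simp add: ennreal_mult' mult_ac)
    also have "\<dots> = ennreal (1/2) * ennreal ((norm (g y))\<^sup>2)"
      by (subst nn_integral_cmult) (auto simp: nn_integral_poisson_kernel[OF t])
    finally show "(\<integral>\<^sup>+w. ?A (y, w) \<partial>lebesgue) = ennreal (1/2) * ennreal ((norm (g y))\<^sup>2)" .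
  qed
  also have "\<dots> = ennreal (1/2) * ?I" by (rule nn_integral_cmult) measurable
  also have "(\<integral>\<^sup>+z. ?B z \<partial>lebesgue2) = (\<integral>\<^sup>+w. (\<integral>\<^sup>+y. ?B (y, w) \<partial>lebesgue) \<partial>lebesgue)"
    by (rule L.nn_integral_snd[OF mB, symmetric])
  also have "\<dots> = (\<integral>\<^sup>+y. ennreal (1/2) * ennreal ((norm (g y))\<^sup>2) \<partial>lebesgue)"
  proof (rule nn_integral_cong)
    fix w
    have "(\<integral>\<^sup>+y. ?B (y, w) \<partial>lebesgue) = (\<integral>\<^sup>+y. ennreal (1/2) * ennreal ((norm (g w))\<^sup>2) * ennreal (poisson_kernel t (w - y)) \<partial>lebesgue)"
      using t by (intro nn_integral_cong) (simp add: ennreal_mult' mult_ac poisson_kernel_commute[of t w])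
    also have "\<dots> = ennreal (1/2) * ennreal ((norm (g w))\<^sup>2)"
      by (subst nn_integral_cmult) (auto simp: nn_integral_poisson_kernel[OF t])
    finally show "(\<integral>\<^sup>+y. ?B (y, w) \<partial>lebesgue) = ennreal (1/2) * ennreal ((norm (g w))\<^sup>2)" .
  qed
  also have "\<dots> = ennreal (1/2) * ?I" by (rule nn_integral_cmult) measurable
  finally show ?thesis by (simp only: half)
qed

lemma borel_measurable_poisson_deriv_pair:
  fixes g :: "real ^ 'n \<Rightarrow> complex"
  assumes g: "g \<in> borel_measurable lebesgue"
  shows "(\<lambda>z. poisson_deriv (fst z) g (snd z)) \<in> borel_measurable (borel \<Otimes>\<^sub>M borel)"
proof -
  interpret sigma_finite_measure "lebesgue :: (real ^ 'n) measure" by (rule sigma_finite_lebesgue)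
  let ?P = "(borel \<Otimes>\<^sub>M borel) \<Otimes>\<^sub>M lebesgue :: ((real \<times> (real ^ 'n)) \<times> (real ^ 'n)) measure"
  have 1: "(\<lambda>z. snd z) \<in> measurable ?P borel"
    by (rule measurable_compose[OF measurable_snd id_lebesgue_borel])
  have 2: "(\<lambda>z. (fst (fst z), snd (fst z) - snd z)) \<in> measurable ?P (borel \<Otimes>\<^sub>M borel)"
    using 1 by measurable
  have 3: "(\<lambda>z. poisson_dt (fst (fst z)) (snd (fst z) - snd z)) \<in> borel_measurable ?P"
    using measurable_compose[OF 2 borel_measurable_poisson_dt] by simp
  have 4: "(\<lambda>z. g (snd z)) \<in> borel_measurable ?P" using g by measurable
  have "(\<lambda>z. poisson_dt (fst (fst z)) (snd (fst z) - snd z) *\<^sub>R g (snd z)) \<in> borel_measurable ?P"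
    using 3 4 by (rule borel_measurable_scaleR)
  then have "(\<lambda>(x, y). poisson_dt (fst x) (snd x - y) *\<^sub>R g y) \<in> borel_measurable ?P"
    by (simp add: split_def)
  from borel_measurable_lebesgue_integral[OF this] show ?thesis
    unfolding poisson_deriv_def[abs_def] .
qed

text \<open>The squared L2 norm of the time derivative of P_t g as a quadratic form in g: two first
  derivatives at time t convolve to the second derivative at time 2 t.\<close>

definition energy_density :: "real \<Rightarrow> (real ^ 'n \<Rightarrow> complex) \<Rightarrow> real" where
  "energy_density t g = (LINT z|lebesgue2. poisson_dt2 (2 * t) (fst z - snd z) * (g (fst z) \<bullet> g (snd z)))"

text \<open>Squaring the derivative and integrating over x gives a triple integral whose
  x-integration is the convolution of two derivative kernels. Absolute convergence follows from the
  bound of the derivative by the kernel, the semigroup law and the Schur test.\<close>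

lemma nn_integral_poisson_deriv_square:
  fixes g :: "real ^ 'n \<Rightarrow> complex"
  assumes g: "integrable lebesgue g" and g2: "square_norm g < \<infinity>" and t: "t > 0"
  shows "square_norm (poisson_deriv t g) = ennreal (energy_density t g)"
    and "energy_density t g \<ge> 0"
proof -
  let ?L = "lebesgue :: (real ^ 'n) measure"
  let ?LL = "?L \<Otimes>\<^sub>M ?L"
  let ?M = "?L \<Otimes>\<^sub>M ?LL"
  interpret L: pair_sigma_finite ?L ?L by (rule pair_sigma_finite_lebesgue)
  interpret LL: pair_sigma_finite ?L "?L \<Otimes>\<^sub>M ?L"
    by (intro pair_sigma_finite.intro sigma_finite_lebesgue L.sigma_finite_measure_axioms)
  have gm[measurable]: "g \<in> borel_measurable lebesgue" using g by simp
  let ?c = "(real CARD('n) + 2) / t"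
  have c0: "?c \<ge> 0" using t by simp
  have gM: "g \<in> M_Poisson" by (rule integrable_M_Poisson[OF g])
  let ?T = "\<lambda>x z. (poisson_dt t (x - fst z) *\<^sub>R g (fst z)) \<bullet> (poisson_dt t (x - snd z) *\<^sub>R g (snd z))"
  have Ik: "integrable lebesgue (\<lambda>y. poisson_dt t (x - y) *\<^sub>R g y)" for x
    by (rule has_vector_derivative_poisson(2)[OF gM t])
  have sq: "(norm (poisson_deriv t g x))\<^sup>2 = (LINT z|?LL. ?T x z)" for x
    unfolding power2_norm_eq_inner poisson_deriv_def
    by (rule integral_pair_inner(2)[OF Ik Ik, symmetric])
  have d1: "(\<lambda>v. fst v - fst (snd v)) \<in> measurable ?M borel"
    and d2: "(\<lambda>v. fst v - snd (snd v)) \<in> measurable ?M borel"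
    by (intro borel_measurable_diff measurable_compose[OF _ id_lebesgue_borel] measurable_fst measurable_compose[OF measurable_snd measurable_fst] measurable_compose[OF measurable_snd measurable_snd])+
  have [measurable]: "(\<lambda>v. poisson_dt t (fst v - fst (snd v))) \<in> borel_measurable ?M"
    "(\<lambda>v. poisson_dt t (fst v - snd (snd v))) \<in> borel_measurable ?M"
    "(\<lambda>v. poisson_kernel t (fst v - fst (snd v))) \<in> borel_measurable ?M"
    "(\<lambda>v. poisson_kernel t (fst v - snd (snd v))) \<in> borel_measurable ?M"
    by (rule measurable_compose[OF d1 borel_measurable_poisson_kernel_unary(2)]
        measurable_compose[OF d2 borel_measurable_poisson_kernel_unary(2)]
        measurable_compose[OF d1 borel_measurable_poisson_kernel_unary(1)]
        measurable_compose[OF d2 borel_measurable_poisson_kernel_unary(1)])+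
  have [measurable]: "(\<lambda>v. g (fst (snd v))) \<in> borel_measurable ?M"
    "(\<lambda>v. g (snd (snd v))) \<in> borel_measurable ?M"
    by (intro measurable_compose[OF _ gm] measurable_compose[OF measurable_snd measurable_fst] measurable_compose[OF measurable_snd measurable_snd])+
  have mT: "(\<lambda>v. ?T (fst v) (snd v)) \<in> borel_measurable ?M"
    by measurable
  have IT: "integrable ?M (\<lambda>v. ?T (fst v) (snd v))"
  proof (rule integrableI_bounded[OF mT])
    let ?N = "\<lambda>v. ennreal (?c * ?c) * ennreal (poisson_kernel t (fst v - fst (snd v)) * poisson_kernel t (fst v - snd (snd v)) * (norm (g (fst (snd v))) * norm (g (snd (snd v)))))"
    have "(\<integral>\<^sup>+v. ennreal (norm (?T (fst v) (snd v))) \<partial>?M) \<le> (\<integral>\<^sup>+v. ?N v \<partial>?M)"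
    proof (rule nn_integral_mono)
      fix v :: "(real ^ 'n) \<times> ((real ^ 'n) \<times> (real ^ 'n))"
      let ?y = "fst (snd v)" and ?w = "snd (snd v)" and ?x = "fst v"
      have "norm (?T ?x (snd v)) \<le> norm (poisson_dt t (?x - ?y) *\<^sub>R g ?y) * norm (poisson_dt t (?x - ?w) *\<^sub>R g ?w)"
        unfolding real_norm_def by (rule Cauchy_Schwarz_ineq2)
      also have "\<dots> \<le> (?c * poisson_kernel t (?x - ?y) * norm (g ?y)) * (?c * poisson_kernel t (?x - ?w) * norm (g ?w))"
        unfolding norm_scaleR
        by (intro mult_mono abs_poisson_dt_le t order_refl mult_nonneg_nonneg c0 norm_ge_zero poisson_kernel_nonneg abs_ge_zero)
      also have "\<dots> = (?c * ?c) * (poisson_kernel t (?x - ?y) * poisson_kernel t (?x - ?w) * (norm (g ?y) * norm (g ?w)))"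
        by (simp only: mult_ac)
      finally have "ennreal (norm (?T ?x (snd v))) \<le> ennreal \<dots>" by (rule ennreal_leI)
      also have "\<dots> = ?N v" by (rule ennreal_mult') (use c0 in simp)
      finally show "ennreal (norm (?T ?x (snd v))) \<le> ?N v" .
    qed
    also have "\<dots> = (\<integral>\<^sup>+z. (\<integral>\<^sup>+x. ?N (x, z) \<partial>?L) \<partial>?LL)"
      by (rule LL.nn_integral_snd[symmetric]) measurable
    also have "\<dots> = (\<integral>\<^sup>+z. ennreal (?c * ?c) * ennreal (poisson_kernel (t + t) (fst z - snd z) * (norm (g (fst z)) * norm (g (snd z)))) \<partial>?LL)"
    proof (rule nn_integral_cong)
      fix z :: "(real ^ 'n) \<times> (real ^ 'n)"
      let ?k = "norm (g (fst z)) * norm (g (snd z))"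
      have "(\<integral>\<^sup>+x. ?N (x, z) \<partial>?L) = (\<integral>\<^sup>+x. ennreal (?c * ?c) * ennreal ?k * ennreal (poisson_kernel t (fst z - x) * poisson_kernel t (x - snd z)) \<partial>?L)"
        using c0 t by (intro nn_integral_cong) (simp add: mult_ac poisson_kernel_commute[of t "fst z"] flip: ennreal_mult)
      also have "\<dots> = ennreal (?c * ?c) * ennreal ?k * ennreal (poisson_kernel (t + t) (fst z - snd z))"
        unfolding nn_integral_poisson_kernel_convolution[OF t t, symmetric]
        by (rule nn_integral_cmult) (subst (2) poisson_kernel_commute, measurable)
      also have "\<dots> = ennreal (?c * ?c) * ennreal (poisson_kernel (t + t) (fst z - snd z) * ?k)"
        using t by (simp add: ennreal_mult' ennreal_mult'' mult_ac)
      finally show "(\<integral>\<^sup>+x. ?N (x, z) \<partial>?L) = ennreal (?c * ?c) * ennreal (poisson_kernel (t + t) (fst z - snd z) * ?k)" .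
    qed
    also have "\<dots> = ennreal (?c * ?c) * (\<integral>\<^sup>+z. ennreal (poisson_kernel (t + t) (fst z - snd z) * (norm (g (fst z)) * norm (g (snd z)))) \<partial>?LL)"
      by (rule nn_integral_cmult) measurable
    also have "\<dots> \<le> ennreal (?c * ?c) * square_norm g"
      using poisson_kernel_Schur[OF gm, of "t + t"] t by (intro mult_left_mono) auto
    also have "\<dots> < \<infinity>" using g2 by (simp add: ennreal_mult_less_top)
    finally show "(\<integral>\<^sup>+v. ennreal (norm (?T (fst v) (snd v))) \<partial>?M) < \<infinity>" .
  qed
  then have IT': "integrable ?M (\<lambda>(x, z). ?T x z)" by (simp add: split_def)
  have "(LINT x|lebesgue. (norm (poisson_deriv t g x))\<^sup>2) = (LINT z|?LL. (LINT x|?L. ?T x z))"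
    unfolding sq by (rule LL.Fubini_integral[OF IT', symmetric])
  also have "\<dots> = energy_density t g"
    unfolding energy_density_def
  proof (rule Bochner_Integration.integral_cong[OF refl])
    fix z :: "(real ^ 'n) \<times> (real ^ 'n)"
    have "(LINT x|?L. ?T x z) = (LINT x|?L. (poisson_dt t (fst z - x) * poisson_dt t (x - snd z)) * (g (fst z) \<bullet> g (snd z)))"
      by (intro Bochner_Integration.integral_cong refl) (simp add: poisson_dt_commute[of t "fst z"])
    also have "\<dots> = poisson_dt2 (2 * t) (fst z - snd z) * (g (fst z) \<bullet> g (snd z))"
    proof -
      have "(LINT x|?L. poisson_dt t (fst z - x) * poisson_dt t (x - snd z)) = poisson_dt2 (2 * t) (fst z - snd z)"
        unfolding mult_2 by (rule poisson_dt_convolution[OF t t])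
      then show ?thesis by simp
    qed
    finally show "(LINT x|?L. ?T x z) = poisson_dt2 (2 * t) (fst z - snd z) * (g (fst z) \<bullet> g (snd z))" .
  qed
  finally have I: "(LINT x|lebesgue. (norm (poisson_deriv t g x))\<^sup>2) = energy_density t g" .
  have int: "integrable ?L (\<lambda>x. (norm (poisson_deriv t g x))\<^sup>2)"
    unfolding sq using LL.integrable_fst'[OF IT] by simp
  show "square_norm (poisson_deriv t g) = ennreal (energy_density t g)"
    unfolding I[symmetric] by (rule nn_integral_eq_integral[OF int]) simp
  show "energy_density t g \<ge> 0"
    unfolding I[symmetric] by (rule Bochner_Integration.integral_nonneg) simp
qed

text \<open>A primitive of t times \<open>energy_density\<close>: if p' and p'' denote time
  derivatives of the kernel, then t p'(2 t) / 2 - p(2 t) / 4 has the derivative t p''(2 t) in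
  t.\<close>

definition energy :: "real \<Rightarrow> (real ^ 'n \<Rightarrow> complex) \<Rightarrow> real" where
  "energy t g = (LINT z|lebesgue2.
     (t / 2 * poisson_dt (2 * t) (fst z - snd z) - poisson_kernel (2 * t) (fst z - snd z) / 4) *\<^sub>R (g (fst z) \<bullet> g (snd z)))"

lemma energy_kernel_bound:
  fixes z :: "real ^ 'n"
  assumes t: "t > 0"
  shows "\<bar>t / 2 * poisson_dt (2 * t) z - poisson_kernel (2 * t) z / 4\<bar> \<le> (real CARD('n) + 3) / 4 * poisson_kernel (2 * t) z"
proof -
  let ?p = "poisson_kernel (2 * t) z"
  have p: "?p \<ge> 0" using t by simp
  have "\<bar>poisson_dt (2 * t) z\<bar> \<le> (real CARD('n) + 2) / (2 * t) * ?p"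
    using abs_poisson_dt_le[of "2 * t" z] t by simp
  then have "t / 2 * \<bar>poisson_dt (2 * t) z\<bar> \<le> t / 2 * ((real CARD('n) + 2) / (2 * t) * ?p)"
    using t by (intro mult_left_mono) auto
  also have "\<dots> = (real CARD('n) + 2) / 4 * ?p" using t by simp
  finally have 1: "\<bar>t / 2 * poisson_dt (2 * t) z\<bar> \<le> (real CARD('n) + 2) / 4 * ?p"
    using t by (simp add: abs_mult)
  have "\<bar>t / 2 * poisson_dt (2 * t) z - ?p / 4\<bar> \<le> \<bar>t / 2 * poisson_dt (2 * t) z\<bar> + \<bar>?p / 4\<bar>"
    by (rule abs_triangle_ineq4)
  also have "\<dots> \<le> (real CARD('n) + 2) / 4 * ?p + ?p / 4"
    using 1 p by simp
  also have "\<dots> = (real CARD('n) + 3) / 4 * ?p" by (simp add: field_simps)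
  finally show ?thesis .
qed

lemma measurable_pair_kernels:
  "(\<lambda>z. poisson_kernel t (fst z - snd z :: real ^ 'n) / 4) \<in> borel_measurable lebesgue2"
  by (rule borel_measurable_divide[OF borel_measurable_poisson_kernel_pair(1) borel_measurable_const])

lemma energy_bound:
  fixes g :: "real ^ 'n \<Rightarrow> complex"
  assumes g: "integrable lebesgue g" and t: "t > 0"
  shows "ennreal \<bar>energy t g\<bar> \<le> ennreal ((real CARD('n) + 3) / 4) * square_norm g"
    and "integrable lebesgue2 (\<lambda>z. (t / 2 * poisson_dt (2 * t) (fst z - snd z) - poisson_kernel (2 * t) (fst z - snd z) / 4) *\<^sub>R (g (fst z) \<bullet> g (snd z)))"
proof -
  let ?C = "(real CARD('n) + 3) / 4"
  let ?e = "\<lambda>z :: (real ^ 'n) \<times> (real ^ 'n). t / 2 * poisson_dt (2 * t) (fst z - snd z) - poisson_kernel (2 * t) (fst z - snd z) / 4"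
  let ?LL = "lebesgue \<Otimes>\<^sub>M lebesgue :: ((real ^ 'n) \<times> (real ^ 'n)) measure"
  have t2: "2 * t > 0" using t by simp
  have gm[measurable]: "g \<in> borel_measurable lebesgue" using g by simp
  have em[measurable]: "?e \<in> borel_measurable ?LL"
    by (intro borel_measurable_diff borel_measurable_times borel_measurable_const measurable_pair_kernels borel_measurable_poisson_kernel_pair)
  have h: "integrable ?LL (\<lambda>z. g (fst z) \<bullet> g (snd z))" by (rule integral_pair_inner(1)[OF g g])
  show I: "integrable ?LL (\<lambda>z. ?e z *\<^sub>R (g (fst z) \<bullet> g (snd z)))"
  proof (rule integrable_scaleR_bound[where k="\<lambda>_. 1" and C="?C * (poisson_const TYPE('n) * (2 * t) / (2 * t) ^ (CARD('n) + 1))"])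
    show "integrable ?LL (\<lambda>z. 1 *\<^sub>R (g (fst z) \<bullet> g (snd z)))" using h by simp
    fix z :: "(real ^ 'n) \<times> (real ^ 'n)"
    have "\<bar>?e z\<bar> \<le> ?C * poisson_kernel (2 * t) (fst z - snd z)" by (rule energy_kernel_bound[OF t])
    also have "\<dots> \<le> ?C * (poisson_const TYPE('n) * (2 * t) / (2 * t) ^ (CARD('n) + 1))"
      by (intro mult_left_mono poisson_kernel_le_decay[OF t2 t2]) auto
    finally show "\<bar>?e z\<bar> \<le> ?C * (poisson_const TYPE('n) * (2 * t) / (2 * t) ^ (CARD('n) + 1)) * 1" by simp
  qed (use h in \<open>auto intro: em\<close>)
  have "ennreal \<bar>energy t g\<bar> \<le> (\<integral>\<^sup>+z. ennreal (norm (?e z *\<^sub>R (g (fst z) \<bullet> g (snd z)))) \<partial>?LL)"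
    using integral_norm_bound_ennreal[OF I] by (simp add: energy_def)
  also have "\<dots> \<le> (\<integral>\<^sup>+z. ennreal ?C * ennreal (poisson_kernel (2 * t) (fst z - snd z) * (norm (g (fst z)) * norm (g (snd z)))) \<partial>?LL)"
  proof (rule nn_integral_mono)
    fix z :: "(real ^ 'n) \<times> (real ^ 'n)"
    have "norm (?e z *\<^sub>R (g (fst z) \<bullet> g (snd z))) \<le> (?C * poisson_kernel (2 * t) (fst z - snd z)) * (norm (g (fst z)) * norm (g (snd z)))"
      unfolding norm_scaleR using energy_kernel_bound[OF t] Cauchy_Schwarz_ineq2 t
      by (intro mult_mono) auto
    then show "ennreal (norm (?e z *\<^sub>R (g (fst z) \<bullet> g (snd z)))) \<le> ennreal ?C * ennreal (poisson_kernel (2 * t) (fst z - snd z) * (norm (g (fst z)) * norm (g (snd z))))"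
      by (subst ennreal_mult'[symmetric]) (auto simp: mult.assoc intro!: ennreal_leI)
  qed
  also have "\<dots> = ennreal ?C * (\<integral>\<^sup>+z. ennreal (poisson_kernel (2 * t) (fst z - snd z) * (norm (g (fst z)) * norm (g (snd z)))) \<partial>?LL)"
    by (rule nn_integral_cmult) measurable
  also have "\<dots> \<le> ennreal ?C * square_norm g"
    by (intro mult_left_mono poisson_kernel_Schur[OF gm t2]) auto
  finally show "ennreal \<bar>energy t g\<bar> \<le> ennreal ?C * square_norm g" .
qed

text \<open>Near t the differentiated kernel is bounded uniformly in space, and this constant is an
  admissible majorant because g(y) \<bullet> g(w) is integrable on the product.\<close>

lemma has_real_derivative_energy:
  fixes g :: "real ^ 'n \<Rightarrow> complex"
  assumes g: "integrable lebesgue g" and t: "t > 0"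
  shows "((\<lambda>s. energy s g) has_real_derivative t * energy_density t g) (at t)"
proof -
  let ?LL = "lebesgue \<Otimes>\<^sub>M lebesgue :: ((real ^ 'n) \<times> (real ^ 'n)) measure"
  let ?h = "\<lambda>z. g (fst z) \<bullet> g (snd z)"
  let ?k = "\<lambda>s (z :: (real ^ 'n) \<times> (real ^ 'n)). s / 2 * poisson_dt (2 * s) (fst z - snd z) - poisson_kernel (2 * s) (fst z - snd z) / 4"
  let ?k' = "\<lambda>s (z :: (real ^ 'n) \<times> (real ^ 'n)). s * poisson_dt2 (2 * s) (fst z - snd z)"
  let ?C = "(real CARD('n) + 2)\<^sup>2 + 3 * (real CARD('n) + 2)"
  let ?B = "(2 * t) * (?C / t\<^sup>2 * (poisson_const TYPE('n) * (3 * t) / t ^ (CARD('n) + 1)))"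
  have h: "integrable ?LL ?h" by (rule integral_pair_inner(1)[OF g g])
  then have hm: "?h \<in> borel_measurable ?LL" by simp
  have s: "s > 0" "t < 2 * s" "s < 2 * t" "2 * s < 3 * t" if "\<bar>s - t\<bar> < t / 2" for s
  proof -
    have "s - t < t / 2" "t - s < t / 2" using that by linarith+
    then show "s > 0" "t < 2 * s" "s < 2 * t" "2 * s < 3 * t" using t by linarith+
  qed
  have D: "((\<lambda>s. ?k s z) has_real_derivative ?k' s z) (at s)" if "\<bar>s - t\<bar> < t / 2" for s z
  proof -
    let ?x = "fst z - snd z"
    have 1: "((\<lambda>s. poisson_dt (2 * s) ?x) has_real_derivative poisson_dt2 (2 * s) ?x * 2) (at s)"
      using s(1)[OF that] by (intro DERIV_chain2[OF has_real_derivative_poisson_dt] DERIV_cmult_Id) auto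
    have 2: "((\<lambda>s. poisson_kernel (2 * s) ?x) has_real_derivative poisson_dt (2 * s) ?x * 2) (at s)"
      using s(1)[OF that] by (intro DERIV_chain2[OF has_real_derivative_poisson_kernel] DERIV_cmult_Id) auto
    show ?thesis
      by (rule DERIV_cong) (rule derivative_eq_intros 1 2 refl | simp)+
  qed
  have B: "\<bar>?k' s z\<bar> \<le> ?B" if "\<bar>s - t\<bar> < t / 2" for s z
  proof -
    let ?x = "fst z - snd z"
    note s = s[OF that]
    have s2: "2 * s > 0" using s by simp
    have "t\<^sup>2 \<le> (2 * s)\<^sup>2 + (norm ?x)\<^sup>2"
    proof -
      have "t\<^sup>2 \<le> (2 * s)\<^sup>2" using s t by (intro power_mono) auto
      then show ?thesis using zero_le_power2[of "norm ?x"] by linarith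
    qed
    from poisson_kernel_le_decay[OF s2 t this]
    have "poisson_kernel (2 * s) ?x \<le> poisson_const TYPE('n) * (2 * s) / t ^ (CARD('n) + 1)" .
    also have "\<dots> \<le> poisson_const TYPE('n) * (3 * t) / t ^ (CARD('n) + 1)"
      using s t poisson_const_pos[where 'n='n] by (intro divide_right_mono mult_left_mono) auto
    finally have p: "poisson_kernel (2 * s) ?x \<le> poisson_const TYPE('n) * (3 * t) / t ^ (CARD('n) + 1)" .
    have "?C / (2 * s)\<^sup>2 \<le> ?C / t\<^sup>2"
      using s t by (intro divide_left_mono power_mono mult_pos_pos) auto
    then have "?C / (2 * s)\<^sup>2 * poisson_kernel (2 * s) ?x \<le> ?C / t\<^sup>2 * (poisson_const TYPE('n) * (3 * t) / t ^ (CARD('n) + 1))"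
      using p s2 by (intro mult_mono) (auto simp: less_imp_le)
    then have "\<bar>poisson_dt2 (2 * s) ?x\<bar> \<le> ?C / t\<^sup>2 * (poisson_const TYPE('n) * (3 * t) / t ^ (CARD('n) + 1))"
      using abs_poisson_dt2_le[OF s2, of ?x] by linarith
    then have "s * \<bar>poisson_dt2 (2 * s) ?x\<bar> \<le> ?B"
      using s t by (intro mult_mono) auto
    then show ?thesis using s by (simp add: abs_mult)
  qed
  have "((\<lambda>s. LINT z|?LL. ?k s z *\<^sub>R ?h z) has_vector_derivative (LINT z|?LL. ?k' t z *\<^sub>R ?h z)) (at t)"
  proof (rule has_vector_derivative_integral_parameter(1)[where \<delta>="t / 2" and k="?k" and k'="?k'" and h="?h" and M="?LL" and t=t and m="\<lambda>_. ?B"])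
    show "t / 2 > 0" using t by simp
    show "integrable ?LL (\<lambda>y. ?B * norm (?h y))" using h by (intro integrable_mult_right integrable_norm)
    show "integrable ?LL (\<lambda>y. ?k t y *\<^sub>R ?h y)" by (rule energy_bound(2)[OF g t])
    show "(\<lambda>y. ?k s y *\<^sub>R ?h y) \<in> borel_measurable ?LL" for s
      by (intro borel_measurable_scaleR hm borel_measurable_diff borel_measurable_times borel_measurable_const measurable_pair_kernels borel_measurable_poisson_kernel_pair)
    show "(\<lambda>y. ?k' t y *\<^sub>R ?h y) \<in> borel_measurable ?LL"
      by (intro borel_measurable_scaleR hm borel_measurable_times borel_measurable_const borel_measurable_poisson_kernel_pair)
  qed (use D B in auto)
  moreover have "(LINT z|?LL. ?k' t z *\<^sub>R ?h z) = t * energy_density t g"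
    unfolding energy_density_def by (simp add: mult.assoc)
  ultimately show ?thesis
    unfolding energy_def has_real_derivative_iff_has_vector_derivative by simp
qed

text \<open>By the fundamental theorem of calculus the integral over a compact time interval is a
  difference of two energies, each bounded by (n + 3) / 4 times the squared norm of g, uniformly in
  time. Monotone convergence then exhausts all positive times.\<close>

theorem square_function_L2:
  fixes g :: "real ^ 'n \<Rightarrow> complex"
  assumes g: "integrable lebesgue g" and g2: "square_norm g < \<infinity>"
  shows "(\<integral>\<^sup>+t\<in>{0<..}. (\<integral>\<^sup>+x. ennreal (t * (norm (poisson_deriv t g x))\<^sup>2) \<partial>lebesgue) \<partial>lborel) \<le>
    ennreal ((real CARD('n) + 3) / 2) * square_norm g"
proof -
  interpret sigma_finite_measure "lebesgue :: (real ^ 'n) measure" by (rule sigma_finite_lebesgue)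
  have gm: "g \<in> borel_measurable lebesgue" using g by simp
  obtain I where I: "square_norm g = ennreal I" "I \<ge> 0"
    using g2 by (metis less_top_ennreal infinity_ennreal_def)
  let ?C = "(real CARD('n) + 3) / 4"
  define \<Psi> where "\<Psi> t = square_norm (poisson_deriv t g)" for t
  have \<Psi>: "\<Psi> t = ennreal (energy_density t g)" and e0: "energy_density t g \<ge> 0" if "t > 0" for t
    unfolding \<Psi>_def using nn_integral_poisson_deriv_square[OF g g2 that] by auto
  have \<Psi>m: "\<Psi> \<in> borel_measurable borel"
  proof -
    have id2: "(\<lambda>z. (fst z, snd z)) \<in> measurable (borel \<Otimes>\<^sub>M lebesgue) (borel \<Otimes>\<^sub>M borel :: (real \<times> (real ^ 'n)) measure)"
      by (intro measurable_Pair measurable_fst measurable_compose[OF measurable_snd id_lebesgue_borel])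
    have "(\<lambda>z. poisson_deriv (fst z) g (snd z)) \<in> borel_measurable (borel \<Otimes>\<^sub>M lebesgue)"
      using measurable_compose[OF id2 borel_measurable_poisson_deriv_pair[OF gm]] by simp
    then have "(\<lambda>(t, x). ennreal ((norm (poisson_deriv t g x))\<^sup>2)) \<in> borel_measurable (borel \<Otimes>\<^sub>M lebesgue)"
      unfolding split_def by measurable
    from borel_measurable_nn_integral[OF this] show ?thesis unfolding \<Psi>_def[abs_def] .
  qed
  \<comment> \<open>\<open>energy_density\<close> is entered through \<open>\<Psi>\<close>, whose
    measurability in t is known from Tonelli.\<close>
  define f where "f t = (if t > 0 then t * enn2real (\<Psi> t) else 0)" for t :: real
  have fm: "f \<in> borel_measurable borel" unfolding f_def[abs_def] using \<Psi>m by measurable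
  have f: "f t = t * energy_density t g" if "t > 0" for t
    using that \<Psi>[OF that] e0[OF that] by (simp add: f_def)
  have f0: "f t \<ge> 0" for t by (simp add: f_def)
  have inner: "(\<integral>\<^sup>+x. ennreal (t * (norm (poisson_deriv t g x))\<^sup>2) \<partial>lebesgue) = ennreal (f t)" if t: "t > 0" for t
  proof -
    have m: "(\<lambda>x. ennreal ((norm (poisson_deriv t g x))\<^sup>2)) \<in> borel_measurable lebesgue"
    proof -
      have "(\<lambda>x. (t, x)) \<in> measurable lebesgue (borel \<Otimes>\<^sub>M borel :: (real \<times> (real ^ 'n)) measure)"
        by (intro measurable_Pair measurable_const id_lebesgue_borel) simp
      from measurable_compose[OF this borel_measurable_poisson_deriv_pair[OF gm]] show ?thesis by simp
    qed
    have "(\<integral>\<^sup>+x. ennreal (t * (norm (poisson_deriv t g x))\<^sup>2) \<partial>lebesgue) = (\<integral>\<^sup>+x. ennreal t * ennreal ((norm (poisson_deriv t g x))\<^sup>2) \<partial>lebesgue)"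
      using t by (intro nn_integral_cong) (simp add: ennreal_mult')
    also have "\<dots> = ennreal t * \<Psi> t" unfolding \<Psi>_def by (rule nn_integral_cmult[OF m])
    finally show ?thesis using \<Psi>[OF t] e0[OF t] t by (simp add: f ennreal_mult')
  qed
  have fin: "(\<integral>\<^sup>+t. ennreal (f t) * indicator {\<epsilon>..R} t \<partial>lborel) \<le> ennreal (2 * ?C * I)" if \<epsilon>: "0 < \<epsilon>" and R: "\<epsilon> \<le> R" for \<epsilon> R
  proof -
    have "(\<integral>\<^sup>+t. ennreal (f t) * indicator {\<epsilon>..R} t \<partial>lborel) = ennreal (energy R g - energy \<epsilon> g)"
    proof (rule nn_integral_FTC_Icc[OF fm _ _ R])
      fix t assume "t \<in> {\<epsilon>..R}"
      then have "t > 0" using \<epsilon> by auto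
      then show "((\<lambda>t. energy t g) has_real_derivative f t) (at t)"
        using has_real_derivative_energy[OF g] f by simp
    qed (use f0 in auto)
    also have "\<dots> \<le> ennreal (2 * ?C * I)"
    proof (rule ennreal_leI)
      have *: "\<bar>energy t g\<bar> \<le> ?C * I" if "t > 0" for t
      proof -
        have "ennreal \<bar>energy t g\<bar> \<le> ennreal (?C * I)"
          using energy_bound(1)[OF g that] unfolding I(1) by (subst ennreal_mult') auto
        then show ?thesis using I(2) by (subst (asm) ennreal_le_iff) auto
      qed
      have "R > 0" using \<epsilon> R by simp
      have "energy R g - energy \<epsilon> g \<le> \<bar>energy R g\<bar> + \<bar>energy \<epsilon> g\<bar>" by linarith
      also have "\<dots> \<le> ?C * I + ?C * I" by (intro add_mono * \<epsilon> \<open>R > 0\<close>)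
      finally show "energy R g - energy \<epsilon> g \<le> 2 * ?C * I" by (simp only: mult_2 distrib_right)
    qed
    finally show ?thesis .
  qed
  let ?F = "\<lambda>k t. ennreal (f t) * indicator {1 / (real k + 1)..real k + 1} t"
  have inc: "incseq ?F"
  proof (rule incseq_SucI, rule le_funI)
    fix k and t :: real
    have "1 / (real (Suc k) + 1) \<le> 1 / (real k + 1)" by (simp add: field_simps)
    then have "{1 / (real k + 1)..real k + 1} \<subseteq> {1 / (real (Suc k) + 1)..real (Suc k) + 1}" by auto
    then show "?F k t \<le> ?F (Suc k) t" by (intro mult_left_mono) (auto simp: indicator_def)
  qed
  have "(\<integral>\<^sup>+t\<in>{0<..}. (\<integral>\<^sup>+x. ennreal (t * (norm (poisson_deriv t g x))\<^sup>2) \<partial>lebesgue) \<partial>lborel) \<le> (\<integral>\<^sup>+t. (SUP k. ?F k t) \<partial>lborel)"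
  proof (rule nn_integral_mono)
    fix t :: real
    show "(\<integral>\<^sup>+x. ennreal (t * (norm (poisson_deriv t g x))\<^sup>2) \<partial>lebesgue) * indicator {0<..} t \<le> (SUP k. ?F k t)"
    proof (cases "t > 0")
      case True
      obtain k where k: "max t (1 / t) \<le> real k" using real_arch_simple by blast
      have "1 / (real k + 1) \<le> t"
      proof -
        have "1 \<le> t * real k" using k True by (simp add: divide_le_eq mult.commute)
        also have "\<dots> \<le> t * (real k + 1)" using True by simp
        finally show ?thesis by (simp add: divide_le_eq)
      qed
      then have "?F k t = ennreal (f t)" using k by simp
      moreover have "?F k t \<le> (SUP k. ?F k t)" by (rule SUP_upper) simp
      ultimately have "ennreal (f t) \<le> (SUP k. ?F k t)" by (simp only:)
      then show ?thesis using True inner[OF True] by simp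
    qed simp
  qed
  also have "\<dots> = (SUP k. \<integral>\<^sup>+t. ?F k t \<partial>lborel)"
    by (rule nn_integral_monotone_convergence_SUP[OF inc]) (use fm in measurable)
  also have "\<dots> \<le> ennreal (2 * ?C * I)"
  proof (rule SUP_least)
    fix k
    have "1 / (real k + 1) \<le> 1" "1 \<le> real k + 1" by auto
    then have "1 / (real k + 1) \<le> real k + 1" by (rule order_trans)
    then show "(\<integral>\<^sup>+t. ?F k t \<partial>lborel) \<le> ennreal (2 * ?C * I)" by (intro fin) auto
  qed
  also have "2 * ?C * I = (real CARD('n) + 3) / 2 * I" by simp
  also have "ennreal \<dots> = ennreal ((real CARD('n) + 3) / 2) * ennreal I"
    by (rule ennreal_mult') simp
  finally show ?thesis unfolding I(1) .
qed

subsection \<open>Mean oscillation and Poisson oscillation\<close>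

abbreviation ball_vol :: "'n::finite itself \<Rightarrow> real" where
  "ball_vol _ \<equiv> unit_ball_vol (real CARD('n))"

lemma ball_vol_pos: "ball_vol TYPE('n::finite) > 0"
  by simp

lemma ball_lebesgue[measurable]: "ball x r \<in> sets (lebesgue :: 'a::euclidean_space measure)"
  by simp

lemma emeasure_lebesgue_ball:
  "r > 0 \<Longrightarrow> emeasure lebesgue (ball (x :: real ^ 'n) r) = ennreal (ball_vol TYPE('n) * r ^ CARD('n))"
  using emeasure_ball[of r x] by simp

lemma measure_lebesgue_ball:
  "r > 0 \<Longrightarrow> measure lebesgue (ball (x :: real ^ 'n) r) = ball_vol TYPE('n) * r ^ CARD('n)"
  by (simp add: measure_def emeasure_ball)

lemma locally_integrable_ball:
  assumes "locally_integrable f"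
  shows "set_integrable lebesgue (ball x r) f"
  using assms compact_cball[of x r] unfolding locally_integrable_def
  by (auto intro: set_integrable_subset[of lebesgue "cball x r"])

lemma locally_integrable_measurable:
  fixes f :: "real ^ 'n \<Rightarrow> complex"
  assumes f: "locally_integrable f"
  shows "f \<in> borel_measurable lebesgue"
proof (rule borel_measurable_LIMSEQ_metric)
  show "(\<lambda>x. indicator (ball 0 (real k)) x *\<^sub>R f x) \<in> borel_measurable lebesgue" for k
    using locally_integrable_ball[OF f, of 0 "real k"] unfolding set_integrable_def by auto
  fix x :: "real ^ 'n"
  obtain K where K: "norm x < real K" using reals_Archimedean2 by blast
  have "eventually (\<lambda>k. indicator (ball 0 (real k)) x *\<^sub>R f x = f x) sequentially"
    unfolding eventually_sequentially using K by (intro exI[of _ K]) auto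
  then show "(\<lambda>k. indicator (ball 0 (real k)) x *\<^sub>R f x) \<longlonglongrightarrow> f x"
    by (rule tendsto_eventually)
qed

lemma nn_set_integral_triangle:
  fixes f g h :: "real ^ 'n \<Rightarrow> complex"
  assumes f: "f \<in> borel_measurable lebesgue" "g \<in> borel_measurable lebesgue" and B: "B \<in> sets lebesgue"
    and t: "t \<ge> 0" "\<And>y. y \<in> B \<Longrightarrow> norm (g y - h y) \<le> t"
  shows "(\<integral>\<^sup>+y\<in>B. ennreal (norm (f y - h y)) \<partial>lebesgue) \<le>
    (\<integral>\<^sup>+y\<in>B. ennreal (norm (f y - g y)) \<partial>lebesgue) + ennreal t * emeasure lebesgue B"
proof -
  have "(\<integral>\<^sup>+y\<in>B. ennreal (norm (f y - h y)) \<partial>lebesgue) \<le>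
      (\<integral>\<^sup>+y. ennreal (norm (f y - g y)) * indicator B y + ennreal t * indicator B y \<partial>lebesgue)"
  proof (rule nn_integral_mono)
    fix y
    have "norm (f y - h y) \<le> norm (f y - g y) + t" if "y \<in> B"
      using norm_triangle_ineq[of "f y - g y" "g y - h y"] t(2)[OF that] by simp
    then show "ennreal (norm (f y - h y)) * indicator B y \<le> ennreal (norm (f y - g y)) * indicator B y + ennreal t * indicator B y"
      using t(1) by (auto simp: indicator_def simp flip: ennreal_plus intro: ennreal_leI)
  qed
  also have "\<dots> = (\<integral>\<^sup>+y\<in>B. ennreal (norm (f y - g y)) \<partial>lebesgue) + ennreal t * emeasure lebesgue B"
    using f B by (subst nn_integral_add) (auto simp: nn_integral_cmult_indicator)
  finally show ?thesis .
qed

lemma nn_ball_integral_triangle: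
  fixes f g h :: "real ^ 'n \<Rightarrow> complex"
  assumes f: "f \<in> borel_measurable lebesgue" "g \<in> borel_measurable lebesgue" and r: "r > 0" and a: "a \<ge> 0"
    and fg: "(\<integral>\<^sup>+y\<in>ball x r. ennreal (norm (f y - g y)) \<partial>lebesgue) \<le> ennreal a"
    and t: "t \<ge> 0" "\<And>y. y \<in> ball x r \<Longrightarrow> norm (g y - h y) \<le> t"
  shows "(\<integral>\<^sup>+y\<in>ball x r. ennreal (norm (f y - h y)) \<partial>lebesgue) \<le> ennreal (a + t * (ball_vol TYPE('n) * r ^ CARD('n)))"
proof -
  have "(\<integral>\<^sup>+y\<in>ball x r. ennreal (norm (f y - h y)) \<partial>lebesgue) \<le>
      (\<integral>\<^sup>+y\<in>ball x r. ennreal (norm (f y - g y)) \<partial>lebesgue) + ennreal t * emeasure lebesgue (ball x r)"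
    by (rule nn_set_integral_triangle[OF f ball_lebesgue t])
  also have "\<dots> \<le> ennreal a + ennreal t * ennreal (ball_vol TYPE('n) * r ^ CARD('n))"
    unfolding emeasure_lebesgue_ball[OF r] by (rule add_right_mono[OF fg])
  also have "\<dots> = ennreal (a + t * (ball_vol TYPE('n) * r ^ CARD('n)))"
    unfolding ennreal_mult'[OF t(1), symmetric] using a t(1) r by (intro ennreal_plus[symmetric] mult_nonneg_nonneg) auto
  finally show ?thesis .
qed

abbreviation deviation :: "('a::euclidean_space \<Rightarrow> complex) \<Rightarrow> 'a set \<Rightarrow> complex \<Rightarrow> ennreal" where
  "deviation f B c \<equiv> (\<integral>\<^sup>+y\<in>B. ennreal (norm (f y - c)) \<partial>lebesgue)"

abbreviation poisson_norm :: "real \<Rightarrow> (real ^ 'n \<Rightarrow> complex) \<Rightarrow> real ^ 'n \<Rightarrow> ennreal" where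
  "poisson_norm r f x \<equiv> (\<integral>\<^sup>+y. ennreal (poisson_kernel r (x - y) * norm (f y)) \<partial>lebesgue)"

text \<open>The set and its volume are left general because both balls and cubes will be
  inserted.\<close>

lemma norm_mean_diff_le:
  fixes f :: "real ^ 'n \<Rightarrow> complex"
  assumes f: "set_integrable lebesgue B f" and B: "B \<in> sets lebesgue" and m: "emeasure lebesgue B = ennreal \<mu>" "\<mu> > 0"
  shows "ennreal (norm ((LINT y:B|lebesgue. f y) /\<^sub>R \<mu> - c)) * ennreal \<mu> \<le> deviation f B c"
proof -
  have mB: "measure lebesgue B = \<mu>" using m by (simp add: measure_def)
  have c: "set_integrable lebesgue B (\<lambda>_. c)" using B m by (simp add: set_integrable_def)
  have fc: "set_integrable lebesgue B (\<lambda>y. f y - c)" using f c by (rule set_integral_diff)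
  have "(LINT y:B|lebesgue. f y - c) = (LINT y:B|lebesgue. f y) - \<mu> *\<^sub>R c"
    using f c B m mB by (subst set_integral_diff) (auto simp: set_lebesgue_integral_def)
  then have "\<mu> *\<^sub>R ((LINT y:B|lebesgue. f y) /\<^sub>R \<mu> - c) = (LINT y:B|lebesgue. f y - c)"
    using m(2) by (simp add: scaleR_diff_right)
  then have "norm ((LINT y:B|lebesgue. f y) /\<^sub>R \<mu> - c) * \<mu> = norm (LINT y:B|lebesgue. f y - c)"
    using m(2) by (metis abs_of_pos mult.commute norm_scaleR)
  then have "ennreal (norm ((LINT y:B|lebesgue. f y) /\<^sub>R \<mu> - c)) * ennreal \<mu> = ennreal (norm (LINT y:B|lebesgue. f y - c))"
    using m(2) by (simp flip: ennreal_mult)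
  also have "\<dots> \<le> (\<integral>\<^sup>+y. ennreal (norm (indicator B y *\<^sub>R (f y - c))) \<partial>lebesgue)"
    unfolding set_lebesgue_integral_def
    by (rule integral_norm_bound_ennreal) (use fc in \<open>simp add: set_integrable_def\<close>)
  also have "\<dots> = deviation f B c"
    by (intro nn_integral_cong) (auto simp: indicator_def)
  finally show ?thesis .
qed

text \<open>The mean differs from c by at most the mean deviation from c, so the mean is an optimal
  constant up to a factor 2.\<close>

lemma nn_mean_oscillation_le:
  fixes f :: "real ^ 'n \<Rightarrow> complex"
  assumes f: "f \<in> borel_measurable lebesgue" "set_integrable lebesgue B f" and B: "B \<in> sets lebesgue" and m: "emeasure lebesgue B = ennreal \<mu>" "\<mu> > 0"
  shows "deviation f B ((LINT y:B|lebesgue. f y) /\<^sub>R \<mu>) \<le> 2 * deviation f B c"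
proof -
  let ?m = "(LINT y:B|lebesgue. f y) /\<^sub>R \<mu>"
  have "deviation f B ?m \<le>
    deviation f B c + ennreal (norm (c - ?m)) * emeasure lebesgue B"
    by (rule nn_set_integral_triangle[OF f(1) _ B]) auto
  also have "ennreal (norm (c - ?m)) * emeasure lebesgue B \<le> deviation f B c"
    unfolding m(1) norm_minus_commute[of c] by (rule norm_mean_diff_le[OF f(2) B m])
  finally show ?thesis by (simp add: mult_2 add_mono)
qed

lemma ennreal_le_suminf: "f k \<le> suminf f" for f :: "nat \<Rightarrow> ennreal"
  using sum_le_suminf[of f "{k}"] by simp

text \<open>Only the least k with y in the ball of radius 2^k r is used. For k = j + 1 the point
  lies outside the ball of radius 2^j r, so the decay is that of the inner radius; this shift by one
  is the factor 2^(n+1).\<close>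

lemma poisson_kernel_annuli:
  fixes x y :: "real ^ 'n"
  assumes r: "r > 0"
  shows "ennreal (poisson_kernel r (x - y)) \<le>
    (\<Sum>k. ennreal (poisson_const TYPE('n) * 2 ^ (CARD('n) + 1) / r ^ CARD('n) * (1 / 2 ^ (CARD('n) + 1)) ^ k) * indicator (ball x (2 ^ k * r)) y)"
proof -
  let ?n = "CARD('n)" and ?c = "poisson_const TYPE('n)"
  let ?t = "\<lambda>k. ennreal (?c * 2 ^ (?n + 1) / r ^ ?n * (1 / 2 ^ (?n + 1)) ^ k) * indicator (ball x (2 ^ k * r)) y"
  have c: "?c > 0" by (rule poisson_const_pos)
  obtain K where "dist x y / r < 2 ^ K" using real_arch_pow[of 2 "dist x y / r"] by auto
  then have "dist x y < 2 ^ K * r" using r by (simp add: divide_less_eq)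
  define k where "k = (LEAST k. dist x y < 2 ^ k * r)"
  have k: "dist x y < 2 ^ k * r" unfolding k_def using \<open>dist x y < 2 ^ K * r\<close> by (rule LeastI)
  have "poisson_kernel r (x - y) \<le> ?c * 2 ^ (?n + 1) / r ^ ?n * (1 / 2 ^ (?n + 1)) ^ k"
  proof (cases k)
    case 0
    have "poisson_kernel r (x - y) \<le> ?c * r / r ^ (?n + 1)"
      by (rule poisson_kernel_le_decay[OF r r]) simp
    also have "\<dots> = ?c * 1 / r ^ ?n" using r by simp
    also have "\<dots> \<le> ?c * 2 ^ (?n + 1) / r ^ ?n"
      using r c by (intro divide_right_mono mult_left_mono one_le_power) auto
    finally show ?thesis using 0 by simp
  next
    case (Suc j)
    have "\<not> dist x y < 2 ^ j * r"
      using not_less_Least[of j "\<lambda>k. dist x y < 2 ^ k * r"] Suc by (simp add: k_def)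
    then have "2 ^ j * r \<le> norm (x - y)" by (simp add: dist_norm)
    then have "(2 ^ j * r)\<^sup>2 \<le> (norm (x - y))\<^sup>2" using r by (intro power_mono) auto
    then have "(2 ^ j * r)\<^sup>2 \<le> r\<^sup>2 + (norm (x - y))\<^sup>2" using zero_le_power2[of r] by linarith
    then have "poisson_kernel r (x - y) \<le> ?c * r / (2 ^ j * r) ^ (?n + 1)"
      using r by (intro poisson_kernel_le_decay) auto
    also have "\<dots> = ?c / r ^ ?n * (1 / 2 ^ (?n + 1)) ^ j"
    proof -
      have "(2 ^ j :: real) ^ (?n + 1) = (2 ^ (?n + 1)) ^ j"
        by (simp only: power_mult[symmetric] mult.commute)
      moreover have "(2 ^ j * r) ^ (?n + 1) = (2 ^ j) ^ (?n + 1) * r ^ (?n + 1)"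
        by (rule power_mult_distrib)
      ultimately have "(2 ^ j * r) ^ (?n + 1) = (2 ^ (?n + 1)) ^ j * (r ^ ?n * r)"
        by simp
      then show ?thesis using r by (simp add: power_one_over del: power_Suc)
    qed
    also have "\<dots> = ?c * 2 ^ (?n + 1) / r ^ ?n * (1 / 2 ^ (?n + 1)) ^ k"
      unfolding Suc by simp
    finally show ?thesis .
  qed
  then have "ennreal (poisson_kernel r (x - y)) \<le> ?t k" using k by (simp add: ennreal_leI)
  also have "\<dots> \<le> (\<Sum>k. ?t k)" by (rule ennreal_le_suminf)
  finally show ?thesis .
qed

text \<open>The kernel decays like 2^(-k(n+1)) while the integrals grow like 2^(k \<kappa>). With x
  = 2^(\<kappa> - n - 1) < 1 the sum of (k + 1) x^k is 1 / (1 - x)^2; the factor k + 1 leaves room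
  for the drift of means over growing balls.\<close>

lemma nn_integral_poisson_annuli:
  fixes x :: "real ^ 'n" and g :: "real ^ 'n \<Rightarrow> real"
  assumes r: "r > 0" and g: "g \<in> borel_measurable lebesgue" "\<And>y. g y \<ge> 0" and B: "B \<ge> 0"
    and \<kappa>: "\<kappa> < real CARD('n) + 1"
    and bound: "\<And>k. (\<integral>\<^sup>+y\<in>ball x (2 ^ k * r). ennreal (g y) \<partial>lebesgue) \<le> ennreal (B * (real (Suc k) * (2 powr \<kappa>) ^ k))"
  shows "(\<integral>\<^sup>+y. ennreal (poisson_kernel r (x - y) * g y) \<partial>lebesgue) \<le>
    ennreal (poisson_const TYPE('n) * 2 ^ (CARD('n) + 1) / (1 - 2 powr (\<kappa> - (real CARD('n) + 1)))\<^sup>2 * B / r ^ CARD('n))"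
proof -
  let ?n = "CARD('n)"
  let ?K = "poisson_const TYPE('n) * 2 ^ (?n + 1) / r ^ ?n"
  let ?q = "2 powr (\<kappa> - (real ?n + 1))"
  have K: "?K \<ge> 0" using poisson_const_pos[where 'n='n] r by simp
  have q: "0 < ?q" "?q < 1" using \<kappa> by (auto simp: powr_less_one)
  have q_eq: "?q = 1 / 2 ^ (?n + 1) * 2 powr \<kappa>"
    using powr_realpow[of 2 "?n + 1"] by (simp add: powr_diff add.commute)
  note [measurable] = g(1)
  have "(\<integral>\<^sup>+y. ennreal (poisson_kernel r (x - y) * g y) \<partial>lebesgue) \<le>
    (\<integral>\<^sup>+y. (\<Sum>k. ennreal (?K * (1 / 2 ^ (?n + 1)) ^ k) * (ennreal (g y) * indicator (ball x (2 ^ k * r)) y)) \<partial>lebesgue)"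
  proof (rule nn_integral_mono)
    fix y
    have "ennreal (poisson_kernel r (x - y) * g y) = ennreal (poisson_kernel r (x - y)) * ennreal (g y)"
      by (rule ennreal_mult''[OF g(2)])
    also have "\<dots> \<le> (\<Sum>k. ennreal (?K * (1 / 2 ^ (?n + 1)) ^ k) * indicator (ball x (2 ^ k * r)) y) * ennreal (g y)"
      by (intro mult_right_mono poisson_kernel_annuli[OF r]) simp
    also have "\<dots> = (\<Sum>k. ennreal (?K * (1 / 2 ^ (?n + 1)) ^ k) * indicator (ball x (2 ^ k * r)) y * ennreal (g y))"
      by (rule ennreal_suminf_multc[symmetric])
    finally show "ennreal (poisson_kernel r (x - y) * g y) \<le> (\<Sum>k. ennreal (?K * (1 / 2 ^ (?n + 1)) ^ k) * (ennreal (g y) * indicator (ball x (2 ^ k * r)) y))"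
      by (simp only: mult_ac)
  qed
  also have "\<dots> = (\<Sum>k. (\<integral>\<^sup>+y. ennreal (?K * (1 / 2 ^ (?n + 1)) ^ k) * (ennreal (g y) * indicator (ball x (2 ^ k * r)) y) \<partial>lebesgue))"
    by (rule nn_integral_suminf) measurable
  also have "\<dots> \<le> (\<Sum>k. ennreal (?K * B * (real (Suc k) * ?q ^ k)))"
  proof (rule suminf_le)
    fix k
    have "(\<integral>\<^sup>+y. ennreal (?K * (1 / 2 ^ (?n + 1)) ^ k) * (ennreal (g y) * indicator (ball x (2 ^ k * r)) y) \<partial>lebesgue) =
      ennreal (?K * (1 / 2 ^ (?n + 1)) ^ k) * (\<integral>\<^sup>+y\<in>ball x (2 ^ k * r). ennreal (g y) \<partial>lebesgue)"
      by (rule nn_integral_cmult) measurable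
    also have "\<dots> \<le> ennreal (?K * (1 / 2 ^ (?n + 1)) ^ k) * ennreal (B * (real (Suc k) * (2 powr \<kappa>) ^ k))"
      by (intro mult_left_mono bound) simp
    also have "\<dots> = ennreal (?K * (1 / 2 ^ (?n + 1)) ^ k * (B * (real (Suc k) * (2 powr \<kappa>) ^ k)))"
      by (rule ennreal_mult'[symmetric]) (use K in \<open>intro mult_nonneg_nonneg; simp\<close>)
    also have "?K * (1 / 2 ^ (?n + 1)) ^ k * (B * (real (Suc k) * (2 powr \<kappa>) ^ k)) = ?K * B * (real (Suc k) * ?q ^ k)"
      unfolding q_eq power_mult_distrib by (simp only: mult_ac)
    finally show "(\<integral>\<^sup>+y. ennreal (?K * (1 / 2 ^ (?n + 1)) ^ k) * (ennreal (g y) * indicator (ball x (2 ^ k * r)) y) \<partial>lebesgue) \<le> ennreal (?K * B * (real (Suc k) * ?q ^ k))" .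
  qed auto
  also have "\<dots> = ennreal (?K * B * (1 / (1 - ?q)\<^sup>2))"
  proof (rule suminf_ennreal_eq)
    show "0 \<le> ?K * B * (real (Suc k) * ?q ^ k)" for k
      using K B q by (intro mult_nonneg_nonneg) auto
    have "(\<lambda>k. of_nat (Suc k) * ?q ^ k) sums (1 / (1 - ?q)\<^sup>2)"
      by (rule geometric_deriv_sums) (use q in simp)
    then show "(\<lambda>k. ?K * B * (real (Suc k) * ?q ^ k)) sums (?K * B * (1 / (1 - ?q)\<^sup>2))"
      by (intro sums_mult) simp
  qed
  also have "?K * B * (1 / (1 - ?q)\<^sup>2) = poisson_const TYPE('n) * 2 ^ (?n + 1) / (1 - ?q)\<^sup>2 * B / r ^ ?n"
    by simp
  finally show ?thesis .
qed

definition lip_const :: "'n::finite itself \<Rightarrow> real" where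
  "lip_const _ = (real CARD('n) + 1) * 3 powr ((real CARD('n) + 1) / 2 + 2)"

lemma lip_const_pos: "lip_const TYPE('n::finite) > 0"
  by (auto simp: lip_const_def intro!: mult_pos_pos add_nonneg_pos)

lemma borel_measurable_poisson_kernel_norm:
  fixes f :: "real ^ 'n \<Rightarrow> complex"
  assumes "f \<in> borel_measurable lebesgue"
  shows "(\<lambda>y. ennreal (poisson_kernel r (x - y) * norm (f y - c))) \<in> borel_measurable lebesgue"
proof -
  have "(\<lambda>y. norm (f y - c)) \<in> borel_measurable lebesgue" using assms by simp
  from borel_measurable_times[OF lebesgue_measurable_poisson_kernel(1) this] show ?thesis
    by (rule measurable_compose[OF _ measurable_ennreal])
qed

lemma poisson_Lipschitz:
  fixes h :: "real ^ 'n \<Rightarrow> complex"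
  assumes h: "h \<in> M_Poisson" and s: "s > 0" and d: "norm (x - x0) \<le> s"
  shows "ennreal (norm (poisson s h x - poisson s h x0)) \<le>
    ennreal (lip_const TYPE('n) * norm (x - x0) / s) * poisson_norm s h x0"
proof -
  let ?l = "lip_const TYPE('n) * norm (x - x0) / s"
  have l: "?l \<ge> 0" using lip_const_pos[where 'n='n] s by simp
  have hm: "h \<in> borel_measurable lebesgue" by (rule M_Poisson_measurable[OF h])
  note I = M_Poisson_integrable[OF h s]
  have "poisson s h x - poisson s h x0 = (LINT y|lebesgue. (poisson_kernel s (x - y) - poisson_kernel s (x0 - y)) *\<^sub>R h y)"
    unfolding poisson_def scaleR_left_diff_distrib by (rule Bochner_Integration.integral_diff[OF I I, symmetric])
  also have "ennreal (norm \<dots>) \<le> (\<integral>\<^sup>+y. ennreal (norm ((poisson_kernel s (x - y) - poisson_kernel s (x0 - y)) *\<^sub>R h y)) \<partial>lebesgue)"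
    by (rule integral_norm_bound_ennreal) (simp add: scaleR_left_diff_distrib I)
  also have "\<dots> \<le> (\<integral>\<^sup>+y. ennreal ?l * ennreal (poisson_kernel s (x0 - y) * norm (h y)) \<partial>lebesgue)"
  proof (rule nn_integral_mono)
    fix y
    have "\<bar>poisson_kernel s (x - y) - poisson_kernel s (x0 - y)\<bar> \<le> ?l * poisson_kernel s (x0 - y)"
      using poisson_kernel_Lipschitz[OF s, of "x - y" "x0 - y"] d by (simp add: lip_const_def)
    then have "norm ((poisson_kernel s (x - y) - poisson_kernel s (x0 - y)) *\<^sub>R h y) \<le> ?l * (poisson_kernel s (x0 - y) * norm (h y))"
      unfolding norm_scaleR real_norm_def mult.assoc[symmetric] by (intro mult_right_mono) auto
    then show "ennreal (norm ((poisson_kernel s (x - y) - poisson_kernel s (x0 - y)) *\<^sub>R h y)) \<le> ennreal ?l * ennreal (poisson_kernel s (x0 - y) * norm (h y))"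
      unfolding ennreal_mult'[OF l, symmetric] by (rule ennreal_leI)
  qed
  also have "\<dots> = ennreal ?l * poisson_norm s h x0"
    using hm by (intro nn_integral_cmult) measurable
  finally show ?thesis .
qed

text \<open>A general function of the class provides no rate, so this is dominated convergence: the
  kernel at time 2^k r is at most 2^k times that at time r, and at each fixed y the integrand tends
  to zero. It disposes of the far end of the telescoping sum over dilations.\<close>

lemma poisson_dilation_tail:
  fixes f :: "real ^ 'n \<Rightarrow> complex"
  assumes f: "f \<in> M_Poisson" and r: "r > 0"
  shows "(\<lambda>k. \<integral>\<^sup>+y. ennreal (poisson_kernel (2 ^ k * r) (x - y) / 2 ^ k * norm (f y)) \<partial>lebesgue) \<longlonglongrightarrow> 0"
proof -
  have fm[measurable]: "f \<in> borel_measurable lebesgue" by (rule M_Poisson_measurable[OF f])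
  have "(\<lambda>k. \<integral>\<^sup>+y. ennreal (poisson_kernel (2 ^ k * r) (x - y) / 2 ^ k * norm (f y)) \<partial>lebesgue) \<longlonglongrightarrow> (\<integral>\<^sup>+y. 0 \<partial>(lebesgue :: (real ^ 'n) measure))"
  proof (rule nn_integral_dominated_convergence[where w="\<lambda>y. ennreal (poisson_kernel r (x - y) * norm (f y))"])
    show "poisson_norm r f x < \<infinity>"
      by (rule M_Poisson_nn_integral_finite[OF f r])
    show "AE y in lebesgue. ennreal (poisson_kernel (2 ^ k * r) (x - y) / 2 ^ k * norm (f y)) \<le> ennreal (poisson_kernel r (x - y) * norm (f y))" for k
    proof (rule AE_I2)
      fix y
      have "r\<^sup>2 \<le> (2 ^ k * r)\<^sup>2" using r by (intro power_mono) auto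
      then have "r\<^sup>2 + (norm (x - y))\<^sup>2 \<le> 1 * ((2 ^ k * r)\<^sup>2 + (norm (x - y))\<^sup>2)" by simp
      from poisson_kernel_compare[OF _ r this] r
      have "poisson_kernel (2 ^ k * r) (x - y) \<le> 2 ^ k * poisson_kernel r (x - y)" by simp
      then have "poisson_kernel (2 ^ k * r) (x - y) / 2 ^ k \<le> poisson_kernel r (x - y)" by (simp add: divide_le_eq mult.commute)
      then show "ennreal (poisson_kernel (2 ^ k * r) (x - y) / 2 ^ k * norm (f y)) \<le> ennreal (poisson_kernel r (x - y) * norm (f y))"
        by (intro ennreal_leI mult_right_mono) auto
    qed
    show "AE y in lebesgue. (\<lambda>k. ennreal (poisson_kernel (2 ^ k * r) (x - y) / 2 ^ k * norm (f y))) \<longlonglongrightarrow> 0"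
    proof (rule AE_I2)
      fix y
      let ?c = "poisson_const TYPE('n)"
      have "(\<lambda>k. poisson_kernel (2 ^ k * r) (x - y) / 2 ^ k * norm (f y)) \<longlonglongrightarrow> 0"
      proof (rule tendsto_sandwich[OF _ _ tendsto_const])
        show "eventually (\<lambda>k. 0 \<le> poisson_kernel (2 ^ k * r) (x - y) / 2 ^ k * norm (f y)) sequentially"
          using r by (intro always_eventually) simp
        show "eventually (\<lambda>k. poisson_kernel (2 ^ k * r) (x - y) / 2 ^ k * norm (f y) \<le> ?c / r ^ CARD('n) * norm (f y) * (1/2) ^ k) sequentially"
        proof (intro always_eventually allI)
          fix k
          have s: "2 ^ k * r > 0" using r by simp
          have "r \<le> 2 ^ k * r" using r by simp
          then have le: "r ^ CARD('n) \<le> (2 ^ k * r) ^ CARD('n)" using r by (intro power_mono) auto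
          have "poisson_kernel (2 ^ k * r) (x - y) \<le> ?c * (2 ^ k * r) / (2 ^ k * r) ^ (CARD('n) + 1)"
            by (rule poisson_kernel_le_decay[OF s s]) simp
          also have "\<dots> = ?c / (2 ^ k * r) ^ CARD('n)" using s by simp
          also have "\<dots> \<le> ?c / r ^ CARD('n)"
            using le r poisson_const_pos[where 'n='n] by (intro divide_left_mono mult_pos_pos) auto
          finally have "poisson_kernel (2 ^ k * r) (x - y) / 2 ^ k * norm (f y) \<le> ?c / r ^ CARD('n) / 2 ^ k * norm (f y)"
            by (intro mult_right_mono divide_right_mono) auto
          then show "poisson_kernel (2 ^ k * r) (x - y) / 2 ^ k * norm (f y) \<le> ?c / r ^ CARD('n) * norm (f y) * (1/2) ^ k"
            by (simp add: power_one_over field_simps)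
        qed
        have "(\<lambda>k. ?c / r ^ CARD('n) * norm (f y) * (1/2) ^ k) \<longlonglongrightarrow> ?c / r ^ CARD('n) * norm (f y) * 0"
          by (intro tendsto_mult tendsto_const LIMSEQ_realpow_zero) auto
        then show "(\<lambda>k. ?c / r ^ CARD('n) * norm (f y) * (1/2) ^ k) \<longlonglongrightarrow> 0" by simp
      qed
      from tendsto_ennrealI[OF this] show "(\<lambda>k. ennreal (poisson_kernel (2 ^ k * r) (x - y) / 2 ^ k * norm (f y))) \<longlonglongrightarrow> 0"
        by simp
    qed
  qed measurable
  then show ?thesis by simp
qed

section \<open>Equivalence of the two oscillation conditions for an abstract gauge\<close>

text \<open>
  \<open>N x r\<close> abstracts the norm of the indicator of a ball \<open>B\<close>. The weight \<open>w\<close> is \<open>\<phi> (\<cdot>, 1 / N B)\<close> in the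
  application; it makes \<open>N\<close> of small balls inside \<open>B\<close> summable over bounded overlaps.
\<close>

locale ball_gauge =
  fixes N :: "real ^ 'n \<Rightarrow> real \<Rightarrow> real" and \<kappa> D :: real
  assumes N_pos: "r > 0 \<Longrightarrow> N x r > 0"
    and \<kappa>_ge: "real CARD('n) \<le> \<kappa>" and \<kappa>_less: "\<kappa> < real CARD('n) + 1"
    and D_pos: "D > 0"
    and N_grow: "r > 0 \<Longrightarrow> \<Lambda> \<ge> 1 \<Longrightarrow> N x (\<Lambda> * r) \<le> D * \<Lambda> powr \<kappa> * N x r"
    and N_weight: "r > 0 \<Longrightarrow> \<exists>w. w \<in> borel_measurable lebesgue \<and> (\<integral>\<^sup>+y\<in>ball x r. w y \<partial>lebesgue) \<le> ennreal D \<and>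
      (\<forall>z s. s > 0 \<longrightarrow> ball z s \<subseteq> ball x r \<longrightarrow> ennreal (N z s) \<le> ennreal (D * N x r) * (\<integral>\<^sup>+y\<in>ball z s. w y \<partial>lebesgue))"
begin

definition osc_bound :: "(real ^ 'n \<Rightarrow> complex) \<Rightarrow> real \<Rightarrow> bool" where
  "osc_bound f A \<longleftrightarrow> (\<forall>x. \<forall>r>0. deviation f (ball x r) (ball_mean f x r) \<le> ennreal (A * N x r))"

definition poisson_osc_bound :: "(real ^ 'n \<Rightarrow> complex) \<Rightarrow> real \<Rightarrow> bool" where
  "poisson_osc_bound f A \<longleftrightarrow> (\<forall>x. \<forall>r>0. (\<integral>\<^sup>+y\<in>ball x r. ennreal (norm (f y - poisson r f y)) \<partial>lebesgue) \<le> ennreal (A * N x r))"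

definition annuli_const :: real where
  "annuli_const = poisson_const TYPE('n) * 2 ^ (CARD('n) + 1) / (1 - 2 powr (\<kappa> - (real CARD('n) + 1)))\<^sup>2"

lemma annuli_const_pos: "annuli_const > 0"
proof -
  have "2 powr (\<kappa> - (real CARD('n) + 1)) < (1 :: real)" using \<kappa>_less by (simp add: powr_less_one)
  then show ?thesis unfolding annuli_const_def using poisson_const_pos[where 'n='n]
    by (intro divide_pos_pos mult_pos_pos zero_less_power) auto
qed

lemma powr_\<kappa>_power: "(2 ^ k) powr \<kappa> = (2 powr \<kappa>) ^ k"
  by (simp add: powr_powr mult.commute flip: powr_realpow)

text \<open>
  Averaging over the balls of radius \<open>s\<close> that meet \<open>ball x R\<close> replaces a covering argument.
\<close>

lemma nn_integral_ball_averaging: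
  fixes g :: "real ^ 'n \<Rightarrow> real"
  assumes g: "g \<in> borel_measurable lebesgue" "\<And>y. g y \<ge> 0" and A: "A \<ge> 0"
    and s: "s > 0" and R: "s \<le> R"
    and bound: "\<And>z. (\<integral>\<^sup>+y\<in>ball z s. ennreal (g y) \<partial>lebesgue) \<le> ennreal (A * N z s)"
  shows "(\<integral>\<^sup>+y\<in>ball x R. ennreal (g y) \<partial>lebesgue) \<le> ennreal (A * D * D * N x (3 * R))"
proof -
  let ?L = "lebesgue :: (real ^ 'n) measure"
  interpret L: pair_sigma_finite ?L ?L by (rule pair_sigma_finite_lebesgue)
  have R0: "R > 0" "3 * R > 0" using s R by auto
  have N0: "N x (3 * R) > 0" by (rule N_pos[OF R0(2)])
  obtain w where w: "w \<in> borel_measurable lebesgue" "(\<integral>\<^sup>+y\<in>ball x (3 * R). w y \<partial>lebesgue) \<le> ennreal D"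
    "\<And>z s. s > 0 \<Longrightarrow> ball z s \<subseteq> ball x (3 * R) \<Longrightarrow> ennreal (N z s) \<le> ennreal (D * N x (3 * R)) * (\<integral>\<^sup>+y\<in>ball z s. w y \<partial>lebesgue)"
    using N_weight[OF R0(2), of x] by blast
  define V where "V = ball_vol TYPE('n) * s ^ CARD('n)"
  have V: "V > 0" using s by (simp add: V_def)
  have emV: "emeasure lebesgue (ball y s) = ennreal V" for y :: "real ^ 'n"
    unfolding V_def by (rule emeasure_lebesgue_ball[OF s])
  have Vc: "(\<integral>\<^sup>+z. c * indicator (ball y s) z \<partial>?L) = c * ennreal V" for c y
    using nn_integral_cmult_indicator[of "ball y s" ?L c] emV by simp
  have [measurable]: "(\<lambda>z. g (snd z)) \<in> borel_measurable (?L \<Otimes>\<^sub>M ?L)" "(\<lambda>z. w (snd z)) \<in> borel_measurable (?L \<Otimes>\<^sub>M ?L)"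
    using g(1) w(1) by measurable
  have [measurable]: "(\<lambda>z. indicator (ball (fst z) s) (snd z) :: ennreal) \<in> borel_measurable (?L \<Otimes>\<^sub>M ?L)"
    unfolding indicator_def mem_ball
    by (rule borel_measurable_pair_lebesgue) measurable
  have [measurable]: "(\<lambda>z. indicator (ball x R) (snd z) :: ennreal) \<in> borel_measurable (?L \<Otimes>\<^sub>M ?L)"
    "(\<lambda>z. indicator (ball x (3 * R)) (snd z) :: ennreal) \<in> borel_measurable (?L \<Otimes>\<^sub>M ?L)"
    by measurable
  let ?G = "\<lambda>z y. ennreal (g y) * indicator (ball x R) y * indicator (ball z s) y"
  let ?W = "\<lambda>z y. w y * indicator (ball x (3 * R)) y * indicator (ball z s) y"
  have swap: "indicator (ball z s) y = (indicator (ball y s) z :: ennreal)" for y z :: "real ^ 'n"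
    by (simp add: indicator_def dist_commute)
  \<comment> \<open>Each y lies in \<open>ball z s\<close> for a set of centres z of measure V, so
    integration over z multiplies by V.\<close>
  have "(\<integral>\<^sup>+y\<in>ball x R. ennreal (g y) \<partial>?L) * ennreal V = (\<integral>\<^sup>+y. (\<integral>\<^sup>+z. ?G z y \<partial>?L) \<partial>?L)"
    unfolding swap Vc using g(1) by (subst nn_integral_multc) auto
  also have "\<dots> = (\<integral>\<^sup>+z. (\<integral>\<^sup>+y. ?G z y \<partial>?L) \<partial>?L)"
    by (rule L.Fubini') (simp add: split_def, measurable)
  also have "\<dots> \<le> (\<integral>\<^sup>+z. ennreal (A * D * N x (3 * R)) * (\<integral>\<^sup>+y. ?W z y \<partial>?L) \<partial>?L)"
  proof (rule nn_integral_mono)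
    fix z
    show "(\<integral>\<^sup>+y. ?G z y \<partial>?L) \<le> ennreal (A * D * N x (3 * R)) * (\<integral>\<^sup>+y. ?W z y \<partial>?L)"
    \<comment> \<open>A ball of radius s \<le> R can meet \<open>ball x R\<close> only if its centre
      is within 2 R of x, and then it lies in \<open>ball x (3 * R)\<close>.\<close>
    proof (cases "dist x z < 2 * R")
      case True
      have sub: "ball z s \<subseteq> ball x (3 * R)"
      proof
        fix y assume "y \<in> ball z s"
        then have "dist z y < R" using R by simp
        then show "y \<in> ball x (3 * R)" using True dist_triangle[of x y z] by simp
      qed
      have "(\<integral>\<^sup>+y. ?G z y \<partial>?L) \<le> (\<integral>\<^sup>+y\<in>ball z s. ennreal (g y) \<partial>?L)"
        by (intro nn_integral_mono) (auto simp: indicator_def)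
      also have "\<dots> \<le> ennreal A * ennreal (N z s)" using bound[of z] A by (simp add: ennreal_mult')
      also have "\<dots> \<le> ennreal A * (ennreal (D * N x (3 * R)) * (\<integral>\<^sup>+y\<in>ball z s. w y \<partial>?L))"
        by (intro mult_left_mono w(3)[OF s sub]) simp
      also have "\<dots> = ennreal (A * D * N x (3 * R)) * (\<integral>\<^sup>+y\<in>ball z s. w y \<partial>?L)"
        using A by (simp add: mult.assoc ennreal_mult')
      also have "(\<integral>\<^sup>+y\<in>ball z s. w y \<partial>?L) = (\<integral>\<^sup>+y. ?W z y \<partial>?L)"
        using sub by (intro nn_integral_cong) (auto simp: indicator_def)
      finally show ?thesis .
    next
      case False
      have "?G z y = 0" for y
      proof -
        have "\<not> (y \<in> ball x R \<and> y \<in> ball z s)"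
          using False R dist_triangle[of x z y] by (auto simp: dist_commute)
        then show ?thesis by (auto simp: indicator_def)
      qed
      then have "(\<integral>\<^sup>+y. ?G z y \<partial>?L) = (\<integral>\<^sup>+y. 0 \<partial>?L)" by (intro nn_integral_cong)
      then show ?thesis by simp
    qed
  qed
  also have "\<dots> = ennreal (A * D * N x (3 * R)) * (\<integral>\<^sup>+z. (\<integral>\<^sup>+y. ?W z y \<partial>?L) \<partial>?L)"
    by (rule nn_integral_cmult, rule sigma_finite_measure.borel_measurable_nn_integral[OF sigma_finite_lebesgue]) (simp add: split_def, measurable)
  also have "(\<integral>\<^sup>+z. (\<integral>\<^sup>+y. ?W z y \<partial>?L) \<partial>?L) = (\<integral>\<^sup>+y. (\<integral>\<^sup>+z. ?W z y \<partial>?L) \<partial>?L)"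
    by (rule L.Fubini'[symmetric]) (simp add: split_def, measurable)
  also have "\<dots> = (\<integral>\<^sup>+y\<in>ball x (3 * R). w y \<partial>?L) * ennreal V"
    unfolding swap Vc using w(1) by (subst nn_integral_multc) auto
  also have "ennreal (A * D * N x (3 * R)) * ((\<integral>\<^sup>+y\<in>ball x (3 * R). w y \<partial>?L) * ennreal V) \<le>
      ennreal (A * D * N x (3 * R)) * (ennreal D * ennreal V)"
    by (intro mult_left_mono mult_right_mono w(2)) auto
  also have "\<dots> = ennreal (A * D * D * N x (3 * R)) * ennreal V"
  proof -
    have h: "A * D * N x (3 * R) \<ge> 0" using A D_pos N0 by simp
    have "ennreal (A * D * N x (3 * R)) * ennreal D = ennreal (A * D * N x (3 * R) * D)"
      by (rule ennreal_mult'[OF h, symmetric])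
    also have "A * D * N x (3 * R) * D = A * D * D * N x (3 * R)" by simp
    finally show ?thesis by (simp only: mult.assoc[symmetric])
  qed
  finally have "ennreal V * (\<integral>\<^sup>+y\<in>ball x R. ennreal (g y) \<partial>?L) \<le> ennreal V * ennreal (A * D * D * N x (3 * R))"
    by (simp only: mult.commute)
  then show ?thesis
    using V by (subst (asm) ennreal_mult_le_mult_iff) auto
qed

lemma N_grow_annuli:
  assumes s: "s > 0"
  shows "N x (2 ^ k * s) \<le> D * (2 powr \<kappa>) ^ k * N x s"
    and "N x (3 * (2 ^ k * s)) \<le> D * 3 powr \<kappa> * (2 powr \<kappa>) ^ k * N x s"
proof -
  show "N x (2 ^ k * s) \<le> D * (2 powr \<kappa>) ^ k * N x s"
    using N_grow[OF s, of "2 ^ k" x] by (simp add: powr_\<kappa>_power)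
  have k1: "1 \<le> (2::real) ^ k" by simp
  have "1 \<le> 3 * (2::real) ^ k" using k1 by linarith
  from N_grow[OF s this, of x]
  have "N x (3 * 2 ^ k * s) \<le> D * (3 * 2 ^ k) powr \<kappa> * N x s" .
  also have "(3 * 2 ^ k) powr \<kappa> = 3 powr \<kappa> * (2 powr \<kappa>) ^ k"
    by (simp add: powr_mult powr_\<kappa>_power)
  finally show "N x (3 * (2 ^ k * s)) \<le> D * 3 powr \<kappa> * (2 powr \<kappa>) ^ k * N x s"
    by (simp only: mult.assoc)
qed

definition majorant_const :: real where
  "majorant_const = annuli_const * (D * D * D * 3 powr \<kappa>)"

lemma majorant_const_pos: "majorant_const > 0"
  unfolding majorant_const_def using annuli_const_pos D_pos by simp

text \<open>The hypothesis concerns balls of the one radius s. Averaging over them controls the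
  balls of radius 2^k s by the gauge of balls three times as large, whose growth is slow enough for
  the sum over annuli.\<close>

lemma poisson_majorant:
  fixes g :: "real ^ 'n \<Rightarrow> real"
  assumes g: "g \<in> borel_measurable lebesgue" "\<And>y. g y \<ge> 0" and A: "A \<ge> 0" and s: "s > 0"
    and bound: "\<And>z. (\<integral>\<^sup>+y\<in>ball z s. ennreal (g y) \<partial>lebesgue) \<le> ennreal (A * N z s)"
  shows "(\<integral>\<^sup>+y. ennreal (poisson_kernel s (x - y) * g y) \<partial>lebesgue) \<le> ennreal (majorant_const * A * N x s / s ^ CARD('n))"
proof -
  let ?B = "A * D * D * (D * 3 powr \<kappa>) * N x s"
  have N0: "N x s > 0" by (rule N_pos[OF s])
  have ADD: "A * D * D \<ge> 0" using A D_pos by simp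
  have B: "?B \<ge> 0" using A D_pos N0 by simp
  have "(\<integral>\<^sup>+y. ennreal (poisson_kernel s (x - y) * g y) \<partial>lebesgue) \<le> ennreal (annuli_const * ?B / s ^ CARD('n))"
    unfolding annuli_const_def
  proof (rule nn_integral_poisson_annuli[OF s g B \<kappa>_less])
    fix k
    have "s \<le> 2 ^ k * s" using s by simp
    then have "(\<integral>\<^sup>+y\<in>ball x (2 ^ k * s). ennreal (g y) \<partial>lebesgue) \<le> ennreal (A * D * D * N x (3 * (2 ^ k * s)))"
      by (rule nn_integral_ball_averaging[OF g A s _ bound])
    also have "\<dots> \<le> ennreal (A * D * D * (D * 3 powr \<kappa> * (2 powr \<kappa>) ^ k * N x s))"
      by (intro ennreal_leI mult_left_mono N_grow_annuli(2)[OF s] ADD)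
    also have "A * D * D * (D * 3 powr \<kappa> * (2 powr \<kappa>) ^ k * N x s) = ?B * (1 * (2 powr \<kappa>) ^ k)" by simp
    also have "ennreal \<dots> \<le> ennreal (?B * (real (Suc k) * (2 powr \<kappa>) ^ k))"
      by (intro ennreal_leI mult_left_mono mult_right_mono B) auto
    finally show "(\<integral>\<^sup>+y\<in>ball x (2 ^ k * s). ennreal (g y) \<partial>lebesgue) \<le> ennreal (?B * (real (Suc k) * (2 powr \<kappa>) ^ k))" .
  qed
  also have "annuli_const * ?B = majorant_const * A * N x s" by (simp add: majorant_const_def)
  finally show ?thesis .
qed

definition telescope_const :: real where
  "telescope_const = lip_const TYPE('n) * majorant_const * D / (1 - 2 powr (\<kappa> - (real CARD('n) + 1)))"

lemma telescope_const_pos: "telescope_const > 0"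
proof -
  have "2 powr (\<kappa> - (real CARD('n) + 1)) < (1 :: real)" using \<kappa>_less by (simp add: powr_less_one)
  then show ?thesis unfolding telescope_const_def using lip_const_pos[where 'n='n] majorant_const_pos D_pos
    by (intro divide_pos_pos mult_pos_pos) auto
qed

text \<open>
  The semigroup property turns \<open>P\<^sub>s f - P\<^bsub>2 s\<^esub> f\<close> into \<open>P\<^sub>s (f - P\<^sub>s f)\<close>, so the oscillation of
  \<open>P\<^sub>r f\<close> can be telescoped over \<open>s = 2\<^sup>k r\<close>.
\<close>

lemma poisson_oscillation:
  assumes f: "f \<in> M_Poisson" and A: "A \<ge> 0" and osc: "poisson_osc_bound f A" and r: "r > 0" and x: "norm (x - x0) \<le> r"
  shows "norm (poisson r f x - poisson r f x0) \<le> telescope_const * A * N x0 r / r ^ CARD('n)"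
proof -
  let ?n = "CARD('n)" and ?q = "2 powr (\<kappa> - (real CARD('n) + 1))" and ?L = "lip_const TYPE('n)"
  define s where "s k = 2 ^ k * r" for k :: nat
  define U where "U k = poisson (s k) f x - poisson (s k) f x0" for k
  define M0 where "M0 = ?L * majorant_const * D * A * N x0 r / r ^ ?n"
  have q: "0 < ?q" "?q < 1" using \<kappa>_less by (auto simp: powr_less_one)
  have L: "?L > 0" by (rule lip_const_pos)
  have N0: "N x0 r > 0" by (rule N_pos[OF r])
  have M0: "M0 \<ge> 0" using L majorant_const_pos D_pos A N0 r by (simp add: M0_def)
  have s: "s k > 0" "r \<le> s k" for k using r by (auto simp: s_def)
  have xs: "norm (x - x0) \<le> s k" for k using x s(2) by (rule order_trans)
  have xk: "norm (x - x0) / s k \<le> 1 / 2 ^ k" for k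
    using x r by (simp add: s_def divide_simps)
  have step: "norm (U k - U (Suc k)) \<le> M0 * ?q ^ k" for k
  proof -
    let ?s = "s k"
    define h where "h y = f y - poisson ?s f y" for y
    have Pf: "poisson ?s f \<in> M_Poisson" by (rule poisson_semigroup(2)[OF f s(1) s(1)])
    have h: "h \<in> M_Poisson" unfolding h_def by (rule M_Poisson_diff[OF f Pf])
    have Ph: "poisson ?s h z = poisson ?s f z - poisson (s (Suc k)) f z" for z
    proof -
      have "s (Suc k) = ?s + ?s" by (simp add: s_def)
      then show ?thesis
        unfolding h_def using poisson_diff[OF f Pf s(1)] poisson_semigroup(1)[OF f s(1) s(1)] by simp
    qed
    have "U k - U (Suc k) = poisson ?s h x - poisson ?s h x0"
      by (simp add: U_def Ph)
    then have "ennreal (norm (U k - U (Suc k))) \<le> ennreal (?L * norm (x - x0) / ?s) * poisson_norm ?s h x0"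
      using poisson_Lipschitz[OF h s(1) xs] by simp
    also have "\<dots> \<le> ennreal (?L * norm (x - x0) / ?s) * ennreal (majorant_const * A * N x0 ?s / ?s ^ ?n)"
    proof (intro mult_left_mono poisson_majorant A s(1))
      show "(\<lambda>y. norm (h y)) \<in> borel_measurable lebesgue" using M_Poisson_measurable[OF h] by simp
      show "(\<integral>\<^sup>+y\<in>ball z ?s. ennreal (norm (h y)) \<partial>lebesgue) \<le> ennreal (A * N z ?s)" for z
        using osc s(1) unfolding poisson_osc_bound_def h_def by blast
    qed auto
    also have "\<dots> \<le> ennreal (?L * (1 / 2 ^ k)) * ennreal (majorant_const * A * (D * (2 powr \<kappa>) ^ k * N x0 r) / ?s ^ ?n)"
    proof (rule mult_mono)
      have "?L * (norm (x - x0) / ?s) \<le> ?L * (1 / 2 ^ k)" using L by (intro mult_left_mono xk) auto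
      then show "ennreal (?L * norm (x - x0) / ?s) \<le> ennreal (?L * (1 / 2 ^ k))" by (intro ennreal_leI) simp
      show "ennreal (majorant_const * A * N x0 ?s / ?s ^ ?n) \<le> ennreal (majorant_const * A * (D * (2 powr \<kappa>) ^ k * N x0 r) / ?s ^ ?n)"
        using s(1)[of k] majorant_const_pos A N_grow_annuli(1)[OF r, of x0 k]
        by (intro ennreal_leI divide_right_mono mult_left_mono) (auto simp: s_def)
    qed auto
    also have "\<dots> = ennreal (?L * (1 / 2 ^ k) * (majorant_const * A * (D * (2 powr \<kappa>) ^ k * N x0 r) / ?s ^ ?n))"
      using L by (intro ennreal_mult'[symmetric]) simp
    \<comment> \<open>The Lipschitz bound contributes 2^(-k) and the majorant 2^(k (\<kappa> - n)),
      together the k-th power of \<open>?q\<close>.\<close>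
    also have "?L * (1 / 2 ^ k) * (majorant_const * A * (D * (2 powr \<kappa>) ^ k * N x0 r) / ?s ^ ?n) = M0 * ?q ^ k"
    proof -
      have "?q = 2 powr \<kappa> / (2 ^ ?n * 2)"
        using powr_realpow[of 2 "?n + 1"] by (simp add: powr_diff add.commute)
      then have 1: "?q ^ k = (2 powr \<kappa>) ^ k / ((2 ^ ?n) ^ k * 2 ^ k)"
        by (simp only: power_divide power_mult_distrib)
      have 2: "?s ^ ?n = (2 ^ ?n) ^ k * r ^ ?n"
        by (simp only: s_def power_mult_distrib power_mult[symmetric] mult.commute[of k])
      show ?thesis unfolding 1 2 M0_def by (simp add: mult_ac)
    qed
    finally show ?thesis using M0 q by (subst (asm) ennreal_le_iff) auto
  qed
  have sum: "norm (U 0) - norm (U K) \<le> M0 / (1 - ?q)" for K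
  proof -
    have "norm (U 0) - norm (U K) \<le> norm (U 0 - U K)" by (rule norm_triangle_ineq2)
    also have "U 0 - U K = (\<Sum>k<K. U k - U (Suc k))" by (simp add: sum_lessThan_telescope')
    also have "norm \<dots> \<le> (\<Sum>k<K. M0 * ?q ^ k)" by (intro sum_norm_le step)
    also have "\<dots> = M0 * (\<Sum>k<K. ?q ^ k)" by (simp add: sum_distrib_left)
    also have "\<dots> \<le> M0 * (\<Sum>k. ?q ^ k)"
      using q by (intro mult_left_mono M0 sum_le_suminf summable_geometric) auto
    also have "(\<Sum>k. ?q ^ k) = 1 / (1 - ?q)" using q by (intro suminf_geometric) auto
    finally show ?thesis by simp
  qed
  \<comment> \<open>The values P_s f alone need not tend to zero, but their differences at two fixed
    points do: the Lipschitz bound contributes the factor 2^(-k) required by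
    \<open>poisson_dilation_tail\<close>.\<close>
  have U0: "(\<lambda>K. norm (U K)) \<longlonglongrightarrow> 0"
  proof -
    let ?T = "\<lambda>k. \<integral>\<^sup>+y. ennreal (poisson_kernel (2 ^ k * r) (x0 - y) / 2 ^ k * norm (f y)) \<partial>lebesgue"
    have fm[measurable]: "f \<in> borel_measurable lebesgue" by (rule M_Poisson_measurable[OF f])
    have "(\<lambda>K. ennreal (norm (U K))) \<longlonglongrightarrow> 0"
    proof (rule tendsto_sandwich[OF _ _ tendsto_const])
      show "eventually (\<lambda>K. 0 \<le> ennreal (norm (U K))) sequentially" by simp
      have "(\<lambda>k. ennreal ?L * ?T k) \<longlonglongrightarrow> ennreal ?L * 0"
        by (rule ennreal_tendsto_cmult[OF _ poisson_dilation_tail[OF f r]]) simp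
      then show "(\<lambda>k. ennreal ?L * ?T k) \<longlonglongrightarrow> 0" by simp
      show "eventually (\<lambda>k. ennreal (norm (U k)) \<le> ennreal ?L * ?T k) sequentially"
      proof (intro always_eventually allI)
        fix k
        have "ennreal (norm (U k)) \<le> ennreal (?L * norm (x - x0) / s k) * (\<integral>\<^sup>+y. ennreal (poisson_kernel (s k) (x0 - y) * norm (f y)) \<partial>lebesgue)"
          unfolding U_def by (rule poisson_Lipschitz[OF f s(1) xs])
        also have "\<dots> \<le> ennreal (?L * (1 / 2 ^ k)) * (\<integral>\<^sup>+y. ennreal (poisson_kernel (s k) (x0 - y) * norm (f y)) \<partial>lebesgue)"
        proof (rule mult_right_mono)
          have "?L * (norm (x - x0) / s k) \<le> ?L * (1 / 2 ^ k)" using L by (intro mult_left_mono xk) auto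
          then show "ennreal (?L * norm (x - x0) / s k) \<le> ennreal (?L * (1 / 2 ^ k))" by (intro ennreal_leI) simp
        qed simp
        also have "ennreal (?L * (1 / 2 ^ k)) = ennreal ?L * ennreal (1 / 2 ^ k)"
          by (rule ennreal_mult'') simp
        also have "ennreal ?L * ennreal (1 / 2 ^ k) * (\<integral>\<^sup>+y. ennreal (poisson_kernel (s k) (x0 - y) * norm (f y)) \<partial>lebesgue) =
            ennreal ?L * (\<integral>\<^sup>+y. ennreal (1 / 2 ^ k) * ennreal (poisson_kernel (s k) (x0 - y) * norm (f y)) \<partial>lebesgue)"
          unfolding mult.assoc by (subst nn_integral_cmult) measurable
        also have "\<dots> = ennreal ?L * ?T k"
          by (intro arg_cong[where f="\<lambda>c. ennreal ?L * c"] nn_integral_cong)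
            (simp add: s_def flip: ennreal_mult')
        finally show "ennreal (norm (U k)) \<le> ennreal ?L * ?T k" .
      qed
    qed
    from tendsto_enn2real[OF this[unfolded ennreal_0[symmetric]]] show ?thesis by simp
  qed
  have "norm (U 0) - 0 \<le> M0 / (1 - ?q)"
    by (rule LIMSEQ_le_const2[OF tendsto_diff[OF tendsto_const U0]]) (use sum in auto)
  also have "M0 / (1 - ?q) = telescope_const * A * N x0 r / r ^ ?n"
    by (simp add: M0_def telescope_const_def)
  finally show ?thesis by (simp add: U_def s_def)
qed

lemma ball_mean_alt:
  "r > 0 \<Longrightarrow> ball_mean f x r = (LINT y:ball x r|lebesgue. f y) /\<^sub>R (ball_vol TYPE('n) * r ^ CARD('n))" for x :: "real ^ 'n"
  by (simp only: ball_mean_def measure_lebesgue_ball)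

text \<open>On a ball of radius r, f is compared with P_r f by hypothesis, and P_r f with the
  constant P_r f(x) by the telescoping estimate. The factor 2 replaces this constant by the
  mean.\<close>

lemma BMO_Poisson_imp_osc:
  assumes f: "f \<in> M_Poisson" and A: "A \<ge> 0" and osc: "poisson_osc_bound f A"
  shows "osc_bound f (2 * (1 + ball_vol TYPE('n) * telescope_const) * A)"
  unfolding osc_bound_def
proof (intro allI impI)
  fix x :: "real ^ 'n" and r :: real assume r: "r > 0"
  let ?\<mu> = "ball_vol TYPE('n) * r ^ CARD('n)" and ?c = "poisson r f x" and ?B = "ball x r"
  let ?t = "telescope_const * A * N x r / r ^ CARD('n)"
  have N0: "N x r > 0" by (rule N_pos[OF r])
  have t0: "?t \<ge> 0" using telescope_const_pos A N0 r by simp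
  have \<mu>: "?\<mu> > 0" using r by simp
  have fm: "f \<in> borel_measurable lebesgue" by (rule M_Poisson_measurable[OF f])
  have fl: "locally_integrable f" using f by (simp add: M_Poisson_def)
  have "deviation f ?B (ball_mean f x r) \<le> 2 * deviation f ?B ?c"
    unfolding ball_mean_alt[OF r]
    by (rule nn_mean_oscillation_le[OF fm locally_integrable_ball[OF fl] ball_lebesgue emeasure_lebesgue_ball[OF r] \<mu>])
  also have "deviation f ?B ?c \<le> ennreal (A * N x r + ?t * ?\<mu>)"
  proof (rule nn_ball_integral_triangle[where g="poisson r f"])
    show "(\<integral>\<^sup>+y\<in>?B. ennreal (norm (f y - poisson r f y)) \<partial>lebesgue) \<le> ennreal (A * N x r)"
      using osc r unfolding poisson_osc_bound_def by blast
    show "norm (poisson r f y - ?c) \<le> ?t" if "y \<in> ?B" for y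
      by (rule poisson_oscillation[OF f A osc r]) (use that in \<open>simp add: dist_norm norm_minus_commute\<close>)
  qed (use fm borel_measurable_poisson[OF fm, of r] r A N0 t0 in auto)
  also have "?t * ?\<mu> = ball_vol TYPE('n) * telescope_const * A * N x r" using r by simp
  finally have "deviation f ?B (ball_mean f x r) \<le> 2 * ennreal (A * N x r + ball_vol TYPE('n) * telescope_const * A * N x r)"
    by (simp add: mult_left_mono)
  also have "\<dots> = ennreal (2 * (A * N x r + ball_vol TYPE('n) * telescope_const * A * N x r))"
    by (subst ennreal_mult') auto
  also have "2 * (A * N x r + ball_vol TYPE('n) * telescope_const * A * N x r) = 2 * (1 + ball_vol TYPE('n) * telescope_const) * A * N x r"
    by (simp add: algebra_simps)
  finally show "deviation f ?B (ball_mean f x r) \<le> ennreal (2 * (1 + ball_vol TYPE('n) * telescope_const) * A * N x r)" .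
qed

text \<open>Consecutive means over the balls of radius 2^k r differ by at most a multiple of 2^(k
  (\<kappa> - n)). Because \<kappa> \<ge> n these bounds do not decrease, so k of them sum to at
  most k times the last one; with the deviation from the k-th mean this makes the factor k +
  1.\<close>

lemma nn_integral_oscillation_annuli:
  assumes f: "locally_integrable f" and A: "A \<ge> 0" and osc: "osc_bound f A" and r: "r > 0"
  shows "deviation f (ball x (2 ^ k * r)) (ball_mean f x r) \<le>
    ennreal (A * D * 2 powr \<kappa> * N x r * (real (Suc k) * (2 powr \<kappa>) ^ k))"
proof -
  let ?n = "CARD('n)"
  have fm: "f \<in> borel_measurable lebesgue" by (rule locally_integrable_measurable[OF f])
  define s where "s k = 2 ^ k * r" for k :: nat
  define m where "m k = ball_mean f x (s k)" for k
  define \<mu> where "\<mu> k = ball_vol TYPE('n) * s k ^ ?n" for k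
  have s: "s k > 0" for k using r by (simp add: s_def)
  have \<mu>: "\<mu> k > 0" for k using s by (simp add: \<mu>_def)
  have em: "emeasure lebesgue (ball x (s k)) = ennreal (\<mu> k)" for k
    unfolding \<mu>_def by (rule emeasure_lebesgue_ball[OF s])
  have \<mu>k: "\<mu> k = (2 ^ ?n) ^ k * \<mu> 0" for k
  proof -
    have "s k ^ ?n = (2 ^ ?n) ^ k * r ^ ?n"
      by (simp only: s_def power_mult_distrib power_mult[symmetric] mult.commute[of k])
    then show ?thesis by (simp add: \<mu>_def s_def)
  qed
  have N0: "N x r > 0" by (rule N_pos[OF r])
  define E where "E = A * D * 2 powr \<kappa> * N x r"
  have E: "E \<ge> 0" using A D_pos N0 by (simp add: E_def)
  have k2: "(1::real) \<le> 2 powr \<kappa>" using \<kappa>_ge by (intro ge_one_powr_ge_zero) auto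
  have oscN: "deviation f (ball x (s k)) (m k) \<le> ennreal (A * D * (2 powr \<kappa>) ^ k * N x r)" for k
  proof -
    have "deviation f (ball x (s k)) (m k) \<le> ennreal (A * N x (s k))"
      using osc s unfolding osc_bound_def m_def by blast
    also have "\<dots> \<le> ennreal (A * (D * (2 powr \<kappa>) ^ k * N x r))"
      using A N_grow_annuli(1)[OF r] by (intro ennreal_leI mult_left_mono) (auto simp: s_def)
    finally show ?thesis by (simp only: mult.assoc)
  qed
  have q: "1 \<le> 2 powr \<kappa> / 2 ^ ?n"
  proof -
    have "2 ^ ?n = 2 powr real ?n" by (simp add: powr_realpow)
    also have "\<dots> \<le> 2 powr \<kappa>" using \<kappa>_ge by (intro powr_mono) auto
    finally show ?thesis by simp
  qed
  let ?q = "2 powr \<kappa> / 2 ^ ?n"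
  have step: "norm (m k - m (Suc k)) \<le> E / \<mu> 0 * ?q ^ k" for k
  proof -
    have "ennreal (norm (m k - m (Suc k)) * \<mu> k) = ennreal (norm (m k - m (Suc k))) * ennreal (\<mu> k)"
      by (rule ennreal_mult') simp
    also have "\<dots> \<le> deviation f (ball x (s k)) (m (Suc k))"
      unfolding m_def[of k] ball_mean_alt[OF s] \<mu>_def[symmetric]
      by (rule norm_mean_diff_le[OF locally_integrable_ball[OF f] ball_lebesgue em \<mu>])
    also have "\<dots> \<le> deviation f (ball x (s (Suc k))) (m (Suc k))"
    proof (rule nn_set_integral_set_mono)
      show "ball x (s k) \<subseteq> ball x (s (Suc k))" using r by (intro subset_ball) (simp add: s_def)
    qed
    also have "\<dots> \<le> ennreal (A * D * (2 powr \<kappa>) ^ Suc k * N x r)" by (rule oscN)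
    also have "A * D * (2 powr \<kappa>) ^ Suc k * N x r = E * (2 powr \<kappa>) ^ k" by (simp add: E_def)
    finally have "norm (m k - m (Suc k)) * \<mu> k \<le> E * (2 powr \<kappa>) ^ k"
      using E by (subst (asm) ennreal_le_iff) auto
    then have "norm (m k - m (Suc k)) \<le> E * (2 powr \<kappa>) ^ k / \<mu> k" using \<mu>[of k] by (simp add: pos_le_divide_eq)
    also have "\<dots> = E / \<mu> 0 * ?q ^ k" unfolding \<mu>k[of k] by (simp add: power_divide)
    finally show ?thesis .
  qed
  have dist: "norm (m k - m 0) \<le> E / \<mu> 0 * (real k * ?q ^ k)" for k
  proof -
    have "m 0 - m k = (\<Sum>j<k. m j - m (Suc j))" by (simp add: sum_lessThan_telescope')
    then have "norm (m k - m 0) = norm (\<Sum>j<k. m j - m (Suc j))" by (simp add: norm_minus_commute)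
    also have "\<dots> \<le> (\<Sum>j<k. E / \<mu> 0 * ?q ^ j)" by (intro sum_norm_le step)
    also have "\<dots> \<le> (\<Sum>j<k. E / \<mu> 0 * ?q ^ k)"
    proof (intro sum_mono mult_left_mono)
      show "?q ^ j \<le> ?q ^ k" if "j \<in> {..<k}" for j using q that by (intro power_increasing) auto
      show "0 \<le> E / \<mu> 0" using E \<mu>[of 0] by simp
    qed
    also have "\<dots> = E / \<mu> 0 * (real k * ?q ^ k)" by simp
    finally show ?thesis .
  qed
  have d0: "0 \<le> E / \<mu> 0 * (real k * ?q ^ k)"
    using E \<mu>[of 0] q by (intro mult_nonneg_nonneg divide_nonneg_pos zero_le_power) auto
  have "deviation f (ball x (s k)) (m 0) \<le>
      deviation f (ball x (s k)) (m k) + ennreal (norm (m k - m 0)) * emeasure lebesgue (ball x (s k))"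
    by (rule nn_set_integral_triangle[OF fm _ ball_lebesgue]) auto
  also have "\<dots> \<le> ennreal (A * D * (2 powr \<kappa>) ^ k * N x r) + ennreal (E / \<mu> 0 * (real k * ?q ^ k)) * ennreal (\<mu> k)"
    unfolding em by (intro add_mono oscN mult_right_mono ennreal_leI dist) auto
  also have "ennreal (E / \<mu> 0 * (real k * ?q ^ k)) * ennreal (\<mu> k) = ennreal (E / \<mu> 0 * (real k * ?q ^ k) * \<mu> k)"
    by (rule ennreal_mult'[OF d0, symmetric])
  also have "E / \<mu> 0 * (real k * ?q ^ k) * \<mu> k = E * (real k * (2 powr \<kappa>) ^ k)"
    unfolding \<mu>k[of k] using \<mu>[of 0] by (simp add: power_divide)
  also have "ennreal (A * D * (2 powr \<kappa>) ^ k * N x r) \<le> ennreal (E * (2 powr \<kappa>) ^ k)"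
  proof (rule ennreal_leI)
    have "A * D * N x r * (2 powr \<kappa>) ^ k * 1 \<le> A * D * N x r * (2 powr \<kappa>) ^ k * 2 powr \<kappa>"
      using A D_pos N0 by (intro mult_left_mono k2) auto
    then show "A * D * (2 powr \<kappa>) ^ k * N x r \<le> E * (2 powr \<kappa>) ^ k" by (simp add: E_def mult_ac)
  qed
  also have "ennreal (E * (2 powr \<kappa>) ^ k) + ennreal (E * (real k * (2 powr \<kappa>) ^ k)) = ennreal (E * (2 powr \<kappa>) ^ k + E * (real k * (2 powr \<kappa>) ^ k))"
    by (rule ennreal_plus[symmetric]) (use E in auto)
  also have "E * (2 powr \<kappa>) ^ k + E * (real k * (2 powr \<kappa>) ^ k) = E * (real (Suc k) * (2 powr \<kappa>) ^ k)"
    by (simp add: algebra_simps)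
  finally show ?thesis by (simp add: add_right_mono m_def s_def E_def)
qed

definition far_const :: real where
  "far_const = annuli_const * D * 2 powr \<kappa>"

lemma far_const_pos: "far_const > 0"
  unfolding far_const_def using annuli_const_pos D_pos by simp

lemma poisson_oscillation_bound:
  assumes f: "locally_integrable f" and A: "A \<ge> 0" and osc: "osc_bound f A" and r: "r > 0"
  shows "poisson_norm r (\<lambda>y. f y - ball_mean f x r) x \<le> ennreal (far_const * A * N x r / r ^ CARD('n))"
proof -
  let ?B = "A * D * 2 powr \<kappa> * N x r"
  have B: "?B \<ge> 0" using A D_pos N_pos[OF r, of x] by simp
  have m: "(\<lambda>y. norm (f y - ball_mean f x r)) \<in> borel_measurable lebesgue"
    using locally_integrable_measurable[OF f] by simp
  have "poisson_norm r (\<lambda>y. f y - ball_mean f x r) x \<le> ennreal (annuli_const * ?B / r ^ CARD('n))"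
    unfolding annuli_const_def
    by (rule nn_integral_poisson_annuli[OF r m _ B \<kappa>_less nn_integral_oscillation_annuli[OF f A osc r]]) simp
  also have "annuli_const * ?B = far_const * A * N x r" by (simp add: far_const_def)
  finally show ?thesis .
qed

text \<open>Bounded oscillation controls f at infinity: f minus its mean over the unit ball has a
  finite Poisson integral, and constants belong to the class.\<close>

lemma osc_imp_M_Poisson:
  assumes f: "locally_integrable f" and A: "A \<ge> 0" and osc: "osc_bound f A"
  shows "f \<in> M_Poisson"
proof -
  let ?c = "ball_mean f 0 1"
  have "(\<lambda>y. f y - ?c) \<in> M_Poisson"
  proof (rule M_PoissonI[where t=1 and x=0])
    show "(\<lambda>y. f y - ?c) \<in> borel_measurable lebesgue" using locally_integrable_measurable[OF f] by simp
    show "poisson_norm 1 (\<lambda>y. f y - ?c) 0 < \<infinity>"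
      using poisson_oscillation_bound[OF f A osc, of 1 0] by (auto intro: le_less_trans)
  qed simp
  from M_Poisson_add[OF this M_Poisson_const[of ?c]] show ?thesis by simp
qed

definition to_poisson_const :: real where
  "to_poisson_const = 1 + ball_vol TYPE('n) * 3 powr ((real CARD('n) + 1) / 2) * far_const"

lemma to_poisson_const_pos: "to_poisson_const > 0"
  unfolding to_poisson_const_def using far_const_pos by (intro add_pos_nonneg) auto

text \<open>Since P_r fixes constants it may be applied to f minus its mean over the ball; the
  Harnack inequality moves the base point from y to the centre of the ball.\<close>

lemma BMO_imp_poisson_osc:
  assumes f: "locally_integrable f" and A: "A \<ge> 0" and osc: "osc_bound f A"
  shows "poisson_osc_bound f (to_poisson_const * A)"
  unfolding poisson_osc_bound_def
proof (intro allI impI)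
  fix x :: "real ^ 'n" and r :: real assume r: "r > 0"
  let ?\<mu> = "ball_vol TYPE('n) * r ^ CARD('n)" and ?c = "ball_mean f x r" and ?B = "ball x r"
  let ?H = "3 powr ((real CARD('n) + 1) / 2)"
  let ?t = "?H * (far_const * A * N x r / r ^ CARD('n))"
  have N0: "N x r > 0" by (rule N_pos[OF r])
  have t0: "?t \<ge> 0" using far_const_pos A N0 r by simp
  have \<mu>: "?\<mu> > 0" using r by simp
  have fm: "f \<in> borel_measurable lebesgue" by (rule locally_integrable_measurable[OF f])
  have fM: "f \<in> M_Poisson" by (rule osc_imp_M_Poisson[OF f A osc])
  have P: "ennreal (norm (?c - poisson r f y)) \<le> ennreal ?t" if y: "y \<in> ?B" for y
  proof -
    have "poisson r (\<lambda>z. f z - ?c) y = poisson r f y - ?c"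
      using poisson_diff[OF fM M_Poisson_const[of ?c] r, of y] poisson_const[OF r, of ?c y] by simp
    then have "ennreal (norm (?c - poisson r f y)) \<le> poisson_norm r (\<lambda>z. f z - ?c) y"
      using norm_poisson_le[OF r, of "\<lambda>z. f z - ?c" y] by (simp add: norm_minus_commute)
    also have "\<dots> \<le> (\<integral>\<^sup>+z. ennreal ?H * ennreal (poisson_kernel r (x - z) * norm (f z - ?c)) \<partial>lebesgue)"
    proof (rule nn_integral_mono)
      fix z
      have "norm (y - x) \<le> r" using y by (simp add: dist_norm norm_minus_commute)
      from poisson_kernel_Harnack[OF r this, of z]
      have "poisson_kernel r (y - z) * norm (f z - ?c) \<le> ?H * poisson_kernel r (x - z) * norm (f z - ?c)"
        by (intro mult_right_mono) auto
      then show "ennreal (poisson_kernel r (y - z) * norm (f z - ?c)) \<le> ennreal ?H * ennreal (poisson_kernel r (x - z) * norm (f z - ?c))"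
        by (subst ennreal_mult'[symmetric]) (auto simp: mult.assoc intro: ennreal_leI)
    qed
    also have "\<dots> = ennreal ?H * poisson_norm r (\<lambda>z. f z - ?c) x"
      by (rule nn_integral_cmult[OF borel_measurable_poisson_kernel_norm[OF fm]])
    also have "\<dots> \<le> ennreal ?H * ennreal (far_const * A * N x r / r ^ CARD('n))"
      by (intro mult_left_mono poisson_oscillation_bound[OF f A osc r]) simp
    also have "\<dots> = ennreal ?t" by (rule ennreal_mult'[symmetric]) simp
    finally show ?thesis .
  qed
  have "(\<integral>\<^sup>+y\<in>?B. ennreal (norm (f y - poisson r f y)) \<partial>lebesgue) \<le> ennreal (A * N x r + ?t * ?\<mu>)"
  proof (rule nn_ball_integral_triangle[where g="\<lambda>_. ?c"])
    show "deviation f ?B ?c \<le> ennreal (A * N x r)"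
      using osc r unfolding osc_bound_def by blast
    show "norm (?c - poisson r f y) \<le> ?t" if "y \<in> ?B" for y
      using P[OF that] t0 by (subst (asm) ennreal_le_iff) auto
  qed (use fm r A N0 t0 in auto)
  also have "A * N x r + ?t * ?\<mu> = to_poisson_const * A * N x r" using r by (simp add: to_poisson_const_def algebra_simps)
  finally show "(\<integral>\<^sup>+y\<in>?B. ennreal (norm (f y - poisson r f y)) \<partial>lebesgue) \<le> ennreal (to_poisson_const * A * N x r)" .
qed

end

subsection \<open>Tents\<close>

lemma nn_integral_cube_on:
  "(\<integral>\<^sup>+y. u y \<partial>cube_on b k) = (\<integral>\<^sup>+y\<in>hcube b k. u y \<partial>lebesgue)"
  by (rule nn_integral_restrict_space) simp

lemma integral_cube_on:
  "(LINT y|cube_on b k. f y) = (LINT y:hcube b k|lebesgue. f y)" for f :: "_ \<Rightarrow> 'b::{banach, second_countable_topology}"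
  by (simp add: integral_restrict_space set_lebesgue_integral_def)

lemma integrable_cube_on_iff:
  "integrable (cube_on b k) f \<longleftrightarrow> set_integrable lebesgue (hcube b k) f" for f :: "_ \<Rightarrow> 'b::{banach, second_countable_topology}"
  by (simp add: integrable_restrict_space set_integrable_def)

definition cube_center :: "real ^ 'n \<Rightarrow> real \<Rightarrow> real ^ 'n" where
  "cube_center b k = (\<chi> i. b $ i + k / 2)"

text \<open>The radius n k comes from estimating the Euclidean norm by the l1 norm; only constants
  depending on n are lost.\<close>

lemma hcube_subset_ball:
  fixes b :: "real ^ 'n"
  assumes k: "k > 0"
  shows "hcube b k \<subseteq> ball (cube_center b k) (real CARD('n) * k)"
proof
  fix y assume y: "y \<in> hcube b k"
  have "dist (cube_center b k) y \<le> (\<Sum>i\<in>UNIV. \<bar>(cube_center b k - y) $ i\<bar>)"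
    unfolding dist_norm by (rule norm_le_l1_cart)
  also have "\<dots> \<le> (\<Sum>i\<in>(UNIV :: 'n set). k / 2)"
  proof (rule sum_mono)
    fix i
    have "b $ i \<le> y $ i" "y $ i < b $ i + k" using y by (auto simp: hcube_def)
    moreover have "(cube_center b k - y) $ i = b $ i + k / 2 - y $ i" by (simp add: cube_center_def)
    ultimately show "\<bar>(cube_center b k - y) $ i\<bar> \<le> k / 2" by (simp only: abs_le_iff) auto
  qed
  also have "\<dots> < real CARD('n) * k" using k by simp
  finally show "y \<in> ball (cube_center b k) (real CARD('n) * k)" by simp
qed

lemma locally_integrable_cube:
  assumes f: "locally_integrable f" and k: "k > 0"
  shows "integrable (cube_on b k) f"
  unfolding integrable_cube_on_iff
  by (rule set_integrable_subset[OF locally_integrable_ball[OF f] hcube_lebesgue hcube_subset_ball[OF k]])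

lemma cube_avg_alt:
  fixes b :: "real ^ 'n"
  shows "cube_avg b k f = (LINT y:hcube b k|lebesgue. f y) /\<^sub>R k ^ CARD('n)"
  by (simp add: cube_avg_def integral_cube_on divide_inverse)

text \<open>The corner of the cube of side 4 r centred at x, a cube that contains the ball of radius
  2 r.\<close>

definition big_corner :: "real ^ 'n \<Rightarrow> real \<Rightarrow> real ^ 'n" where
  "big_corner x r = (\<chi> i. x $ i - 2 * r)"

lemma ball_subset_big_cube:
  fixes x :: "real ^ 'n"
  shows "ball x (2 * r) \<subseteq> hcube (big_corner x r) (4 * r)"
proof
  fix y assume y: "y \<in> ball x (2 * r)"
  show "y \<in> hcube (big_corner x r) (4 * r)"
    unfolding hcube_def
  proof (intro CollectI allI)
    fix i
    have "\<bar>(x - y) $ i\<bar> \<le> norm (x - y)" by (rule component_le_norm_cart)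
    then have "\<bar>x $ i - y $ i\<bar> < 2 * r" using y by (simp add: dist_norm)
    then show "big_corner x r $ i \<le> y $ i \<and> y $ i < big_corner x r $ i + 4 * r"
      by (simp add: big_corner_def abs_less_iff)
  qed
qed

lemma big_cube_subset_ball:
  fixes x :: "real ^ 'n"
  assumes "r > 0"
  shows "hcube (big_corner x r) (4 * r) \<subseteq> ball x (4 * real CARD('n) * r)"
proof -
  have "cube_center (big_corner x r) (4 * r) = x"
    by (simp add: cube_center_def big_corner_def vec_eq_iff)
  then show ?thesis using hcube_subset_ball[of "4 * r" "big_corner x r"] assms by (simp add: mult_ac)
qed

lemma continuous_poisson_dt:
  fixes x :: "real ^ 'n"
  assumes t: "t > 0"
  shows "continuous_on UNIV (\<lambda>y. poisson_dt t (x - y))"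
proof -
  have "t\<^sup>2 + (norm (x - y))\<^sup>2 > 0" for y :: "real ^ 'n" using t by (intro add_pos_nonneg) auto
  then have nz: "t\<^sup>2 + (norm (x - y))\<^sup>2 \<noteq> 0" for y :: "real ^ 'n" by (metis less_irrefl)
  show ?thesis
    unfolding poisson_dt_def poisson_kernel_def
    by (intro continuous_intros) (use nz t in auto)
qed

lemma borel_measurable_poisson_deriv_slice:
  fixes g :: "real ^ 'n \<Rightarrow> complex"
  assumes g: "g \<in> borel_measurable lebesgue"
  shows "(\<lambda>x. ennreal (c * (norm (poisson_deriv t g x))\<^sup>2)) \<in> borel_measurable borel"
proof -
  have "(\<lambda>x. (t, x)) \<in> measurable borel (borel \<Otimes>\<^sub>M borel :: (real \<times> (real ^ 'n)) measure)"
    by (intro measurable_Pair measurable_const) auto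
  from measurable_compose[OF this borel_measurable_poisson_deriv_pair[OF g]] show ?thesis by simp
qed

lemma borel_measurable_poisson_deriv_energy:
  fixes g :: "real ^ 'n \<Rightarrow> complex"
  assumes g: "g \<in> borel_measurable lebesgue"
  shows "(\<lambda>t. \<integral>\<^sup>+x. ennreal (t * (norm (poisson_deriv t g x))\<^sup>2) \<partial>lebesgue) \<in> borel_measurable borel"
proof -
  have id2: "(\<lambda>z. (fst z, snd z)) \<in> measurable (borel \<Otimes>\<^sub>M lebesgue) (borel \<Otimes>\<^sub>M borel :: (real \<times> (real ^ 'n)) measure)"
    by (intro measurable_Pair measurable_fst measurable_compose[OF measurable_snd id_lebesgue_borel])
  have "(\<lambda>z. poisson_deriv (fst z) g (snd z)) \<in> borel_measurable (borel \<Otimes>\<^sub>M lebesgue)"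
    using measurable_compose[OF id2 borel_measurable_poisson_deriv_pair[OF g]] by simp
  then have "(\<lambda>(t, x). ennreal (t * (norm (poisson_deriv t g x))\<^sup>2)) \<in> borel_measurable (borel \<Otimes>\<^sub>M lebesgue)"
    unfolding split_def by measurable
  from sigma_finite_measure.borel_measurable_nn_integral[OF sigma_finite_lebesgue this] show ?thesis .
qed

lemma poisson_deriv_const:
  assumes t: "t > 0"
  shows "poisson_deriv t (\<lambda>_. c) (x :: real ^ 'n) = 0"
proof -
  have "((\<lambda>s. poisson s (\<lambda>_. c) x) has_vector_derivative poisson_deriv t (\<lambda>_. c) x) (at t)"
    by (rule has_vector_derivative_poisson(1)[OF M_Poisson_const t])
  moreover have "((\<lambda>s. poisson s (\<lambda>_. c) x) has_vector_derivative 0) (at t)"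
    by (rule has_vector_derivative_transform_within_open[where S="{0<..}" and f="\<lambda>_. c"])
      (use t in \<open>auto simp: poisson_const\<close>)
  ultimately show ?thesis by (rule vector_derivative_unique_at)
qed

lemma poisson_deriv_add:
  fixes f g :: "real ^ 'n \<Rightarrow> complex"
  assumes "f \<in> M_Poisson" "g \<in> M_Poisson" "t > 0"
  shows "poisson_deriv t (\<lambda>x. f x + g x) x = poisson_deriv t f x + poisson_deriv t g x"
  unfolding poisson_deriv_def scaleR_add_right
  by (intro Bochner_Integration.integral_add has_vector_derivative_poisson(2) assms)

lemma M_Poisson_indicator:
  assumes f: "f \<in> M_Poisson" and S: "S \<in> sets lebesgue"
  shows "(\<lambda>x. indicator S x *\<^sub>R f x) \<in> M_Poisson"
proof -
  have fm: "f \<in> borel_measurable lebesgue" by (rule M_Poisson_measurable[OF f])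
  have m: "(\<lambda>x. indicator S x *\<^sub>R f x) \<in> borel_measurable lebesgue" using fm S by simp
  show ?thesis
  proof (rule M_PoissonI[OF m, where t=1 and x=0])
    have "poisson_norm 1 (\<lambda>y. indicator S y *\<^sub>R f y) 0 \<le>
      poisson_norm 1 f 0"
      by (intro nn_integral_mono ennreal_leI mult_left_mono) (auto simp: indicator_def)
    also have "\<dots> < \<infinity>" by (rule M_Poisson_nn_integral_finite[OF f]) simp
    finally show "poisson_norm 1 (\<lambda>y. indicator S y *\<^sub>R f y) 0 < \<infinity>" .
  qed simp
qed

section \<open>The Carleson estimate for an abstract gauge\<close>

lemma ennreal_two_times: "2 * ennreal X = ennreal (2 * X)"
  using ennreal_mult'[of 2 X] by simp

text \<open>For y far from the ball the kernel at time t is at most a multiple of t / r times the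
  kernel at time r. The factor t cancels the 1 / t of the time derivative, so the far part of f can
  be bounded uniformly in t.\<close>

lemma poisson_kernel_far:
  fixes x x0 y :: "real ^ 'n"
  assumes t: "t > 0" and r: "r > 0" and x: "norm (x - x0) \<le> r" and y: "2 * r \<le> norm (x0 - y)"
  shows "poisson_kernel t (x - y) \<le> t / r * 5 powr ((real CARD('n) + 1) / 2) * poisson_kernel r (x0 - y)"
proof (rule poisson_kernel_compare[OF t r])
  let ?d = "norm (x0 - y)" and ?e = "norm (x - y)"
  have "?d \<le> norm (x0 - x) + ?e" using norm_triangle_ineq[of "x0 - x" "x - y"] by simp
  then have "?d \<le> 2 * ?e" using x y by (simp add: norm_minus_commute)
  then have "?d\<^sup>2 \<le> (2 * ?e)\<^sup>2" by (intro power_mono) auto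
  then have 1: "?d\<^sup>2 \<le> 4 * ?e\<^sup>2" by (simp add: power_mult_distrib)
  have "(2 * r)\<^sup>2 \<le> ?d\<^sup>2" using y r by (intro power_mono) auto
  then have 2: "4 * r\<^sup>2 \<le> ?d\<^sup>2" by (simp add: power_mult_distrib)
  have "a + d \<le> 5 * (b + e)" if "d \<le> 4 * e" "4 * a \<le> d" "0 \<le> b" for a b d e :: real
    using that by (simp add: algebra_simps)
  from this[OF 1 2] show "r\<^sup>2 + ?d\<^sup>2 \<le> 5 * (t\<^sup>2 + ?e\<^sup>2)" by simp
qed

text \<open>\<open>local_weight\<close> provides what the dyadic inequality asks for: a weight whose
  integral over each dyadic subcube dominates the gauge of a circumscribed ball. Its square integral
  is required to have the size of that of the constant N x r / r^n on the big cube.\<close>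

locale carleson_gauge = ball_gauge N \<kappa> D for N :: "real ^ 'n \<Rightarrow> real \<Rightarrow> real" and \<kappa> D +
  fixes E :: real
  assumes E_nonneg: "E \<ge> 0"
    and local_weight: "r > 0 \<Longrightarrow> \<exists>w. integrable (cube_on (big_corner x r) (4 * r)) w \<and>
      integrable (cube_on (big_corner x r) (4 * r)) (\<lambda>y. (w y)\<^sup>2) \<and>
      (LINT y|cube_on (big_corner x r) (4 * r). (w y)\<^sup>2) \<le> E * (N x r)\<^sup>2 / r ^ CARD('n) \<and>
      (\<forall>b k. dyadic_sub (big_corner x r) (4 * r) b k \<longrightarrow>
         N (cube_center b k) (real CARD('n) * k) \<le> (LINT y|cube_on b k. w y))"
begin

text \<open>The oscillation condition speaks of balls. The circumscribed ball, together with the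
  factor 2 for exchanging the mean, transfers it to cubes.\<close>

lemma cube_oscillation:
  assumes f: "locally_integrable f" and A: "A \<ge> 0" and osc: "osc_bound f A" and k: "k > 0"
  shows "(LINT y|cube_on b k. norm (f y - cube_avg b k f)) \<le> 2 * A * N (cube_center b k) (real CARD('n) * k)"
proof -
  let ?x = "cube_center b k" and ?r = "real CARD('n) * k"
  have r: "?r > 0" using k by simp
  have fm: "f \<in> borel_measurable lebesgue" by (rule locally_integrable_measurable[OF f])
  have fi: "integrable (cube_on b k) f" by (rule locally_integrable_cube[OF f k])
  have int: "integrable (cube_on b k) (\<lambda>y. norm (f y - cube_avg b k f))"
    by (intro integrable_norm Bochner_Integration.integrable_diff fi integrable_cube_const k)
  have "ennreal (LINT y|cube_on b k. norm (f y - cube_avg b k f)) = (\<integral>\<^sup>+y. ennreal (norm (f y - cube_avg b k f)) \<partial>cube_on b k)"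
    by (rule nn_integral_eq_integral[OF int, symmetric]) simp
  also have "\<dots> \<le> 2 * deviation f (hcube b k) (ball_mean f ?x ?r)"
    unfolding nn_integral_cube_on cube_avg_alt
    by (rule nn_mean_oscillation_le[OF fm fi[unfolded integrable_cube_on_iff] hcube_lebesgue emeasure_hcube(1)[OF k]]) (use k in simp)
  also have "\<dots> \<le> 2 * deviation f (ball ?x ?r) (ball_mean f ?x ?r)"
    by (intro mult_left_mono nn_set_integral_set_mono hcube_subset_ball k) simp
  also have "\<dots> \<le> 2 * ennreal (A * N ?x ?r)"
    using osc r unfolding osc_bound_def by (intro mult_left_mono) auto
  also have "\<dots> = ennreal (2 * A * N ?x ?r)"
    using ennreal_mult'[of 2 "A * N ?x ?r"] by (simp add: mult.assoc)
  finally show ?thesis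
    using A N_pos[OF r, of ?x] by (subst (asm) ennreal_le_iff) auto
qed

text \<open>(n + 3) / 2 is the constant of the square function; 128 * 2^n is 32 * 2^n from the
  dyadic inequality times 4 from squaring the weight 2 A w.\<close>

definition local_const :: real where
  "local_const = (real CARD('n) + 3) / 2 * (128 * 2 ^ CARD('n) * E)"

lemma local_const_nonneg: "local_const \<ge> 0"
  unfolding local_const_def using E_nonneg by simp

text \<open>
  The square function estimate is applied to the dyadic averages of \<open>f\<close>; Fatou's lemma then
  passes to \<open>f\<close> itself, because the averages converge weakly to \<open>f\<close>.
\<close>

lemma local_square_function:
  fixes x :: "real ^ 'n"
  assumes f: "locally_integrable f" and A: "A \<ge> 0" and osc: "osc_bound f A" and r: "r > 0"
  defines "Q \<equiv> hcube (big_corner x r) (4 * r)" and "c \<equiv> cube_avg (big_corner x r) (4 * r) f"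
  shows "(\<integral>\<^sup>+t\<in>{0<..}. (\<integral>\<^sup>+y. ennreal (t * (norm (poisson_deriv t (\<lambda>y. indicator Q y *\<^sub>R (f y - c)) y))\<^sup>2) \<partial>lebesgue) \<partial>lborel) \<le>
    ennreal (local_const * A\<^sup>2 * (N x r)\<^sup>2 / r ^ CARD('n))"
proof -
  let ?a = "big_corner x r" and ?h = "4 * r"
  have h: "?h > 0" using r by simp
  have fm[measurable]: "f \<in> borel_measurable lebesgue" by (rule locally_integrable_measurable[OF f])
  have fi: "integrable (cube_on ?a ?h) f" by (rule locally_integrable_cube[OF f h])
  have Qm[measurable]: "Q \<in> sets lebesgue" by (simp add: Q_def)
  obtain w where w: "integrable (cube_on ?a ?h) w" "integrable (cube_on ?a ?h) (\<lambda>y. (w y)\<^sup>2)"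
    "(LINT y|cube_on ?a ?h. (w y)\<^sup>2) \<le> E * (N x r)\<^sup>2 / r ^ CARD('n)"
    "\<And>b k. dyadic_sub ?a ?h b k \<Longrightarrow> N (cube_center b k) (real CARD('n) * k) \<le> (LINT y|cube_on b k. w y)"
    using local_weight[OF r, of x] by blast
  let ?W = "\<lambda>y. 2 * A * w y"
  let ?K = "128 * 2 ^ CARD('n) * E * A\<^sup>2 * (N x r)\<^sup>2 / r ^ CARD('n)"
  have avg: "(LINT y|cube_on ?a ?h. (norm (dyadic_avg M ?a ?h f y - c))\<^sup>2) \<le> ?K" for M
  proof -
    have "(LINT y|cube_on ?a ?h. (norm (dyadic_avg M ?a ?h f y - c))\<^sup>2) \<le> 32 * 2 ^ CARD('n) * (LINT y|cube_on ?a ?h. (?W y)\<^sup>2)"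
      unfolding c_def
    proof (rule dyadic_oscillation_L2[OF h fi])
      show "integrable (cube_on ?a ?h) ?W" using w(1) by simp
      show "integrable (cube_on ?a ?h) (\<lambda>y. (?W y)\<^sup>2)" using w(2) by (simp add: power_mult_distrib)
      fix b k assume bk: "dyadic_sub ?a ?h b k"
      have k: "k > 0" by (rule dyadic_sub_props(1)[OF bk h])
      have "(LINT y|cube_on b k. norm (f y - cube_avg b k f)) \<le> 2 * A * N (cube_center b k) (real CARD('n) * k)"
        by (rule cube_oscillation[OF f A osc k])
      also have "\<dots> \<le> 2 * A * (LINT y|cube_on b k. w y)"
        using A by (intro mult_left_mono w(4)[OF bk]) simp
      finally show "(LINT y|cube_on b k. norm (f y - cube_avg b k f)) \<le> (LINT y|cube_on b k. ?W y)" by simp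
    qed
    also have "(LINT y|cube_on ?a ?h. (?W y)\<^sup>2) = 4 * A\<^sup>2 * (LINT y|cube_on ?a ?h. (w y)\<^sup>2)"
      by (simp add: power_mult_distrib)
    also have "32 * 2 ^ CARD('n) * (4 * A\<^sup>2 * (LINT y|cube_on ?a ?h. (w y)\<^sup>2)) \<le> 32 * 2 ^ CARD('n) * (4 * A\<^sup>2 * (E * (N x r)\<^sup>2 / r ^ CARD('n)))"
      by (intro mult_left_mono w(3)) auto
    finally show ?thesis by (simp add: mult_ac)
  qed
  define g where "g M y = indicator Q y *\<^sub>R (dyadic_avg M ?a ?h f y - c)" for M y
  define gl where "gl y = indicator Q y *\<^sub>R (f y - c)" for y
  have ig: "integrable lebesgue (g M)" for M
  proof -
    have "integrable (cube_on ?a ?h) (\<lambda>y. dyadic_avg M ?a ?h f y - c)"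
      by (rule integrable_cube_dyadic_avg[OF h, where \<Phi>="\<lambda>z. z - c"]) (intro continuous_intros)
    then show ?thesis unfolding integrable_cube_on_iff set_integrable_def g_def[abs_def] Q_def .
  qed
  have g2: "square_norm (g M) \<le> ennreal ?K" for M
  proof -
    have "square_norm (g M) = (\<integral>\<^sup>+y. ennreal ((norm (dyadic_avg M ?a ?h f y - c))\<^sup>2) \<partial>cube_on ?a ?h)"
      unfolding nn_integral_cube_on by (intro nn_integral_cong) (auto simp: g_def Q_def indicator_def)
    also have "\<dots> = ennreal (LINT y|cube_on ?a ?h. (norm (dyadic_avg M ?a ?h f y - c))\<^sup>2)"
      by (rule nn_integral_eq_integral, rule integrable_cube_dyadic_avg[OF h, where \<Phi>="\<lambda>z. (norm (z - c))\<^sup>2"])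
        (auto intro!: continuous_intros)
    also have "\<dots> \<le> ennreal ?K" by (intro ennreal_leI avg)
    finally show ?thesis .
  qed
  have lim: "(\<lambda>M. poisson_deriv t (g M) y) \<longlonglongrightarrow> poisson_deriv t gl y" if t: "t > 0" for t y
  proof -
    let ?k = "\<lambda>z. poisson_dt t (y - z)"
    have kc: "continuous_on UNIV ?k" by (rule continuous_poisson_dt[OF t])
    have ik: "integrable (cube_on ?a ?h) (\<lambda>z. ?k z *\<^sub>R u z)" if "integrable lebesgue (\<lambda>z. indicator Q z *\<^sub>R u z)" for u :: "real ^ 'n \<Rightarrow> complex"
    proof -
      have "integrable lebesgue (\<lambda>z. ?k z *\<^sub>R (indicator Q z *\<^sub>R u z))"
        by (rule has_vector_derivative_poisson(2)[OF integrable_M_Poisson[OF that] t])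
      then show ?thesis
        unfolding integrable_cube_on_iff unfolding set_integrable_def Q_def[symmetric] by (simp add: mult.commute)
    qed
    have c0: "integrable lebesgue (\<lambda>z. indicator Q z *\<^sub>R c)"
      using integrable_cube_const[OF h, of ?a c] unfolding integrable_cube_on_iff set_integrable_def Q_def .
    have f0: "integrable lebesgue (\<lambda>z. indicator Q z *\<^sub>R f z)"
      using fi unfolding integrable_cube_on_iff set_integrable_def Q_def .
    have d0: "integrable lebesgue (\<lambda>z. indicator Q z *\<^sub>R dyadic_avg M ?a ?h f z)" for M
      using integrable_cube_dyadic_avg[OF h, where \<Phi>="\<lambda>z. z" and N=M and a="?a" and h="?h" and f=f and b="?a"]
      unfolding integrable_cube_on_iff set_integrable_def Q_def by simp
    have eq: "poisson_deriv t (\<lambda>z. indicator Q z *\<^sub>R (u z - c)) y = (LINT z|cube_on ?a ?h. ?k z *\<^sub>R u z) - (LINT z|cube_on ?a ?h. ?k z *\<^sub>R c)"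
      if u: "integrable lebesgue (\<lambda>z. indicator Q z *\<^sub>R u z)" for u :: "real ^ 'n \<Rightarrow> complex"
    proof -
      have "poisson_deriv t (\<lambda>z. indicator Q z *\<^sub>R (u z - c)) y = (LINT z|cube_on ?a ?h. ?k z *\<^sub>R (u z - c))"
        unfolding poisson_deriv_def integral_cube_on unfolding set_lebesgue_integral_def Q_def[symmetric]
        by (intro Bochner_Integration.integral_cong) (auto simp: mult.commute)
      also have "\<dots> = (LINT z|cube_on ?a ?h. ?k z *\<^sub>R u z) - (LINT z|cube_on ?a ?h. ?k z *\<^sub>R c)"
        unfolding scaleR_diff_right by (rule Bochner_Integration.integral_diff[OF ik[OF u] ik[OF c0]])
      finally show ?thesis .
    qed
    show ?thesis
      unfolding g_def[abs_def] gl_def[abs_def] eq[OF d0] eq[OF f0]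
      by (intro tendsto_diff tendsto_const dyadic_avg_weak_limit[OF h fi kc])
  qed
  let ?e = "\<lambda>u t y. ennreal (t * (norm (poisson_deriv t u y))\<^sup>2)"
  have gm: "g M \<in> borel_measurable lebesgue" for M using ig[of M] by simp
  have inner: "(\<integral>\<^sup>+y. ?e gl t y \<partial>lebesgue) * indicator {0<..} t \<le> liminf (\<lambda>M. (\<integral>\<^sup>+y. ?e (g M) t y \<partial>lebesgue) * indicator {0<..} t)" for t
  proof (cases "t > 0")
    case True
    have "(\<lambda>M. ?e (g M) t y) \<longlonglongrightarrow> ?e gl t y" for y
      by (intro tendsto_ennrealI tendsto_intros lim[OF True])
    then have "?e gl t y = liminf (\<lambda>M. ?e (g M) t y)" for y
      using lim_imp_Liminf[OF sequentially_bot] by metis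
    then have "(\<integral>\<^sup>+y. ?e gl t y \<partial>lebesgue) = (\<integral>\<^sup>+y. liminf (\<lambda>M. ?e (g M) t y) \<partial>lebesgue)" by simp
    also have "\<dots> \<le> liminf (\<lambda>M. \<integral>\<^sup>+y. ?e (g M) t y \<partial>lebesgue)"
      by (intro nn_integral_liminf borel_measurable_lebesgue_borel borel_measurable_poisson_deriv_slice gm)
    finally show ?thesis using True by simp
  qed simp
  have "(\<integral>\<^sup>+t\<in>{0<..}. (\<integral>\<^sup>+y. ?e gl t y \<partial>lebesgue) \<partial>lborel) \<le> (\<integral>\<^sup>+t. liminf (\<lambda>M. (\<integral>\<^sup>+y. ?e (g M) t y \<partial>lebesgue) * indicator {0<..} t) \<partial>lborel)"
    by (intro nn_integral_mono inner)
  also have "\<dots> \<le> liminf (\<lambda>M. \<integral>\<^sup>+t\<in>{0<..}. (\<integral>\<^sup>+y. ?e (g M) t y \<partial>lebesgue) \<partial>lborel)"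
    by (intro nn_integral_liminf borel_measurable_times_ennreal)
      (use borel_measurable_poisson_deriv_energy[OF gm] in auto)
  also have "\<dots> \<le> liminf (\<lambda>M :: nat. ennreal ((real CARD('n) + 3) / 2 * ?K))"
  proof (intro Liminf_mono always_eventually allI)
    fix M
    have "(\<integral>\<^sup>+t\<in>{0<..}. (\<integral>\<^sup>+y. ?e (g M) t y \<partial>lebesgue) \<partial>lborel) \<le> ennreal ((real CARD('n) + 3) / 2) * square_norm (g M)"
      by (rule square_function_L2[OF ig]) (use g2[of M] in \<open>auto intro: le_less_trans\<close>)
    also have "\<dots> \<le> ennreal ((real CARD('n) + 3) / 2) * ennreal ?K" by (intro mult_left_mono g2) simp
    also have "\<dots> = ennreal ((real CARD('n) + 3) / 2 * ?K)" by (rule ennreal_mult'[symmetric]) simp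
    finally show "(\<integral>\<^sup>+t\<in>{0<..}. (\<integral>\<^sup>+y. ?e (g M) t y \<partial>lebesgue) \<partial>lborel) \<le> ennreal ((real CARD('n) + 3) / 2 * ?K)" .
  qed
  also have "\<dots> = ennreal ((real CARD('n) + 3) / 2 * ?K)" by (rule Liminf_const) simp
  also have "(real CARD('n) + 3) / 2 * ?K = local_const * A\<^sup>2 * (N x r)\<^sup>2 / r ^ CARD('n)"
    by (simp add: local_const_def)
  finally show ?thesis unfolding gl_def[abs_def] .
qed

text \<open>The summand 1 belongs to the deviation from the mean over the ball. The other one pays
  for passing to the average over the big cube, on which the kernel at time r has a lower bound
  because the cube lies in the ball of radius 4 n r.\<close>

definition mean_const :: real where
  "mean_const = (1 + (1 + (4 * real CARD('n))\<^sup>2) powr ((real CARD('n) + 1) / 2) / (poisson_const TYPE('n) * 4 ^ CARD('n))) * far_const"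

lemma mean_const_nonneg: "mean_const \<ge> 0"
  unfolding mean_const_def using far_const_pos poisson_const_pos[where 'n='n]
  by (intro mult_nonneg_nonneg add_nonneg_nonneg divide_nonneg_nonneg) auto

lemma poisson_big_cube_bound:
  fixes x :: "real ^ 'n"
  assumes f: "locally_integrable f" and A: "A \<ge> 0" and osc: "osc_bound f A" and r: "r > 0"
  defines "c \<equiv> cube_avg (big_corner x r) (4 * r) f"
  shows "poisson_norm r (\<lambda>y. f y - c) x \<le> ennreal (mean_const * A * N x r / r ^ CARD('n))"
proof -
  let ?n = "CARD('n)" and ?a = "big_corner x r" and ?h = "4 * r" and ?m = "ball_mean f x r"
  let ?F = "far_const * A * N x r / r ^ ?n"
  let ?P = "(1 + (4 * real ?n)\<^sup>2) powr ((real ?n + 1) / 2)" and ?c0 = "poisson_const TYPE('n)"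
  have h: "?h > 0" using r by simp
  have c0: "?c0 > 0" by (rule poisson_const_pos)
  have P: "?P > 0"
  proof -
    have "1 + (4 * real ?n)\<^sup>2 > 0" by (intro add_pos_nonneg) auto
    then show ?thesis by simp
  qed
  have F0: "?F \<ge> 0" using far_const_pos A N_pos[OF r, of x] r by simp
  have fm[measurable]: "f \<in> borel_measurable lebesgue" by (rule locally_integrable_measurable[OF f])
  have bound: "poisson_norm r (\<lambda>y. f y - ?m) x \<le> ennreal ?F"
    by (rule poisson_oscillation_bound[OF f A osc r])
  have fi: "set_integrable lebesgue (hcube ?a ?h) f"
    using locally_integrable_cube[OF f h] unfolding integrable_cube_on_iff .
  have mP: "(\<lambda>y. ennreal (poisson_kernel r (x - y) * norm (f y - ?m))) \<in> borel_measurable lebesgue"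
    by (rule borel_measurable_poisson_kernel_norm[OF fm])
  have dist: "norm (c - ?m) \<le> ?P / (?c0 * 4 ^ ?n) * ?F"
  proof -
    have "ennreal (norm (c - ?m)) * ennreal (?h ^ ?n) \<le> deviation f (hcube ?a ?h) ?m"
      unfolding c_def cube_avg_alt
      by (rule norm_mean_diff_le[OF fi hcube_lebesgue emeasure_hcube(1)[OF h]]) (use r in simp)
    also have "\<dots> \<le> (\<integral>\<^sup>+y. ennreal (?P * r ^ ?n / ?c0) * ennreal (poisson_kernel r (x - y) * norm (f y - ?m)) \<partial>lebesgue)"
    proof (rule nn_integral_mono)
      fix y
      show "ennreal (norm (f y - ?m)) * indicator (hcube ?a ?h) y \<le> ennreal (?P * r ^ ?n / ?c0) * ennreal (poisson_kernel r (x - y) * norm (f y - ?m))"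
      proof (cases "y \<in> hcube ?a ?h")
        case True
        then have "norm (x - y) \<le> (4 * real ?n) * r" using big_cube_subset_ball[OF r, of x] by (auto simp: dist_norm)
        from poisson_kernel_ge[OF r this] have "?c0 / (?P * r ^ ?n) \<le> poisson_kernel r (x - y)" .
        then have "1 \<le> ?P * r ^ ?n / ?c0 * poisson_kernel r (x - y)"
          using c0 P r by (simp add: field_simps)
        then have "1 * norm (f y - ?m) \<le> ?P * r ^ ?n / ?c0 * poisson_kernel r (x - y) * norm (f y - ?m)"
          by (intro mult_right_mono) auto
        then show ?thesis using True c0 P r
          by (subst ennreal_mult'[symmetric]) (auto simp: mult.assoc intro!: ennreal_leI)
      qed simp
    qed
    also have "\<dots> = ennreal (?P * r ^ ?n / ?c0) * poisson_norm r (\<lambda>y. f y - ?m) x"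
      by (rule nn_integral_cmult[OF mP])
    also have "\<dots> \<le> ennreal (?P * r ^ ?n / ?c0) * ennreal ?F" by (intro mult_left_mono bound) simp
    also have "\<dots> = ennreal (?P * r ^ ?n / ?c0 * ?F)"
      by (rule ennreal_mult'[symmetric]) (use c0 P r in simp)
    finally have "ennreal (norm (c - ?m) * ?h ^ ?n) \<le> ennreal (?P * r ^ ?n / ?c0 * ?F)"
      by (subst ennreal_mult') auto
    then have "norm (c - ?m) * ?h ^ ?n \<le> ?P * r ^ ?n / ?c0 * ?F"
    proof (subst (asm) ennreal_le_iff)
      show "0 \<le> ?P * r ^ ?n / ?c0 * ?F" by (rule mult_nonneg_nonneg[OF _ F0]) (use c0 P r in simp)
    qed
    then have "norm (c - ?m) \<le> ?P * r ^ ?n / ?c0 * ?F / ?h ^ ?n"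
      by (simp only: pos_le_divide_eq[OF zero_less_power[OF h]])
    also have "\<dots> = ?P / (?c0 * 4 ^ ?n) * ?F" using r by (simp add: power_mult_distrib)
    finally show ?thesis .
  qed
  have "poisson_norm r (\<lambda>y. f y - c) x \<le>
    (\<integral>\<^sup>+y. ennreal (poisson_kernel r (x - y) * norm (f y - ?m)) + ennreal (norm (c - ?m)) * ennreal (poisson_kernel r (x - y)) \<partial>lebesgue)"
  proof (rule nn_integral_mono)
    fix y
    have "norm (f y - c) \<le> norm (f y - ?m) + norm (c - ?m)"
      using norm_triangle_ineq4[of "f y - ?m" "c - ?m"] by simp
    then have "poisson_kernel r (x - y) * norm (f y - c) \<le> poisson_kernel r (x - y) * (norm (f y - ?m) + norm (c - ?m))"
      using r by (intro mult_left_mono) auto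
    then have "ennreal (poisson_kernel r (x - y) * norm (f y - c)) \<le> ennreal (poisson_kernel r (x - y) * norm (f y - ?m) + norm (c - ?m) * poisson_kernel r (x - y))"
      by (intro ennreal_leI) (simp add: algebra_simps)
    also have "\<dots> = ennreal (poisson_kernel r (x - y) * norm (f y - ?m)) + ennreal (norm (c - ?m) * poisson_kernel r (x - y))"
      using r by (intro ennreal_plus) auto
    also have "ennreal (norm (c - ?m) * poisson_kernel r (x - y)) = ennreal (norm (c - ?m)) * ennreal (poisson_kernel r (x - y))"
      by (rule ennreal_mult') simp
    finally show "ennreal (poisson_kernel r (x - y) * norm (f y - c)) \<le> ennreal (poisson_kernel r (x - y) * norm (f y - ?m)) + ennreal (norm (c - ?m)) * ennreal (poisson_kernel r (x - y))" .
  qed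
  also have "\<dots> = poisson_norm r (\<lambda>y. f y - ?m) x + ennreal (norm (c - ?m))"
  proof -
    have mp: "(\<lambda>y. ennreal (poisson_kernel r (x - y))) \<in> borel_measurable lebesgue"
      by (rule measurable_compose[OF lebesgue_measurable_poisson_kernel(1) measurable_ennreal])
    show ?thesis
      using mP mp by (subst nn_integral_add) (auto simp: nn_integral_cmult nn_integral_poisson_kernel[OF r])
  qed
  also have "\<dots> \<le> ennreal ?F + ennreal (?P / (?c0 * 4 ^ ?n) * ?F)"
    by (intro add_mono bound ennreal_leI dist)
  also have "\<dots> = ennreal (?F + ?P / (?c0 * 4 ^ ?n) * ?F)"
    by (rule ennreal_plus[symmetric, OF F0 mult_nonneg_nonneg[OF _ F0]]) (use c0 P in simp)
  also have "?F + ?P / (?c0 * 4 ^ ?n) * ?F = mean_const * A * N x r / r ^ ?n"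
    by (simp add: mean_const_def algebra_simps add_divide_distrib)
  finally show ?thesis .
qed

definition far_tent_const :: real where
  "far_tent_const = (real CARD('n) + 2) * 5 powr ((real CARD('n) + 1) / 2) * mean_const"

lemma far_tent_const_nonneg: "far_tent_const \<ge> 0"
  unfolding far_tent_const_def using mean_const_nonneg by simp

text \<open>Outside the big cube y has distance at least 2 r from the centre, so the derivative
  kernel at time t is at most C / r times the kernel at time r and base point x0. The Poisson
  integral of |f - c| at x0 is known from \<open>poisson_big_cube_bound\<close>.\<close>

lemma far_derivative_bound:
  fixes x0 :: "real ^ 'n"
  assumes f: "locally_integrable f" and A: "A \<ge> 0" and osc: "osc_bound f A" and r: "r > 0"
    and t: "t > 0" and x: "norm (x - x0) \<le> r"
  defines "Q \<equiv> hcube (big_corner x0 r) (4 * r)" and "c \<equiv> cube_avg (big_corner x0 r) (4 * r) f"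
  shows "norm (poisson_deriv t (\<lambda>y. indicator (- Q) y *\<^sub>R (f y - c)) x) \<le> far_tent_const * A * N x0 r / (r * r ^ CARD('n))"
proof -
  let ?H = "5 powr ((real CARD('n) + 1) / 2)" and ?n = "real CARD('n) + 2"
  let ?g = "\<lambda>y. indicator (- Q) y *\<^sub>R (f y - c)"
  have fM: "f \<in> M_Poisson" by (rule osc_imp_M_Poisson[OF f A osc])
  have fcM: "(\<lambda>y. f y - c) \<in> M_Poisson" by (rule M_Poisson_diff[OF fM M_Poisson_const])
  have gM: "?g \<in> M_Poisson" by (rule M_Poisson_indicator[OF fcM]) (simp add: Q_def)
  have N0: "N x0 r > 0" by (rule N_pos[OF r])
  have m: "(\<lambda>y. ennreal (poisson_kernel r (x0 - y) * norm (f y - c))) \<in> borel_measurable lebesgue"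
    by (rule borel_measurable_poisson_kernel_norm[OF M_Poisson_measurable[OF fM]])
  have "ennreal (norm (poisson_deriv t ?g x)) \<le> (\<integral>\<^sup>+y. ennreal (norm (poisson_dt t (x - y) *\<^sub>R ?g y)) \<partial>lebesgue)"
    unfolding poisson_deriv_def by (rule integral_norm_bound_ennreal[OF has_vector_derivative_poisson(2)[OF gM t]])
  also have "\<dots> \<le> (\<integral>\<^sup>+y. ennreal (?n / r * ?H) * ennreal (poisson_kernel r (x0 - y) * norm (f y - c)) \<partial>lebesgue)"
  proof (rule nn_integral_mono)
    fix y
    show "ennreal (norm (poisson_dt t (x - y) *\<^sub>R ?g y)) \<le> ennreal (?n / r * ?H) * ennreal (poisson_kernel r (x0 - y) * norm (f y - c))"
    proof (cases "y \<in> Q")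
      case False
      then have "y \<notin> ball x0 (2 * r)" using ball_subset_big_cube[of x0 r] by (auto simp: Q_def)
      then have y: "2 * r \<le> norm (x0 - y)" by (simp add: dist_norm)
      have "\<bar>poisson_dt t (x - y)\<bar> \<le> ?n / t * poisson_kernel t (x - y)" by (rule abs_poisson_dt_le[OF t])
      also have "\<dots> \<le> ?n / t * (t / r * ?H * poisson_kernel r (x0 - y))"
        using t by (intro mult_left_mono poisson_kernel_far[OF t r x y]) auto
      also have "\<dots> = ?n / r * ?H * poisson_kernel r (x0 - y)" using t by simp
      finally have "\<bar>poisson_dt t (x - y)\<bar> * norm (f y - c) \<le> ?n / r * ?H * poisson_kernel r (x0 - y) * norm (f y - c)"
        by (intro mult_right_mono) auto
      then show ?thesis using False r
        by (subst ennreal_mult'[symmetric]) (auto simp: mult.assoc intro!: ennreal_leI)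
    qed simp
  qed
  also have "\<dots> = ennreal (?n / r * ?H) * poisson_norm r (\<lambda>y. f y - c) x0"
    by (rule nn_integral_cmult[OF m])
  also have "\<dots> \<le> ennreal (?n / r * ?H) * ennreal (mean_const * A * N x0 r / r ^ CARD('n))"
    unfolding c_def by (intro mult_left_mono poisson_big_cube_bound[OF f A osc r]) simp
  also have "\<dots> = ennreal (?n / r * ?H * (mean_const * A * N x0 r / r ^ CARD('n)))"
    by (rule ennreal_mult'[symmetric]) (use r in simp)
  also have "?n / r * ?H * (mean_const * A * N x0 r / r ^ CARD('n)) = far_tent_const * A * N x0 r / (r * r ^ CARD('n))"
    by (simp add: far_tent_const_def)
  finally show ?thesis
    using far_tent_const_nonneg A N0 r by (subst (asm) ennreal_le_iff) auto
qed

definition tent_const :: real where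
  "tent_const = 2 * local_const + 2 * ball_vol TYPE('n) * far_tent_const\<^sup>2"

lemma tent_const_nonneg: "tent_const \<ge> 0"
  unfolding tent_const_def using local_const_nonneg by simp

text \<open>f = g + g' + c, where g is the part of f - c on the big cube; the constant has zero
  derivative. The local part is covered by the square function. The derivative of the far part is
  bounded by a constant F, and integrating t F^2 over the tent gives at most a multiple of r^2 F^2
  |B|, which is of order N^2 / r^n.\<close>

lemma tent_bound:
  fixes x :: "real ^ 'n"
  assumes f: "locally_integrable f" and A: "A \<ge> 0" and osc: "osc_bound f A" and r: "r > 0"
  shows "(\<integral>\<^sup>+t\<in>{0<..<r}. (\<integral>\<^sup>+y\<in>ball x r. ennreal (t * (norm (poisson_deriv t f y))\<^sup>2) \<partial>lebesgue) \<partial>lborel) \<le>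
    ennreal (tent_const * A\<^sup>2 * (N x r)\<^sup>2 / r ^ CARD('n))"
proof -
  let ?n = "CARD('n)"
  define Q where "Q = hcube (big_corner x r) (4 * r)"
  define c where "c = cube_avg (big_corner x r) (4 * r) f"
  define g where "g y = indicator Q y *\<^sub>R (f y - c)" for y
  define g' where "g' y = indicator (- Q) y *\<^sub>R (f y - c)" for y
  let ?F = "far_tent_const * A * N x r / (r * r ^ ?n)"
  have fM: "f \<in> M_Poisson" by (rule osc_imp_M_Poisson[OF f A osc])
  have fcM: "(\<lambda>y. f y - c) \<in> M_Poisson" by (rule M_Poisson_diff[OF fM M_Poisson_const])
  have gM: "g \<in> M_Poisson" unfolding g_def by (rule M_Poisson_indicator[OF fcM]) (simp add: Q_def)
  have g'M: "g' \<in> M_Poisson" unfolding g'_def by (rule M_Poisson_indicator[OF fcM]) (simp add: Q_def)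
  have gm: "g \<in> borel_measurable lebesgue" by (rule M_Poisson_measurable[OF gM])
  have split: "poisson_deriv t f y = poisson_deriv t g y + poisson_deriv t g' y" if t: "t > 0" for t y
  proof -
    have "f = (\<lambda>z. (g z + g' z) + c)" by (auto simp: g_def g'_def indicator_def fun_eq_iff)
    then have "poisson_deriv t f y = poisson_deriv t (\<lambda>z. (g z + g' z) + c) y" by simp
    also have "\<dots> = poisson_deriv t (\<lambda>z. g z + g' z) y + poisson_deriv t (\<lambda>_. c) y"
      by (rule poisson_deriv_add[OF M_Poisson_add[OF gM g'M] M_Poisson_const t])
    also have "poisson_deriv t (\<lambda>z. g z + g' z) y = poisson_deriv t g y + poisson_deriv t g' y"
      by (rule poisson_deriv_add[OF gM g'M t])
    finally show ?thesis by (simp add: poisson_deriv_const[OF t])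
  qed
  let ?e = "\<lambda>t y. ennreal (t * (norm (poisson_deriv t g y))\<^sup>2)"
  have pt: "ennreal (t * (norm (poisson_deriv t f y))\<^sup>2) * indicator (ball x r) y \<le> 2 * ?e t y + ennreal (2 * r * ?F\<^sup>2) * indicator (ball x r) y"
    if t: "0 < t" "t < r" for t y
  proof (cases "y \<in> ball x r")
    case True
    then have "norm (y - x) \<le> r" by (simp add: dist_norm norm_minus_commute)
    from far_derivative_bound[OF f A osc r t(1) this]
    have b: "norm (poisson_deriv t g' y) \<le> ?F" unfolding g'_def[abs_def] Q_def c_def .
    have "(norm (poisson_deriv t f y))\<^sup>2 \<le> (norm (poisson_deriv t g y) + norm (poisson_deriv t g' y))\<^sup>2"
      unfolding split[OF t(1)] by (intro power_mono norm_triangle_ineq) simp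
    also have "\<dots> \<le> 2 * (norm (poisson_deriv t g y))\<^sup>2 + 2 * (norm (poisson_deriv t g' y))\<^sup>2"
      using sum_squares_bound[of "norm (poisson_deriv t g y)" "norm (poisson_deriv t g' y)"] by (simp add: power2_sum)
    also have "\<dots> \<le> 2 * (norm (poisson_deriv t g y))\<^sup>2 + 2 * ?F\<^sup>2"
      by (intro add_left_mono mult_left_mono power_mono b) auto
    finally have "t * (norm (poisson_deriv t f y))\<^sup>2 \<le> t * (2 * (norm (poisson_deriv t g y))\<^sup>2 + 2 * ?F\<^sup>2)"
      using t by (intro mult_left_mono) auto
    also have "\<dots> = 2 * (t * (norm (poisson_deriv t g y))\<^sup>2) + t * (2 * ?F\<^sup>2)" by (simp add: algebra_simps)
    also have "\<dots> \<le> 2 * (t * (norm (poisson_deriv t g y))\<^sup>2) + r * (2 * ?F\<^sup>2)"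
      using t by (intro add_left_mono mult_right_mono) auto
    finally have "ennreal (t * (norm (poisson_deriv t f y))\<^sup>2) \<le> ennreal (2 * (t * (norm (poisson_deriv t g y))\<^sup>2) + r * (2 * ?F\<^sup>2))"
      by (rule ennreal_leI)
    also have "\<dots> = ennreal (2 * (t * (norm (poisson_deriv t g y))\<^sup>2)) + ennreal (r * (2 * ?F\<^sup>2))"
      by (rule ennreal_plus) (use t r in auto)
    also have "ennreal (2 * (t * (norm (poisson_deriv t g y))\<^sup>2)) = 2 * ?e t y"
      using ennreal_mult'[of 2 "t * (norm (poisson_deriv t g y))\<^sup>2"] by simp
    also have "r * (2 * ?F\<^sup>2) = 2 * r * ?F\<^sup>2" by simp
    finally show ?thesis using True by simp
  qed simp
  let ?V = "ball_vol TYPE('n) * r ^ ?n"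
  have "(\<integral>\<^sup>+t\<in>{0<..<r}. (\<integral>\<^sup>+y\<in>ball x r. ennreal (t * (norm (poisson_deriv t f y))\<^sup>2) \<partial>lebesgue) \<partial>lborel) \<le>
    (\<integral>\<^sup>+t. 2 * ((\<integral>\<^sup>+y. ?e t y \<partial>lebesgue) * indicator {0<..} t) + ennreal (2 * r * ?F\<^sup>2 * ?V) * indicator {0<..<r} t \<partial>lborel)"
  proof (rule nn_integral_mono)
    fix t :: real
    show "(\<integral>\<^sup>+y\<in>ball x r. ennreal (t * (norm (poisson_deriv t f y))\<^sup>2) \<partial>lebesgue) * indicator {0<..<r} t \<le>
      2 * ((\<integral>\<^sup>+y. ?e t y \<partial>lebesgue) * indicator {0<..} t) + ennreal (2 * r * ?F\<^sup>2 * ?V) * indicator {0<..<r} t"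
    proof (cases "0 < t \<and> t < r")
      case True
      have em: "?e t \<in> borel_measurable lebesgue"
        by (intro borel_measurable_lebesgue_borel borel_measurable_poisson_deriv_slice gm)
      have "(\<integral>\<^sup>+y\<in>ball x r. ennreal (t * (norm (poisson_deriv t f y))\<^sup>2) \<partial>lebesgue) \<le> (\<integral>\<^sup>+y. 2 * ?e t y + ennreal (2 * r * ?F\<^sup>2) * indicator (ball x r) y \<partial>lebesgue)"
        by (intro nn_integral_mono pt) (use True in auto)
      also have "\<dots> = 2 * (\<integral>\<^sup>+y. ?e t y \<partial>lebesgue) + ennreal (2 * r * ?F\<^sup>2) * emeasure lebesgue (ball x r)"
      proof -
        have "(\<integral>\<^sup>+y. 2 * ?e t y + ennreal (2 * r * ?F\<^sup>2) * indicator (ball x r) y \<partial>lebesgue) =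
          (\<integral>\<^sup>+y. 2 * ?e t y \<partial>lebesgue) + (\<integral>\<^sup>+y. ennreal (2 * r * ?F\<^sup>2) * indicator (ball x r) y \<partial>lebesgue)"
          by (rule nn_integral_add) (use em in auto)
        also have "(\<integral>\<^sup>+y. 2 * ?e t y \<partial>lebesgue) = 2 * (\<integral>\<^sup>+y. ?e t y \<partial>lebesgue)" by (rule nn_integral_cmult[OF em])
        also have "(\<integral>\<^sup>+y. ennreal (2 * r * ?F\<^sup>2) * indicator (ball x r) y \<partial>lebesgue) = ennreal (2 * r * ?F\<^sup>2) * emeasure lebesgue (ball x r)"
          by (rule nn_integral_cmult_indicator) simp
        finally show ?thesis .
      qed
      also have "ennreal (2 * r * ?F\<^sup>2) * emeasure lebesgue (ball x r) = ennreal (2 * r * ?F\<^sup>2 * ?V)"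
        unfolding emeasure_lebesgue_ball[OF r] by (rule ennreal_mult'[symmetric]) (use r in simp)
      finally show ?thesis using True by simp
    qed simp
  qed
  also have "\<dots> = 2 * (\<integral>\<^sup>+t\<in>{0<..}. (\<integral>\<^sup>+y. ?e t y \<partial>lebesgue) \<partial>lborel) + ennreal (2 * r * ?F\<^sup>2 * ?V) * emeasure lborel {0<..<r}"
  proof -
    have m: "(\<lambda>t. (\<integral>\<^sup>+y. ?e t y \<partial>lebesgue) * indicator {0<..} t) \<in> borel_measurable lborel"
      using borel_measurable_poisson_deriv_energy[OF gm] by (intro borel_measurable_times_ennreal) auto
    show ?thesis
      using m by (subst nn_integral_add) (auto simp: nn_integral_cmult nn_integral_cmult_indicator)
  qed
  also have "\<dots> \<le> 2 * ennreal (local_const * A\<^sup>2 * (N x r)\<^sup>2 / r ^ ?n) + ennreal (2 * r * ?F\<^sup>2 * ?V) * ennreal r"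
  proof (rule add_mono)
    show "2 * (\<integral>\<^sup>+t\<in>{0<..}. (\<integral>\<^sup>+y. ?e t y \<partial>lebesgue) \<partial>lborel) \<le> 2 * ennreal (local_const * A\<^sup>2 * (N x r)\<^sup>2 / r ^ ?n)"
      using local_square_function[OF f A osc r, of x] unfolding g_def[abs_def] Q_def c_def by (rule mult_left_mono) simp
    show "ennreal (2 * r * ?F\<^sup>2 * ?V) * emeasure lborel {0<..<r} \<le> ennreal (2 * r * ?F\<^sup>2 * ?V) * ennreal r" using r by simp
  qed
  also have "2 * ennreal (local_const * A\<^sup>2 * (N x r)\<^sup>2 / r ^ ?n) = ennreal (2 * (local_const * A\<^sup>2 * (N x r)\<^sup>2 / r ^ ?n))"
    by (rule ennreal_two_times)
  also have "ennreal (2 * r * ?F\<^sup>2 * ?V) * ennreal r = ennreal (2 * r * ?F\<^sup>2 * ?V * r)"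
    by (rule ennreal_mult''[symmetric]) (use r in simp)
  also have "ennreal (2 * (local_const * A\<^sup>2 * (N x r)\<^sup>2 / r ^ ?n)) + ennreal (2 * r * ?F\<^sup>2 * ?V * r) =
     ennreal (2 * (local_const * A\<^sup>2 * (N x r)\<^sup>2 / r ^ ?n) + 2 * r * ?F\<^sup>2 * ?V * r)"
  proof (rule ennreal_plus[symmetric])
    show "0 \<le> 2 * (local_const * A\<^sup>2 * (N x r)\<^sup>2 / r ^ ?n)" using local_const_nonneg r by simp
    show "0 \<le> 2 * r * ?F\<^sup>2 * ?V * r" using r by simp
  qed
  also have "2 * r * ?F\<^sup>2 * ?V * r = 2 * ball_vol TYPE('n) * far_tent_const\<^sup>2 * (A\<^sup>2 * (N x r)\<^sup>2 / r ^ ?n)"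
    using r by (simp add: power_divide power_mult_distrib power2_eq_square)
  also have "2 * (local_const * A\<^sup>2 * (N x r)\<^sup>2 / r ^ ?n) + 2 * ball_vol TYPE('n) * far_tent_const\<^sup>2 * (A\<^sup>2 * (N x r)\<^sup>2 / r ^ ?n) = tent_const * A\<^sup>2 * (N x r)\<^sup>2 / r ^ ?n"
    by (simp add: tent_const_def algebra_simps add_divide_distrib)
  finally show ?thesis .
qed

abbreviation delta_energy :: "(real ^ 'n \<Rightarrow> complex) \<Rightarrow> real \<Rightarrow> real ^ 'n \<Rightarrow> ennreal" where
  "delta_energy f t y \<equiv> ennreal (t * (norm (poisson_deriv t f y - poisson_deriv (2 * t) f y))\<^sup>2)"

text \<open>The summand 2 is for the derivative at time t. The derivative at time 2 t is estimated
  on the tent over the doubled ball, whose gauge is at most D * 2 powr \<kappa> times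
  larger.\<close>

definition square_const :: real where
  "square_const = tent_const * (2 + D\<^sup>2 * (2 powr \<kappa>)\<^sup>2)"

lemma square_const_nonneg: "square_const \<ge> 0"
  unfolding square_const_def using tent_const_nonneg by simp

lemma tent_bound_difference:
  fixes x :: "real ^ 'n"
  assumes f: "locally_integrable f" and A: "A \<ge> 0" and osc: "osc_bound f A" and r: "r > 0"
  shows "(\<integral>\<^sup>+t\<in>{0<..<r}. (\<integral>\<^sup>+y\<in>ball x r. delta_energy f t y \<partial>lebesgue) \<partial>lborel) \<le>
    ennreal (square_const * A\<^sup>2 * (N x r)\<^sup>2 / r ^ CARD('n))"
proof -
  let ?n = "CARD('n)"
  have fM: "f \<in> M_Poisson" by (rule osc_imp_M_Poisson[OF f A osc])
  have fm: "f \<in> borel_measurable lebesgue" by (rule M_Poisson_measurable[OF fM])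
  define H where "H t = (\<integral>\<^sup>+y\<in>ball x r. ennreal (t * (norm (poisson_deriv t f y))\<^sup>2) \<partial>lebesgue)" for t
  have Hm: "H \<in> borel_measurable borel"
  proof -
    have id2: "(\<lambda>z. (fst z, snd z)) \<in> measurable (borel \<Otimes>\<^sub>M lebesgue) (borel \<Otimes>\<^sub>M borel :: (real \<times> (real ^ 'n)) measure)"
      by (intro measurable_Pair measurable_fst measurable_compose[OF measurable_snd id_lebesgue_borel])
    have "(\<lambda>z. poisson_deriv (fst z) f (snd z)) \<in> borel_measurable (borel \<Otimes>\<^sub>M lebesgue)"
      using measurable_compose[OF id2 borel_measurable_poisson_deriv_pair[OF fm]] by simp
    then have "(\<lambda>(t, y). ennreal (t * (norm (poisson_deriv t f y))\<^sup>2) * indicator (ball x r) y) \<in> borel_measurable (borel \<Otimes>\<^sub>M lebesgue)"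
      unfolding split_def by measurable
    from sigma_finite_measure.borel_measurable_nn_integral[OF sigma_finite_lebesgue this] show ?thesis unfolding H_def[abs_def] .
  qed
  have inner: "(\<integral>\<^sup>+y\<in>ball x r. delta_energy f t y \<partial>lebesgue) \<le> 2 * H t + H (2 * t)"
    if t: "t > 0" for t
  proof -
    have sm: "(\<lambda>y. ennreal (c * (norm (poisson_deriv t f y))\<^sup>2) * indicator (ball x r) y) \<in> borel_measurable lebesgue" for c t
      using borel_measurable_lebesgue_borel[OF borel_measurable_poisson_deriv_slice[OF fm, of c t]]
      by (intro borel_measurable_times_ennreal) auto
    have "(\<integral>\<^sup>+y\<in>ball x r. delta_energy f t y \<partial>lebesgue) \<le>
      (\<integral>\<^sup>+y. 2 * (ennreal (t * (norm (poisson_deriv t f y))\<^sup>2) * indicator (ball x r) y) + ennreal (2 * t * (norm (poisson_deriv (2 * t) f y))\<^sup>2) * indicator (ball x r) y \<partial>lebesgue)"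
    proof (rule nn_integral_mono)
      fix y
      let ?a = "poisson_deriv t f y" and ?b = "poisson_deriv (2 * t) f y"
      have "(norm (?a - ?b))\<^sup>2 \<le> (norm ?a + norm ?b)\<^sup>2" by (intro power_mono norm_triangle_ineq4) simp
      also have "\<dots> \<le> 2 * (norm ?a)\<^sup>2 + 2 * (norm ?b)\<^sup>2"
        using sum_squares_bound[of "norm ?a" "norm ?b"] by (simp add: power2_sum)
      finally have "t * (norm (?a - ?b))\<^sup>2 \<le> t * (2 * (norm ?a)\<^sup>2 + 2 * (norm ?b)\<^sup>2)" using t by (intro mult_left_mono) auto
      also have "\<dots> = 2 * (t * (norm ?a)\<^sup>2) + 2 * t * (norm ?b)\<^sup>2" by (simp add: algebra_simps)
      finally have "ennreal (t * (norm (?a - ?b))\<^sup>2) \<le> ennreal (2 * (t * (norm ?a)\<^sup>2) + 2 * t * (norm ?b)\<^sup>2)" by (rule ennreal_leI)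
      also have "\<dots> = ennreal (2 * (t * (norm ?a)\<^sup>2)) + ennreal (2 * t * (norm ?b)\<^sup>2)" by (rule ennreal_plus) (use t in auto)
      also have "ennreal (2 * (t * (norm ?a)\<^sup>2)) = 2 * ennreal (t * (norm ?a)\<^sup>2)" using ennreal_mult'[of 2 "t * (norm ?a)\<^sup>2"] by simp
      finally show "ennreal (t * (norm (?a - ?b))\<^sup>2) * indicator (ball x r) y \<le>
         2 * (ennreal (t * (norm ?a)\<^sup>2) * indicator (ball x r) y) + ennreal (2 * t * (norm ?b)\<^sup>2) * indicator (ball x r) y"
        by (simp add: indicator_def)
    qed
    also have "\<dots> = 2 * H t + H (2 * t)"
      unfolding H_def using sm[of t t] sm[of "2 * t" "2 * t"] by (subst nn_integral_add) (auto simp: nn_integral_cmult)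
    finally show ?thesis .
  qed
  have "(\<integral>\<^sup>+t\<in>{0<..<r}. (\<integral>\<^sup>+y\<in>ball x r. delta_energy f t y \<partial>lebesgue) \<partial>lborel) \<le>
    (\<integral>\<^sup>+t. 2 * (H t * indicator {0<..<r} t) + H (2 * t) * indicator {0<..<2 * r} (2 * t) \<partial>lborel)"
  proof (rule nn_integral_mono)
    fix t :: real
    show "(\<integral>\<^sup>+y\<in>ball x r. delta_energy f t y \<partial>lebesgue) * indicator {0<..<r} t \<le>
      2 * (H t * indicator {0<..<r} t) + H (2 * t) * indicator {0<..<2 * r} (2 * t)"
      using inner[of t] by (auto simp: indicator_def)
  qed
  also have "\<dots> = 2 * (\<integral>\<^sup>+t\<in>{0<..<r}. H t \<partial>lborel) + (\<integral>\<^sup>+t. H (2 * t) * indicator {0<..<2 * r} (2 * t) \<partial>lborel)"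
  proof -
    have m1: "(\<lambda>t. H t * indicator {0<..<r} t) \<in> borel_measurable lborel" using Hm by simp
    have m2: "(\<lambda>t. H (2 * t) * indicator {0<..<2 * r} (2 * t)) \<in> borel_measurable lborel"
      using measurable_compose[OF _ Hm, of "\<lambda>t. 2 * t" borel] by simp
    show ?thesis using m1 m2 by (subst nn_integral_add) (auto simp: nn_integral_cmult)
  qed
  \<comment> \<open>Rescaling 2 t to t extends the times to (0, 2 r); the Jacobian 1 / 2 is bounded
    by 1.\<close>
  also have "(\<integral>\<^sup>+t. H (2 * t) * indicator {0<..<2 * r} (2 * t) \<partial>lborel) \<le> (\<integral>\<^sup>+t\<in>{0<..<2 * r}. H t \<partial>lborel)"
  proof -
    let ?u = "\<lambda>t. H t * indicator {0<..<2 * r} t"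
    have um: "?u \<in> borel_measurable borel" using Hm by simp
    have "(\<integral>\<^sup>+t. ?u t \<partial>lborel) = ennreal \<bar>2\<bar> * (\<integral>\<^sup>+t. ?u (0 + 2 * t) \<partial>lborel)"
      by (rule nn_integral_real_affine[OF um]) simp
    then have "(\<integral>\<^sup>+t. ?u t \<partial>lborel) = 2 * (\<integral>\<^sup>+t. ?u (2 * t) \<partial>lborel)" by simp
    moreover have "X \<le> 2 * X" for X :: ennreal by (simp add: mult_2 add_increasing)
    ultimately show ?thesis by simp
  qed
  also have "(\<integral>\<^sup>+t\<in>{0<..<2 * r}. H t \<partial>lborel) \<le> (\<integral>\<^sup>+t\<in>{0<..<2 * r}. (\<integral>\<^sup>+y\<in>ball x (2 * r). ennreal (t * (norm (poisson_deriv t f y))\<^sup>2) \<partial>lebesgue) \<partial>lborel)"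
    unfolding H_def using r by (intro nn_integral_mono mult_right_mono nn_set_integral_set_mono subset_ball) auto
  also have "\<dots> \<le> ennreal (tent_const * A\<^sup>2 * (N x (2 * r))\<^sup>2 / (2 * r) ^ ?n)"
    by (rule tent_bound[OF f A osc]) (use r in simp)
  also have "\<dots> \<le> ennreal (tent_const * A\<^sup>2 * (D * 2 powr \<kappa> * N x r)\<^sup>2 / r ^ ?n)"
  proof (intro ennreal_leI frac_le mult_left_mono power_mono)
    show "N x (2 * r) \<le> D * 2 powr \<kappa> * N x r" using N_grow[OF r, of 2 x] by simp
    show "0 \<le> N x (2 * r)" using N_pos[of "2 * r" x] r by simp
  qed (use r tent_const_nonneg in auto)
  also have "(\<integral>\<^sup>+t\<in>{0<..<r}. H t \<partial>lborel) \<le> ennreal (tent_const * A\<^sup>2 * (N x r)\<^sup>2 / r ^ ?n)"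
    unfolding H_def by (rule tent_bound[OF f A osc r])
  finally have "(\<integral>\<^sup>+t\<in>{0<..<r}. (\<integral>\<^sup>+y\<in>ball x r. delta_energy f t y \<partial>lebesgue) \<partial>lborel) \<le>
     2 * ennreal (tent_const * A\<^sup>2 * (N x r)\<^sup>2 / r ^ ?n) + ennreal (tent_const * A\<^sup>2 * (D * 2 powr \<kappa> * N x r)\<^sup>2 / r ^ ?n)"
    by (simp add: add_mono mult_left_mono)
  also have "2 * ennreal (tent_const * A\<^sup>2 * (N x r)\<^sup>2 / r ^ ?n) = ennreal (2 * (tent_const * A\<^sup>2 * (N x r)\<^sup>2 / r ^ ?n))"
    by (rule ennreal_two_times)
  also have "ennreal (2 * (tent_const * A\<^sup>2 * (N x r)\<^sup>2 / r ^ ?n)) + ennreal (tent_const * A\<^sup>2 * (D * 2 powr \<kappa> * N x r)\<^sup>2 / r ^ ?n) =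
     ennreal (2 * (tent_const * A\<^sup>2 * (N x r)\<^sup>2 / r ^ ?n) + tent_const * A\<^sup>2 * (D * 2 powr \<kappa> * N x r)\<^sup>2 / r ^ ?n)"
    by (rule ennreal_plus[symmetric]) (use r tent_const_nonneg in auto)
  also have "2 * (tent_const * A\<^sup>2 * (N x r)\<^sup>2 / r ^ ?n) + tent_const * A\<^sup>2 * (D * 2 powr \<kappa> * N x r)\<^sup>2 / r ^ ?n = square_const * A\<^sup>2 * (N x r)\<^sup>2 / r ^ ?n"
    by (simp add: square_const_def power_mult_distrib algebra_simps add_divide_distrib)
  finally show ?thesis .
qed

lemma square_measure_tent:
  fixes x :: "real ^ 'n"
  assumes f: "locally_integrable f" and A: "A \<ge> 0" and osc: "osc_bound f A" and r: "r > 0"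
  shows "emeasure (square_measure f) (tent x r) \<le> ennreal (square_const * A\<^sup>2 * (N x r)\<^sup>2 / r ^ CARD('n))"
proof -
  have fM: "f \<in> M_Poisson" by (rule osc_imp_M_Poisson[OF f A osc])
  have fm: "f \<in> borel_measurable lebesgue" by (rule M_Poisson_measurable[OF fM])
  let ?U = "upper_half_space :: ((real ^ 'n) \<times> real) set"
  let ?d = "\<lambda>(x, t). ennreal ((norm (t_deriv_poisson t (\<lambda>y. f y - poisson t f y) x))\<^sup>2 / t)"
  let ?G = "\<lambda>z. ennreal (snd z * (norm (poisson_deriv (snd z) f (fst z) - poisson_deriv (2 * snd z) f (fst z)))\<^sup>2)"
  have U: "open ?U" unfolding upper_half_space_def by (intro open_Times) auto
  have Ul: "?U \<in> sets lebesgue" using U by simp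
  have tent: "open (tent x r)" unfolding tent_def by (intro open_Times) auto
  have tl: "tent x r \<in> sets lebesgue" using tent by simp
  have tU: "tent x r \<subseteq> ?U" by (auto simp: tent_def upper_half_space_def)
  have Gm2: "?G \<in> borel_measurable (borel \<Otimes>\<^sub>M borel)"
  proof -
    have 1: "(\<lambda>z. (snd z, fst z)) \<in> measurable (borel \<Otimes>\<^sub>M borel :: ((real ^ 'n) \<times> real) measure) (borel \<Otimes>\<^sub>M borel)"
      by measurable
    have 2: "(\<lambda>z. (2 * snd z, fst z)) \<in> measurable (borel \<Otimes>\<^sub>M borel :: ((real ^ 'n) \<times> real) measure) (borel \<Otimes>\<^sub>M borel)"
      by measurable
    have [measurable]: "(\<lambda>z. poisson_deriv (snd z) f (fst z)) \<in> borel_measurable (borel \<Otimes>\<^sub>M borel)"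
      "(\<lambda>z. poisson_deriv (2 * snd z) f (fst z)) \<in> borel_measurable (borel \<Otimes>\<^sub>M borel)"
      using measurable_compose[OF 1 borel_measurable_poisson_deriv_pair[OF fm]]
        measurable_compose[OF 2 borel_measurable_poisson_deriv_pair[OF fm]] by simp_all
    show ?thesis by measurable
  qed
  then have Gm: "?G \<in> borel_measurable borel" by (simp add: borel_prod)
  \<comment> \<open>The density agrees with the Borel function \<open>?G\<close> on the half space,
    so its measurability is obtained for the restricted measure.\<close>
  have dG: "?d z = ?G z" if "z \<in> ?U" for z
  proof -
    have t: "snd z > 0" using that by (auto simp: upper_half_space_def)
    then show ?thesis
      by (simp add: split_def t_deriv_poisson_eq[OF fM t] power_mult_distrib power2_eq_square)
  qed
  have dm: "?d \<in> borel_measurable (restrict_space lebesgue ?U)"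
  proof -
    have "?G \<in> borel_measurable (restrict_space lebesgue ?U)"
      by (intro measurable_restrict_space1 borel_measurable_lebesgue_borel Gm)
    then show ?thesis
      by (rule measurable_cong[THEN iffD1, rotated]) (simp add: space_restrict_space dG)
  qed
  have "emeasure (square_measure f) (tent x r) = (\<integral>\<^sup>+z. ?d z * indicator (tent x r) z \<partial>restrict_space lebesgue ?U)"
    unfolding square_measure_def
    by (rule emeasure_density[OF dm]) (use tl tU Ul in \<open>auto simp: sets_restrict_space_iff\<close>)
  also have "\<dots> = (\<integral>\<^sup>+z. ?d z * indicator (tent x r) z * indicator ?U z \<partial>lebesgue)"
    by (rule nn_integral_restrict_space) (use Ul in simp)
  also have "\<dots> = (\<integral>\<^sup>+z. ?G z * indicator (tent x r) z \<partial>lborel)"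
    unfolding nn_integral_completion using tU dG by (intro nn_integral_cong) (auto simp: indicator_def split: prod.splits)
  also have "\<dots> = (\<integral>\<^sup>+z. ?G z * indicator (tent x r) z \<partial>(lborel \<Otimes>\<^sub>M lborel))"
    by (simp add: lborel_prod)
  also have "\<dots> = (\<integral>\<^sup>+t. (\<integral>\<^sup>+y. ?G (y, t) * indicator (tent x r) (y, t) \<partial>lborel) \<partial>lborel)"
  proof (rule lborel_pair.nn_integral_snd[symmetric])
    have "(\<lambda>z. ?G z * indicator (tent x r) z) \<in> borel_measurable borel" using Gm tent by simp
    then show "(\<lambda>z. ?G z * indicator (tent x r) z) \<in> borel_measurable (lborel \<Otimes>\<^sub>M lborel)" by (simp add: lborel_prod)
  qed
  also have "\<dots> = (\<integral>\<^sup>+t\<in>{0<..<r}. (\<integral>\<^sup>+y\<in>ball x r. delta_energy f t y \<partial>lebesgue) \<partial>lborel)"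
    unfolding nn_integral_completion
  proof (rule nn_integral_cong)
    fix t :: real
    show "(\<integral>\<^sup>+y. ?G (y, t) * indicator (tent x r) (y, t) \<partial>lborel) =
      (\<integral>\<^sup>+y\<in>ball x r. delta_energy f t y \<partial>lborel) * indicator {0<..<r} t"
    proof (cases "t \<in> {0<..<r}")
      case True
      then show ?thesis by (auto intro!: nn_integral_cong simp: tent_def indicator_def)
    next
      case False
      then have "(\<integral>\<^sup>+y. ?G (y, t) * indicator (tent x r) (y, t) \<partial>lborel) = (\<integral>\<^sup>+y. 0 \<partial>(lborel :: (real ^ 'n) measure))"
        by (intro nn_integral_cong) (auto simp: tent_def indicator_def)
      then show ?thesis using False by simp
    qed
  qed
  also have "\<dots> \<le> ennreal (square_const * A\<^sup>2 * (N x r)\<^sup>2 / r ^ CARD('n))"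
    by (rule tent_bound_difference[OF f A osc r])
  finally show ?thesis .
qed

end

subsection \<open>Growth functions\<close>

text \<open>Young's inequality with exponents q and q' for the product y^(1/q) * y^(-1/q) =
  1.\<close>

lemma Young_one:
  fixes y q :: real
  assumes y: "y > 0" and q: "q > 1"
  shows "1 \<le> y / q + (1 - 1 / q) * y powr (- (1 / (q - 1)))"
proof -
  let ?q' = "q / (q - 1)"
  have q': "?q' > 1" "1 / q + 1 / ?q' = 1" using q by (auto simp: field_simps)
  have e: "- (1 / q) * ?q' = - (1 / (q - 1))" "1 / ?q' = 1 - 1 / q" using q by (auto simp: field_simps)
  have "y powr (1 / q) * y powr (- (1 / q)) \<le> (y powr (1 / q)) powr q / q + (y powr (- (1 / q))) powr ?q' / ?q'"
    by (rule Youngs_inequality[OF q q']) auto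
  moreover have "y powr (1 / q) * y powr (- (1 / q)) = 1" using y by (simp flip: powr_add)
  moreover have "(y powr (1 / q)) powr q = y" using y q by (simp add: powr_powr)
  moreover have "(y powr (- (1 / q))) powr ?q' / ?q' = (1 - 1 / q) * y powr (- (1 / (q - 1)))"
    unfolding powr_powr e(1) e(2)[symmetric] by simp
  ultimately show ?thesis by simp
qed

lemma ennreal_linear:
  assumes "0 \<le> a" "0 \<le> b" "0 \<le> c" "0 \<le> d"
  shows "ennreal (a * b + c * d) = ennreal a * ennreal b + ennreal c * ennreal d"
  using assms by (simp add: ennreal_plus ennreal_mult'')

lemma square_le_powr:
  fixes y q :: real
  assumes y: "y \<ge> 0" and q: "q > 2"
  shows "y\<^sup>2 \<le> y powr q + 1"
proof (cases "y \<le> 1")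
  case True
  then have "y\<^sup>2 \<le> 1" using y by (simp add: power_le_one)
  then show ?thesis by (simp add: add_increasing)
next
  case False
  then have "y\<^sup>2 = y powr 2" by simp
  also have "\<dots> \<le> y powr q" using False q by (intro powr_mono) auto
  finally show ?thesis by simp
qed

lemma ball_measure_facts:
  fixes x :: "real ^ 'n"
  assumes r: "r > 0"
  shows "emeasure lebesgue (ball x r) = ennreal (measure lebesgue (ball x r))" "measure lebesgue (ball x r) > 0"
proof -
  have "ball_vol TYPE('n) * r ^ CARD('n) > 0" using ball_vol_pos r by (intro mult_pos_pos) auto
  then show "emeasure lebesgue (ball x r) = ennreal (measure lebesgue (ball x r))" "measure lebesgue (ball x r) > 0"
    unfolding measure_lebesgue_ball[OF r] emeasure_lebesgue_ball[OF r] by auto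
qed

lemma ball_avg_alt:
  assumes "r > 0"
  shows "ball_avg x r g * emeasure lebesgue (ball (x :: real ^ 'n) r) = (\<integral>\<^sup>+y\<in>ball x r. g y \<partial>lebesgue)"
proof -
  let ?e = "emeasure lebesgue (ball x r)"
  have "?e \<noteq> 0" "?e \<noteq> top" unfolding ball_measure_facts(1)[OF assms] using ball_measure_facts(2)[OF assms, of x] by simp_all
  then have "a / ?e * ?e = a" for a unfolding ennreal_divide_times
    by (metis ennreal_divide_self less_top mult.right_neutral)
  then show ?thesis unfolding ball_avg_def .
qed

lemma nn_set_integral_pos:
  fixes g :: "real ^ 'n \<Rightarrow> ennreal"
  assumes g: "g \<in> borel_measurable lebesgue" and pos: "\<And>y. g y > 0" and B: "B \<in> sets lebesgue" and BB: "emeasure lebesgue B > 0"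
  shows "(\<integral>\<^sup>+y\<in>B. g y \<partial>lebesgue) > 0"
proof (rule ccontr)
  assume "\<not> ?thesis"
  then have "(\<integral>\<^sup>+y\<in>B. g y \<partial>lebesgue) = 0" by simp
  then have "AE y in lebesgue. g y * indicator B y = 0"
    using g B by (subst (asm) nn_integral_0_iff_AE) auto
  then have "AE y in lebesgue. y \<notin> B"
    by eventually_elim (use pos in \<open>auto simp: indicator_def less_le split: if_splits\<close>)
  then have "B \<in> null_sets lebesgue" using AE_iff_null_sets[OF B] by simp
  then have "emeasure lebesgue B = 0" by (rule null_setsD1)
  then show False using BB by simp
qed

lemma ball_avg_pos:
  fixes g :: "real ^ 'n \<Rightarrow> ennreal"
  assumes g: "g \<in> borel_measurable lebesgue" and pos: "\<And>y. g y > 0" and r: "r > 0"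
  shows "ball_avg x r g > 0"
proof -
  have "(\<integral>\<^sup>+y\<in>ball x r. g y \<partial>lebesgue) > 0"
    by (rule nn_set_integral_pos[OF g pos ball_lebesgue]) (use ball_measure_facts[OF r, of x] in simp)
  then show ?thesis unfolding ball_avg_def ball_measure_facts(1)[OF r] by (simp add: ennreal_zero_less_divide)
qed

lemma ball_SUP_bound:
  fixes F :: "real \<Rightarrow> real ^ 'n \<Rightarrow> real \<Rightarrow> ennreal"
  assumes "(SUP t\<in>{0<..}. SUP x. SUP r\<in>{0<..}. F t x r) < \<infinity>"
  obtains C where "C \<ge> 1" "\<And>t x r. t > 0 \<Longrightarrow> r > 0 \<Longrightarrow> F t x r \<le> ennreal C"
proof -
  let ?S = "SUP t\<in>{0<..}. SUP x. SUP r\<in>{0<..}. F t x r"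
  have "F t x r \<le> ennreal (max 1 (enn2real ?S))" if "t > 0" "r > 0" for t x r
  proof -
    have "F t x r \<le> (SUP r\<in>{0<..}. F t x r)" using that by (intro SUP_upper) simp
    also have "\<dots> \<le> (SUP x. SUP r\<in>{0<..}. F t x r)" by (rule SUP_upper) simp
    also have "\<dots> \<le> ?S" using that by (intro SUP_upper) simp
    also have "\<dots> = ennreal (enn2real ?S)" using assms by simp
    also have "\<dots> \<le> ennreal (max 1 (enn2real ?S))" by (rule ennreal_leI) simp
    finally show ?thesis .
  qed
  then show thesis by (intro that[of "max 1 (enn2real ?S)"]) auto
qed

abbreviation weight_mass :: "(real ^ 'n \<Rightarrow> real \<Rightarrow> real) \<Rightarrow> real \<Rightarrow> (real ^ 'n) set \<Rightarrow> ennreal" where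
  "weight_mass \<phi> t S \<equiv> (\<integral>\<^sup>+y\<in>S. ennreal (\<phi> y t) \<partial>lebesgue)"

text \<open>Balls have finite mass, and a subset of a ball carries at least a multiple of the q-th
  power of its relative volume. For q = 1 the average over the ball is at most C * \<phi> y t at
  almost every y, and this is integrated over S. For q > 1 an infinite average would make the
  product in the condition infinite, since the other factor is positive; the second claim is then
  Hoelder's inequality on S.\<close>

lemma Muckenhoupt_bounds:
  fixes \<phi> :: "real ^ 'n \<Rightarrow> real \<Rightarrow> real"
  assumes meas: "\<And>t. t > 0 \<Longrightarrow> (\<lambda>x. \<phi> x t) \<in> borel_measurable lebesgue"
    and pos: "\<And>x t. t > 0 \<Longrightarrow> \<phi> x t > 0"
    and q: "q \<ge> 1" and M: "Muckenhoupt \<phi> q"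
  shows "\<exists>C\<ge>1. \<forall>t>0. \<forall>x. \<forall>r>0. weight_mass \<phi> t (ball x r) < \<infinity> \<and>
    (\<forall>S\<in>sets lebesgue. S \<subseteq> ball x r \<longrightarrow>
       weight_mass \<phi> t (ball x r) * ennreal ((measure lebesgue S / measure lebesgue (ball x r)) powr q) \<le>
       ennreal C * weight_mass \<phi> t S)"
proof (cases "q = 1")
  case True
  obtain C where C: "C \<ge> 1" and le: "\<And>t x r. t > 0 \<Longrightarrow> r > 0 \<Longrightarrow> ball_avg x r (\<lambda>y. ennreal (\<phi> y t)) *
           esssup (restrict_space lebesgue (ball x r)) (\<lambda>y. inverse (ennreal (\<phi> y t))) \<le> ennreal C"
    using ball_SUP_bound[OF M[unfolded Muckenhoupt_def if_P[OF True]]] by metis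
  show ?thesis
  proof (intro exI[of _ C] conjI C allI impI ballI)
    fix t r :: real and x :: "real ^ 'n" assume t: "t > 0" and r: "r > 0"
    let ?B = "ball x r" and ?A = "ball_avg x r (\<lambda>y. ennreal (\<phi> y t))"
    let ?s = "esssup (restrict_space lebesgue ?B) (\<lambda>y. inverse (ennreal (\<phi> y t)))"
    have V: "emeasure lebesgue ?B = ennreal (measure lebesgue ?B)" "measure lebesgue ?B > 0"
      using ball_measure_facts[OF r] by auto
    have A: "AE y in lebesgue. y \<in> ?B \<longrightarrow> inverse (ennreal (\<phi> y t)) \<le> ?s"
      using esssup_AE[where M="restrict_space lebesgue ?B" and f="\<lambda>y. inverse (ennreal (\<phi> y t))"]
      by (subst (asm) AE_restrict_space_iff) auto
    have le1: "?A \<le> ennreal C * ennreal (\<phi> y t)" if "inverse (ennreal (\<phi> y t)) \<le> ?s" for y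
    proof -
      have "?A = ?A * (inverse (ennreal (\<phi> y t)) * ennreal (\<phi> y t))"
        using pos[OF t, of y] by (simp add: inverse_ennreal flip: ennreal_mult')
      also have "\<dots> \<le> ?A * (?s * ennreal (\<phi> y t))" by (intro mult_left_mono mult_right_mono that) auto
      also have "\<dots> \<le> ennreal C * ennreal (\<phi> y t)"
        using mult_right_mono[OF le[OF t r, of x], of "ennreal (\<phi> y t)"] by (simp add: mult.assoc)
      finally show ?thesis .
    qed
    have A1: "AE y in lebesgue. y \<in> ?B \<longrightarrow> ?A \<le> ennreal C * ennreal (\<phi> y t)"
      using A by eventually_elim (use le1 in auto)
    \<comment> \<open>A ball is not null, so the almost everywhere bound holds at some point of it,
      and its right-hand side is finite there.\<close>
    have nn: "\<not> (AE y in lebesgue. y \<notin> ?B)"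
      using V AE_iff_null_sets[of ?B lebesgue] null_setsD1[of ?B lebesgue] by auto
    have "\<exists>y\<in>?B. ?A \<le> ennreal C * ennreal (\<phi> y t)"
    proof (rule ccontr)
      assume "\<not> ?thesis"
      then have "AE y in lebesgue. y \<notin> ?B" using A1 by (auto elim!: eventually_mono)
      then show False using nn by simp
    qed
    then obtain y where "?A \<le> ennreal C * ennreal (\<phi> y t)" by blast
    then have "?A < \<infinity>" by (rule le_less_trans) (simp add: ennreal_mult_less_top)
    then show "weight_mass \<phi> t ?B < \<infinity>"
      unfolding ball_avg_alt[OF r, symmetric] V(1) by (simp add: ennreal_mult_less_top)
    fix S assume S: "S \<in> sets lebesgue" "S \<subseteq> ?B"
    have fS: "emeasure lebesgue S = ennreal (measure lebesgue S)"
      using emeasure_mono[OF S(2), of lebesgue] V by (intro emeasure_eq_ennreal_measure) (auto simp: top_unique)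
    have "?A * emeasure lebesgue S = (\<integral>\<^sup>+y\<in>S. ?A \<partial>lebesgue)" using S by (simp add: nn_integral_cmult_indicator)
    also have "\<dots> \<le> (\<integral>\<^sup>+y. ennreal C * (ennreal (\<phi> y t) * indicator S y) \<partial>lebesgue)"
      by (rule nn_integral_mono_AE, use A1 in eventually_elim) (use S in \<open>auto simp: indicator_def\<close>)
    also have "\<dots> = ennreal C * weight_mass \<phi> t S"
      using meas[OF t] S by (intro nn_integral_cmult) auto
    finally have 1: "?A * emeasure lebesgue S \<le> ennreal C * weight_mass \<phi> t S" .
    have "weight_mass \<phi> t ?B * ennreal ((measure lebesgue S / measure lebesgue ?B) powr q) =
      ?A * (ennreal (measure lebesgue ?B) * ennreal (measure lebesgue S / measure lebesgue ?B))"
      unfolding ball_avg_alt[OF r, symmetric] V(1) True by (simp add: mult.assoc)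
    also have "ennreal (measure lebesgue ?B) * ennreal (measure lebesgue S / measure lebesgue ?B) = emeasure lebesgue S"
      using V by (simp add: fS flip: ennreal_mult')
    finally show "weight_mass \<phi> t ?B * ennreal ((measure lebesgue S / measure lebesgue ?B) powr q) \<le>
       ennreal C * weight_mass \<phi> t S" using 1 by simp
  qed
next
  case False
  then have q1: "q > 1" using q by simp
  obtain C where C: "C \<ge> 1" and le: "\<And>t x r. t > 0 \<Longrightarrow> r > 0 \<Longrightarrow> ball_avg x r (\<lambda>y. ennreal (\<phi> y t)) *
           ennpow (ball_avg x r (\<lambda>y. inverse (ennpow (ennreal (\<phi> y t)) (1 / (q - 1))))) (q - 1) \<le> ennreal C"
    using ball_SUP_bound[OF M[unfolded Muckenhoupt_def if_not_P[OF False]]] by metis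
  show ?thesis
  proof (intro exI[of _ C] conjI C allI impI)
    fix t r :: real and x :: "real ^ 'n" assume t: "t > 0" and r: "r > 0"
    let ?B = "ball x r" and ?A = "ball_avg x r (\<lambda>y. ennreal (\<phi> y t))" and ?V = "measure lebesgue (ball x r)"
    define h where "h y = \<phi> y t powr (- (1 / (q - 1)))" for y
    have h: "inverse (ennpow (ennreal (\<phi> y t)) (1 / (q - 1))) = ennreal (h y)" for y
      using pos[OF t, of y] by (simp add: ennpow_def h_def inverse_ennreal powr_minus)
    let ?s = "ball_avg x r (\<lambda>y. ennreal (h y))"
    have hm: "h \<in> borel_measurable lebesgue" unfolding h_def using meas[OF t] by measurable
    have hpos: "h y > 0" for y using pos[OF t, of y] by (simp add: h_def)
    have V: "emeasure lebesgue ?B = ennreal ?V" "?V > 0"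
      using ball_measure_facts[OF r] by auto
    have As: "?A * ennpow ?s (q - 1) \<le> ennreal C" using le[OF t r, of x] unfolding h .
    have A0: "?A > 0" using meas[OF t] pos[OF t] r by (intro ball_avg_pos) auto
    have s0: "?s > 0" using hm hpos r by (intro ball_avg_pos) auto
    have sfin: "?s \<noteq> \<infinity>"
    proof
      assume "?s = \<infinity>"
      then have "?A * ennpow ?s (q - 1) = \<infinity>" using A0 by (simp add: ennpow_def ennreal_mult_eq_top_iff)
      then show False using As by (simp add: top_unique)
    qed
    define \<sigma> where "\<sigma> = enn2real ?s"
    have s: "?s = ennreal \<sigma>" using sfin by (simp add: \<sigma>_def less_top)
    have \<sigma>0: "\<sigma> > 0" using s0 s by simp
    have p: "ennpow ?s (q - 1) = ennreal (\<sigma> powr (q - 1))" using sfin by (simp add: ennpow_def \<sigma>_def)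
    have Afin: "?A \<noteq> \<infinity>"
    proof
      assume "?A = \<infinity>"
      then have "?A * ennpow ?s (q - 1) = \<infinity>" using \<sigma>0 by (simp add: p ennreal_mult_eq_top_iff)
      then show False using As by (simp add: top_unique)
    qed
    define a where "a = enn2real ?A"
    have A: "?A = ennreal a" using Afin by (simp add: a_def less_top)
    have a0: "a > 0" using A0 A by simp
    have aC: "a * \<sigma> powr (q - 1) \<le> C"
      using As a0 C unfolding p A by (simp add: ennreal_mult''[symmetric])
    have mass: "weight_mass \<phi> t ?B = ennreal (a * ?V)"
      unfolding ball_avg_alt[OF r, symmetric] V(1) A using V by (simp add: ennreal_mult'')
    then show "weight_mass \<phi> t ?B < \<infinity>" by simp
    have hmass: "(\<integral>\<^sup>+y\<in>?B. ennreal (h y) \<partial>lebesgue) = ennreal (\<sigma> * ?V)"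
      unfolding ball_avg_alt[OF r, symmetric] V(1) s using V by (simp add: ennreal_mult'')
    show "\<forall>S\<in>sets lebesgue. S \<subseteq> ?B \<longrightarrow>
       weight_mass \<phi> t ?B * ennreal ((measure lebesgue S / ?V) powr q) \<le>
       ennreal C * weight_mass \<phi> t S"
    proof (intro ballI impI)
      fix S assume S: "S \<in> sets lebesgue" "S \<subseteq> ?B"
      define e where "e = measure lebesgue S"
      have fS: "emeasure lebesgue S = ennreal e" unfolding e_def
        using emeasure_mono[OF S(2), of lebesgue] V by (intro emeasure_eq_ennreal_measure) (auto simp: top_unique)
      show "weight_mass \<phi> t ?B * ennreal ((measure lebesgue S / ?V) powr q) \<le>
         ennreal C * weight_mass \<phi> t S"
      proof (cases "e > 0")
        case False
        then have "measure lebesgue S = 0" using measure_nonneg[of lebesgue S] unfolding e_def by linarith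
        then show ?thesis using q by simp
      next
        case True
        have "weight_mass \<phi> t S \<le> weight_mass \<phi> t ?B"
          by (rule nn_set_integral_set_mono[OF S(2)])
        then have "weight_mass \<phi> t S < \<infinity>" unfolding mass by (rule le_less_trans) simp
        then obtain m where m: "weight_mass \<phi> t S = ennreal m" "m \<ge> 0"
          by (cases "\<integral>\<^sup>+y\<in>S. ennreal (\<phi> y t) \<partial>lebesgue") auto
        \<comment> \<open>Hoelder's inequality on \<open>S\<close> in the guise of Young's inequality with an optimal scaling \<open>\<theta>\<close>.\<close>
        define \<theta> where "\<theta> = (\<sigma> * ?V / e) powr (q - 1)"
        have \<theta>0: "\<theta> > 0" using \<sigma>0 V True by (simp add: \<theta>_def)
        define \<tau> where "\<tau> = \<theta> powr (- (1 / (q - 1)))"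
        have "\<tau> = (\<sigma> * ?V / e) powr (- 1)" unfolding \<tau>_def \<theta>_def powr_powr using q1 by simp
        then have \<tau>: "\<tau> = e / (\<sigma> * ?V)" using \<sigma>0 V True by (simp add: powr_minus_divide)
        have \<tau>0: "\<tau> > 0" using \<theta>0 by (simp add: \<tau>_def)
        have "ennreal e = (\<integral>\<^sup>+y. indicator S y \<partial>lebesgue)" using S fS by simp
        also have "\<dots> \<le> (\<integral>\<^sup>+y. ennreal (\<theta> / q) * (ennreal (\<phi> y t) * indicator S y) + ennreal ((1 - 1 / q) * \<tau>) * (ennreal (h y) * indicator S y) \<partial>lebesgue)"
        proof (rule nn_integral_mono)
          fix y
          have "1 \<le> \<theta> * \<phi> y t / q + (1 - 1 / q) * (\<theta> * \<phi> y t) powr (- (1 / (q - 1)))"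
            using \<theta>0 pos[OF t] q1 by (intro Young_one) auto
          also have "(\<theta> * \<phi> y t) powr (- (1 / (q - 1))) = \<tau> * h y"
            using \<theta>0 pos[OF t, of y] by (simp add: powr_mult \<tau>_def h_def)
          finally have "1 \<le> \<theta> / q * \<phi> y t + (1 - 1 / q) * \<tau> * h y" by (simp add: mult.assoc)
          then have "ennreal 1 \<le> ennreal (\<theta> / q * \<phi> y t + (1 - 1 / q) * \<tau> * h y)" by (rule ennreal_leI)
          also have "\<dots> = ennreal (\<theta> / q) * ennreal (\<phi> y t) + ennreal ((1 - 1 / q) * \<tau>) * ennreal (h y)"
            using \<theta>0 q1 \<tau>0 pos[OF t, of y] hpos[of y] by (intro ennreal_linear) auto
          finally show "indicator S y \<le> ennreal (\<theta> / q) * (ennreal (\<phi> y t) * indicator S y) + ennreal ((1 - 1 / q) * \<tau>) * (ennreal (h y) * indicator S y)"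
            by (simp add: indicator_def)
        qed
        also have "\<dots> = ennreal (\<theta> / q) * weight_mass \<phi> t S + ennreal ((1 - 1 / q) * \<tau>) * (\<integral>\<^sup>+y\<in>S. ennreal (h y) \<partial>lebesgue)"
          using meas[OF t] hm S by (subst nn_integral_add) (auto simp: nn_integral_cmult)
        also have "\<dots> \<le> ennreal (\<theta> / q) * ennreal m + ennreal ((1 - 1 / q) * \<tau>) * ennreal (\<sigma> * ?V)"
          unfolding m(1) hmass[symmetric] by (intro add_left_mono mult_left_mono nn_set_integral_set_mono S) simp
        also have "\<dots> = ennreal (\<theta> / q * m + (1 - 1 / q) * \<tau> * (\<sigma> * ?V))"
          using \<theta>0 q1 \<tau>0 m(2) \<sigma>0 V by (intro ennreal_linear[symmetric]) auto
        \<comment> \<open>The choice of \<open>\<theta>\<close> makes the second summand exactly (1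
          - 1 / q) e, which is absorbed on the left.\<close>
        also have "(1 - 1 / q) * \<tau> * (\<sigma> * ?V) = (1 - 1 / q) * e" using \<tau> \<sigma>0 V by simp
        finally have "e \<le> \<theta> / q * m + (1 - 1 / q) * e"
          using \<theta>0 q1 m(2) True by (subst (asm) ennreal_le_iff) (auto intro!: add_nonneg_nonneg mult_nonneg_nonneg)
        then have "e / q \<le> \<theta> * m / q" by (simp add: algebra_simps)
        then have e1: "e \<le> \<theta> * m" using q1 by (simp add: divide_le_cancel)
        have \<theta>': "\<theta> = \<sigma> powr (q - 1) * (?V / e) powr (q - 1)"
          unfolding \<theta>_def using \<sigma>0 V True by (simp flip: powr_mult)
        have "a * ?V * (e / ?V) powr q \<le> C * m"
        proof -
          have "(?V / e) powr (q - 1) * (e / ?V) powr q = e / ?V"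
          proof -
            have "(?V / e) powr (q - 1) = (e / ?V) powr (- (q - 1))"
              using powr_minus_divide[of "e / ?V" "q - 1"] V True by (simp add: powr_divide)
            then show ?thesis using V True by (simp flip: powr_add)
          qed
          then have "\<theta> * (e / ?V) powr q = \<sigma> powr (q - 1) * (e / ?V)" unfolding \<theta>' by (simp add: mult.assoc)
          moreover have "e * (e / ?V) powr q \<le> \<theta> * m * (e / ?V) powr q" by (rule mult_right_mono[OF e1]) simp
          moreover have "\<theta> * m * (e / ?V) powr q = \<theta> * (e / ?V) powr q * m" by simp
          ultimately have "e * (e / ?V) powr q \<le> \<sigma> powr (q - 1) * (e / ?V) * m" by (simp only:)
          then have "e * (?V * (e / ?V) powr q) \<le> e * (\<sigma> powr (q - 1) * m)"
            using V by (simp add: field_simps)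
          then have "?V * (e / ?V) powr q \<le> \<sigma> powr (q - 1) * m" using True by simp
          then have "a * (?V * (e / ?V) powr q) \<le> a * (\<sigma> powr (q - 1) * m)" using a0 by simp
          also have "\<dots> = (a * \<sigma> powr (q - 1)) * m" by simp
          also have "\<dots> \<le> C * m" by (rule mult_right_mono[OF aC m(2)])
          finally show ?thesis by (simp add: mult.assoc)
        qed
        then show ?thesis unfolding mass m(1) e_def[symmetric] using C m(2)
          by (simp add: ennreal_mult''[symmetric] ennreal_leI)
      qed
    qed
  qed
qed

section \<open>The norm of the indicator of a ball\<close>

lemma ennreal_mult3:
  assumes "0 \<le> k" "0 \<le> l" "0 \<le> m"
  shows "ennreal k * (ennreal l * (ennreal m * M)) = ennreal (k * l * m) * M"
  using assms by (simp add: ennreal_mult'' mult.assoc)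

text \<open>A growth function with one lower type \<open>p\<close> and one Muckenhoupt exponent
  \<open>q\<close> fixed. The constants a, b and c belong to the upper type 1, the lower type and
  the Muckenhoupt condition; taking them at least 1 keeps later estimates monotone.\<close>

locale growth =
  fixes \<phi> :: "real ^ 'n \<Rightarrow> real \<Rightarrow> real" and p q a b c :: real
  assumes meas: "t > 0 \<Longrightarrow> (\<lambda>x. \<phi> x t) \<in> borel_measurable lebesgue"
    and pos: "t > 0 \<Longrightarrow> \<phi> x t > 0"
    and zero: "\<phi> x 0 = 0"
    and mono: "0 \<le> s \<Longrightarrow> s \<le> t \<Longrightarrow> \<phi> x s \<le> \<phi> x t"
    and upper: "t > 0 \<Longrightarrow> s \<ge> 1 \<Longrightarrow> \<phi> x (s * t) \<le> a * s * \<phi> x t"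
    and lower: "t > 0 \<Longrightarrow> 0 < s \<Longrightarrow> s < 1 \<Longrightarrow> \<phi> x (s * t) \<le> b * s powr p * \<phi> x t"
    and cst: "p > 0" "q \<ge> 1" "a \<ge> 1" "b \<ge> 1" "c \<ge> 1"
    and mass_finite: "t > 0 \<Longrightarrow> r > 0 \<Longrightarrow> weight_mass \<phi> t (ball x r) < \<infinity>"
    and mass_subset: "t > 0 \<Longrightarrow> r > 0 \<Longrightarrow> S \<in> sets lebesgue \<Longrightarrow> S \<subseteq> ball x r \<Longrightarrow>
       weight_mass \<phi> t (ball x r) * ennreal ((measure lebesgue S / measure lebesgue (ball x r)) powr q) \<le>
       ennreal c * weight_mass \<phi> t S"
begin

definition mass :: "real \<Rightarrow> (real ^ 'n) set \<Rightarrow> ennreal" where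
  "mass t S = weight_mass \<phi> t S"

definition N :: "real ^ 'n \<Rightarrow> real \<Rightarrow> real" where
  "N x r = enn2real (ball_norm \<phi> x r)"

lemma mass_mono: "0 \<le> s \<Longrightarrow> s \<le> t \<Longrightarrow> mass s S \<le> mass t S"
  unfolding mass_def by (intro nn_integral_mono mult_right_mono ennreal_leI mono) auto

lemma mass_set_mono: "S \<subseteq> T \<Longrightarrow> mass t S \<le> mass t T"
  unfolding mass_def by (rule nn_set_integral_set_mono)

lemma mass_scale:
  assumes S: "S \<in> sets lebesgue" and t: "t > 0" and k: "k \<ge> 0" and le: "\<And>y. \<phi> y (s * t) \<le> k * \<phi> y t"
  shows "mass (s * t) S \<le> ennreal k * mass t S"
proof -
  have "mass (s * t) S \<le> (\<integral>\<^sup>+y. ennreal k * (ennreal (\<phi> y t) * indicator S y) \<partial>lebesgue)"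
    unfolding mass_def using ennreal_leI[OF le]
    by (intro nn_integral_mono) (auto simp: indicator_def ennreal_mult'[OF k])
  also have "\<dots> = ennreal k * mass t S"
    unfolding mass_def using meas[OF t] S by (intro nn_integral_cmult) auto
  finally show ?thesis .
qed

lemma mass_upper: "S \<in> sets lebesgue \<Longrightarrow> t > 0 \<Longrightarrow> s \<ge> 1 \<Longrightarrow> mass (s * t) S \<le> ennreal (a * s) * mass t S"
  using upper cst by (intro mass_scale) auto

lemma mass_lower: "S \<in> sets lebesgue \<Longrightarrow> t > 0 \<Longrightarrow> s > 0 \<Longrightarrow> s < 1 \<Longrightarrow> mass (s * t) S \<le> ennreal (b * s powr p) * mass t S"
  using lower cst by (intro mass_scale) auto

lemma mass_ball_real:
  assumes t: "t > 0" and r: "r > 0"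
  obtains m where "mass t (ball x r) = ennreal m" "m > 0"
proof -
  have "mass t (ball x r) > 0"
    unfolding mass_def
    by (rule nn_set_integral_pos) (use meas[OF t] pos[OF t] ball_measure_facts[OF r, of x] in auto)
  moreover have "mass t (ball x r) < \<infinity>" unfolding mass_def by (rule mass_finite[OF t r])
  ultimately show thesis by (intro that[of "enn2real (mass t (ball x r))"]) (auto simp: enn2real_positive_iff)
qed

lemma ball_norm_alt: "ball_norm \<phi> x r = Inf {ennreal l | l. l > 0 \<and> mass (1 / l) (ball x r) \<le> 1}"
proof -
  have "(\<integral>\<^sup>+y. ennreal (\<phi> y (norm (indicator (ball x r) y :: real) / l)) \<partial>lebesgue) = mass (1 / l) (ball x r)" for l
    unfolding mass_def by (rule nn_integral_cong) (auto simp: indicator_def zero)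
  then show ?thesis unfolding Lphi_norm_def by simp
qed

lemma ball_norm_witness:
  assumes r: "r > 0"
  shows "\<exists>l>0. mass (1 / l) (ball x r) \<le> 1"
proof -
  obtain m where m: "mass 1 (ball x r) = ennreal m" "m > 0" by (rule mass_ball_real[OF _ r]) auto
  \<comment> \<open>The summand 2 makes s < 1, and b * s powr p * m = b m / (b m + 2) \<le>
    1.\<close>
  define s where "s = (1 / (b * m + 2)) powr (1 / p)"
  have bm: "b * m > 0" using m cst by simp
  have s0: "s > 0" using bm by (simp add: s_def)
  have "s < 1 powr (1 / p)" unfolding s_def using bm cst by (intro powr_less_mono2) auto
  then have s1: "s < 1" by simp
  have sp: "s powr p = 1 / (b * m + 2)" unfolding s_def powr_powr using bm cst by simp
  have "mass (s * 1) (ball x r) \<le> ennreal (b * s powr p) * mass 1 (ball x r)"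
    by (rule mass_lower) (use s0 s1 in auto)
  also have "\<dots> = ennreal (b * s powr p * m)" using m cst by (simp add: ennreal_mult'')
  also have "\<dots> \<le> ennreal 1" unfolding sp using bm by (intro ennreal_leI) (simp add: field_simps)
  finally show ?thesis using s0 by (intro exI[of _ "1 / s"]) simp
qed

text \<open>If l < 1, the lower type bounds the mass at level 1 by b * l powr p, so l cannot be
  arbitrarily small. This makes the norm positive, while \<open>ball_norm_witness\<close> makes it
  finite.\<close>

lemma ball_norm_lower_bound:
  assumes r: "r > 0"
  shows "\<exists>e>0. \<forall>l>0. mass (1 / l) (ball x r) \<le> 1 \<longrightarrow> e \<le> l"
proof -
  obtain m where m: "mass 1 (ball x r) = ennreal m" "m > 0" by (rule mass_ball_real[OF _ r]) auto
  define e where "e = min 1 ((m / b) powr (1 / p))"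
  have e0: "e > 0" using m cst by (simp add: e_def)
  have "e \<le> l" if l: "l > 0" "mass (1 / l) (ball x r) \<le> 1" for l
  proof (cases "l < 1")
    case True
    have "mass (l * (1 / l)) (ball x r) \<le> ennreal (b * l powr p) * mass (1 / l) (ball x r)"
      by (rule mass_lower) (use l True in auto)
    also have "\<dots> \<le> ennreal (b * l powr p) * 1" by (rule mult_left_mono[OF l(2)]) simp
    finally have "ennreal m \<le> ennreal (b * l powr p)" using l m by simp
    then have "m \<le> b * l powr p" using cst by (subst (asm) ennreal_le_iff) auto
    then have "m / b \<le> l powr p" using cst by (simp add: field_simps)
    then have "(m / b) powr (1 / p) \<le> (l powr p) powr (1 / p)" using cst m by (intro powr_mono2) auto
    also have "\<dots> = l" unfolding powr_powr using cst l by simp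
    finally show ?thesis by (simp add: e_def)
  qed (simp add: e_def)
  then show ?thesis using e0 by blast
qed

lemma ball_norm_N:
  assumes r: "r > 0"
  shows "ball_norm \<phi> x r = ennreal (N x r)" "N x r > 0"
proof -
  obtain l where l: "l > 0" "mass (1 / l) (ball x r) \<le> 1" using ball_norm_witness[OF r] by blast
  have "ball_norm \<phi> x r \<le> ennreal l" unfolding ball_norm_alt by (rule Inf_lower) (use l in blast)
  then have fin: "ball_norm \<phi> x r < \<infinity>" by (rule le_less_trans) simp
  obtain e where e: "e > 0" "\<And>l. l > 0 \<Longrightarrow> mass (1 / l) (ball x r) \<le> 1 \<Longrightarrow> e \<le> l" using ball_norm_lower_bound[OF r] by blast
  have "ennreal e \<le> ball_norm \<phi> x r" unfolding ball_norm_alt by (rule Inf_greatest) (use e in \<open>auto intro: ennreal_leI\<close>)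
  moreover have "ennreal e > 0" using e by simp
  ultimately have "ball_norm \<phi> x r > 0" by (rule less_le_trans[rotated])
  then show "ball_norm \<phi> x r = ennreal (N x r)" "N x r > 0" using fin by (auto simp: N_def enn2real_positive_iff)
qed

lemma mass_le_one:
  assumes r: "r > 0" and l: "l > N x r"
  shows "mass (1 / l) (ball x r) \<le> 1"
proof -
  have "ball_norm \<phi> x r < ennreal l" unfolding ball_norm_N(1)[OF r] using l ball_norm_N(2)[OF r, of x] by (intro ennreal_lessI) auto
  then obtain k where k: "k > 0" "mass (1 / k) (ball x r) \<le> 1" "ennreal k < ennreal l"
    unfolding ball_norm_alt Inf_less_iff by blast
  then have "k < l" by (simp add: ennreal_less_iff)
  then have "mass (1 / l) (ball x r) \<le> mass (1 / k) (ball x r)" using k by (intro mass_mono) (auto simp: field_simps)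
  then show ?thesis using k(2) by (rule order_trans)
qed

lemma mass_gt_one:
  assumes r: "r > 0" and l: "0 < l" "l < N x r"
  shows "mass (1 / l) (ball x r) > 1"
proof (rule ccontr)
  assume "\<not> ?thesis"
  then have "ball_norm \<phi> x r \<le> ennreal l" unfolding ball_norm_alt by (intro Inf_lower) (use l in auto)
  then show False unfolding ball_norm_N(1)[OF r] using l by (simp add: ennreal_le_iff)
qed

text \<open>Since \<phi> may jump in its second variable, the mass at level 1 / N need not be 1. The
  levels 1 / (2 N) and 2 / N lie strictly on the two sides, and the upper type transports their
  bounds over a factor 2, here and in \<open>mass_norm_ge\<close>.\<close>

lemma mass_norm_le:
  assumes r: "r > 0"
  shows "mass (1 / N x r) (ball x r) \<le> ennreal (2 * a)"
proof -
  have N: "N x r > 0" by (rule ball_norm_N(2)[OF r])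
  have "mass (2 * (1 / (2 * N x r))) (ball x r) \<le> ennreal (a * 2) * mass (1 / (2 * N x r)) (ball x r)"
    by (rule mass_upper) (use N in auto)
  also have "\<dots> \<le> ennreal (a * 2) * 1" by (intro mult_left_mono mass_le_one r) (use N in auto)
  finally show ?thesis by (simp add: mult.commute)
qed

lemma mass_norm_ge:
  assumes r: "r > 0"
  shows "1 \<le> ennreal (2 * a) * mass (1 / N x r) (ball x r)"
proof -
  have N: "N x r > 0" by (rule ball_norm_N(2)[OF r])
  have "1 \<le> mass (1 / (N x r / 2)) (ball x r)" by (intro less_imp_le mass_gt_one r) (use N in auto)
  also have "1 / (N x r / 2) = 2 * (1 / N x r)" by simp
  also have "mass (2 * (1 / N x r)) (ball x r) \<le> ennreal (a * 2) * mass (1 / N x r) (ball x r)"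
    by (rule mass_upper) (use N in auto)
  finally show ?thesis by (simp add: mult.commute)
qed

text \<open>Upper type 1 is what makes the bound linear in the mass: the level 1 / N z s is N x r /
  N z s \<ge> 1 times the level 1 / N x r, so the factor N z s on the left cancels.\<close>

lemma N_le_mass:
  assumes r: "r > 0" and s: "s > 0" and sub: "ball z s \<subseteq> ball x r"
  shows "ennreal (N z s) \<le> ennreal (2 * a\<^sup>2 * N x r) * mass (1 / N x r) (ball z s)"
proof -
  have N: "N x r > 0" "N z s > 0" by (rule ball_norm_N(2)[OF r], rule ball_norm_N(2)[OF s])
  have a0: "a > 0" using cst by simp
  have le: "N z s \<le> N x r"
  proof (rule ccontr)
    assume "\<not> ?thesis"
    then obtain l where l: "N x r < l" "l < N z s" using dense[of "N x r" "N z s"] by auto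
    have "1 < mass (1 / l) (ball z s)" by (rule mass_gt_one[OF s]) (use l N in auto)
    also have "\<dots> \<le> mass (1 / l) (ball x r)" by (rule mass_set_mono[OF sub])
    also have "\<dots> \<le> 1" by (rule mass_le_one[OF r l(1)])
    finally show False by simp
  qed
  have eq: "1 / N z s = N x r / N z s * (1 / N x r)" using N by simp
  have "1 \<le> ennreal (2 * a) * mass (1 / N z s) (ball z s)" by (rule mass_norm_ge[OF s])
  also have "\<dots> \<le> ennreal (2 * a) * (ennreal (a * (N x r / N z s)) * mass (1 / N x r) (ball z s))"
    by (subst eq, intro mult_left_mono mass_upper) (use N le in \<open>auto simp: field_simps\<close>)
  finally have "ennreal (N z s) * 1 \<le> ennreal (N z s) * (ennreal (2 * a) * (ennreal (a * (N x r / N z s)) * mass (1 / N x r) (ball z s)))"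
    by (rule mult_left_mono) simp
  also have "\<dots> = ennreal (N z s * (2 * a) * (a * (N x r / N z s))) * mass (1 / N x r) (ball z s)"
    using N a0 by (intro ennreal_mult3) auto
  also have "N z s * (2 * a) * (a * (N x r / N z s)) = 2 * a\<^sup>2 * N x r"
    using N by (simp add: power2_eq_square)
  finally show ?thesis by simp
qed

text \<open>n q / p is the growth exponent that the Muckenhoupt exponent and the lower type produce.
  The maximum with n supplies \<kappa> \<ge> n and stays below n + 1 whenever n q / p does.\<close>

definition \<kappa> :: real where "\<kappa> = max (real CARD('n)) (real CARD('n) * q / p)"

text \<open>One constant for three purposes: 2 a^2 for small balls inside a ball, 2 a for the mass
  at level 1 / N, and the last summand for the growth under dilation.\<close>

definition D :: real where "D = 2 * a\<^sup>2 + 2 * a + (b * c * (2 * a)\<^sup>2) powr (1 / p)"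

lemma mass_dilate:
  assumes t: "t > 0" and r: "r > 0" and \<Lambda>: "\<Lambda> \<ge> 1"
  shows "mass t (ball x (\<Lambda> * r)) \<le> ennreal (c * \<Lambda> powr (real CARD('n) * q)) * mass t (ball x r)"
proof -
  have R: "\<Lambda> * r > 0" using \<Lambda> r by simp
  have sub: "ball x r \<subseteq> ball x (\<Lambda> * r)" using \<Lambda> r by (intro subset_ball) simp
  have "measure lebesgue (ball x r) / measure lebesgue (ball x (\<Lambda> * r)) = 1 / \<Lambda> ^ CARD('n)"
    unfolding measure_lebesgue_ball[OF r] measure_lebesgue_ball[OF R] using r
    by (simp add: power_mult_distrib less_imp_neq[OF ball_vol_pos, symmetric])
  also have "\<dots> = \<Lambda> powr (- real CARD('n))" using \<Lambda> by (simp add: powr_minus powr_realpow divide_inverse)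
  finally have e: "(measure lebesgue (ball x r) / measure lebesgue (ball x (\<Lambda> * r))) powr q = \<Lambda> powr (- (real CARD('n) * q))"
    by (simp add: powr_powr)
  have "mass t (ball x (\<Lambda> * r)) * ennreal (\<Lambda> powr (- (real CARD('n) * q))) \<le> ennreal c * mass t (ball x r)"
    using mass_subset[OF t R ball_lebesgue sub] unfolding e mass_def .
  then have "mass t (ball x (\<Lambda> * r)) * ennreal (\<Lambda> powr (- (real CARD('n) * q))) * ennreal (\<Lambda> powr (real CARD('n) * q)) \<le>
    ennreal c * mass t (ball x r) * ennreal (\<Lambda> powr (real CARD('n) * q))" by (rule mult_right_mono) simp
  moreover have "ennreal (\<Lambda> powr (- (real CARD('n) * q))) * ennreal (\<Lambda> powr (real CARD('n) * q)) = 1"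
    using \<Lambda> by (simp flip: ennreal_mult' powr_add)
  ultimately show ?thesis using cst by (simp add: mult.assoc ennreal_mult'' mult.commute[of "mass t (ball x r)"])
qed

text \<open>For s = N x r / N x (\<Lambda> r) < 1, the lower bound for the mass of the large ball,
  the lower type applied to s, and the doubling of masses give 1 \<le> K * \<Lambda>^(n q) * s^p,
  and a p-th root is taken. For s \<ge> 1 the norm has not grown.\<close>

lemma N_grow:
  assumes r: "r > 0" and \<Lambda>: "\<Lambda> \<ge> 1"
  shows "N x (\<Lambda> * r) \<le> D * \<Lambda> powr \<kappa> * N x r"
proof -
  let ?n = "real CARD('n)"
  define s where "s = N x r / N x (\<Lambda> * r)"
  have R: "\<Lambda> * r > 0" using \<Lambda> r by simp
  have N: "N x r > 0" "N x (\<Lambda> * r) > 0" by (rule ball_norm_N(2)[OF r], rule ball_norm_N(2)[OF R])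
  have D1: "D \<ge> 1" using cst by (simp add: D_def add_increasing add_increasing2)
  have s0: "s > 0" using N by (simp add: s_def)
  define K where "K = b * c * (2 * a)\<^sup>2"
  have K0: "K > 0" using cst by (simp add: K_def)
  show ?thesis
  proof (cases "s < 1")
    case False
    then have "N x (\<Lambda> * r) \<le> N x r" using N by (simp add: s_def)
    also have "\<dots> \<le> D * \<Lambda> powr \<kappa> * N x r"
    proof -
      have "\<Lambda> powr \<kappa> \<ge> 1" using \<Lambda> by (intro ge_one_powr_ge_zero) (auto simp: \<kappa>_def)
      then have "1 * 1 \<le> D * \<Lambda> powr \<kappa>" using D1 by (intro mult_mono) auto
      then show ?thesis using N by simp
    qed
    finally show ?thesis .
  next
    case True
    have eq: "1 / N x (\<Lambda> * r) = s * (1 / N x r)" using N by (simp add: s_def)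
    have "1 \<le> ennreal (2 * a) * mass (1 / N x (\<Lambda> * r)) (ball x (\<Lambda> * r))" by (rule mass_norm_ge[OF R])
    also have "\<dots> \<le> ennreal (2 * a) * (ennreal (b * s powr p) * mass (1 / N x r) (ball x (\<Lambda> * r)))"
      by (subst eq, intro mult_left_mono mass_lower) (use N s0 True in auto)
    also have "\<dots> \<le> ennreal (2 * a) * (ennreal (b * s powr p) * (ennreal (c * \<Lambda> powr (?n * q)) * mass (1 / N x r) (ball x r)))"
      by (intro mult_left_mono mass_dilate r \<Lambda>) (use N in auto)
    also have "\<dots> \<le> ennreal (2 * a) * (ennreal (b * s powr p) * (ennreal (c * \<Lambda> powr (?n * q)) * ennreal (2 * a)))"
      by (intro mult_left_mono mass_norm_le r) auto
    also have "\<dots> = ennreal (2 * a * (b * s powr p) * (c * \<Lambda> powr (?n * q))) * ennreal (2 * a)"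
      using cst by (intro ennreal_mult3) auto
    also have "\<dots> = ennreal (2 * a * (b * s powr p) * (c * \<Lambda> powr (?n * q)) * (2 * a))"
      using cst by (intro ennreal_mult[symmetric]) auto
    also have "2 * a * (b * s powr p) * (c * \<Lambda> powr (?n * q)) * (2 * a) = K * \<Lambda> powr (?n * q) * s powr p"
      by (simp add: K_def power2_eq_square)
    finally have "1 \<le> K * \<Lambda> powr (?n * q) * s powr p" by simp
    then have "1 / s powr p \<le> K * \<Lambda> powr (?n * q)" using s0 by (simp add: field_simps)
    moreover have "1 / s powr p = (1 / s) powr p" using s0 by (simp add: powr_divide)
    ultimately have "((1 / s) powr p) powr (1 / p) \<le> (K * \<Lambda> powr (?n * q)) powr (1 / p)"
      using cst by (intro powr_mono2) auto
    moreover have "((1 / s) powr p) powr (1 / p) = 1 / s" unfolding powr_powr using cst s0 by simp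
    moreover have "(K * \<Lambda> powr (?n * q)) powr (1 / p) = K powr (1 / p) * \<Lambda> powr (?n * q / p)"
      using K0 by (simp add: powr_mult powr_powr)
    ultimately have "1 / s \<le> K powr (1 / p) * \<Lambda> powr (?n * q / p)" by simp
    also have "\<dots> \<le> D * \<Lambda> powr \<kappa>"
    proof (intro mult_mono)
      show "K powr (1 / p) \<le> D" using cst by (simp add: D_def K_def)
      show "\<Lambda> powr (?n * q / p) \<le> \<Lambda> powr \<kappa>" using \<Lambda> by (intro powr_mono) (auto simp: \<kappa>_def)
    qed (use D1 in auto)
    finally have "1 / s * N x r \<le> D * \<Lambda> powr \<kappa> * N x r" using N by (intro mult_right_mono) auto
    then show ?thesis using N by (simp add: s_def)
  qed
qed

lemma ball_gauge:
  assumes \<kappa>: "real CARD('n) * q / p < real CARD('n) + 1"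
  shows "ball_gauge N \<kappa> D"
proof
  show "N x r > 0" if "r > 0" for x r by (rule ball_norm_N(2)[OF that])
  show "real CARD('n) \<le> \<kappa>" by (simp add: \<kappa>_def)
  show "\<kappa> < real CARD('n) + 1" using assms by (simp add: \<kappa>_def)
  show "D > 0" using cst by (simp add: D_def add_pos_nonneg)
  show "N x (\<Lambda> * r) \<le> D * \<Lambda> powr \<kappa> * N x r" if "r > 0" "\<Lambda> \<ge> 1" for x r \<Lambda> by (rule N_grow[OF that])
  fix x :: "real ^ 'n" and r :: real assume r: "r > 0"
  have N: "N x r > 0" by (rule ball_norm_N(2)[OF r])
  have D: "2 * a \<le> D" "2 * a\<^sup>2 \<le> D" using cst by (auto simp: D_def)
  show "\<exists>w. w \<in> borel_measurable lebesgue \<and> (\<integral>\<^sup>+y\<in>ball x r. w y \<partial>lebesgue) \<le> ennreal D \<and>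
      (\<forall>z s. s > 0 \<longrightarrow> ball z s \<subseteq> ball x r \<longrightarrow> ennreal (N z s) \<le> ennreal (D * N x r) * (\<integral>\<^sup>+y\<in>ball z s. w y \<partial>lebesgue))"
  proof (intro exI[of _ "\<lambda>y. ennreal (\<phi> y (1 / N x r))"] conjI allI impI)
    show "(\<lambda>y. ennreal (\<phi> y (1 / N x r))) \<in> borel_measurable lebesgue" using meas[of "1 / N x r"] N by simp
    have "mass (1 / N x r) (ball x r) \<le> ennreal D"
      using order_trans[OF mass_norm_le[OF r] ennreal_leI[OF D(1)]] .
    then show "(\<integral>\<^sup>+y\<in>ball x r. ennreal (\<phi> y (1 / N x r)) \<partial>lebesgue) \<le> ennreal D" unfolding mass_def .
    fix z s assume s: "s > 0" "ball z s \<subseteq> ball x r"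
    have "ennreal (N z s) \<le> ennreal (2 * a\<^sup>2 * N x r) * mass (1 / N x r) (ball z s)" by (rule N_le_mass[OF r s])
    also have "\<dots> \<le> ennreal (D * N x r) * mass (1 / N x r) (ball z s)"
      using D N by (intro mult_right_mono ennreal_leI) auto
    finally show "ennreal (N z s) \<le> ennreal (D * N x r) * (\<integral>\<^sup>+y\<in>ball z s. ennreal (\<phi> y (1 / N x r)) \<partial>lebesgue)"
      unfolding mass_def .
  qed
qed

end

section \<open>Square integrable weights from the two alternatives\<close>

lemma reverse_Hoelder_square:
  fixes \<phi> :: "real ^ 'n \<Rightarrow> real \<Rightarrow> real"
  assumes meas: "\<And>t. t > 0 \<Longrightarrow> (\<lambda>x. \<phi> x t) \<in> borel_measurable lebesgue"
    and pos: "\<And>x t. t > 0 \<Longrightarrow> \<phi> x t > 0"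
    and Q: "Q > 2" and RH: "reverse_Hoelder \<phi> Q"
  shows "\<exists>C\<ge>1. \<forall>t>0. \<forall>x. \<forall>r>0. \<forall>m>0. weight_mass \<phi> t (ball x r) = ennreal m \<longrightarrow>
    (\<integral>\<^sup>+y\<in>ball x r. ennreal ((\<phi> y t)\<^sup>2) \<partial>lebesgue) \<le> ennreal (C * m\<^sup>2 / measure lebesgue (ball x r))"
proof -
  have avg: "ball_avg x r (\<lambda>y. ennreal (\<phi> y t)) = ennreal (m / measure lebesgue (ball x r))"
    if "r > 0" "m > 0" "weight_mass \<phi> t (ball x r) = ennreal m" for x :: "real ^ 'n" and r m t
    using ball_measure_facts[OF that(1), of x] that(2) unfolding ball_avg_def that(3) ball_measure_facts(1)[OF that(1)]
    by (simp add: divide_ennreal)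
  have inv: "F \<le> ennreal (C * \<alpha>)" if "F * inverse (ennreal \<alpha>) \<le> ennreal C" "\<alpha> > 0" "C \<ge> 1" for F C \<alpha>
  proof -
    have "F = F * (inverse (ennreal \<alpha>) * ennreal \<alpha>)" using that(2) by (simp add: inverse_ennreal flip: ennreal_mult')
    also have "\<dots> \<le> ennreal C * ennreal \<alpha>" using mult_right_mono[OF that(1), of "ennreal \<alpha>"] by (simp add: mult.assoc)
    also have "\<dots> = ennreal (C * \<alpha>)" using that by (simp add: ennreal_mult'')
    finally show ?thesis .
  qed
  show ?thesis
  proof (cases "Q = \<infinity>")
    case True
    obtain C where C: "C \<ge> 1" and le: "\<And>t x r. t > 0 \<Longrightarrow> r > 0 \<Longrightarrow>
        esssup (restrict_space lebesgue (ball x r)) (\<lambda>y. ennreal (\<phi> y t)) *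
           inverse (ball_avg x r (\<lambda>y. ennreal (\<phi> y t))) \<le> ennreal C"
      using ball_SUP_bound[OF RH[unfolded reverse_Hoelder_def if_P[OF True]]] by metis
    show ?thesis
    proof (intro exI[of _ "C\<^sup>2"] conjI allI impI)
      show "1 \<le> C\<^sup>2" using C by simp
      fix t r m :: real and x :: "real ^ 'n"
      assume t: "t > 0" and r: "r > 0" and m: "m > 0" "weight_mass \<phi> t (ball x r) = ennreal m"
      let ?B = "ball x r" and ?V = "measure lebesgue (ball x r)"
      let ?k = "C * (m / ?V)"
      have V: "emeasure lebesgue ?B = ennreal ?V" "?V > 0" using ball_measure_facts[OF r] by auto
      have \<alpha>: "m / ?V > 0" using V m by simp
      have k0: "?k \<ge> 0" by (rule mult_nonneg_nonneg[OF _ less_imp_le[OF \<alpha>]]) (use C in simp)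
      have s: "esssup (restrict_space lebesgue ?B) (\<lambda>y. ennreal (\<phi> y t)) \<le> ennreal ?k"
        by (rule inv[OF _ \<alpha> C]) (use le[OF t r, of x] avg[OF r m] in simp)
      have "AE y in lebesgue. y \<in> ?B \<longrightarrow> ennreal (\<phi> y t) \<le> esssup (restrict_space lebesgue ?B) (\<lambda>y. ennreal (\<phi> y t))"
        using esssup_AE[where M="restrict_space lebesgue ?B" and f="\<lambda>y. ennreal (\<phi> y t)"]
        by (subst (asm) AE_restrict_space_iff) auto
      then have "(\<integral>\<^sup>+y\<in>?B. ennreal ((\<phi> y t)\<^sup>2) \<partial>lebesgue) \<le> (\<integral>\<^sup>+y\<in>?B. ennreal (?k\<^sup>2) \<partial>lebesgue)"
      proof (intro nn_integral_mono_AE, eventually_elim)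
        case (elim y)
        show ?case
        proof (cases "y \<in> ?B")
          case True
          then have "ennreal (\<phi> y t) \<le> ennreal ?k" using elim s by (auto intro: order_trans)
          then have "\<phi> y t \<le> ?k" using k0 by (subst (asm) ennreal_le_iff) auto
          then have "(\<phi> y t)\<^sup>2 \<le> ?k\<^sup>2" using pos[OF t, of y] by (intro power_mono) auto
          then show ?thesis using True by (simp add: ennreal_leI)
        qed simp
      qed
      also have "\<dots> = ennreal (?k\<^sup>2) * ennreal ?V" using V by (simp add: nn_integral_cmult_indicator)
      also have "\<dots> = ennreal (?k\<^sup>2 * ?V)" by (rule ennreal_mult[symmetric]) simp_all
      also have "?k\<^sup>2 * ?V = C\<^sup>2 * m\<^sup>2 / ?V" using V by (simp add: power2_eq_square)
      finally show "(\<integral>\<^sup>+y\<in>?B. ennreal ((\<phi> y t)\<^sup>2) \<partial>lebesgue) \<le> ennreal (C\<^sup>2 * m\<^sup>2 / ?V)" .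
    qed
  next
    case False
    define q where "q = enn2real Q"
    have "Q = ennreal q" using False by (simp add: q_def less_top)
    then have q: "q > 2" using Q ennreal_less_iff[of 2 q] by simp
    obtain C where C: "C \<ge> 1" and le: "\<And>t x r. t > 0 \<Longrightarrow> r > 0 \<Longrightarrow>
        ennpow (ball_avg x r (\<lambda>y. ennpow (ennreal (\<phi> y t)) q)) (1 / q) *
           inverse (ball_avg x r (\<lambda>y. ennreal (\<phi> y t))) \<le> ennreal C"
      using ball_SUP_bound[OF RH[unfolded reverse_Hoelder_def if_not_P[OF False]]] unfolding q_def by metis
    show ?thesis
    proof (intro exI[of _ "2 * C\<^sup>2"] conjI allI impI)
      show "1 \<le> 2 * C\<^sup>2" using C one_le_power[OF C, of 2] by linarith
      fix t r m :: real and x :: "real ^ 'n"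
      assume t: "t > 0" and r: "r > 0" and m: "m > 0" "weight_mass \<phi> t (ball x r) = ennreal m"
      let ?B = "ball x r" and ?V = "measure lebesgue (ball x r)"
      define k where "k = C * (m / ?V)"
      let ?A = "ball_avg x r (\<lambda>y. ennreal (\<phi> y t powr q))"
      have V: "emeasure lebesgue ?B = ennreal ?V" "?V > 0" using ball_measure_facts[OF r] by auto
      have \<alpha>: "m / ?V > 0" using V m by simp
      have k0: "k > 0" unfolding k_def by (rule mult_pos_pos[OF _ \<alpha>]) (use C in simp)
      have pw: "ennpow (ennreal (\<phi> y t)) q = ennreal (\<phi> y t powr q)" for y
        using pos[OF t, of y] by (simp add: ennpow_def)
      have s: "ennpow ?A (1 / q) \<le> ennreal k" unfolding k_def
        by (rule inv[OF _ \<alpha> C]) (use le[OF t r, of x] avg[OF r m] in \<open>simp add: pw\<close>)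
      have Afin: "?A \<noteq> \<infinity>" using s by (auto simp: ennpow_def top_unique)
      define A where "A = enn2real ?A"
      have A: "?A = ennreal A" "A \<ge> 0" using Afin by (auto simp: A_def less_top)
      have "A powr (1 / q) \<le> k" using s Afin k0 by (simp add: ennpow_def A_def)
      then have "(A powr (1 / q)) powr q \<le> k powr q" using q by (intro powr_mono2) auto
      then have Ak: "A \<le> k powr q" using A(2) q by (simp add: powr_powr)
      have Aq: "(\<integral>\<^sup>+y\<in>?B. ennreal (\<phi> y t powr q) \<partial>lebesgue) = ennreal (A * ?V)"
        unfolding ball_avg_alt[OF r, symmetric] V(1) A using V A by (simp add: ennreal_mult'')
      have "(\<integral>\<^sup>+y\<in>?B. ennreal ((\<phi> y t)\<^sup>2) \<partial>lebesgue) \<le>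
        (\<integral>\<^sup>+y. ennreal (k\<^sup>2 / k powr q) * (ennreal (\<phi> y t powr q) * indicator ?B y) + ennreal (k\<^sup>2) * indicator ?B y \<partial>lebesgue)"
      proof (rule nn_integral_mono)
        fix y
        \<comment> \<open>\<open>k\<close> is C times the average of \<phi> over the ball; the
          inequality y^2 \<le> y powr q + 1 for y = \<phi> / k reduces the square integral to the
          reverse Hoelder integral, which is at most k powr q times the volume.\<close>
        have "(\<phi> y t / k)\<^sup>2 \<le> (\<phi> y t / k) powr q + 1" using pos[OF t, of y] k0 q by (intro square_le_powr) auto
        then have "k\<^sup>2 * (\<phi> y t / k)\<^sup>2 \<le> k\<^sup>2 * ((\<phi> y t / k) powr q + 1)" by (rule mult_left_mono) simp
        moreover have "k\<^sup>2 * (\<phi> y t / k)\<^sup>2 = (\<phi> y t)\<^sup>2" using k0 by (simp add: power_divide)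
        moreover have "k\<^sup>2 * ((\<phi> y t / k) powr q + 1) = k\<^sup>2 / k powr q * \<phi> y t powr q + k\<^sup>2 * 1"
          using k0 pos[OF t, of y] by (simp add: powr_divide distrib_left)
        ultimately have "ennreal ((\<phi> y t)\<^sup>2) \<le> ennreal (k\<^sup>2 / k powr q * \<phi> y t powr q + k\<^sup>2 * 1)" by (intro ennreal_leI) (simp only:)
        also have "\<dots> = ennreal (k\<^sup>2 / k powr q) * ennreal (\<phi> y t powr q) + ennreal (k\<^sup>2) * ennreal 1"
          by (rule ennreal_linear) auto
        finally show "ennreal ((\<phi> y t)\<^sup>2) * indicator ?B y \<le> ennreal (k\<^sup>2 / k powr q) * (ennreal (\<phi> y t powr q) * indicator ?B y) + ennreal (k\<^sup>2) * indicator ?B y"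
          by (simp add: indicator_def)
      qed
      also have "\<dots> = ennreal (k\<^sup>2 / k powr q) * (\<integral>\<^sup>+y\<in>?B. ennreal (\<phi> y t powr q) \<partial>lebesgue) + ennreal (k\<^sup>2) * ennreal ?V"
        using meas[OF t] V by (subst nn_integral_add) (auto simp: nn_integral_cmult nn_integral_cmult_indicator)
      also have "\<dots> = ennreal (k\<^sup>2 / k powr q * (A * ?V) + k\<^sup>2 * ?V)"
        unfolding Aq using A V by (intro ennreal_linear[symmetric]) auto
      also have "\<dots> \<le> ennreal (2 * C\<^sup>2 * m\<^sup>2 / ?V)"
      proof (rule ennreal_leI)
        have "A / k powr q \<le> 1" using Ak k0 by simp
        then have "k\<^sup>2 * ?V * (A / k powr q) \<le> k\<^sup>2 * ?V * 1" using V by (intro mult_left_mono) auto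
        then have "k\<^sup>2 / k powr q * (A * ?V) + k\<^sup>2 * ?V \<le> 2 * (k\<^sup>2 * ?V)" by (simp add: mult_ac)
        also have "2 * (k\<^sup>2 * ?V) = 2 * C\<^sup>2 * m\<^sup>2 / ?V" unfolding k_def using V by (simp add: power2_eq_square)
        finally show "k\<^sup>2 / k powr q * (A * ?V) + k\<^sup>2 * ?V \<le> 2 * C\<^sup>2 * m\<^sup>2 / ?V" .
      qed
      finally show "(\<integral>\<^sup>+y\<in>?B. ennreal ((\<phi> y t)\<^sup>2) \<partial>lebesgue) \<le> ennreal (2 * C\<^sup>2 * m\<^sup>2 / ?V)" .
    qed
  qed
qed

text \<open>The centre of the subcube lies within 4 n r of x, and the radius n k is at most 4 n r
  since k \<le> 4 r.\<close>

lemma circumscribed_ball_subset: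
  fixes x :: "real ^ 'n"
  assumes r: "r > 0" and d: "dyadic_sub (big_corner x r) (4 * r) b k"
  shows "ball (cube_center b k) (real CARD('n) * k) \<subseteq> ball x (8 * real CARD('n) * r)"
proof
  let ?n = "real CARD('n)"
  have k: "k > 0" "hcube b k \<subseteq> hcube (big_corner x r) (4 * r)" "k \<le> 4 * r"
    using dyadic_sub_props[OF d] r by auto
  have "cube_center b k \<in> hcube b k" using k(1) by (simp add: cube_center_def hcube_def)
  then have c: "dist x (cube_center b k) < 4 * ?n * r" using k(2) big_cube_subset_ball[OF r, of x] by auto
  have nk: "?n * k \<le> 4 * ?n * r" using mult_left_mono[OF k(3), of ?n] by (simp add: mult_ac)
  fix y assume "y \<in> ball (cube_center b k) (?n * k)"
  then have "dist x y < 4 * ?n * r + ?n * k" using c dist_triangle[of x y "cube_center b k"] by simp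
  moreover have "4 * ?n * r + ?n * k \<le> 8 * ?n * r" using nk by linarith
  ultimately have "dist x y < 8 * ?n * r" by (rule less_le_trans)
  then show "y \<in> ball x (8 * ?n * r)" by simp
qed

lemma integrable_cube_bound:
  fixes g :: "real ^ 'n \<Rightarrow> real"
  assumes g: "g \<in> borel_measurable lebesgue" "\<And>y. g y \<ge> 0" and K: "K \<ge> 0" "(\<integral>\<^sup>+y\<in>hcube b k. ennreal (g y) \<partial>lebesgue) \<le> ennreal K"
  shows "integrable (cube_on b k) g" "(LINT y|cube_on b k. g y) \<le> K"
    "(\<integral>\<^sup>+y\<in>hcube b k. ennreal (g y) \<partial>lebesgue) = ennreal (LINT y|cube_on b k. g y)"
proof -
  show 1: "integrable (cube_on b k) g"
  proof (rule integrableI_nonneg)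
    show "g \<in> borel_measurable (cube_on b k)" using g(1) by (rule measurable_restrict_space1)
    show "(\<integral>\<^sup>+y. ennreal (g y) \<partial>cube_on b k) < \<infinity>" unfolding nn_integral_cube_on using K(2) by (rule le_less_trans) simp
  qed (use g in auto)
  show 2: "(\<integral>\<^sup>+y\<in>hcube b k. ennreal (g y) \<partial>lebesgue) = ennreal (LINT y|cube_on b k. g y)"
    unfolding nn_integral_cube_on[symmetric] using 1 g by (intro nn_integral_eq_integral) auto
  show "(LINT y|cube_on b k. g y) \<le> K" using K unfolding 2 by simp
qed

context growth
begin

lemma N_dilate:
  assumes r: "r > 0"
  shows "N x (8 * real CARD('n) * r) \<le> D * (8 * real CARD('n)) powr \<kappa> * N x r"
proof -
  have "1 \<le> 8 * real CARD('n)" using zero_less_card_finite[where 'a='n] by linarith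
  then show ?thesis using N_grow[OF r, of "8 * real CARD('n)" x] by simp
qed

text \<open>With R = 8 n r, the first alternative bounds the gauge of a small ball by C * N x R
  times the volume ratio, and for the ball circumscribed to a cube of side k this ratio is k^n / (8
  r)^n. Hence the constant C * N x R / (8 r)^n integrates to the required bound over each
  subcube.\<close>

lemma carleson_gauge_monotone:
  assumes \<kappa>: "real CARD('n) * q / p < real CARD('n) + 1" and C: "C > 0"
    and mon: "\<And>x1 r1 x2 r2. r1 > 0 \<Longrightarrow> r2 > 0 \<Longrightarrow> ball x1 r1 \<subseteq> ball x2 r2 \<Longrightarrow>
      ball_norm \<phi> x1 r1 / emeasure lebesgue (ball x1 r1) \<le> ennreal C * (ball_norm \<phi> x2 r2 / emeasure lebesgue (ball x2 r2))"
  shows "carleson_gauge N \<kappa> D ((C * (D * (8 * real CARD('n)) powr \<kappa>))\<^sup>2)"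
proof (intro carleson_gauge.intro carleson_gauge_axioms.intro ball_gauge \<kappa>)
  let ?n = "CARD('n)"
  let ?G = "D * (8 * real ?n) powr \<kappa>"
  fix x :: "real ^ 'n" and r :: real assume r: "r > 0"
  let ?R = "8 * real ?n * r"
  have R: "?R > 0" using r by simp
  have NR: "N x ?R > 0" by (rule ball_norm_N(2)[OF R])
  define w where "w = C * N x ?R / (8 * r) ^ ?n"
  have r4: "4 * r > 0" using r by simp
  show "\<exists>w. integrable (cube_on (big_corner x r) (4 * r)) w \<and>
      integrable (cube_on (big_corner x r) (4 * r)) (\<lambda>y. (w y)\<^sup>2) \<and>
      (LINT y|cube_on (big_corner x r) (4 * r). (w y)\<^sup>2) \<le> (C * ?G)\<^sup>2 * (N x r)\<^sup>2 / r ^ ?n \<and>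
      (\<forall>b k. dyadic_sub (big_corner x r) (4 * r) b k \<longrightarrow>
         N (cube_center b k) (real ?n * k) \<le> (LINT y|cube_on b k. w y))"
  proof (intro exI[of _ "\<lambda>_. w"] conjI allI impI)
    show "integrable (cube_on (big_corner x r) (4 * r)) (\<lambda>y. w)" "integrable (cube_on (big_corner x r) (4 * r)) (\<lambda>y. w\<^sup>2)"
      using r4 by auto
    have "(LINT y|cube_on (big_corner x r) (4 * r). w\<^sup>2) = (4 * r) ^ ?n * w\<^sup>2" using integral_cube_const(1)[OF r4, of "big_corner x r" "w\<^sup>2"] by simp
    also have "\<dots> = (C * N x ?R)\<^sup>2 / r ^ ?n * (1 / 16 ^ ?n)"
    proof -
      have "(8 * r) ^ ?n = 8 ^ ?n * r ^ ?n" "(4 * r) ^ ?n = 4 ^ ?n * r ^ ?n" by (simp_all add: power_mult_distrib)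
      moreover have "(8 :: real) ^ ?n * 8 ^ ?n = 4 ^ ?n * 16 ^ ?n" by (simp flip: power_mult_distrib)
      ultimately show ?thesis using r unfolding w_def by (simp add: power2_eq_square field_simps)
    qed
    also have "\<dots> \<le> (C * N x ?R)\<^sup>2 / r ^ ?n * 1" using r by (intro mult_left_mono) auto
    also have "\<dots> \<le> (C * (?G * N x r))\<^sup>2 / r ^ ?n * 1"
      using r C NR N_dilate[OF r, of x] by (intro mult_right_mono divide_right_mono power_mono mult_left_mono) auto
    finally show "(LINT y|cube_on (big_corner x r) (4 * r). w\<^sup>2) \<le> (C * ?G)\<^sup>2 * (N x r)\<^sup>2 / r ^ ?n"
      by (simp add: power_mult_distrib mult_ac)
    fix b k assume d: "dyadic_sub (big_corner x r) (4 * r) b k"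
    have k: "k > 0" using dyadic_sub_props(1)[OF d r4] .
    have nk: "real ?n * k > 0" using k by simp
    let ?z = "cube_center b k" and ?s = "real ?n * k"
    let ?V1 = "measure lebesgue (ball ?z ?s)" and ?V2 = "measure lebesgue (ball x ?R)"
    have V: "?V1 > 0" "?V2 > 0" using ball_measure_facts(2)[OF nk] ball_measure_facts(2)[OF R] by auto
    have "ennreal (N ?z ?s) / ennreal ?V1 \<le> ennreal C * (ennreal (N x ?R) / ennreal ?V2)"
      using mon[OF nk R circumscribed_ball_subset[OF r d]]
      unfolding ball_norm_N(1)[OF nk] ball_norm_N(1)[OF R] ball_measure_facts(1)[OF nk] ball_measure_facts(1)[OF R] .
    then have "ennreal (N ?z ?s / ?V1) \<le> ennreal (C * (N x ?R / ?V2))"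
      unfolding divide_ennreal[OF less_imp_le[OF ball_norm_N(2)[OF nk]] V(1)] divide_ennreal[OF less_imp_le[OF NR] V(2)]
      by (subst ennreal_mult'[OF less_imp_le[OF C]])
    then have "N ?z ?s / ?V1 \<le> C * (N x ?R / ?V2)" using C NR V by (subst (asm) ennreal_le_iff) auto
    then have "N ?z ?s \<le> C * (N x ?R / ?V2) * ?V1" using V by (simp add: pos_divide_le_eq)
    also have "\<dots> = C * N x ?R * (?V1 / ?V2)" by simp
    also have "?V1 / ?V2 = k ^ ?n / (8 * r) ^ ?n"
      unfolding measure_lebesgue_ball[OF nk] measure_lebesgue_ball[OF R]
      using less_imp_neq[OF ball_vol_pos, symmetric, where 'n='n] by (simp add: power_mult_distrib)
    also have "C * N x ?R * (k ^ ?n / (8 * r) ^ ?n) = k ^ ?n *\<^sub>R w" by (simp add: w_def)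
    finally show "N ?z ?s \<le> (LINT y|cube_on b k. w)" unfolding integral_cube_const(1)[OF k] .
  qed
qed simp

text \<open>The gauge of a small ball is bounded linearly by its mass at the level 1 / N x R, and
  this mass by that of the inscribed cube, so a multiple of \<phi> at this fixed level serves as the
  weight on all subcubes. The reverse Hoelder condition controls its square integral.\<close>

lemma carleson_gauge_reverse_Hoelder:
  assumes \<kappa>: "real CARD('n) * q / p < real CARD('n) + 1" and Q: "Q > 2" "reverse_Hoelder \<phi> Q"
  shows "\<exists>E. carleson_gauge N \<kappa> D E"
proof -
  let ?n = "CARD('n)"
  let ?G = "D * (8 * real ?n) powr \<kappa>" and ?v = "ball_vol TYPE('n)"
  obtain C where C: "C \<ge> 1" and RH: "\<And>t x r m. t > 0 \<Longrightarrow> r > 0 \<Longrightarrow> m > 0 \<Longrightarrow> mass t (ball x r) = ennreal m \<Longrightarrow>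
    (\<integral>\<^sup>+y\<in>ball x r. ennreal ((\<phi> y t)\<^sup>2) \<partial>lebesgue) \<le> ennreal (C * m\<^sup>2 / measure lebesgue (ball x r))"
    using reverse_Hoelder_square[OF meas pos Q] unfolding mass_def by blast
  \<comment> \<open>2 a^2 comes from \<open>N_le_mass\<close>; the rest passes from the
    circumscribed ball to the cube, whose relative volume is 1 / (v n^n) with v the volume of the
    unit ball.\<close>
  define W where "W = 2 * a\<^sup>2 * c * (?v * real ?n ^ ?n) powr q"
  have W0: "W \<ge> 0" using cst by (simp add: W_def)
  have v0: "?v > 0" by (rule ball_vol_pos)
  define E where "E = (W * ?G)\<^sup>2 * (C * (2 * a)\<^sup>2) / (?v * (8 * real ?n) ^ ?n)"
  have "carleson_gauge N \<kappa> D E"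
  proof (intro carleson_gauge.intro carleson_gauge_axioms.intro ball_gauge \<kappa>)
    show "0 \<le> E" unfolding E_def using v0 C by (intro divide_nonneg_nonneg mult_nonneg_nonneg) auto
    fix x :: "real ^ 'n" and r :: real assume r: "r > 0"
    let ?R = "8 * real ?n * r" and ?Q = "cube_on (big_corner x r) (4 * r)"
    have R: "?R > 0" using r by simp
    have r4: "4 * r > 0" using r by simp
    have NR: "N x ?R > 0" by (rule ball_norm_N(2)[OF R])
    define t where "t = 1 / N x ?R"
    have t: "t > 0" using NR by (simp add: t_def)
    have \<phi>m: "(\<lambda>y. \<phi> y t) \<in> borel_measurable lebesgue" by (rule meas[OF t])
    have \<phi>0: "\<phi> y t \<ge> 0" for y using pos[OF t, of y] by simp
    obtain m where m: "mass t (ball x ?R) = ennreal m" "m > 0" by (rule mass_ball_real[OF t R])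
    have m2: "m \<le> 2 * a" using mass_norm_le[OF R, of x] cst unfolding t_def[symmetric] m(1) by simp
    have big: "hcube (big_corner x r) (4 * r) \<subseteq> ball x ?R"
    proof -
      have "ball x (4 * real ?n * r) \<subseteq> ball x ?R" using r by (intro subset_ball) simp
      then show ?thesis using big_cube_subset_ball[OF r, of x] by blast
    qed
    have small: "integrable (cube_on b k) (\<lambda>y. \<phi> y t)" "mass t (hcube b k) = ennreal (LINT y|cube_on b k. \<phi> y t)"
      if "hcube b k \<subseteq> ball x ?R" for b k
    proof -
      have "weight_mass \<phi> t (hcube b k) \<le> ennreal m"
        using order_trans[OF mass_set_mono[OF that, of t] eq_refl[OF m(1)]] unfolding mass_def .
      from integrable_cube_bound[OF \<phi>m \<phi>0 _ this] m(2)
      show "integrable (cube_on b k) (\<lambda>y. \<phi> y t)" "mass t (hcube b k) = ennreal (LINT y|cube_on b k. \<phi> y t)"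
        unfolding mass_def by auto
    qed
    let ?K = "C * m\<^sup>2 / (?v * ?R ^ ?n)"
    have "(\<integral>\<^sup>+y\<in>hcube (big_corner x r) (4 * r). ennreal ((\<phi> y t)\<^sup>2) \<partial>lebesgue) \<le> (\<integral>\<^sup>+y\<in>ball x ?R. ennreal ((\<phi> y t)\<^sup>2) \<partial>lebesgue)"
      by (rule nn_set_integral_set_mono[OF big])
    also have "\<dots> \<le> ennreal ?K" using RH[OF t R m(2) m(1)] unfolding measure_lebesgue_ball[OF R] .
    finally have sq: "(\<integral>\<^sup>+y\<in>hcube (big_corner x r) (4 * r). ennreal ((\<phi> y t)\<^sup>2) \<partial>lebesgue) \<le> ennreal ?K" .
    have K0: "?K \<ge> 0" using C v0 R by (intro divide_nonneg_nonneg mult_nonneg_nonneg) auto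
    have sqm: "(\<lambda>y. (\<phi> y t)\<^sup>2) \<in> borel_measurable lebesgue" using \<phi>m by measurable
    note sq' = integrable_cube_bound[OF sqm zero_le_power2 K0 sq]
    define w where "w y = W * N x ?R * \<phi> y t" for y
    show "\<exists>w. integrable ?Q w \<and> integrable ?Q (\<lambda>y. (w y)\<^sup>2) \<and>
      (LINT y|?Q. (w y)\<^sup>2) \<le> E * (N x r)\<^sup>2 / r ^ ?n \<and>
      (\<forall>b k. dyadic_sub (big_corner x r) (4 * r) b k \<longrightarrow>
         N (cube_center b k) (real ?n * k) \<le> (LINT y|cube_on b k. w y))"
    proof (intro exI[of _ w] conjI allI impI)
      show "integrable ?Q w" unfolding w_def[abs_def] by (intro integrable_mult_right small big)
      have w2: "(w y)\<^sup>2 = (W * N x ?R)\<^sup>2 * (\<phi> y t)\<^sup>2" for y by (simp add: w_def power_mult_distrib)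
      show "integrable ?Q (\<lambda>y. (w y)\<^sup>2)" unfolding w2 by (intro integrable_mult_right sq')
      have "(LINT y|?Q. (w y)\<^sup>2) = (W * N x ?R)\<^sup>2 * (LINT y|?Q. (\<phi> y t)\<^sup>2)" unfolding w2 by simp
      also have "\<dots> \<le> (W * N x ?R)\<^sup>2 * ?K" by (intro mult_left_mono sq') simp
      also have "\<dots> \<le> (W * (?G * N x r))\<^sup>2 * (C * (2 * a)\<^sup>2 / (?v * ?R ^ ?n))"
        using W0 NR N_dilate[OF r, of x] C m m2 v0 R
        by (intro mult_mono power_mono divide_right_mono) auto
      also have "\<dots> = E * (N x r)\<^sup>2 / r ^ ?n" unfolding E_def using v0 r
        by (simp add: power_mult_distrib mult_ac)
      finally show "(LINT y|?Q. (w y)\<^sup>2) \<le> E * (N x r)\<^sup>2 / r ^ ?n" .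
      fix b k assume d: "dyadic_sub (big_corner x r) (4 * r) b k"
      have k: "k > 0" "hcube b k \<subseteq> hcube (big_corner x r) (4 * r)" using dyadic_sub_props[OF d r4] by auto
      have nk: "real ?n * k > 0" using k by simp
      let ?z = "cube_center b k" and ?s = "real ?n * k"
      let ?I = "LINT y|cube_on b k. \<phi> y t" and ?v' = "(?v * real ?n ^ ?n) powr q"
      have I0: "?I \<ge> 0" by (rule Bochner_Integration.integral_nonneg) (use \<phi>0 in auto)
      have "measure lebesgue (hcube b k) / measure lebesgue (ball ?z ?s) = 1 / (?v * real ?n ^ ?n)"
        unfolding measure_lebesgue_ball[OF nk] using emeasure_hcube(1)[OF k(1), of b] k(1)
        by (simp only: measure_def) (simp add: power_mult_distrib)
      then have "mass t (ball ?z ?s) * ennreal ((1 / (?v * real ?n ^ ?n)) powr q) \<le> ennreal c * mass t (hcube b k)"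
        using mass_subset[OF t nk hcube_lebesgue hcube_subset_ball[OF k(1)], of b] unfolding mass_def by simp
      then have "mass t (ball ?z ?s) * ennreal ((1 / (?v * real ?n ^ ?n)) powr q) * ennreal ?v' \<le> ennreal c * mass t (hcube b k) * ennreal ?v'"
        by (rule mult_right_mono) simp
      moreover have "ennreal ((1 / (?v * real ?n ^ ?n)) powr q) * ennreal ?v' = 1"
      proof -
        have "(1 / (?v * real ?n ^ ?n)) powr q * ?v' = 1"
          unfolding powr_mult[symmetric] by (simp add: less_imp_neq[OF ball_vol_pos, symmetric])
        then show ?thesis by (simp flip: ennreal_mult')
      qed
      moreover have e: "ennreal c * ennreal ?I * ennreal ?v' = ennreal (c * ?v' * ?I)"
      proof -
        have "ennreal c * ennreal ?I * ennreal ?v' = ennreal (c * ?I * ?v')"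
          using cst I0 by (subst ennreal_mult, auto)+
        then show ?thesis by (simp only: mult_ac)
      qed
      ultimately have mb: "mass t (ball ?z ?s) \<le> ennreal (c * ?v' * ?I)"
        unfolding small(2)[OF order_trans[OF k(2) big]] e by (simp add: mult.assoc)
      have "ennreal (N ?z ?s) \<le> ennreal (2 * a\<^sup>2 * N x ?R) * mass t (ball ?z ?s)"
        unfolding t_def by (rule N_le_mass[OF R nk circumscribed_ball_subset[OF r d]])
      also have "\<dots> \<le> ennreal (2 * a\<^sup>2 * N x ?R) * ennreal (c * ?v' * ?I)" by (rule mult_left_mono[OF mb]) simp
      also have "\<dots> = ennreal (2 * a\<^sup>2 * N x ?R * (c * ?v' * ?I))" using cst I0 NR by (intro ennreal_mult[symmetric]) auto
      finally have "N ?z ?s \<le> 2 * a\<^sup>2 * N x ?R * (c * ?v' * ?I)" using cst I0 NR by (subst (asm) ennreal_le_iff) auto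
      then show "N ?z ?s \<le> (LINT y|cube_on b k. w y)" by (simp add: w_def W_def mult_ac)
    qed
  qed
  then show ?thesis ..
qed

end

section \<open>From the indices to admissible exponents\<close>

lemma lower_type_le_one:
  fixes \<phi> :: "real ^ 'n \<Rightarrow> real \<Rightarrow> real"
  assumes g: "growth_function \<phi>" and p: "unif_lower_type \<phi> p"
  shows "p \<le> 1"
proof (rule ccontr)
  assume "\<not> p \<le> 1"
  then have p1: "p - 1 > 0" by simp
  obtain a where a: "\<And>x t s. t \<ge> 0 \<Longrightarrow> s \<ge> 1 \<Longrightarrow> \<phi> x (s * t) \<le> a * s powr 1 * \<phi> x t"
    using g unfolding growth_function_def unif_upper_type_def by blast
  obtain b where b: "\<And>x t s. t \<ge> 0 \<Longrightarrow> 0 < s \<Longrightarrow> s < 1 \<Longrightarrow> \<phi> x (s * t) \<le> b * s powr p * \<phi> x t"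
    using p unfolding unif_lower_type_def by blast
  have pos: "\<phi> 0 t > 0" if "t > 0" for t using g that unfolding growth_function_def by blast
  define K where "K = max 1 a * max 1 b"
  have K0: "K > 0" by (simp add: K_def less_max_iff_disj)
  \<comment> \<open>Down from 1 to s by the lower type p and back up to 1 by the upper type
    1.\<close>
  have le: "1 \<le> K * s powr (p - 1)" if s: "0 < s" "s < 1" for s
  proof -
    have "\<phi> 0 1 = \<phi> 0 ((1 / s) * s)" using s by simp
    also have "\<dots> \<le> a * (1 / s) powr 1 * \<phi> 0 s" by (rule a) (use s in auto)
    also have "\<dots> \<le> max 1 a * (1 / s) * \<phi> 0 s" using s pos[OF s(1)] by (intro mult_right_mono) (auto simp: divide_right_mono)
    also have "\<dots> \<le> max 1 a * (1 / s) * (max 1 b * s powr p * \<phi> 0 1)"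
    proof (rule mult_left_mono)
      have "\<phi> 0 s \<le> b * s powr p * \<phi> 0 1" using b[of 1 s 0] s by simp
      also have "\<dots> \<le> max 1 b * s powr p * \<phi> 0 1" using pos[of 1] by (intro mult_right_mono) auto
      finally show "\<phi> 0 s \<le> max 1 b * s powr p * \<phi> 0 1" .
    qed (use s in auto)
    finally have "1 * \<phi> 0 1 \<le> (max 1 a * (1 / s) * (max 1 b * s powr p)) * \<phi> 0 1" using s by (simp add: mult.assoc)
    then have "1 \<le> max 1 a * (1 / s) * (max 1 b * s powr p)" using pos[of 1] by (subst (asm) mult_le_cancel_right) auto
    also have "\<dots> = K * (s powr p / s)" by (simp add: K_def)
    also have "s powr p / s = s powr (p - 1)" using s by (simp add: powr_diff)
    finally show ?thesis .
  qed
  \<comment> \<open>Chosen so that s powr (p - 1) = 1 / (K + 1), which turns the inequality into 1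
    \<le> K / (K + 1).\<close>
  define s where "s = (1 / (K + 1)) powr (1 / (p - 1))"
  have s0: "s > 0" using K0 by (simp add: s_def)
  have "s < 1 powr (1 / (p - 1))" unfolding s_def using K0 p1 by (intro powr_less_mono2) auto
  then have s1: "s < 1" by simp
  have "s powr (p - 1) = 1 / (K + 1)" unfolding s_def powr_powr using p1 K0 by simp
  then have "1 \<le> K * (1 / (K + 1))" using le[OF s0 s1] by simp
  then show False using K0 by (simp add: field_simps)
qed

lemma pred_quot_le_one: "pred_quot r \<le> 1"
proof -
  have "(s - 1) / s \<le> 1" if "s \<ge> 0" for s :: real using that by (cases "s = 0") (auto simp: divide_le_eq)
  then show ?thesis by (simp add: pred_quot_def)
qed

lemma Muckenhoupt_index_ge_one:
  assumes "growth_function \<phi>"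
  shows "Muckenhoupt_index \<phi> \<ge> 1"
  unfolding Muckenhoupt_index_def
  using assms by (intro cInf_greatest) (auto simp: growth_function_def Muckenhoupt_infty_def)

text \<open>The indices need not be attained, but the inequality is strict and so persists for
  exponents close to them. Lower types are at most 1, which makes the defining supremum
  meaningful.\<close>

lemma growth_function_exponents:
  fixes \<phi> :: "real ^ 'n \<Rightarrow> real \<Rightarrow> real"
  assumes g: "growth_function \<phi>"
    and ind: "2 * real CARD('n) * Muckenhoupt_index \<phi> / lower_type_index \<phi>
           - real CARD('n) * pred_quot (reverse_Hoelder_index \<phi>) < real CARD('n) + 1"
  obtains p q where "p > 0" "unif_lower_type \<phi> p" "q \<ge> 1" "Muckenhoupt \<phi> q" "real CARD('n) * q / p < real CARD('n) + 1"
proof -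
  let ?n = "real CARD('n)" and ?P = "Muckenhoupt_index \<phi>" and ?i = "lower_type_index \<phi>"
  let ?L = "{p. p > 0 \<and> unif_lower_type \<phi> p}" and ?M = "{q. q \<ge> 1 \<and> Muckenhoupt \<phi> q}"
  have n: "?n > 0" by simp
  obtain p0 where p0: "p0 > 0" "unif_lower_type \<phi> p0" using g unfolding growth_function_def by blast
  have bdd: "bdd_above ?L" by (rule bdd_aboveI[of _ 1]) (use lower_type_le_one[OF g] in auto)
  have "p0 \<le> ?i" unfolding lower_type_index_def by (rule cSup_upper[OF _ bdd]) (use p0 in auto)
  then have i: "?i > 0" using p0 by simp
  have "?n * pred_quot (reverse_Hoelder_index \<phi>) \<le> ?n * 1" by (intro mult_left_mono pred_quot_le_one) simp
  \<comment> \<open>The available bound n + 1 + n is enlarged to 2 (n + 1), so that halving gives n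
    P / i < n + 1.\<close>
  then have "2 * ?n * ?P / ?i < 2 * ?n + 2" using ind by (simp only: mult_1_right)
  then have "?n * ?P < (?n + 1) * ?i" using i by (simp add: pos_divide_less_eq algebra_simps)
  then have "?n * ?P / (?n + 1) < ?i" by (simp add: pos_divide_less_eq mult.commute)
  then obtain p where p: "p > 0" "unif_lower_type \<phi> p" "?n * ?P / (?n + 1) < p"
    unfolding lower_type_index_def using less_cSup_iff[OF _ bdd] p0 by auto
  then have "?P < (?n + 1) * p / ?n" using n by (simp add: field_simps)
  then obtain q where q: "q \<ge> 1" "Muckenhoupt \<phi> q" "q < (?n + 1) * p / ?n"
    using cInf_lessD[of ?M "(?n + 1) * p / ?n"] g unfolding Muckenhoupt_index_def growth_function_def Muckenhoupt_infty_def by auto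
  have "?n * q / p < ?n + 1" using q(3) p(1) n by (simp add: field_simps)
  then show thesis using that p q by blast
qed

lemma growth_function_imp_growth:
  fixes \<phi> :: "real ^ 'n \<Rightarrow> real \<Rightarrow> real"
  assumes g: "growth_function \<phi>" and p: "p > 0" "unif_lower_type \<phi> p" and q: "q \<ge> 1" "Muckenhoupt \<phi> q"
  shows "\<exists>a b c. growth \<phi> p q a b c"
proof -
  have meas: "(\<lambda>x. \<phi> x t) \<in> borel_measurable lebesgue" if "t > 0" for t using g that unfolding growth_function_def by auto
  have pos: "\<phi> x t > 0" if "t > 0" for x t using g that unfolding growth_function_def by blast
  obtain a where a: "\<And>x t s. t \<ge> 0 \<Longrightarrow> s \<ge> 1 \<Longrightarrow> \<phi> x (s * t) \<le> a * s powr 1 * \<phi> x t"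
    using g unfolding growth_function_def unif_upper_type_def by blast
  obtain b where b: "\<And>x t s. t \<ge> 0 \<Longrightarrow> 0 < s \<Longrightarrow> s < 1 \<Longrightarrow> \<phi> x (s * t) \<le> b * s powr p * \<phi> x t"
    using p unfolding unif_lower_type_def by blast
  obtain c where c: "c \<ge> 1" "\<And>t x r. t > 0 \<Longrightarrow> r > 0 \<Longrightarrow> weight_mass \<phi> t (ball x r) < \<infinity>"
    "\<And>t x r S. t > 0 \<Longrightarrow> r > 0 \<Longrightarrow> S \<in> sets lebesgue \<Longrightarrow> S \<subseteq> ball x r \<Longrightarrow>
       weight_mass \<phi> t (ball x r) * ennreal ((measure lebesgue S / measure lebesgue (ball x r)) powr q) \<le>
       ennreal c * weight_mass \<phi> t S"
    using Muckenhoupt_bounds[OF meas pos q] by blast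
  have "growth \<phi> p q (max 1 a) (max 1 b) c"
  proof
    show "\<phi> x 0 = 0" for x using g unfolding growth_function_def by blast
    show "\<phi> x s \<le> \<phi> x t" if "0 \<le> s" "s \<le> t" for x s t
      using g that unfolding growth_function_def by (auto intro: mono_onD[of "{0..}" "\<phi> x"])
    show "\<phi> x (s * t) \<le> max 1 a * s * \<phi> x t" if "t > 0" "s \<ge> 1" for x s t
    proof -
      have "a * s powr 1 * \<phi> x t \<le> max 1 a * s * \<phi> x t" using that pos[of t x] by (intro mult_right_mono) auto
      moreover have "\<phi> x (s * t) \<le> a * s powr 1 * \<phi> x t" using that by (intro a) auto
      ultimately show ?thesis by linarith
    qed
    show "\<phi> x (s * t) \<le> max 1 b * s powr p * \<phi> x t" if "t > 0" "0 < s" "s < 1" for x s t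
    proof -
      have "b * s powr p * \<phi> x t \<le> max 1 b * s powr p * \<phi> x t" using that pos[of t x] by (intro mult_right_mono) auto
      moreover have "\<phi> x (s * t) \<le> b * s powr p * \<phi> x t" using that by (intro b) auto
      ultimately show ?thesis by linarith
    qed
  qed (use meas pos c p q in auto)
  then show ?thesis by blast
qed

lemma ennreal_divide_le_iff_times:
  assumes b: "b > 0"
  shows "I / ennreal b \<le> ennreal A \<longleftrightarrow> I \<le> ennreal (A * b)"
proof
  have e: "I = I / ennreal b * ennreal b"
    unfolding ennreal_divide_times using b by simp
  assume "I / ennreal b \<le> ennreal A"
  then have "I / ennreal b * ennreal b \<le> ennreal A * ennreal b" by (rule mult_right_mono) simp
  then show "I \<le> ennreal (A * b)" using e b by (simp add: ennreal_mult'')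
next
  assume "I \<le> ennreal (A * b)"
  then have "I \<le> ennreal b * ennreal A" using b by (simp add: ennreal_mult'' mult.commute)
  then show "I / ennreal b \<le> ennreal A" by (intro divide_le_posI_ennreal) (use b in auto)
qed

section \<open>Transfer to the function spaces\<close>

context growth
begin

text \<open>Norms of balls are positive and finite, so the quotients can be cleared and the suprema
  turn into the predicates of the gauge.\<close>

lemma BMO_norm_le_iff:
  assumes \<kappa>: "real CARD('n) * q / p < real CARD('n) + 1"
  shows "BMO_norm \<phi> f \<le> ennreal A \<longleftrightarrow> ball_gauge.osc_bound N f A"
    and "BMO_Poisson_norm \<phi> f \<le> ennreal A \<longleftrightarrow> ball_gauge.poisson_osc_bound N f A"
proof -
  interpret ball_gauge N \<kappa> D by (rule ball_gauge[OF \<kappa>])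
  have *: "I / ball_norm \<phi> x r \<le> ennreal A \<longleftrightarrow> I \<le> ennreal (A * N x r)" if "r > 0" for x r I
    unfolding ball_norm_N(1)[OF that] by (rule ennreal_divide_le_iff_times[OF ball_norm_N(2)[OF that]])
  show "BMO_norm \<phi> f \<le> ennreal A \<longleftrightarrow> osc_bound f A"
    unfolding BMO_norm_def osc_bound_def SUP_le_iff using * by auto
  show "BMO_Poisson_norm \<phi> f \<le> ennreal A \<longleftrightarrow> poisson_osc_bound f A"
    unfolding BMO_Poisson_norm_def poisson_osc_bound_def SUP_le_iff using * by auto
qed

text \<open>The inclusions hold between sets of functions: bounded mean oscillation implies
  membership in \<open>M_Poisson\<close>, and that class consists of locally integrable
  functions.\<close>

lemma BMO_compare:
  assumes \<kappa>: "real CARD('n) * q / p < real CARD('n) + 1"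
  shows "\<exists>K>0. (\<forall>f\<in>BMO_Poisson \<phi>. f \<in> BMO \<phi> \<and> BMO_norm \<phi> f \<le> ennreal K * BMO_Poisson_norm \<phi> f) \<and>
    (\<forall>f\<in>BMO \<phi>. f \<in> BMO_Poisson \<phi> \<and> BMO_Poisson_norm \<phi> f \<le> ennreal K * BMO_norm \<phi> f)"
proof -
  interpret ball_gauge N \<kappa> D by (rule ball_gauge[OF \<kappa>])
  note iff = BMO_norm_le_iff[OF \<kappa>]
  let ?k1 = "2 * (1 + ball_vol TYPE('n) * telescope_const)" and ?k2 = to_poisson_const
  let ?K = "max ?k1 ?k2"
  have K0: "?K > 0" using to_poisson_const_pos by (simp add: less_max_iff_disj)
  have real: "X = ennreal (enn2real X)" if "X < \<infinity>" for X using that by simp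
  have fin: "ennreal (k * A) \<le> ennreal ?K * ennreal A" if "k \<le> ?K" "A \<ge> 0" for k A
    using that K0 by (subst ennreal_mult[symmetric]) (auto intro!: ennreal_leI mult_right_mono)
  show ?thesis
  proof (intro exI[of _ ?K] conjI ballI)
    show "?K > 0" by (rule K0)
    fix f assume f: "f \<in> BMO_Poisson \<phi>"
    define A where "A = enn2real (BMO_Poisson_norm \<phi> f)"
    have A: "BMO_Poisson_norm \<phi> f = ennreal A" "A \<ge> 0" unfolding A_def using f by (auto simp: BMO_Poisson_def)
    have fM: "f \<in> M_Poisson" using f by (simp add: BMO_Poisson_def)
    have "poisson_osc_bound f A" using iff(2)[of f A] A by simp
    from BMO_Poisson_imp_osc[OF fM A(2) this] have le: "BMO_norm \<phi> f \<le> ennreal (?k1 * A)" unfolding iff .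
    also have "\<dots> \<le> ennreal ?K * ennreal A" by (rule fin[OF _ A(2)]) simp
    finally show "BMO_norm \<phi> f \<le> ennreal ?K * BMO_Poisson_norm \<phi> f" unfolding A(1) .
    have "BMO_norm \<phi> f < \<infinity>" by (rule le_less_trans[OF le]) simp
    then show "f \<in> BMO \<phi>" using fM by (simp add: BMO_def M_Poisson_def)
  next
    fix f assume f: "f \<in> BMO \<phi>"
    define A where "A = enn2real (BMO_norm \<phi> f)"
    have A: "BMO_norm \<phi> f = ennreal A" "A \<ge> 0" unfolding A_def using f by (auto simp: BMO_def)
    have fl: "locally_integrable f" using f by (simp add: BMO_def)
    have o: "osc_bound f A" using iff(1)[of f A] A by simp
    from BMO_imp_poisson_osc[OF fl A(2) o] have le: "BMO_Poisson_norm \<phi> f \<le> ennreal (?k2 * A)" unfolding iff .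
    also have "\<dots> \<le> ennreal ?K * ennreal A" by (rule fin[OF _ A(2)]) simp
    finally show "BMO_Poisson_norm \<phi> f \<le> ennreal ?K * BMO_norm \<phi> f" unfolding A(1) .
    have "BMO_Poisson_norm \<phi> f < \<infinity>" by (rule le_less_trans[OF le]) simp
    then show "f \<in> BMO_Poisson \<phi>" using osc_imp_M_Poisson[OF fl A(2) o] by (simp add: BMO_Poisson_def)
  qed
qed

text \<open>The tent bound is of order N^2 / r^n and the ball has volume of order r^n, so after
  taking square roots and dividing by N all powers of r and N cancel.\<close>

lemma Carleson_square_measure:
  assumes \<kappa>: "real CARD('n) * q / p < real CARD('n) + 1" and E: "carleson_gauge N \<kappa> D E" and f: "f \<in> BMO \<phi>"
  shows "Carleson_measure \<phi> (square_measure f)"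
proof -
  interpret carleson_gauge N \<kappa> D E by (rule E)
  define A where "A = enn2real (BMO_norm \<phi> f)"
  have A: "BMO_norm \<phi> f = ennreal A" "A \<ge> 0" unfolding A_def using f by (auto simp: BMO_def)
  have fl: "locally_integrable f" using f by (simp add: BMO_def)
  have o: "osc_bound f A" using BMO_norm_le_iff(1)[OF \<kappa>, of f A] A by simp
  let ?v = "ball_vol TYPE('n)" and ?U = "upper_half_space :: ((real ^ 'n) \<times> real) set"
  have v0: "?v \<ge> 0" by (rule less_imp_le[OF ball_vol_pos])
  show ?thesis
    unfolding Carleson_measure_def
  proof (intro conjI)
    show "space (square_measure f) = ?U" unfolding square_measure_def by (simp add: space_restrict_space)
    show "sets (restrict_space borel ?U) \<subseteq> sets (square_measure f)"
      unfolding square_measure_def sets_density sets_restrict_space by (intro image_mono) (auto simp: sets_completionI_sets)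
    have "(SUP x. SUP r\<in>{0<..}. ennpow (emeasure lebesgue (ball x r)) (1 / 2) / ball_norm \<phi> x r *
        ennpow (emeasure (square_measure f) (tent x r)) (1 / 2)) \<le> ennreal (sqrt (?v * square_const) * A)"
    proof (intro SUP_least)
      fix x :: "real ^ 'n" and r :: real assume "r \<in> {0<..}"
      then have r: "r > 0" by simp
      have N: "N x r > 0" by (rule ball_norm_N(2)[OF r])
      let ?X = "square_const * A\<^sup>2 * (N x r)\<^sup>2 / r ^ CARD('n)"
      have X0: "?X \<ge> 0" using square_const_nonneg r by simp
      have mono: "ennpow e (1 / 2) \<le> ennreal (sqrt X)" if "e \<le> ennreal X" "X \<ge> 0" for e X
      proof -
        have e: "e \<noteq> \<infinity>" using that by (auto simp: top_unique)
        have "enn2real e \<le> X" using enn2real_mono[OF that(1)] that(2) by simp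
        then show ?thesis using e that(2) by (simp add: ennpow_def powr_half_sqrt ennreal_leI)
      qed
      have b: "ennpow (emeasure lebesgue (ball x r)) (1 / 2) \<le> ennreal (sqrt (?v * r ^ CARD('n)))"
        by (rule mono) (use v0 r in \<open>auto simp only: emeasure_lebesgue_ball zero_le_power mult_nonneg_nonneg less_imp_le order_refl\<close>)
      have "ennpow (emeasure lebesgue (ball x r)) (1 / 2) / ball_norm \<phi> x r * ennpow (emeasure (square_measure f) (tent x r)) (1 / 2) \<le>
        ennreal (sqrt (?v * r ^ CARD('n))) / ennreal (N x r) * ennreal (sqrt ?X)"
        unfolding ball_norm_N(1)[OF r]
        by (intro mult_mono divide_right_mono_ennreal b mono square_measure_tent fl A o r X0) auto
      also have "\<dots> = ennreal (sqrt (?v * r ^ CARD('n)) / N x r * sqrt ?X)"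
        using v0 r N X0 by (subst divide_ennreal) (auto simp only: ennreal_mult real_sqrt_ge_zero zero_le_power mult_nonneg_nonneg less_imp_le divide_nonneg_pos)
      also have "sqrt (?v * r ^ CARD('n)) / N x r * sqrt ?X = sqrt (?v * square_const) * A"
      proof -
        have "sqrt (?v * r ^ CARD('n)) * sqrt ?X = sqrt (?v * square_const * (A * N x r)\<^sup>2)"
          unfolding real_sqrt_mult[symmetric] using r by (simp add: power_mult_distrib mult_ac)
        also have "\<dots> = sqrt (?v * square_const) * (A * N x r)"
          using A(2) N by (simp only: real_sqrt_mult real_sqrt_abs abs_mult abs_of_nonneg less_imp_le abs_of_pos)
        finally show ?thesis using N by (simp add: field_simps)
      qed
      finally show "ennpow (emeasure lebesgue (ball x r)) (1 / 2) / ball_norm \<phi> x r *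
        ennpow (emeasure (square_measure f) (tent x r)) (1 / 2) \<le> ennreal (sqrt (?v * square_const) * A)" .
    qed
    then show "(SUP x. SUP r\<in>{0<..}. ennpow (emeasure lebesgue (ball x r)) (1 / 2) / ball_norm \<phi> x r *
        ennpow (emeasure (square_measure f) (tent x r)) (1 / 2)) < \<infinity>" by (rule le_less_trans) simp
  qed
qed

end

text \<open>As p(\<phi>) \<ge> 1, a product below 2 forces r' < 2, that is r > 2; a supremum above 2
  leaves an admissible exponent above 2.\<close>

lemma reverse_Hoelder_exponent:
  fixes \<phi> :: "real ^ 'n \<Rightarrow> real \<Rightarrow> real"
  assumes g: "growth_function \<phi>" and ind: "Muckenhoupt_index \<phi> * conj_index (reverse_Hoelder_index \<phi>) \<in> {1<..<2}"
  obtains Q where "Q > 2" "reverse_Hoelder \<phi> Q"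
proof -
  let ?r = "reverse_Hoelder_index \<phi>"
  have P: "Muckenhoupt_index \<phi> \<ge> 1" by (rule Muckenhoupt_index_ge_one[OF g])
  have "?r > 2"
  proof (cases "?r = \<infinity>")
    case False
    define r where "r = enn2real ?r"
    have r: "?r = ennreal r" "r \<ge> 0" using False by (auto simp: r_def less_top)
    let ?c = "r / (r - 1)"
    have c: "Muckenhoupt_index \<phi> * ?c > 1" "Muckenhoupt_index \<phi> * ?c < 2" using ind False by (auto simp: conj_index_def r_def)
    \<comment> \<open>Rules out r \<le> 1, in particular the supremum 0 of an empty set of
      exponents: there r / (r - 1) is at most 0, with the convention for division by zero at r =
      1.\<close>
    have c0: "?c > 0"
    proof (rule ccontr)
      assume "\<not> ?c > 0"
      then have "Muckenhoupt_index \<phi> * ?c \<le> 0" using P by (intro mult_nonneg_nonpos) auto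
      then show False using c by simp
    qed
    have "1 * ?c \<le> Muckenhoupt_index \<phi> * ?c" using P c0 by (intro mult_right_mono) auto
    then have c2: "?c < 2" using c by simp
    have "r > 1" using c0 r(2) by (auto simp: zero_less_divide_iff)
    then have "r > 2" using c2 by (simp add: field_simps)
    then show ?thesis unfolding r(1) using ennreal_less_iff[of 2 r] by simp
  qed simp
  then show thesis unfolding reverse_Hoelder_index_def less_Sup_iff using that by blast
qed

text \<open>P_r is linear and fixes f - g almost everywhere, so f - P_r f and g - P_r g agree almost
  everywhere.\<close>

lemma BMO_Poisson_norm_mod_K:
  fixes \<phi> :: "real ^ 'n \<Rightarrow> real \<Rightarrow> real"
  assumes f: "f \<in> M_Poisson" and g: "g \<in> M_Poisson" and K: "(f, g) \<in> mod_K"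
  shows "BMO_Poisson_norm \<phi> f = BMO_Poisson_norm \<phi> g"
  unfolding BMO_Poisson_norm_def
proof (intro SUP_cong refl arg_cong2[where f="(/)"])
  fix x :: "real ^ 'n" and r :: real assume "r \<in> {0<..}"
  then have r: "r > 0" by simp
  have "AE y in lebesgue. poisson r (\<lambda>x. f x - g x) y = f y - g y" using K r by (simp add: mod_K_def K_Poisson_def)
  then show "(\<integral>\<^sup>+y\<in>ball x r. ennreal (norm (f y - poisson r f y)) \<partial>lebesgue) = (\<integral>\<^sup>+y\<in>ball x r. ennreal (norm (g y - poisson r g y)) \<partial>lebesgue)"
  proof (intro nn_integral_cong_AE, eventually_elim)
    case (elim y)
    then have "f y - poisson r f y = g y - poisson r g y" unfolding poisson_diff[OF f g r] by (simp add: algebra_simps)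
    then show ?case by simp
  qed
qed

theorem theorem5p5:
  fixes \<phi> :: "real ^ 'n \<Rightarrow> real \<Rightarrow> real"
  assumes "growth_function \<phi>"
    and "2 * real CARD('n) * Muckenhoupt_index \<phi> / lower_type_index \<phi>
           - real CARD('n) * pred_quot (reverse_Hoelder_index \<phi>) < real CARD('n) + 1"
    and "(\<exists>C>0. \<forall>x1 r1 x2 r2. r1 > 0 \<and> r2 > 0 \<and> ball x1 r1 \<subseteq> ball x2 r2 \<longrightarrow>
            ball_norm \<phi> x1 r1 / emeasure lebesgue (ball x1 r1)
              \<le> ennreal C * (ball_norm \<phi> x2 r2 / emeasure lebesgue (ball x2 r2)))
         \<or> Muckenhoupt_index \<phi> * conj_index (reverse_Hoelder_index \<phi>) \<in> {1<..<2}"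
  shows "(\<forall>f \<in> BMO_Poisson \<phi>. Carleson_measure \<phi> (square_measure f)) \<and>
         (real CARD('n) * Muckenhoupt_index \<phi> < (real CARD('n) + 1) * lower_type_index \<phi> \<longrightarrow>
            BMO \<phi> // mod_K = BMO_Poisson \<phi> // mod_K \<and>
            (\<exists>C>0. \<forall>f \<in> BMO \<phi>. \<forall>g \<in> BMO_Poisson \<phi>. (f, g) \<in> mod_K \<longrightarrow>
               BMO_norm \<phi> f \<le> ennreal C * BMO_Poisson_norm \<phi> g \<and>
               BMO_Poisson_norm \<phi> g \<le> ennreal C * BMO_norm \<phi> f))"
proof -
  obtain p q where p: "p > 0" "unif_lower_type \<phi> p" and q: "q \<ge> 1" "Muckenhoupt \<phi> q"
    and \<kappa>: "real CARD('n) * q / p < real CARD('n) + 1"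
    by (rule growth_function_exponents[OF assms(1,2)])
  obtain a b c where "growth \<phi> p q a b c" using growth_function_imp_growth[OF assms(1) p q] by blast
  then interpret growth \<phi> p q a b c .
  obtain E where E: "carleson_gauge N \<kappa> D E"
    using assms(3)
  proof (elim disjE exE conjE)
    fix C :: real assume "C > 0" and C: "\<forall>x1 r1 x2 r2. r1 > 0 \<and> r2 > 0 \<and> ball x1 r1 \<subseteq> ball x2 r2 \<longrightarrow>
      ball_norm \<phi> x1 r1 / emeasure lebesgue (ball x1 r1) \<le> ennreal C * (ball_norm \<phi> x2 r2 / emeasure lebesgue (ball x2 r2))"
    show thesis by (rule that, rule carleson_gauge_monotone[OF \<kappa> \<open>C > 0\<close>]) (use C in blast)
  next
    assume "Muckenhoupt_index \<phi> * conj_index (reverse_Hoelder_index \<phi>) \<in> {1<..<2}"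
    then obtain Q where "Q > 2" "reverse_Hoelder \<phi> Q" by (rule reverse_Hoelder_exponent[OF assms(1)])
    then show thesis using carleson_gauge_reverse_Hoelder[OF \<kappa>] that by blast
  qed
  obtain K where K: "K > 0"
    and P: "\<And>f. f \<in> BMO_Poisson \<phi> \<Longrightarrow> f \<in> BMO \<phi> \<and> BMO_norm \<phi> f \<le> ennreal K * BMO_Poisson_norm \<phi> f"
    and B: "\<And>f. f \<in> BMO \<phi> \<Longrightarrow> f \<in> BMO_Poisson \<phi> \<and> BMO_Poisson_norm \<phi> f \<le> ennreal K * BMO_norm \<phi> f"
    using BMO_compare[OF \<kappa>] by blast
  \<comment> \<open>The two spaces agree already as sets of functions, which gives the equality of
    the quotients. The comparison of the two seminorms of one function extends to equivalent f and g
    because the Poisson seminorm is constant on classes.\<close>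
  have eq: "BMO \<phi> = BMO_Poisson \<phi>" using P B by blast
  have equiv: "BMO_norm \<phi> f \<le> ennreal K * BMO_Poisson_norm \<phi> g \<and> BMO_Poisson_norm \<phi> g \<le> ennreal K * BMO_norm \<phi> f"
    if "f \<in> BMO \<phi>" "g \<in> BMO_Poisson \<phi>" "(f, g) \<in> mod_K" for f g
  proof -
    have "BMO_Poisson_norm \<phi> f = BMO_Poisson_norm \<phi> g"
      by (rule BMO_Poisson_norm_mod_K[OF _ _ that(3)]) (use that eq in \<open>auto simp: BMO_Poisson_def\<close>)
    then show ?thesis using P[of f] B[of f] that(1) eq by simp
  qed
  show ?thesis
  proof (intro conjI impI ballI exI[of _ K])
    show "Carleson_measure \<phi> (square_measure f)" if "f \<in> BMO_Poisson \<phi>" for f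
      using Carleson_square_measure[OF \<kappa> E] that eq by simp
    show "BMO \<phi> // mod_K = BMO_Poisson \<phi> // mod_K" unfolding eq ..
  qed (use K equiv in auto)
qed

end
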